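(* Let $(M^0,M^1)\in\mathcal M(\theta_0,\theta_1,\theta_\infty)$ and $p\in\mathbb{Z}$. For $(M^0_{(p)},M^1_{(p)})\in\mathfrak M(M^0,M^1)$ and $([\hat M^0_{(p)}]_{\sigma_1},[\hat M^1_{(p)}]_{\sigma_1})\in\hat{\mathfrak M}(M^0,M^1)$ we have $$y(e^{2\pi i}x,M^0_{(p)},M^1_{(p)})=y(x,\mathfrak m(M^0_{(p)},M^1_{(p)})),$$ $$y(e^{\pi i}x,M^0_{(p)},M^1_{(p)})=1/y_{-\theta_\infty}(x,\mathfrak s_0(M^0_{(p)},M^1_{(p)})),$$ $$y(e^{-\pi i}x,M^0_{(p)},M^1_{(p)})=1/y_{-\theta_\infty}(x,\mathfrak s_{-1}(M^0_{(p)},M^1_{(p)})),$$ $$y_{-\theta_\infty}(e^{2\pi i}x,[\hat M^0_{(p)}]_{\sigma_1},[\hat M^1_{(p)}]_{\sigma_1})=y_{-\theta_\infty}(x,\hat{\mathfrak m}([\hat M^0_{(p)}]_{\sigma_1},[\hat M^1_{(p)}]_{\sigma_1})),$$ $$y_{-\theta_\infty}(e^{\pi i}x,[\hat M^0_{(p)}]_{\sigma_1},[\hat M^1_{(p)}]_{\sigma_1})=1/y(x,\hat{\mathfrak s}_1([\hat M^0_{(p)}]_{\sigma_1},[\hat M^1_{(p)}]_{\sigma_1})),$$ $$y_{-\theta_\infty}(e^{-\pi i}x,[\hat M^0_{(p)}]_{\sigma_1},[\hat M^1_{(p)}]_{\sigma_1})=1/y(x,\hat{\mathfrak s}_0([\hat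 M^0_{(p)}]_{\sigma_1},[\hat M^1_{(p)}]_{\sigma_1})).$$
   Context: Painlevé V. For $\theta_0,\theta_1,\theta_\infty\in\mathbb{C}$, $(\mathrm{P_V})$ is $$y''=\Bigl(\frac1{2y}+\frac1{y-1}\Bigr)(y')^2-\frac{y'}x+\frac{(y-1)^2}{x^2}\Bigl(a_\theta y-\frac{b_\theta}y\Bigr)+c_\theta\frac yx-\frac{y(y+1)}{2(y-1)},$$ $a_\theta=\frac18(\theta_0-\theta_1+\theta_\infty)^2$, $b_\theta=\frac18(\theta_0-\theta_1-\theta_\infty)^2$, $c_\theta=1-\theta_0-\theta_1$. It is equivalent to the system for $(y,\mathfrak z,u)$ $$xy'=xy-2\mathfrak z(y-1)^2-(y-1)\bigl(\tfrac12(\theta_0-\theta_1+\theta_\infty)y-\tfrac12(3\theta_0+\theta_1+\theta_\infty)\bigr),$$ $$x\mathfrak z'=y\mathfrak z(\mathfrak z+\tfrac12(\theta_0-\theta_1+\theta_\infty))-y^{-1}(\mathfrak z+\theta_0)(\mathfrak z+\tfrac12(\theta_0+\theta_1+\theta_\infty)),$$ $$x(\ln u)'=-2\mathfrak z-\theta_0+y(\mathfrak z+\tfrac12(\theta_0-\theta_1+\theta_\infty))+y^{-1}(\mathfrak z+\tfrac12(\theta_0+\theta_1+\theta_\infty)),$$ which governs the isomonodromy deformation of $$\frac{d\Xi}{d\xi}=\Bigl(\frac x2\sigma_3+\frac{\mathcal A_0}\xi+\frac{\mathcal A_1}{\xi-1}\Bigr)\Xi,\quad \mathcal A_0=\begin{pmatrix}\mathfrak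 z+\frac12\theta_0&-u(\mathfrak z+\theta_0)\\ u^{-1}\mathfrak z&-\mathfrak z-\frac12\theta_0\end{pmatrix},$$ $$\mathcal A_1=\begin{pmatrix}-\mathfrak z-\frac12(\theta_0+\theta_\infty)&uy(\mathfrak z+\frac12(\theta_0-\theta_1+\theta_\infty))\\ -(uy)^{-1}(\mathfrak z+\frac12(\theta_0+\theta_1+\theta_\infty))&\mathfrak z+\frac12(\theta_0+\theta_\infty)\end{pmatrix},$$ $\sigma_3=\mathrm{diag}(1,-1)$. Monodromy data. For $x=e^{i\phi}t$, $t>0$, $|\phi|<\pi/2$, put $\xi=\frac12(e^{-i\phi}\lambda+1)$, $Y=\exp(-\varpi\sigma_3)\Xi$, $\varpi=\frac14e^{i\phi}t+\frac12\theta_\infty(i\phi+\ln2)$. The resulting linear system in $\lambda$ (singular at $\mp e^{i\phi},\infty$) has, for $k\in\mathbb{Z}$, the solution $Y_k=(I+O(\lambda^{-1}))\exp(\frac14(t\lambda-2\theta_\infty\ln\lambda)\sigma_3)$ as $\lambda\to\infty$ in $|\arg\lambda-\pi/2-(k-2)\pi|<\pi$. The Stokes matrices are defined by $Y_{k+1}=Y_kS_k$; $S_1=\begin{pmatrix}1&0\\ s_1&1\end{pmatrix}$, $S_2=\begin{pmatrix}1&s_2\\ 0&1\end{pmatrix}$. Let $\hat l_0,\hat l_1$ start at $\hat p_{\rm st}$ ($\arg\hat p_{\rm st}=\pi/2$, $|\hat p_{\rm st}|>100$), go straight to near $-e^{i\phi}$, respectively $e^{i\phi}$, circle it once anticlockwise,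 and return. $M^0=(m^0_{ij})$, $M^1=(m^1_{ij})\in SL_2(\mathbb{C})$ are defined by $Y_2|_{\hat l_0}=Y_2M^0$, $Y_2|_{\hat l_1}=Y_2M^1$ (analytic continuation). They satisfy $M^1M^0=S_1^{-1}e^{-\pi i\theta_\infty\sigma_3}S_2^{-1}$, so that $s_2=-e^{\pi i\theta_\infty}(m^0_{12}m^1_{11}+m^0_{22}m^1_{12})$, $s_1=-e^{\pi i\theta_\infty}(m^0_{11}m^1_{21}+m^0_{21}m^1_{22})$. The monodromy manifold $\mathcal M(\theta_0,\theta_1,\theta_\infty)$ is the set of $(M^0,M^1)\in SL_2(\mathbb{C})^2$ with $m^0_{11}m^1_{11}+m^0_{21}m^1_{12}=e^{-\pi i\theta_\infty}$, $\mathrm{tr}M^0=2\cos\pi\theta_0$, $\mathrm{tr}M^1=2\cos\pi\theta_1$, modulo $(M^0,M^1)\sim c^{\sigma_3}(M^0,M^1)c^{-\sigma_3}$, $c\ne0$. For each class $(M^0,M^1)$, $y(x,M^0,M^1)$ denotes a solution of $(\mathrm{P_V})$ whose linear system (for $|\arg x|<\pi/2$) has this class of monodromy data; it is unique if $M^0,M^1\ne\pm I$. The same symbol denotes its analytic continuation to the universal covering of $\mathbb{C}\setminus\{0\}$. $y_{-\theta_\infty}(x,M^0_-,M^1_-)$ denotes, in the same sense, the solution of the Painlevé V equation with parameters $(\theta_0,\theta_1,-\theta_\infty)$ labelled with $(M^0_-,M^1_-)\in\mathcal M(\theta_0,\theta_1,-\theta_\infty)$. Operators. $\sigma_1=\begin{pmatrix}0&1\\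 1&0\end{pmatrix}$, $[M]_{\sigma_1}=\sigma_1M\sigma_1$. For fixed $(M^0,M^1)$ with Stokes matrix $S_2$, and $j=0,1$, $p\in\mathbb{Z}$, put $M^j_{(p)}=(M^1M^0)^pM^j(M^1M^0)^{-p}$ and $\hat M^j_{(p)}=e^{-\frac{\pi i}2\theta_\infty\sigma_3}S_2^{-1}M^j_{(p)}S_2e^{\frac{\pi i}2\theta_\infty\sigma_3}$; $\mathfrak M(M^0,M^1)=\{(M^0_{(p)},M^1_{(p)}):p\in\mathbb{Z}\}$, $\hat{\mathfrak M}(M^0,M^1)=\{([\hat M^0_{(p)}]_{\sigma_1},[\hat M^1_{(p)}]_{\sigma_1}):p\in\mathbb{Z}\}\subset\mathcal M(\theta_0,\theta_1,-\theta_\infty)$. The operators are: $\mathfrak m(M^0_{(p)},M^1_{(p)})=(M^0_{(p+1)},M^1_{(p+1)})$; $\hat{\mathfrak m}([\hat M^0_{(p)}]_{\sigma_1},[\hat M^1_{(p)}]_{\sigma_1})=([\hat M^0_{(p+1)}]_{\sigma_1},[\hat M^1_{(p+1)}]_{\sigma_1})$; $\mathfrak s_0(M^0_{(p)},M^1_{(p)})=([\hat M^0_{(p)}]_{\sigma_1},[\hat M^1_{(p)}]_{\sigma_1})$; $\mathfrak s_{-1}(M^0_{(p)},M^1_{(p)})=([\hat M^0_{(p-1)}]_{\sigma_1},[\hat M^1_{(p-1)}]_{\sigma_1})$; $\hat{\mathfrak s}_0([\hat M^0_{(p)}]_{\sigma_1},[\hat M^1_{(p)}]_{\sigma_1})=(M^0_{(p)},M^1_{(p)})$;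 $\hat{\mathfrak s}_1([\hat M^0_{(p)}]_{\sigma_1},[\hat M^1_{(p)}]_{\sigma_1})=(M^0_{(p+1)},M^1_{(p+1)})$. *)

theory Defs
  imports "HOL-Complex_Analysis.Complex_Analysis"
begin

no_notation fps_nth (infixl \<open>$\<close> 75)

section \<open>Two by two matrices\<close>

type_synonym cmat2 = "complex^2^2"

definition mat2 :: "complex \<Rightarrow> complex \<Rightarrow> complex \<Rightarrow> complex \<Rightarrow> cmat2" where
  "mat2 a b c d = vector [vector [a, b], vector [c, d]]"

definition sigma1 :: cmat2 where "sigma1 = mat2 0 1 1 0"

definition sigma3 :: cmat2 where "sigma3 = mat2 1 0 0 (-1)"

text \<open>\<open>exp_sigma3 a\<close> is the matrix exponential of \<open>a \<sigma>\<^sub>3\<close>, and \<open>pow_sigma3 c\<close> is \<open>c\<close> to the power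
  \<open>\<sigma>\<^sub>3\<close>. Multiplication of a matrix \<open>A\<close> by a complex scalar \<open>c\<close> is written \<open>mat c ** A\<close>.\<close>

definition exp_sigma3 :: "complex \<Rightarrow> cmat2" where
  "exp_sigma3 a = mat2 (exp a) 0 0 (exp (- a))"

definition pow_sigma3 :: "complex \<Rightarrow> cmat2" where
  "pow_sigma3 c = mat2 c 0 0 (inverse c)"

definition conj_sigma1 :: "cmat2 \<Rightarrow> cmat2" where
  "conj_sigma1 A = sigma1 ** A ** sigma1"

definition mat_powi :: "cmat2 \<Rightarrow> int \<Rightarrow> cmat2" where
  "mat_powi P p = (if p \<ge> 0 then (((**) P) ^^ nat p) (mat 1)
                   else (((**) (matrix_inv P)) ^^ nat (- p)) (mat 1))"

lemma mat2_nth [simp]: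
  "mat2 a b c d $ 1 $ 1 = a" "mat2 a b c d $ 1 $ 2 = b"
  "mat2 a b c d $ 2 $ 1 = c" "mat2 a b c d $ 2 $ 2 = d"
  by (simp_all add: mat2_def)

section \<open>The fifth Painleve equation on the universal covering\<close>

text \<open>The universal covering of \<open>\<complex> - {0}\<close> is the plane of \<open>w = ln x\<close>, so that \<open>x = exp w\<close>,
  \<open>arg x = Im w\<close>, and \<open>x \<mapsto> exp (2 \<pi> \<i>) x\<close> is \<open>w \<mapsto> w + 2 \<pi> \<i>\<close>. Functions of \<open>x\<close> on the covering are
  functions of \<open>w\<close>; \<open>ddx\<close> is the derivative with respect to \<open>x\<close>.\<close>

definition ddx :: "(complex \<Rightarrow> complex) \<Rightarrow> complex \<Rightarrow> complex" where
  "ddx f w = deriv f w / exp w"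

definition PV_equation ::
  "complex \<Rightarrow> complex \<Rightarrow> complex \<Rightarrow> (complex \<Rightarrow> complex) \<Rightarrow> complex \<Rightarrow> bool" where
  "PV_equation \<theta>0 \<theta>1 \<theta>i y w \<longleftrightarrow>
    (let x = exp w;
         a = (\<theta>0 - \<theta>1 + \<theta>i)\<^sup>2 / 8;
         b = (\<theta>0 - \<theta>1 - \<theta>i)\<^sup>2 / 8;
         c = 1 - \<theta>0 - \<theta>1
     in ddx (ddx y) w =
          (1 / (2 * y w) + 1 / (y w - 1)) * (ddx y w)\<^sup>2 - ddx y w / x
          + (y w - 1)\<^sup>2 / x\<^sup>2 * (a * y w - b / y w)
          + c * y w / x - y w * (y w + 1) / (2 * (y w - 1)))"

definition PV_system ::
  "complex \<Rightarrow> complex \<Rightarrow> complex \<Rightarrow> (complex \<Rightarrow> complex) \<Rightarrow> (complex \<Rightarrow> complex) \<Rightarrow> (complex \<Rightarrow> complex)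
    \<Rightarrow> complex \<Rightarrow> bool" where
  "PV_system \<theta>0 \<theta>1 \<theta>i y z u w \<longleftrightarrow>
    exp w * ddx y w =
      exp w * y w - 2 * z w * (y w - 1)\<^sup>2
      - (y w - 1) * ((\<theta>0 - \<theta>1 + \<theta>i) / 2 * y w - (3 * \<theta>0 + \<theta>1 + \<theta>i) / 2) \<and>
    exp w * ddx z w =
      y w * z w * (z w + (\<theta>0 - \<theta>1 + \<theta>i) / 2)
      - (z w + \<theta>0) * (z w + (\<theta>0 + \<theta>1 + \<theta>i) / 2) / y w \<and>
    exp w * (ddx u w / u w) =
      - 2 * z w - \<theta>0 + y w * (z w + (\<theta>0 - \<theta>1 + \<theta>i) / 2)
      + (z w + (\<theta>0 + \<theta>1 + \<theta>i) / 2) / y w"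

section \<open>The linear system\<close>

definition A0_mat :: "complex \<Rightarrow> complex \<Rightarrow> complex \<Rightarrow> cmat2" where
  "A0_mat \<theta>0 z u = mat2 (z + \<theta>0 / 2) (- u * (z + \<theta>0)) (z / u) (- z - \<theta>0 / 2)"

definition A1_mat :: "complex \<Rightarrow> complex \<Rightarrow> complex \<Rightarrow> complex \<Rightarrow> complex \<Rightarrow> complex \<Rightarrow> cmat2" where
  "A1_mat \<theta>0 \<theta>1 \<theta>i y z u =
     mat2 (- z - (\<theta>0 + \<theta>i) / 2) (u * y * (z + (\<theta>0 - \<theta>1 + \<theta>i) / 2))
          (- (z + (\<theta>0 + \<theta>1 + \<theta>i) / 2) / (u * y)) (z + (\<theta>0 + \<theta>i) / 2)"

definition Xi_coeff ::
  "complex \<Rightarrow> complex \<Rightarrow> complex \<Rightarrow> complex \<Rightarrow> complex \<Rightarrow> complex \<Rightarrow> complex \<Rightarrow> complex \<Rightarrow> cmat2" where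
  "Xi_coeff \<theta>0 \<theta>1 \<theta>i x y z u \<xi> =
     mat (x / 2) ** sigma3 + mat (1 / \<xi>) ** A0_mat \<theta>0 z u
     + mat (1 / (\<xi> - 1)) ** A1_mat \<theta>0 \<theta>1 \<theta>i y z u"

text \<open>For \<open>x = exp w\<close>, i.e. \<open>t = exp (Re w)\<close> and \<open>\<phi> = Im w\<close>, this is the coefficient matrix of the system
  satisfied by \<open>Y = exp (- \<omega> \<sigma>\<^sub>3) \<Xi>\<close> as a function of \<open>\<zeta>\<close>, where \<open>\<xi> = (exp (- \<i> \<phi>) \<zeta> + 1) / 2\<close>. Here
  \<open>y\<close>, \<open>z\<close>, \<open>u\<close> are the values of the unknown functions at this \<open>x\<close>. The variable \<open>\<zeta>\<close> is usually called lambda.\<close>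

definition Y_coeff ::
  "complex \<Rightarrow> complex \<Rightarrow> complex \<Rightarrow> complex \<Rightarrow> complex \<Rightarrow> complex \<Rightarrow> complex \<Rightarrow> complex \<Rightarrow> cmat2" where
  "Y_coeff \<theta>0 \<theta>1 \<theta>i w y z u \<zeta> =
     (let \<phi> = Im w;
          \<omega> = exp w / 4 + \<theta>i / 2 * (\<i> * of_real \<phi> + of_real (ln 2));
          \<xi> = (cis (- \<phi>) * \<zeta> + 1) / 2
      in mat (cis (- \<phi>) / 2) **
           (exp_sigma3 (- \<omega>) ** Xi_coeff \<theta>0 \<theta>1 \<theta>i (exp w) y z u \<xi> ** exp_sigma3 \<omega>))"

text \<open>The canonical solution \<open>Y\<^sub>k\<close>. It lives on the universal covering of \<open>|\<zeta>| > 1\<close> (the finite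
  singular points have modulus 1), parametrised by \<open>v = ln \<zeta>\<close>, \<open>Re v > 0\<close>. As usual, the asymptotic relation
  in the open sector is meant uniformly in every proper closed subsector.\<close>

definition canonical_solution ::
  "complex \<Rightarrow> complex \<Rightarrow> complex \<Rightarrow> complex \<Rightarrow> complex \<Rightarrow> complex \<Rightarrow> complex \<Rightarrow> int \<Rightarrow> (complex \<Rightarrow> cmat2) \<Rightarrow> bool" where
  "canonical_solution \<theta>0 \<theta>1 \<theta>i w y z u k Y \<longleftrightarrow>
     (\<forall>v. Re v > 0 \<longrightarrow> (\<forall>i j.
        ((\<lambda>v. Y v $ i $ j) has_field_derivative
           exp v * (Y_coeff \<theta>0 \<theta>1 \<theta>i w y z u (exp v) ** Y v) $ i $ j) (at v))) \<and>
     (\<forall>\<delta>>0. \<exists>C R. \<forall>v. Re v > R \<and> \<bar>Im v - pi / 2 - (of_int k - 2) * pi\<bar> \<le> pi - \<delta> \<longrightarrow>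
        norm (Y v ** exp_sigma3 (- ((of_real (exp (Re w)) * exp v - 2 * \<theta>i * v) / 4)) - mat 1)
          \<le> C * exp (- Re v))"

section \<open>Monodromy data\<close>

text \<open>Analytic continuation of a matrix function germ \<open>f\<close> at the initial point of the path \<open>\<gamma>\<close> to the germ
  \<open>g\<close> at its end point.\<close>

definition continues_along ::
  "(real \<Rightarrow> complex) \<Rightarrow> (complex \<Rightarrow> cmat2) \<Rightarrow> (complex \<Rightarrow> cmat2) \<Rightarrow> bool" where
  "continues_along \<gamma> f g \<longleftrightarrow>
     (\<exists>F :: real \<Rightarrow> complex \<Rightarrow> cmat2.
        (\<forall>s\<in>{0..1}. \<forall>i j. (\<lambda>\<zeta>. F s \<zeta> $ i $ j) analytic_on {\<gamma> s}) \<and>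
        (\<forall>s\<in>{0..1}. \<forall>\<^sub>F s' in at s within {0..1}. \<forall>\<^sub>F \<zeta> in nhds (\<gamma> s'). F s' \<zeta> = F s \<zeta>) \<and>
        (\<forall>\<^sub>F \<zeta> in nhds (pathstart \<gamma>). F 0 \<zeta> = f \<zeta>) \<and>
        (\<forall>\<^sub>F \<zeta> in nhds (pathfinish \<gamma>). F 1 \<zeta> = g \<zeta>))"

text \<open>From \<open>P\<close> straight to distance \<open>\<epsilon>\<close> from \<open>a\<close>, once anticlockwise around \<open>a\<close>, and back.\<close>

definition lasso :: "complex \<Rightarrow> complex \<Rightarrow> real \<Rightarrow> real \<Rightarrow> complex" where
  "lasso P a \<epsilon> =
     (let \<alpha> = Arg (P - a); q = a + of_real \<epsilon> * cis \<alpha>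
      in linepath P q +++ (part_circlepath a \<epsilon> \<alpha> (\<alpha> + 2 * pi) +++ linepath q P))"

text \<open>\<open>(M\<^sup>0, M\<^sup>1)\<close> are the monodromy matrices of \<open>Y\<^sub>2\<close> for \<open>x = exp w\<close>. The base point is \<open>\<i> r\<close>, with
  argument \<open>\<pi>/2\<close>, where the principal logarithm \<open>Ln\<close> gives the sheet of the covering on which \<open>Y\<^sub>2\<close> is
  continued. The matrices do not depend on \<open>r > 100\<close> and \<open>\<epsilon> < 1\<close>.\<close>

definition monodromy_data ::
  "complex \<Rightarrow> complex \<Rightarrow> complex \<Rightarrow> complex \<Rightarrow> complex \<Rightarrow> complex \<Rightarrow> complex \<Rightarrow> cmat2 \<times> cmat2 \<Rightarrow> bool" where
  "monodromy_data \<theta>0 \<theta>1 \<theta>i w y z u = (\<lambda>(M0, M1).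
     \<exists>Y2 r \<epsilon>. canonical_solution \<theta>0 \<theta>1 \<theta>i w y z u 2 Y2 \<and> 100 < r \<and> 0 < \<epsilon> \<and> \<epsilon> < 1 \<and>
       continues_along (lasso (\<i> * of_real r) (- cis (Im w)) \<epsilon>)
         (\<lambda>\<zeta>. Y2 (Ln \<zeta>)) (\<lambda>\<zeta>. Y2 (Ln \<zeta>) ** M0) \<and>
       continues_along (lasso (\<i> * of_real r) (cis (Im w)) \<epsilon>)
         (\<lambda>\<zeta>. Y2 (Ln \<zeta>)) (\<lambda>\<zeta>. Y2 (Ln \<zeta>) ** M1))"

section \<open>The monodromy manifold\<close>

definition monodromy_pairs :: "complex \<Rightarrow> complex \<Rightarrow> complex \<Rightarrow> (cmat2 \<times> cmat2) set" where
  "monodromy_pairs \<theta>0 \<theta>1 \<theta>i = {(M0, M1).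
     det M0 = 1 \<and> det M1 = 1 \<and>
     M0 $ 1 $ 1 * M1 $ 1 $ 1 + M0 $ 2 $ 1 * M1 $ 1 $ 2 = exp (- of_real pi * \<i> * \<theta>i) \<and>
     trace M0 = 2 * cos (of_real pi * \<theta>0) \<and> trace M1 = 2 * cos (of_real pi * \<theta>1)}"

definition monodromy_class :: "cmat2 \<times> cmat2 \<Rightarrow> (cmat2 \<times> cmat2) set" where
  "monodromy_class = (\<lambda>(M0, M1).
     {(pow_sigma3 c ** M0 ** pow_sigma3 (inverse c), pow_sigma3 c ** M1 ** pow_sigma3 (inverse c))
      | c. c \<noteq> 0})"

definition monodromy_manifold :: "complex \<Rightarrow> complex \<Rightarrow> complex \<Rightarrow> (cmat2 \<times> cmat2) set set" where
  "monodromy_manifold \<theta>0 \<theta>1 \<theta>i = monodromy_class ` monodromy_pairs \<theta>0 \<theta>1 \<theta>i"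

section \<open>Solutions labelled by monodromy data\<close>

text \<open>The set of all solutions denoted by \<open>y(x, M\<^sup>0, M\<^sup>1)\<close>, for \<open>M = (M\<^sup>0, M\<^sup>1)\<close>. The class of \<open>M\<close> in the
  monodromy manifold is required for \<open>|arg x| < \<pi>/2\<close>; the functions themselves are the continuations to the
  whole covering, which are meromorphic. The functions \<open>y\<close> are normalised at
  their poles (value 0, see \<open>nicely_meromorphic_on_def\<close>), so that an equality of such functions, or of
  one of them with the reciprocal of another (where \<open>1 / 0 = 0\<close>), at all points is the same as equality as
  meromorphic functions. The quantifier \<open>\<forall>\<^sub>\<approx>\<close> discards the isolated points at which the coefficients of the
  equations or of the linear system are not defined.\<close>

definition PV_solutions ::
  "complex \<Rightarrow> complex \<Rightarrow> complex \<Rightarrow> cmat2 \<times> cmat2 \<Rightarrow> (complex \<Rightarrow> complex) set" where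
  "PV_solutions \<theta>0 \<theta>1 \<theta>i M = {y. y nicely_meromorphic_on UNIV \<and>
     (\<forall>\<^sub>\<approx>w\<in>UNIV. y w \<noteq> 0 \<and> y w \<noteq> 1 \<and> PV_equation \<theta>0 \<theta>1 \<theta>i y w) \<and>
     (\<exists>z u. z meromorphic_on UNIV \<and> u meromorphic_on UNIV \<and>
        (\<forall>\<^sub>\<approx>w\<in>UNIV. u w \<noteq> 0 \<and> PV_system \<theta>0 \<theta>1 \<theta>i y z u w) \<and>
        (\<forall>\<^sub>\<approx>w\<in>{w. \<bar>Im w\<bar> < pi / 2}.
           \<exists>N\<in>monodromy_class M. monodromy_data \<theta>0 \<theta>1 \<theta>i w (y w) (z w) (u w) N))}"

section \<open>Operators on monodromy data\<close>

definition stokes1 :: "complex \<Rightarrow> cmat2 \<times> cmat2 \<Rightarrow> cmat2" where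
  "stokes1 \<theta>i = (\<lambda>(M0, M1).
     mat2 1 0 (- exp (of_real pi * \<i> * \<theta>i) * (M0 $ 1 $ 1 * M1 $ 2 $ 1 + M0 $ 2 $ 1 * M1 $ 2 $ 2)) 1)"

definition stokes2 :: "complex \<Rightarrow> cmat2 \<times> cmat2 \<Rightarrow> cmat2" where
  "stokes2 \<theta>i = (\<lambda>(M0, M1).
     mat2 1 (- exp (of_real pi * \<i> * \<theta>i) * (M0 $ 1 $ 2 * M1 $ 1 $ 1 + M0 $ 2 $ 2 * M1 $ 1 $ 2)) 0 1)"

definition orbit_mat :: "cmat2 \<times> cmat2 \<Rightarrow> int \<Rightarrow> cmat2 \<Rightarrow> cmat2" where
  "orbit_mat = (\<lambda>(M0, M1) p A. mat_powi (M1 ** M0) p ** A ** mat_powi (M1 ** M0) (- p))"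

definition mono_orbit :: "cmat2 \<times> cmat2 \<Rightarrow> int \<Rightarrow> cmat2 \<times> cmat2" where
  "mono_orbit M p = (orbit_mat M p (fst M), orbit_mat M p (snd M))"

definition hat_mat :: "complex \<Rightarrow> cmat2 \<times> cmat2 \<Rightarrow> cmat2 \<Rightarrow> cmat2" where
  "hat_mat \<theta>i M A =
     exp_sigma3 (- (of_real pi * \<i> / 2 * \<theta>i)) ** matrix_inv (stokes2 \<theta>i M) ** A
     ** stokes2 \<theta>i M ** exp_sigma3 (of_real pi * \<i> / 2 * \<theta>i)"

definition hat_orbit :: "complex \<Rightarrow> cmat2 \<times> cmat2 \<Rightarrow> int \<Rightarrow> cmat2 \<times> cmat2" where
  "hat_orbit \<theta>i M p =
     (conj_sigma1 (hat_mat \<theta>i M (orbit_mat M p (fst M))),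
      conj_sigma1 (hat_mat \<theta>i M (orbit_mat M p (snd M))))"

text \<open>The operators are given on the orbits by prescribing the image of the element with index \<open>p\<close>;
  \<open>index_map f g\<close> is the map \<open>f p \<mapsto> g p\<close>. The lemmas below show that this is well defined even if the
  indexing of the orbit is not injective.\<close>

definition index_map :: "(int \<Rightarrow> 'a) \<Rightarrow> (int \<Rightarrow> 'b) \<Rightarrow> 'a \<Rightarrow> 'b" where
  "index_map f g N = (THE K. \<exists>p. N = f p \<and> K = g p)"

definition op_m :: "cmat2 \<times> cmat2 \<Rightarrow> cmat2 \<times> cmat2 \<Rightarrow> cmat2 \<times> cmat2" where
  "op_m M = index_map (mono_orbit M) (\<lambda>p. mono_orbit M (p + 1))"

definition op_hat_m :: "complex \<Rightarrow> cmat2 \<times> cmat2 \<Rightarrow> cmat2 \<times> cmat2 \<Rightarrow> cmat2 \<times> cmat2" where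
  "op_hat_m \<theta>i M = index_map (hat_orbit \<theta>i M) (\<lambda>p. hat_orbit \<theta>i M (p + 1))"

definition op_s :: "complex \<Rightarrow> cmat2 \<times> cmat2 \<Rightarrow> int \<Rightarrow> cmat2 \<times> cmat2 \<Rightarrow> cmat2 \<times> cmat2" where
  "op_s \<theta>i M k = index_map (mono_orbit M) (\<lambda>p. hat_orbit \<theta>i M (p + k))"

definition op_hat_s :: "complex \<Rightarrow> cmat2 \<times> cmat2 \<Rightarrow> int \<Rightarrow> cmat2 \<times> cmat2 \<Rightarrow> cmat2 \<times> cmat2" where
  "op_hat_s \<theta>i M k = index_map (hat_orbit \<theta>i M) (\<lambda>p. mono_orbit M (p + k))"

subsection \<open>Well-definedness and basic properties\<close>

lemma cmat2_eq_iff: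
  "A = B \<longleftrightarrow> A $ 1 $ 1 = B $ 1 $ 1 \<and> A $ 1 $ 2 = B $ 1 $ 2 \<and> A $ 2 $ 1 = B $ 2 $ 1 \<and> A $ 2 $ 2 = B $ 2 $ 2"
  for A B :: cmat2
  by (simp only: vec_eq_iff[where 'a = "complex^2"] vec_eq_iff[where 'a = complex] forall_2 conj_assoc)

lemma cmat2_mult_nth: "(A ** B) $ i $ j = A $ i $ 1 * B $ 1 $ j + A $ i $ 2 * B $ 2 $ j" for A B :: cmat2
  by (simp add: matrix_matrix_mult_def sum_2)

lemma mat2_mult:
  "mat2 a b c d ** mat2 a' b' c' d' =
     mat2 (a * a' + b * c') (a * b' + b * d') (c * a' + d * c') (c * b' + d * d')"
  by (simp add: cmat2_eq_iff cmat2_mult_nth)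

lemma mat2_one: "mat 1 = mat2 1 0 0 1"
  by (simp add: cmat2_eq_iff mat_def)

lemma matrix_inv_unique:
  fixes A B :: cmat2
  assumes "A ** B = mat 1" "B ** A = mat 1"
  shows "matrix_inv A = B"
proof -
  have "A ** matrix_inv A = mat 1 \<and> matrix_inv A ** A = mat 1"
    unfolding matrix_inv_def by (rule someI[where x = B]) (use assms in auto)
  then have "matrix_inv A = matrix_inv A ** (A ** B)" "(matrix_inv A ** A) ** B = B"
    using assms by simp_all
  then show ?thesis by (simp only: matrix_mul_assoc)
qed

lemma matrix_inv_SL2:
  fixes A :: cmat2
  assumes "det A = 1"
  shows "A ** matrix_inv A = mat 1" "matrix_inv A ** A = mat 1"
proof -
  let ?B = "mat2 (A $ 2 $ 2) (- A $ 1 $ 2) (- A $ 2 $ 1) (A $ 1 $ 1)"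
  have "A ** ?B = mat 1" "?B ** A = mat 1"
    using assms by (auto simp: cmat2_eq_iff cmat2_mult_nth mat2_one det_2 algebra_simps)
  with matrix_inv_unique[of A ?B] show "A ** matrix_inv A = mat 1" "matrix_inv A ** A = mat 1"
    by simp_all
qed

lemma matrix_inv_SL2_cancel:
  fixes A B :: cmat2
  assumes "det A = 1"
  shows "A ** (matrix_inv A ** B) = B" "matrix_inv A ** (A ** B) = B"
  using assms by (simp_all add: matrix_mul_assoc matrix_inv_SL2)

lemmas mat_assoc = matrix_mul_assoc[symmetric]

lemma funpow_mult_comm: "(((**) P) ^^ n) (mat 1) ** P = P ** (((**) P) ^^ n) (mat 1)" for P :: cmat2
  by (induction n) (simp_all add: matrix_mul_assoc[symmetric])

lemma mat_powi_add_1: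
  assumes "det P = 1"
  shows "mat_powi P (p + 1) = P ** mat_powi P p"
proof (cases "p \<ge> 0")
  case True
  then show ?thesis by (simp add: mat_powi_def nat_add_distrib)
next
  case False
  define n where "n = nat (- p - 1)"
  have "nat (- p) = Suc n" using False by (simp add: n_def)
  then have *: "mat_powi P p = matrix_inv P ** (((**) (matrix_inv P)) ^^ n) (mat 1)"
    using False by (simp add: mat_powi_def)
  have "mat_powi P (p + 1) = (((**) (matrix_inv P)) ^^ n) (mat 1)"
  proof (cases "p = -1")
    case True
    then show ?thesis by (simp add: mat_powi_def n_def)
  next
    case False
    have "nat (- (p + 1)) = n" by (simp add: n_def)
    moreover have "\<not> p + 1 \<ge> 0" using False \<open>\<not> p \<ge> 0\<close> by simp
    ultimately show ?thesis by (simp only: mat_powi_def if_False)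
  qed
  then show ?thesis
    using assms by (simp add: * matrix_mul_assoc matrix_inv_SL2)
qed

lemma mat_powi_comm:
  assumes "det P = 1"
  shows "mat_powi P p ** P = P ** mat_powi P p"
proof (cases "p \<ge> 0")
  case True
  then show ?thesis by (simp add: mat_powi_def funpow_mult_comm)
next
  case False
  define Q where "Q = (((**) (matrix_inv P)) ^^ nat (- p)) (mat 1)"
  have "Q ** matrix_inv P = matrix_inv P ** Q"
    by (simp add: Q_def funpow_mult_comm)
  then have "P ** (Q ** matrix_inv P) ** P = P ** (matrix_inv P ** Q) ** P"
    by simp
  then have "P ** Q = Q ** P"
    using assms by (simp add: mat_assoc matrix_inv_SL2 matrix_inv_SL2_cancel)
  then show ?thesis using False by (simp add: mat_powi_def Q_def)
qed

lemma orbit_mat_add_1: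
  assumes "det (fst M) = 1" "det (snd M) = 1"
  defines "P \<equiv> snd M ** fst M"
  shows "orbit_mat M (p + 1) A = P ** orbit_mat M p A ** matrix_inv P"
proof -
  have P: "det P = 1" using assms by (simp add: det_mul)
  have "mat_powi P (- p) = P ** mat_powi P (- p - 1)"
    using mat_powi_add_1[OF P, of "- p - 1"] by simp
  also have "\<dots> = mat_powi P (- p - 1) ** P" using P by (simp add: mat_powi_comm)
  finally have "mat_powi P (- p) ** matrix_inv P = mat_powi P (- p - 1)"
    using P by (simp add: mat_assoc matrix_inv_SL2)
  moreover have "- (p + 1) = - p - 1" by simp
  ultimately show ?thesis
    unfolding orbit_mat_def P_def using mat_powi_add_1[OF P, of p]
    by (simp add: case_prod_beta P_def matrix_mul_assoc[symmetric])
qed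

lemma orbit_mat_diff_1:
  assumes "det (fst M) = 1" "det (snd M) = 1"
  defines "P \<equiv> snd M ** fst M"
  shows "orbit_mat M (p - 1) A = matrix_inv P ** orbit_mat M p A ** P"
proof -
  have P: "det P = 1" using assms by (simp add: det_mul)
  have "orbit_mat M p A = P ** orbit_mat M (p - 1) A ** matrix_inv P"
    using orbit_mat_add_1[of M "p - 1" A] assms by simp
  then show ?thesis
    using P by (simp add: mat_assoc matrix_inv_SL2 matrix_inv_SL2_cancel)
qed

lemma hat_mat_inject:
  assumes "hat_mat \<theta>i M A = hat_mat \<theta>i M B"
  shows "A = B"
proof -
  let ?S = "stokes2 \<theta>i M" and ?e = "of_real pi * \<i> / 2 * \<theta>i"
  have det: "det ?S = 1" by (simp add: stokes2_def case_prod_beta det_2)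
  have e: "exp_sigma3 a ** exp_sigma3 (- a) = mat 1" "exp_sigma3 (- a) ** exp_sigma3 a = mat 1" for a
    by (simp_all add: exp_sigma3_def mat2_mult mat2_one flip: exp_add)
  have e': "exp_sigma3 a ** (exp_sigma3 (- a) ** C) = C" for a C
    by (simp add: matrix_mul_assoc e)
  have undo: "?S ** (exp_sigma3 ?e ** hat_mat \<theta>i M C ** exp_sigma3 (- ?e)) ** matrix_inv ?S = C" for C
    unfolding hat_mat_def using det
    by (simp only: mat_assoc e e' matrix_mul_rid matrix_inv_SL2 matrix_inv_SL2_cancel)
  show ?thesis using undo[of A] undo[of B] assms by simp
qed

lemma sigma1_sq: "sigma1 ** sigma1 = mat 1"
  unfolding sigma1_def mat2_mult mat2_one by simp

lemma conj_sigma1_inject: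
  assumes "conj_sigma1 A = conj_sigma1 B"
  shows "A = B"
proof -
  have *: "sigma1 ** (sigma1 ** C) = C" for C
    by (simp only: matrix_mul_assoc sigma1_sq matrix_mul_lid)
  have "sigma1 ** conj_sigma1 C ** sigma1 = C" for C
    by (simp only: conj_sigma1_def mat_assoc * sigma1_sq matrix_mul_rid)
  from this[of A] this[of B] show ?thesis unfolding assms by (rule trans[OF sym])
qed

lemma hat_orbit_eq_iff: "hat_orbit \<theta>i M p = hat_orbit \<theta>i M q \<longleftrightarrow> mono_orbit M p = mono_orbit M q"
proof
  assume "hat_orbit \<theta>i M p = hat_orbit \<theta>i M q"
  then show "mono_orbit M p = mono_orbit M q"
    unfolding hat_orbit_def mono_orbit_def prod.inject by (blast dest: conj_sigma1_inject hat_mat_inject)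
qed (simp add: hat_orbit_def mono_orbit_def)

lemma index_map_apply:
  assumes "\<And>q. f q = f p \<Longrightarrow> g q = g p"
  shows "index_map f g (f p) = g p"
  unfolding index_map_def
proof (rule the_equality)
  fix K assume "\<exists>q. f p = f q \<and> K = g q"
  then obtain q where "f q = f p" "K = g q" by (auto dest: sym)
  then show "K = g p" using assms[of q] by simp
qed blast

context
  fixes M :: "cmat2 \<times> cmat2"
  assumes SL2: "det (fst M) = 1" "det (snd M) = 1"
begin

lemma orbit_eq_shift: "mono_orbit M q = mono_orbit M p \<Longrightarrow> mono_orbit M (q + 1) = mono_orbit M (p + 1)"
  by (simp add: mono_orbit_def orbit_mat_add_1[OF SL2])

lemma orbit_eq_shift': "mono_orbit M q = mono_orbit M p \<Longrightarrow> mono_orbit M (q - 1) = mono_orbit M (p - 1)"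
  by (simp add: mono_orbit_def orbit_mat_diff_1[OF SL2])

lemma op_m_orbit: "op_m M (mono_orbit M p) = mono_orbit M (p + 1)"
  unfolding op_m_def by (rule index_map_apply) (rule orbit_eq_shift)

lemma op_hat_m_hat_orbit: "op_hat_m \<theta>i M (hat_orbit \<theta>i M p) = hat_orbit \<theta>i M (p + 1)"
  unfolding op_hat_m_def by (rule index_map_apply) (unfold hat_orbit_eq_iff, rule orbit_eq_shift)

lemma op_s_0_orbit: "op_s \<theta>i M 0 (mono_orbit M p) = hat_orbit \<theta>i M p"
  unfolding op_s_def add_0_right by (rule index_map_apply) (unfold hat_orbit_eq_iff)

lemma op_s_minus_1_orbit: "op_s \<theta>i M (-1) (mono_orbit M p) = hat_orbit \<theta>i M (p - 1)"
  unfolding op_s_def diff_conv_add_uminus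
  by (rule index_map_apply)
     (unfold hat_orbit_eq_iff, rule orbit_eq_shift'[unfolded diff_conv_add_uminus])

lemma op_hat_s_0_hat_orbit: "op_hat_s \<theta>i M 0 (hat_orbit \<theta>i M p) = mono_orbit M p"
  unfolding op_hat_s_def add_0_right by (rule index_map_apply) (unfold hat_orbit_eq_iff)

lemma op_hat_s_1_hat_orbit: "op_hat_s \<theta>i M 1 (hat_orbit \<theta>i M p) = mono_orbit M (p + 1)"
  unfolding op_hat_s_def by (rule index_map_apply) (unfold hat_orbit_eq_iff, rule orbit_eq_shift)

end

lemma monodromy_pairs_SL2:
  assumes "M \<in> monodromy_pairs \<theta>0 \<theta>1 \<theta>i"
  shows "det (fst M) = 1" "det (snd M) = 1"
  using assms by (auto simp: monodromy_pairs_def)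

lemma monodromy_factorization:
  assumes "M \<in> monodromy_pairs \<theta>0 \<theta>1 \<theta>i"
  shows "snd M ** fst M = matrix_inv (stokes1 \<theta>i M) ** exp_sigma3 (- of_real pi * \<i> * \<theta>i)
                    ** matrix_inv (stokes2 \<theta>i M)"
proof -
  define P where "P = snd M ** fst M"
  define e where "e = exp (of_real pi * \<i> * \<theta>i)"
  have e: "e \<noteq> 0" "exp (- (of_real pi * \<i> * \<theta>i)) = 1 / e"
    by (simp_all add: e_def exp_minus field_simps)
  have P11: "P $ 1 $ 1 = 1 / e"
    using assms e by (auto simp: P_def monodromy_pairs_def cmat2_mult_nth algebra_simps)
  have "det P = 1" using assms by (simp add: P_def det_mul monodromy_pairs_SL2)
  then have P22: "P $ 2 $ 2 = e + e * P $ 1 $ 2 * P $ 2 $ 1"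
    using P11 e by (simp add: det_2 field_simps)
  have s: "stokes1 \<theta>i M = mat2 1 0 (- e * P $ 2 $ 1) 1" "stokes2 \<theta>i M = mat2 1 (- e * P $ 1 $ 2) 0 1"
    by (simp_all add: stokes1_def stokes2_def case_prod_beta P_def e_def cmat2_mult_nth algebra_simps)
  have inv: "matrix_inv (stokes1 \<theta>i M) = mat2 1 0 (e * P $ 2 $ 1) 1"
    "matrix_inv (stokes2 \<theta>i M) = mat2 1 (e * P $ 1 $ 2) 0 1"
    unfolding s by (rule matrix_inv_unique; simp add: mat2_mult mat2_one)+
  have "exp_sigma3 (- of_real pi * \<i> * \<theta>i) = mat2 (1 / e) 0 0 e"
    using e by (simp add: exp_sigma3_def e_def)
  then show ?thesis
    unfolding inv P_def[symmetric] using e P11 P22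
    by (simp add: cmat2_eq_iff cmat2_mult_nth algebra_simps)
qed

lemma mat_powi_minus:
  assumes "det P = 1"
  shows "mat_powi P p ** mat_powi P (- p) = mat 1"
proof -
  have 1: "mat_powi P (q + 1) ** mat_powi P (- (q + 1)) = mat_powi P q ** mat_powi P (- q)" for q
  proof -
    have "mat_powi P (- q) = P ** mat_powi P (- (q + 1))"
      using mat_powi_add_1[OF assms, of "- q - 1"] by simp
    moreover have "mat_powi P (q + 1) = mat_powi P q ** P"
      using assms by (simp add: mat_powi_add_1 mat_powi_comm)
    ultimately show ?thesis by (simp add: matrix_mul_assoc)
  qed
  show ?thesis
  proof (induction p rule: int_induct[where k = 0])
    case base
    show ?case by (simp add: mat_powi_def)
  next
    case (step1 q)
    then show ?case using 1[of q] by simp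
  next
    case (step2 q)
    then show ?case using 1[of "q - 1"] by simp
  qed
qed

lemma hat_orbit_in_pairs:
  assumes "M \<in> monodromy_pairs \<theta>0 \<theta>1 \<theta>i"
  shows "hat_orbit \<theta>i M p \<in> monodromy_pairs \<theta>0 \<theta>1 (- \<theta>i)"
proof -
  define P where "P = snd M ** fst M"
  define S where "S = stokes2 \<theta>i M"
  define h where "h = of_real pi * \<i> / 2 * \<theta>i"
  define L where "L = sigma1 ** exp_sigma3 (- h) ** matrix_inv S ** mat_powi P p"
  define R where "R = mat_powi P (- p) ** S ** exp_sigma3 h ** sigma1"
  define T where "T A = L ** A ** R" for A
  have P: "det P = 1" using assms by (simp add: P_def det_mul monodromy_pairs_SL2)
  have S: "det S = 1" by (simp add: S_def stokes2_def case_prod_beta det_2)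
  have e: "exp_sigma3 a ** exp_sigma3 (- a) = mat 1" for a
    by (simp add: exp_sigma3_def mat2_mult mat2_one flip: exp_add)
  have pp: "mat_powi P (- p) ** mat_powi P p = mat 1"
    using mat_powi_minus[OF P, of "- p"] by simp
  have RL: "R ** L = mat 1"
  proof -
    have "R ** L = mat_powi P (- p) ** (S ** (exp_sigma3 h ** (sigma1 ** sigma1) ** exp_sigma3 (- h))
                      ** matrix_inv S) ** mat_powi P p"
      by (simp add: R_def L_def matrix_mul_assoc)
    then show ?thesis using S by (simp add: sigma1_sq e matrix_inv_SL2 pp)
  qed
  have T: "conj_sigma1 (hat_mat \<theta>i M (orbit_mat M p A)) = T A" for A
    by (simp add: T_def L_def R_def conj_sigma1_def hat_mat_def orbit_mat_def P_def S_def h_def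
        case_prod_beta matrix_mul_assoc)
  have tr: "trace (T A) = trace A" for A
  proof -
    have "trace (T A) = trace (R ** (L ** A))"
      unfolding T_def by (rule trace_mul_sym)
    then show ?thesis by (simp add: matrix_mul_assoc RL)
  qed
  have "det R * det L = 1" using RL by (metis det_mul det_I)
  then have dt: "det (T A) = det A" for A by (simp add: T_def det_mul mult.commute)
  have "T (snd M) ** T (fst M) = L ** snd M ** (R ** L) ** fst M ** R"
    by (simp add: T_def matrix_mul_assoc)
  also have "\<dots> = T P" by (simp add: RL T_def P_def matrix_mul_assoc)
  also have "T P = conj_sigma1 (hat_mat \<theta>i M P)"
  proof -
    have "orbit_mat M p P = P ** (mat_powi P p ** mat_powi P (- p))"
      using P by (simp add: orbit_mat_def case_prod_beta P_def[symmetric] mat_powi_comm matrix_mul_assoc)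
    also have "\<dots> = P" by (simp add: mat_powi_minus[OF P])
    finally show ?thesis by (simp flip: T)
  qed
  finally have TT: "T (snd M) ** T (fst M) = conj_sigma1 (hat_mat \<theta>i M P)" .
  have "hat_mat \<theta>i M P = exp_sigma3 (- h) ** matrix_inv S ** matrix_inv (stokes1 \<theta>i M)
      ** exp_sigma3 (- of_real pi * \<i> * \<theta>i) ** (matrix_inv S ** S) ** exp_sigma3 h"
    unfolding hat_mat_def P_def monodromy_factorization[OF assms]
    by (simp add: S_def h_def matrix_mul_assoc)
  also have "\<dots> = exp_sigma3 (- h) ** matrix_inv S ** matrix_inv (stokes1 \<theta>i M)
      ** exp_sigma3 (- of_real pi * \<i> * \<theta>i) ** exp_sigma3 h"
    using S by (simp add: matrix_inv_SL2)
  finally have H: "hat_mat \<theta>i M P = \<dots>" .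
  have inv: "matrix_inv (mat2 1 0 a 1) = mat2 1 0 (- a) 1" "matrix_inv (mat2 1 a 0 1) = mat2 1 (- a) 0 1" for a
    by (rule matrix_inv_unique; simp add: mat2_mult mat2_one)+
  have "conj_sigma1 A $ 1 $ 1 = A $ 2 $ 2" for A
    by (simp add: conj_sigma1_def sigma1_def cmat2_mult_nth)
  then have "(T (snd M) ** T (fst M)) $ 1 $ 1 = hat_mat \<theta>i M P $ 2 $ 2"
    by (simp add: TT)
  also have "\<dots> = exp h * exp (of_real pi * \<i> * \<theta>i) * exp (- h)"
    unfolding H S_def stokes1_def stokes2_def case_prod_beta inv exp_sigma3_def mat2_mult by simp
  also have "\<dots> = exp (of_real pi * \<i> * \<theta>i)" by (simp flip: exp_add)
  finally have "T (fst M) $ 1 $ 1 * T (snd M) $ 1 $ 1 + T (fst M) $ 2 $ 1 * T (snd M) $ 1 $ 2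
     = exp (of_real pi * \<i> * \<theta>i)"
    by (simp add: cmat2_mult_nth algebra_simps)
  then show ?thesis
    using assms by (auto simp: monodromy_pairs_def hat_orbit_def T tr dt)
qed

end

theory Submission
  imports Defs
begin

text \<open>The proof follows one solution \<open>\<Xi>\<close> of the linear system as \<open>w = ln x\<close> varies. Multiplied on the left by the
  solution of the deformation equation, which is entire in the spectral variable, a canonical solution stays
  canonical and keeps its monodromy matrices; so the monodromy data normalised at \<open>arg x + arg \<xi> = \<pi>/2\<close> are
  constant on the whole covering. After a half turn of \<open>x\<close> the sector of the canonical solution \<open>Y\<^sub>2\<close> has moved on
  by one, and conjugation by \<open>\<sigma>\<^sub>1\<close> turns the system at \<open>w + \<pi> \<i>\<close> into the one for \<open>1/y\<close> and \<open>- \<theta>\<^sub>\<infinity>\<close> at \<open>w\<close>. Hence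
  the data are changed by a Stokes matrix, a power of \<open>\<sigma>\<^sub>3\<close> and \<open>\<sigma>\<^sub>1\<close>, and two half turns conjugate by \<open>M\<^sup>1 M\<^sup>0\<close>.

  For the uniqueness of the solution with given data let \<open>\<Xi>\<close> and \<open>\<Xi>'\<close> belong to the same data. Then \<open>\<Xi> \<Xi>'\<^sup>-\<^sup>1\<close> is
  single valued; it extends holomorphically to the two finite singular points, as the local monodromy is not
  \<open>\<plusminus>1\<close>, and it is bounded at infinity by the Phragmen-Lindeloef principle. So it is the identity.\<close>


section \<open>Calculus of two by two matrices\<close>

text \<open>The labels are fixed only for |arg x| < pi/2, whereas the theorem compares points a half
  turn apart. Hence a form of the monodromy data, \<open>mono_rep\<close>, that makes sense at every
  point \<open>w\<close> of the covering and agrees with \<open>monodromy_data\<close> in the strip: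
  continuation along lassos is replaced by three solutions on fixed cut planes, and the sector is
  measured by \<open>Im (e + w)\<close>, the argument of lambda. Every canonical solution in the
  proof is made from the one that the data supply. A full turn of the spectral variable shifts its
  index by two; the one in between is the product with a Stokes matrix read off from M1 M0. The
  analytic content is that this product has the right asymptotics also near the direction that
  neither neighbour controls. In the uniqueness part the obstacle is resonance: the residues have
  eigenvalues +-th/2, so for integral th the quotient of two solutions could have a pole although it
  is single valued. What excludes this is the logarithm that nonscalar local monodromy then
  forces.\<close>

definition cscale :: "complex \<Rightarrow> cmat2 \<Rightarrow> cmat2" (infixr \<open>*m\<close> 75) where
  "c *m A = (\<chi> i j. c * A $ i $ j)"

lemma cscale_nth [simp]: "(c *m A) $ i $ j = c * A $ i $ j"
  by (simp add: cscale_def)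

lemma mat_nth_2 [simp]:
  "(mat c :: cmat2) $ 1 $ 1 = c" "(mat c :: cmat2) $ 2 $ 2 = c"
  "(mat c :: cmat2) $ 1 $ 2 = 0" "(mat c :: cmat2) $ 2 $ 1 = 0"
  by (simp_all add: mat_def)

lemmas cmat2_simps = cmat2_eq_iff cmat2_mult_nth

lemma mat_mult_eq_cscale: "mat c ** A = c *m A" "A ** mat c = c *m A"
  by (simp_all add: cmat2_simps)

lemma cscale_cscale [simp]: "a *m (b *m A) = (a * b) *m A"
  by (simp add: cmat2_simps)

lemma cscale_simps [simp]: "1 *m A = A" "0 *m A = 0" "c *m 0 = 0"
  by (simp_all add: cmat2_simps)

lemma cscale_mult: "(c *m A) ** B = c *m (A ** B)" "A ** (c *m B) = c *m (A ** B)"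
  by (simp_all add: cmat2_simps algebra_simps)

lemma cmat2_mult_algebra:
  fixes A B C :: cmat2
  shows "A ** (B + C) = A ** B + A ** C" "(A + B) ** C = A ** C + B ** C"
    "A ** (B - C) = A ** B - A ** C" "(A - B) ** C = A ** C - B ** C"
    "A ** (- B) = - (A ** B)" "(- A) ** B = - (A ** B)" "A ** 0 = 0" "0 ** A = 0"
  by (simp_all add: cmat2_simps algebra_simps)

section \<open>The Euclidean norm on matrices\<close>

lemma norm_cmat2_sq:
  "(norm (A :: cmat2))\<^sup>2 = (norm (A $ 1 $ 1))\<^sup>2 + (norm (A $ 1 $ 2))\<^sup>2 + (norm (A $ 2 $ 1))\<^sup>2 + (norm (A $ 2 $ 2))\<^sup>2"
  by (simp add: norm_vec_def L2_set_def sum_2)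

lemma norm_cmat2_entry: "norm ((A :: cmat2) $ i $ j) \<le> norm A"
  by (meson Finite_Cartesian_Product.norm_nth_le order_trans)

lemma norm_cmat2_le_sum:
  "norm (A :: cmat2) \<le> norm (A $ 1 $ 1) + norm (A $ 1 $ 2) + norm (A $ 2 $ 1) + norm (A $ 2 $ 2)"
proof (rule power2_le_imp_le)
  show "(norm A)\<^sup>2 \<le> (norm (A $ 1 $ 1) + norm (A $ 1 $ 2) + norm (A $ 2 $ 1) + norm (A $ 2 $ 2))\<^sup>2"
    unfolding norm_cmat2_sq unfolding power2_eq_square by (simp add: algebra_simps)
qed simp

lemma norm_cscale [simp]: "norm (c *m A) = norm c * norm A"
proof -
  have "(norm (c *m A))\<^sup>2 = (norm c * norm A)\<^sup>2"
    unfolding power_mult_distrib norm_cmat2_sq by (simp add: norm_mult power_mult_distrib algebra_simps)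
  then show ?thesis by simp
qed

text \<open>Cauchy-Schwarz in dimension two; after the triangle inequality the defect is the square
  of \<open>norm a * norm d - norm b * norm c\<close>.\<close>

lemma norm_bilinear_2_le:
  fixes a b c d :: complex
  shows "(norm (a * c + b * d))\<^sup>2 \<le> ((norm a)\<^sup>2 + (norm b)\<^sup>2) * ((norm c)\<^sup>2 + (norm d)\<^sup>2)"
proof -
  have "norm (a * c + b * d) \<le> norm a * norm c + norm b * norm d"
    by (metis norm_mult norm_triangle_ineq)
  then have "(norm (a * c + b * d))\<^sup>2 \<le> (norm a * norm c + norm b * norm d)\<^sup>2"
    by (simp add: power_mono)
  also have "\<dots> \<le> ((norm a)\<^sup>2 + (norm b)\<^sup>2) * ((norm c)\<^sup>2 + (norm d)\<^sup>2)"
    using zero_le_power2[of "norm a * norm d - norm b * norm c"]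
    by (simp add: power2_eq_square algebra_simps)
  finally show ?thesis .
qed

lemma scaleR_cmat2_nth: "(r *\<^sub>R (A :: cmat2)) $ i $ j = of_real r * A $ i $ j"
  by (simp add: scaleR_conv_of_real[where 'a = complex])

lemma norm_cmat2_mult: "norm (A ** B) \<le> norm A * norm B" for A B :: cmat2
proof (rule power2_le_imp_le)
  show "(norm (A ** B))\<^sup>2 \<le> (norm A * norm B)\<^sup>2"
    unfolding power_mult_distrib norm_cmat2_sq[of "A ** B"] cmat2_mult_nth
    using norm_bilinear_2_le[of "A$1$1" "B$1$1" "A$1$2" "B$2$1"] norm_bilinear_2_le[of "A$1$1" "B$1$2" "A$1$2" "B$2$2"]
     norm_bilinear_2_le[of "A$2$1" "B$1$1" "A$2$2" "B$2$1"] norm_bilinear_2_le[of "A$2$1" "B$1$2" "A$2$2" "B$2$2"]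
    unfolding norm_cmat2_sq[of A] norm_cmat2_sq[of B] by (simp add: algebra_simps)
qed simp

interpretation cmult: bounded_bilinear "(**) :: cmat2 \<Rightarrow> cmat2 \<Rightarrow> cmat2"
  by (rule bounded_bilinear.intro)
     (use norm_cmat2_mult in \<open>auto simp: cmat2_simps algebra_simps scaleR_cmat2_nth simp del: vector_scaleR_component intro!: exI[of _ 1]\<close>)

interpretation cscale: bounded_bilinear "(*m)"
  by (rule bounded_bilinear.intro)
     (auto simp: cmat2_simps algebra_simps scaleR_conv_of_real[where 'a = complex] intro!: exI[of _ 1])

section \<open>The adjugate in place of the inverse\<close>

definition adj2 :: "cmat2 \<Rightarrow> cmat2" where
  "adj2 A = mat2 (A $ 2 $ 2) (- A $ 1 $ 2) (- A $ 2 $ 1) (A $ 1 $ 1)"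

lemma adj2_nth [simp]:
  "adj2 A $ 1 $ 1 = A $ 2 $ 2" "adj2 A $ 1 $ 2 = - A $ 1 $ 2" "adj2 A $ 2 $ 1 = - A $ 2 $ 1" "adj2 A $ 2 $ 2 = A $ 1 $ 1"
  by (simp_all add: adj2_def)

text \<open>On matrices of determinant 1 the adjugate is the inverse. Being linear in the entries it
  preserves holomorphy and, in this norm, size.\<close>

lemma mult_adj2: "A ** adj2 A = mat (det A)" "adj2 A ** A = mat (det A)"
  by (simp_all add: cmat2_simps det_2 algebra_simps)

lemma adj2_mult: "adj2 (A ** B) = adj2 B ** adj2 A"
  by (simp add: cmat2_simps algebra_simps)

lemma norm_adj2 [simp]: "norm (adj2 A) = norm A"
proof -
  have "(norm (adj2 A))\<^sup>2 = (norm A)\<^sup>2" unfolding norm_cmat2_sq by simp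
  then show ?thesis by simp
qed

lemma det_adj2 [simp]: "det (adj2 A) = det A"
  by (simp add: det_2 algebra_simps)

lemma adj2_cancel:
  assumes "det A = 1"
  shows "A ** adj2 A = mat 1" "adj2 A ** A = mat 1" "A ** (adj2 A ** B) = B" "adj2 A ** (A ** B) = B"
  using assms by (simp_all add: matrix_mul_assoc mult_adj2)

lemma matrix_inv_eq_adj2: "det A = 1 \<Longrightarrow> matrix_inv A = adj2 A"
  by (rule matrix_inv_unique) (simp_all add: adj2_cancel)

lemma cmat2_left_cancel:
  fixes A B C :: cmat2
  assumes "A ** B = A ** C" "det A \<noteq> 0"
  shows "B = C"
proof -
  have "adj2 A ** (A ** B) = adj2 A ** (A ** C)" using assms by simp
  then show ?thesis using assms(2) by (simp add: matrix_mul_assoc mult_adj2 mat_mult_eq_cscale cmat2_eq_iff)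
qed

section \<open>Complex derivatives of matrix functions\<close>

definition has_mderiv :: "(complex \<Rightarrow> cmat2) \<Rightarrow> cmat2 \<Rightarrow> complex \<Rightarrow> bool" where
  "has_mderiv f D z \<longleftrightarrow> (f has_derivative (\<lambda>h. h *m D)) (at z)"

lemma has_mderiv_mult:
  assumes "has_mderiv f D z" "has_mderiv g E z"
  shows "has_mderiv (\<lambda>z. f z ** g z) (D ** g z + f z ** E) z"
  unfolding has_mderiv_def
  by (rule has_derivative_eq_rhs[OF cmult.FDERIV[OF assms[unfolded has_mderiv_def]]])
     (simp add: fun_eq_iff cmat2_simps algebra_simps)

lemma has_mderiv_const: "has_mderiv (\<lambda>z. C) 0 z"
  by (simp add: has_mderiv_def)

lemma has_mderiv_add:
  "has_mderiv f D z \<Longrightarrow> has_mderiv g E z \<Longrightarrow> has_mderiv (\<lambda>z. f z + g z) (D + E) z"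
  unfolding has_mderiv_def cscale.add_right by (rule has_derivative_add)

lemma has_mderiv_diff:
  "has_mderiv f D z \<Longrightarrow> has_mderiv g E z \<Longrightarrow> has_mderiv (\<lambda>z. f z - g z) (D - E) z"
  unfolding has_mderiv_def cscale.diff_right by (rule has_derivative_diff)

lemma has_mderiv_cscale:
  assumes "(c has_field_derivative c') (at z)" "has_mderiv f D z"
  shows "has_mderiv (\<lambda>z. c z *m f z) (c' *m f z + c z *m D) z"
  unfolding has_mderiv_def
  by (rule has_derivative_eq_rhs[OF cscale.FDERIV[OF assms(1)[unfolded has_field_derivative_def] assms(2)[unfolded has_mderiv_def]]])
     (simp add: fun_eq_iff cmat2_simps algebra_simps)

lemma has_mderiv_entry:
  assumes "has_mderiv f D z"
  shows "((\<lambda>z. f z $ i $ j) has_field_derivative D $ i $ j) (at z)"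
  unfolding has_field_derivative_def
  by (rule has_derivative_eq_rhs, rule bounded_linear.has_derivative[OF bounded_linear_vec_nth],
      rule bounded_linear.has_derivative[OF bounded_linear_vec_nth],
      rule assms[unfolded has_mderiv_def]) (simp add: fun_eq_iff)

lemma cmat2_decompose:
  "A = A$1$1 *m mat2 1 0 0 0 + A$1$2 *m mat2 0 1 0 0 + A$2$1 *m mat2 0 0 1 0 + A$2$2 *m mat2 0 0 0 1"
  by (simp add: cmat2_simps)

lemma has_mderivI:
  assumes "\<And>i j. ((\<lambda>z. f z $ i $ j) has_field_derivative D $ i $ j) (at z)"
  shows "has_mderiv f D z"
proof -
  have "has_mderiv (\<lambda>z. (f z $ i $ j) *m C) (D $ i $ j *m C) z" for i j C
    using has_mderiv_cscale[OF assms has_mderiv_const[of C], of i j] by simp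
  then have "has_mderiv (\<lambda>z. f z$1$1 *m mat2 1 0 0 0 + f z$1$2 *m mat2 0 1 0 0 + f z$2$1 *m mat2 0 0 1 0 + f z$2$2 *m mat2 0 0 0 1)
   (D$1$1 *m mat2 1 0 0 0 + D$1$2 *m mat2 0 1 0 0 + D$2$1 *m mat2 0 0 1 0 + D$2$2 *m mat2 0 0 0 1) z"
    by (intro has_mderiv_add)
  then show ?thesis by (simp flip: cmat2_decompose)
qed

text \<open>The Frechet form of the derivative carries the product rule and derivatives along real
  curves; the entrywise form connects it with holomorphic functions of one variable.\<close>

lemma has_mderiv_iff:
  "has_mderiv f D z \<longleftrightarrow> (\<forall>i j. ((\<lambda>z. f z $ i $ j) has_field_derivative D $ i $ j) (at z))"
  using has_mderivI has_mderiv_entry by blast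

lemma has_mderiv_compose:
  assumes "has_mderiv f D (g z)" "(g has_field_derivative g') (at z)"
  shows "has_mderiv (\<lambda>z. f (g z)) (g' *m D) z"
  unfolding has_mderiv_iff
  using DERIV_chain2[OF has_mderiv_entry[OF assms(1)] assms(2)] by (simp add: mult.commute)

lemma has_mderiv_adj2: "has_mderiv f D z \<Longrightarrow> has_mderiv (\<lambda>z. adj2 (f z)) (adj2 D) z"
  unfolding has_mderiv_iff
  by (simp add: forall_2 DERIV_minus)

lemma has_mderiv_curve:
  assumes "has_mderiv f D (g s)" "(g has_vector_derivative g') (at s within S)"
  shows "((\<lambda>s. f (g s)) has_vector_derivative g' *m D) (at s within S)"
proof -
  have "(f \<circ> g has_derivative (\<lambda>h. h *m D) \<circ> (\<lambda>x. x *\<^sub>R g')) (at s within S)"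
    by (rule diff_chain_within[OF assms(2)[unfolded has_vector_derivative_def]])
       (use assms(1) in \<open>auto simp: has_mderiv_def intro: has_derivative_at_withinI\<close>)
  then show ?thesis
    by (simp add: has_vector_derivative_def o_def cscale.scaleR_left)
qed

lemma has_mderiv_continuous: "has_mderiv f D z \<Longrightarrow> isCont f z"
  unfolding has_mderiv_def by (rule has_derivative_continuous)

lemma has_mderiv_transform:
  assumes "has_mderiv f D z" "open S" "z \<in> S" "\<And>w. w \<in> S \<Longrightarrow> f w = g w"
  shows "has_mderiv g D z"
  using has_derivative_transform_within_open[OF assms(1)[unfolded has_mderiv_def] assms(2,3,4)]
  by (simp add: has_mderiv_def)

definition mhol :: "(complex \<Rightarrow> cmat2) \<Rightarrow> complex set \<Rightarrow> bool" where
  "mhol f S \<longleftrightarrow> (\<forall>i j. (\<lambda>z. f z $ i $ j) holomorphic_on S)"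

lemma mhol_iff:
  assumes "open S"
  shows "mhol f S \<longleftrightarrow> (\<forall>z\<in>S. \<exists>D. has_mderiv f D z)"
proof
  assume *: "mhol f S"
  show "\<forall>z\<in>S. \<exists>D. has_mderiv f D z"
  proof
    fix z assume "z \<in> S"
    then have "has_mderiv f (\<chi> i j. deriv (\<lambda>z. f z $ i $ j) z) z"
      unfolding has_mderiv_iff using * assms holomorphic_derivI by (fastforce simp: mhol_def)
    then show "\<exists>D. has_mderiv f D z" ..
  qed
next
  assume "\<forall>z\<in>S. \<exists>D. has_mderiv f D z"
  then show "mhol f S"
    unfolding mhol_def has_mderiv_iff holomorphic_on_open[OF assms] by metis
qed

lemma mhol_continuous_on: "open S \<Longrightarrow> mhol f S \<Longrightarrow> continuous_on S f"
  by (meson mhol_iff has_mderiv_continuous continuous_at_imp_continuous_on)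

lemma mhol_subset: "mhol f S \<Longrightarrow> T \<subseteq> S \<Longrightarrow> mhol f T"
  by (auto simp: mhol_def intro: holomorphic_on_subset)

lemma mhol_intros:
  "mhol (\<lambda>z. C) S"
  "mhol f S \<Longrightarrow> mhol g S \<Longrightarrow> mhol (\<lambda>z. f z + g z) S"
  "mhol f S \<Longrightarrow> mhol g S \<Longrightarrow> mhol (\<lambda>z. f z - g z) S"
  "mhol f S \<Longrightarrow> mhol g S \<Longrightarrow> mhol (\<lambda>z. f z ** g z) S"
  "c holomorphic_on S \<Longrightarrow> mhol f S \<Longrightarrow> mhol (\<lambda>z. c z *m f z) S"
  "mhol f S \<Longrightarrow> mhol (\<lambda>z. adj2 (f z)) S"
  unfolding mhol_def by (auto simp: cmat2_mult_nth forall_2 intro!: holomorphic_intros)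

section \<open>Solutions of linear systems\<close>

definition msol :: "(complex \<Rightarrow> cmat2) \<Rightarrow> complex set \<Rightarrow> (complex \<Rightarrow> cmat2) \<Rightarrow> bool" where
  "msol A S f \<longleftrightarrow> (\<forall>z\<in>S. has_mderiv f (A z ** f z) z)"

lemma msol_subset: "msol A S f \<Longrightarrow> T \<subseteq> S \<Longrightarrow> msol A T f"
  by (auto simp: msol_def)

lemma msol_mhol: "open S \<Longrightarrow> msol A S f \<Longrightarrow> mhol f S"
  by (auto simp: mhol_iff msol_def)

lemma msol_mult_const: "msol A S f \<Longrightarrow> msol A S (\<lambda>z. f z ** C)"
  using has_mderiv_mult[OF _ has_mderiv_const] by (fastforce simp: msol_def matrix_mul_assoc cmat2_mult_algebra)

lemma has_mderiv_zero_constant: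
  assumes "open S" "connected S" "\<And>z. z \<in> S \<Longrightarrow> has_mderiv f 0 z"
  shows "\<exists>C. \<forall>z\<in>S. f z = C"
proof (cases "S = {}")
  case False
  then obtain a where "a \<in> S" by auto
  have "f z $ i $ j = f a $ i $ j" if "z \<in> S" for z i j
    using assms(3)[unfolded has_mderiv_iff] \<open>a \<in> S\<close> that
      DERIV_zero_connected_constant[OF assms(2,1), of "{}" "\<lambda>z. f z $ i $ j"]
    by (metis (no_types, lifting) Diff_empty finite.emptyI zero_index DERIV_continuous continuous_at_imp_continuous_on)
  then show ?thesis by (intro exI[of _ "f a"]) (simp add: cmat2_eq_iff)
qed simp

text \<open>Liouville's formula: the derivative of the determinant is the trace of the coefficient
  times the determinant.\<close>

lemma det_msol_constant:
  assumes "open S" "connected S" "msol A S f" "\<And>z. z \<in> S \<Longrightarrow> trace (A z) = 0"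
  shows "\<exists>d. \<forall>z\<in>S. det (f z) = d"
proof -
  have "((\<lambda>z. det (f z)) has_field_derivative 0) (at z)" if "z \<in> S" for z
  proof -
    have *: "A z $ 2 $ 2 = - A z $ 1 $ 1"
      using assms(4)[OF that] by (simp add: trace_def sum_2 add_eq_0_iff)
    note d = has_mderiv_entry[OF bspec[OF assms(3)[unfolded msol_def] that]]
    show ?thesis unfolding det_2
      by (rule derivative_eq_intros d refl)+ (simp add: cmat2_mult_nth * algebra_simps)
  qed
  then have "has_mderiv (\<lambda>z. det (f z) *m mat 1) 0 z" if "z \<in> S" for z
    using has_mderiv_cscale[OF _ has_mderiv_const[of "mat 1"]] that by fastforce
  from has_mderiv_zero_constant[OF assms(1,2) this] obtain C where
    "\<And>z. z \<in> S \<Longrightarrow> det (f z) *m mat 1 = C" by auto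
  then have "det (f z) = C $ 1 $ 1" if "z \<in> S" for z
    using that by (metis cscale_nth mat_nth_2(1) mult.right_neutral)
  then show ?thesis by blast
qed

text \<open>For a trace-free coefficient \<open>adj2 A = - A\<close>, so \<open>adj2 f\<close>
  solves the dual system and \<open>adj2 f ** g\<close> has derivative zero. The monodromy matrices
  in \<open>sheets_exist\<close> arise in this way.\<close>

lemma msol_quotient_constant:
  assumes "open S" "connected S" "msol A S f" "msol A S g"
    "\<And>z. z \<in> S \<Longrightarrow> trace (A z) = 0" "\<And>z. z \<in> S \<Longrightarrow> det (f z) = 1"
  shows "\<exists>N. \<forall>z\<in>S. g z = f z ** N"
proof -
  have "has_mderiv (\<lambda>z. adj2 (f z) ** g z) 0 z" if "z \<in> S" for z
  proof -
    have *: "A z $ 2 $ 2 = - A z $ 1 $ 1"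
      using assms(5)[OF that] by (simp add: trace_def sum_2 add_eq_0_iff)
    have "has_mderiv (\<lambda>z. adj2 (f z) ** g z) (adj2 (A z ** f z) ** g z + adj2 (f z) ** (A z ** g z)) z"
      using assms(3,4) that by (auto simp: msol_def intro!: has_mderiv_mult has_mderiv_adj2)
    moreover have "adj2 (A z ** f z) ** g z + adj2 (f z) ** (A z ** g z) = 0"
      by (simp add: cmat2_simps * algebra_simps)
    ultimately show ?thesis by simp
  qed
  from has_mderiv_zero_constant[OF assms(1,2) this] obtain C where
    "\<And>z. z \<in> S \<Longrightarrow> adj2 (f z) ** g z = C" by auto
  then have "g z = f z ** C" if "z \<in> S" for z
    using that assms(6) by (metis adj2_cancel(3))
  then show ?thesis by blast
qed

lemma msol_eqI:
  assumes "open S" "connected S" "msol A S f" "msol A S g"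
    "\<And>z. z \<in> S \<Longrightarrow> trace (A z) = 0" "\<And>z. z \<in> S \<Longrightarrow> det (f z) = 1" "a \<in> S" "f a = g a" "z \<in> S"
  shows "f z = g z"
proof -
  obtain N where N: "\<And>z. z \<in> S \<Longrightarrow> g z = f z ** N"
    using msol_quotient_constant[OF assms(1-6)] by auto
  have "f a ** mat 1 = f a ** N" using N[OF assms(7)] assms(8) by simp
  then have "mat 1 = N" by (rule cmat2_left_cancel) (simp only: assms(6)[OF assms(7)] one_neq_zero not_False_eq_True)
  then show ?thesis using N[OF assms(9)] by (metis matrix_mul_rid)
qed

subsection \<open>Gronwall's inequality\<close>

lemma gronwall_real:
  fixes u u' :: "real \<Rightarrow> real"
  assumes "a \<le> b" "\<And>s. s \<in> {a..b} \<Longrightarrow> (u has_real_derivative u' s) (at s within {a..b})"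
    "\<And>s. s \<in> {a..b} \<Longrightarrow> u' s \<le> L * u s"
  shows "u b \<le> u a * exp (L * (b - a))"
proof -
  have d: "((\<lambda>s. u s * exp (- L * s)) has_real_derivative (u' s - L * u s) * exp (- L * s)) (at s within {a..b})"
    if "s \<in> {a..b}" for s
    by (rule derivative_eq_intros assms(2)[OF that] refl)+ (simp add: algebra_simps)
  have "u b * exp (- L * b) \<le> u a * exp (- L * a)"
  proof (rule DERIV_nonpos_imp_decreasing_open[OF assms(1)])
    show "\<exists>y. ((\<lambda>s. u s * exp (- L * s)) has_real_derivative y) (at s) \<and> y \<le> 0" if "a < s" "s < b" for s
      using d[of s] assms(3)[of s] that at_within_Icc_at[of a s b]
      by (intro exI[of _ "(u' s - L * u s) * exp (- L * s)"]) (auto simp: mult_le_0_iff)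
    show "continuous_on {a..b} (\<lambda>s. u s * exp (- L * s))"
      by (rule DERIV_continuous_on[OF d])
  qed
  then have "u b * exp (- L * b) * exp (L * b) \<le> u a * exp (- L * a) * exp (L * b)"
    by (rule mult_right_mono[OF _ exp_ge_zero])
  then have "u b * (exp (- L * b) * exp (L * b)) \<le> u a * (exp (- L * a) * exp (L * b))"
    by (simp only: mult.assoc)
  then have "u b \<le> u a * (exp (- L * a) * exp (L * b))"
    by (simp add: exp_minus)
  also have "exp (- L * a) * exp (L * b) = exp (L * (b - a))"
    by (simp flip: exp_add add: algebra_simps)
  finally show ?thesis .
qed

text \<open>Applied to the squared norm, which is differentiable also where \<open>f\<close>
  vanishes; taking the root removes the factor 2 in the rate.\<close>

lemma gronwall:
  fixes f :: "real \<Rightarrow> 'a::real_inner"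
  assumes "a \<le> b" "\<And>s. s \<in> {a..b} \<Longrightarrow> (f has_vector_derivative f' s) (at s within {a..b})"
    "\<And>s. s \<in> {a..b} \<Longrightarrow> norm (f' s) \<le> K * norm (f s)"
  shows "norm (f b) \<le> norm (f a) * exp (K * (b - a))"
proof (rule power2_le_imp_le)
  have "f b \<bullet> f b \<le> f a \<bullet> f a * exp ((2 * K) * (b - a))"
  proof (rule gronwall_real[OF assms(1)])
    fix s assume s: "s \<in> {a..b}"
    show "((\<lambda>s. f s \<bullet> f s) has_real_derivative 2 * (f s \<bullet> f' s)) (at s within {a..b})"
      using has_derivative_inner[OF assms(2)[OF s, unfolded has_vector_derivative_def] assms(2)[OF s, unfolded has_vector_derivative_def]]
      unfolding has_field_derivative_def
      by (rule has_derivative_eq_rhs) (simp add: fun_eq_iff inner_commute algebra_simps)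
    have "f s \<bullet> f' s \<le> norm (f s) * norm (f' s)" by (rule norm_cauchy_schwarz)
    also have "\<dots> \<le> norm (f s) * (K * norm (f s))"
      by (rule mult_left_mono[OF assms(3)[OF s]]) simp
    finally show "2 * (f s \<bullet> f' s) \<le> 2 * K * (f s \<bullet> f s)"
      by (simp add: dot_square_norm power2_eq_square algebra_simps)
  qed
  also have "\<dots> = (norm (f a) * exp (K * (b - a)))\<^sup>2"
    by (simp add: power_mult_distrib dot_square_norm mult.assoc flip: exp_double)
  finally show "(norm (f b))\<^sup>2 \<le> (norm (f a) * exp (K * (b - a)))\<^sup>2"
    by (simp add: dot_square_norm)
qed simp

text \<open>The constant is absorbed by estimating \<open>f s \<bullet> f s + c\<^sup>2\<close>: the
  mixed term \<open>2 * norm (f s) * c\<close> is at most this sum, and the summand 1 in the rate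
  pays for it.\<close>

lemma gronwall_inhom:
  fixes f :: "real \<Rightarrow> 'a::real_inner"
  assumes "a \<le> b" "\<And>s. s \<in> {a..b} \<Longrightarrow> (f has_vector_derivative f' s) (at s within {a..b})"
    "\<And>s. s \<in> {a..b} \<Longrightarrow> norm (f' s) \<le> K * norm (f s) + c" "0 \<le> K" "0 \<le> c"
  shows "norm (f b) \<le> (norm (f a) + c) * exp ((K + 1) * (b - a))"
proof (rule power2_le_imp_le)
  have "f b \<bullet> f b + c\<^sup>2 \<le> (f a \<bullet> f a + c\<^sup>2) * exp ((2 * K + 1) * (b - a))"
  proof (rule gronwall_real[OF assms(1)])
    fix s assume s: "s \<in> {a..b}"
    show "((\<lambda>s. f s \<bullet> f s + c\<^sup>2) has_real_derivative 2 * (f s \<bullet> f' s)) (at s within {a..b})"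
      using has_derivative_add[OF has_derivative_inner[OF assms(2)[OF s, unfolded has_vector_derivative_def] assms(2)[OF s, unfolded has_vector_derivative_def]] has_derivative_const[of "c\<^sup>2"]]
      unfolding has_field_derivative_def
      by (rule has_derivative_eq_rhs) (simp add: fun_eq_iff inner_commute algebra_simps)
    have "f s \<bullet> f' s \<le> norm (f s) * norm (f' s)" by (rule norm_cauchy_schwarz)
    also have "\<dots> \<le> norm (f s) * (K * norm (f s) + c)"
      by (rule mult_left_mono[OF assms(3)[OF s]]) simp
    finally have "2 * (f s \<bullet> f' s) \<le> 2 * K * (f s \<bullet> f s) + 2 * norm (f s) * c"
      by (simp add: dot_square_norm power2_eq_square algebra_simps)
    also have "\<dots> \<le> (2 * K + 1) * (f s \<bullet> f s + c\<^sup>2)"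
      using zero_le_power2[of "norm (f s) - c"] mult_nonneg_nonneg[OF assms(4) zero_le_power2[of c]]
      by (simp add: dot_square_norm power2_eq_square algebra_simps)
    finally show "2 * (f s \<bullet> f' s) \<le> (2 * K + 1) * (f s \<bullet> f s + c\<^sup>2)" .
  qed
  also have "\<dots> \<le> (norm (f a) + c)\<^sup>2 * exp ((2 * K + 2) * (b - a))"
    using assms by (intro mult_mono) (auto simp: dot_square_norm power2_sum intro!: mult_right_mono)
  also have "\<dots> = ((norm (f a) + c) * exp ((K + 1) * (b - a)))\<^sup>2"
    by (simp add: power_mult_distrib mult.assoc flip: exp_double)
  finally show "(norm (f b))\<^sup>2 \<le> ((norm (f a) + c) * exp ((K + 1) * (b - a)))\<^sup>2"
    using zero_le_power2[of c] by (simp only: dot_square_norm)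
qed (use assms in simp)


section \<open>Linear differential equations in the complex domain\<close>

lemma mhol_primitive:
  assumes "open S" "a \<in> S" "\<And>z. z \<in> S \<Longrightarrow> closed_segment a z \<subseteq> S" "mhol f S"
  shows "\<exists>F. F a = 0 \<and> (\<forall>z\<in>S. has_mderiv F (f z) z)"
proof -
  have "\<exists>g. \<forall>z\<in>S. (g has_field_derivative f z $ i $ j) (at z)" for i j
  proof -
    have "starlike S" using assms(2,3) by (auto simp: starlike_def)
    then show ?thesis
      using holomorphic_starlike_primitive[of S "\<lambda>z. f z $ i $ j" "{}"] assms(1,4) 
      by (auto simp: mhol_def intro!: holomorphic_on_imp_continuous_on intro: holomorphic_on_imp_differentiable_at)
  qed
  then obtain g where g: "\<And>i j z. z \<in> S \<Longrightarrow> (g i j has_field_derivative f z $ i $ j) (at z)"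
    by metis
  have "has_mderiv (\<lambda>z. (\<chi> i j. g i j z) - (\<chi> i j. g i j a)) (f z - 0) z" if "z \<in> S" for z
    by (intro has_mderiv_diff has_mderiv_const) (simp add: has_mderiv_iff g[OF that])
  then show ?thesis
    by (intro exI[of _ "\<lambda>z. (\<chi> i j. g i j z) - (\<chi> i j. g i j a)"]) auto
qed

lemma compact_cone:
  fixes a :: complex
  assumes "compact K"
  shows "compact ((\<lambda>(s, z). a + of_real s * (z - a)) ` ({0..1::real} \<times> K))"
  by (intro compact_continuous_image compact_Times assms) (auto simp: case_prod_beta intro!: continuous_intros)

text \<open>Picard iteration: \<open>d n\<close> is the \<open>n\<close>-fold iterated integral from
  the centre \<open>a\<close> of the star-shaped set. It is majorised by the terms of an exponential
  series, so the sum converges on all of \<open>S\<close> and not only near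
  \<open>a\<close>.\<close>

theorem linear_ode_exists:
  assumes S: "open S" "a \<in> S" "\<And>z. z \<in> S \<Longrightarrow> closed_segment a z \<subseteq> S" and A: "mhol A S"
  shows "\<exists>f. f a = mat 1 \<and> msol A S f"
proof -
  define prim where "prim f = (SOME F. F a = 0 \<and> (\<forall>z\<in>S. has_mderiv F (f z) z))" for f
  have prim: "prim f a = 0" "\<And>z. z \<in> S \<Longrightarrow> has_mderiv (prim f) (f z) z" if "mhol f S" for f
    using someI_ex[OF mhol_primitive[OF S that]] unfolding prim_def by auto
  define d where "d n = ((\<lambda>f. prim (\<lambda>z. A z ** f z)) ^^ n) (\<lambda>z. mat 1)" for n
  have d0: "d 0 = (\<lambda>z. mat 1)" and dS: "d (Suc n) = prim (\<lambda>z. A z ** d n z)" for n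
    by (simp_all add: d_def)
  have dh: "mhol (d n) S" for n
  proof (induction n)
    case 0 show ?case by (simp add: d0 mhol_intros)
  next
    case (Suc n)
    from prim(2)[OF mhol_intros(4)[OF A Suc]] show ?case
      by (auto simp: dS mhol_iff[OF S(1)])
  qed
  have dd: "has_mderiv (d (Suc n)) (A z ** d n z) z" if "z \<in> S" for n z
    using prim(2)[OF mhol_intros(4)[OF A dh] that, of n] by (simp add: dS)
  have da: "d (Suc n) a = 0" for n
    using prim(1)[OF mhol_intros(4)[OF A dh], of n] by (simp add: dS)
  have loc: "\<exists>r>0. ball z0 r \<subseteq> S \<and> (\<exists>B. \<forall>z\<in>ball z0 r. norm (A z) \<le> B) \<and>
      (\<exists>c. summable c \<and> (\<forall>z\<in>ball z0 r. \<forall>n. norm (d n z) \<le> c n))" if "z0 \<in> S" for z0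
  proof -
    obtain r where r: "r > 0" "cball z0 r \<subseteq> S" using S(1) \<open>z0 \<in> S\<close> by (meson open_contains_cball)
    \<comment> \<open>The iterated integrals run along segments from \<open>a\<close>, so the
      coefficient has to be bounded on the cone over the disc and not just on the disc.\<close>
    define K where "K = (\<lambda>(s, z). a + of_real s * (z - a)) ` ({0..1::real} \<times> cball z0 r)"
    have "K \<subseteq> S"
    proof
      fix x assume "x \<in> K"
      then obtain s z where "0 \<le> s" "s \<le> 1" "z \<in> cball z0 r" "x = a + of_real s * (z - a)" by (auto simp: K_def)
      then show "x \<in> S" using S(3)[of z] r(2) 
        by (force simp: in_segment scaleR_conv_of_real algebra_simps)
    qed
    have "compact K" unfolding K_def by (rule compact_cone) simp
    then have "bounded (A ` K)"
      by (intro compact_imp_bounded compact_continuous_image continuous_on_subset[OF mhol_continuous_on[OF S(1) A] \<open>K \<subseteq> S\<close>])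
    then obtain B where B: "B > 0" "\<And>z. z \<in> K \<Longrightarrow> norm (A z) \<le> B"
      by (force simp: bounded_pos)
    define L where "L = norm (z0 - a) + r"
    have L: "L \<ge> 0" "\<And>z. z \<in> cball z0 r \<Longrightarrow> norm (z - a) \<le> L"
    proof -
      fix z assume "z \<in> cball z0 r"
      then show "norm (z - a) \<le> L" using norm_triangle_ineq[of "z - z0" "z0 - a"]
        by (simp add: L_def dist_norm norm_minus_commute)
    qed (use r in \<open>simp add: L_def\<close>)
    define c where "c n = norm (mat 1 :: cmat2) * ((B * L) ^ n /\<^sub>R fact n)" for n
    \<comment> \<open>The factor \<open>s ^ n\<close> makes the induction work: integrating it
      produces the factor \<open>1 / (n + 1)\<close> of the exponential series.\<close>
    have bound: "norm (d n (a + of_real s * (z - a))) \<le> c n * s ^ n" if "z \<in> cball z0 r" "s \<in> {0..1}" for n z s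
      using that(2)
    proof (induction n arbitrary: s)
      case 0 then show ?case by (simp add: d0 c_def)
    next
      case (Suc n)
      show ?case
      proof (cases "s = 0")
        case True then show ?thesis by (simp add: da)
      next
        case False
        then have s: "0 < s" "s \<le> 1" using Suc by auto
        let ?g = "\<lambda>s. a + of_real s * (z - a) :: complex"
        have gd: "(?g has_vector_derivative (z - a)) (at t within X)" for t X
          by (auto intro!: derivative_eq_intros has_vector_derivative_real_field simp: has_vector_derivative_def scaleR_conv_of_real)
        have gS: "?g t \<in> K" if "t \<in> {0..1}" for t
          using that \<open>z \<in> cball z0 r\<close> by (force simp: K_def)
        have D: "((\<lambda>s. d (Suc n) (?g s)) has_vector_derivative (z - a) *m (A (?g t) ** d n (?g t))) (at t within X)"
          if "t \<in> {0..1}" for t X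
          using has_mderiv_curve[OF dd gd] gS[OF that] \<open>K \<subseteq> S\<close> by blast
        have "norm (d (Suc n) (?g s) - d (Suc n) (?g 0)) \<le> c (Suc n) * s ^ Suc n - c (Suc n) * 0 ^ Suc n"
        proof (rule differentiable_bound_general[OF s(1)])
          show "continuous_on {0..s} (\<lambda>s. d (Suc n) (?g s))"
            by (rule continuous_on_vector_derivative[OF D]) (use s in auto)
          show "continuous_on {0..s} (\<lambda>t. c (Suc n) * t ^ Suc n)" by (intro continuous_intros)
          show "((\<lambda>s. d (Suc n) (?g s)) has_vector_derivative (z - a) *m (A (?g t) ** d n (?g t))) (at t)" if "0 < t" "t < s" for t
            using D[of t UNIV] that s by auto
          show "((\<lambda>t. c (Suc n) * t ^ Suc n) has_vector_derivative L * B * (c n * t ^ n)) (at t)" for t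
            unfolding has_real_derivative_iff_has_vector_derivative[symmetric]
            by (rule derivative_eq_intros refl)+ (simp add: c_def divide_simps)
          show "norm ((z - a) *m (A (?g t) ** d n (?g t))) \<le> L * B * (c n * t ^ n)" if "0 < t" "t < s" for t
          proof -
            have "norm (A (?g t) ** d n (?g t)) \<le> B * (c n * t ^ n)"
              by (rule order_trans[OF norm_cmat2_mult mult_mono]) (use Suc.IH[of t] B(2)[OF gS[of t]] that s B(1) in auto)
            then show ?thesis using L(2)[OF \<open>z \<in> cball z0 r\<close>] L(1)
              by (simp add: mult.assoc mult_mono)
          qed
        qed
        then show ?thesis using da by simp
      qed
    qed
    have "summable c"
      unfolding c_def by (intro summable_mult summable_exp_generic)
    moreover have "norm (d n z) \<le> c n" if "z \<in> ball z0 r" for n z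
      using bound[of z 1 n] that by simp
    moreover have "norm (A z) \<le> B" if "z \<in> ball z0 r" for z
      by (rule B(2)) (use that in \<open>auto simp: K_def intro!: image_eqI[of _ _ "(1, z)"]\<close>)
    moreover have "ball z0 r \<subseteq> S" using r by auto
    ultimately show ?thesis using r(1) by blast
  qed
  define f where "f z = (\<Sum>n. d n z)" for z
  have "has_mderiv f (A z0 ** f z0) z0" if z0: "z0 \<in> S" for z0
  proof -
    from loc[OF z0] obtain r B c where r: "r > 0" "ball z0 r \<subseteq> S" and B: "\<And>z. z \<in> ball z0 r \<Longrightarrow> norm (A z) \<le> B"
      and c: "summable c" "\<And>z n. z \<in> ball z0 r \<Longrightarrow> norm (d n z) \<le> c n" by blast
    have ul: "uniform_limit (ball z0 r) (\<lambda>n x. \<Sum>i<n. d i x) (\<lambda>x. \<Sum>i. d i x) sequentially"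
      by (rule Weierstrass_m_test[OF c(2) c(1)])
    have B0: "B \<ge> 0" using B[of z0] r by (meson centre_in_ball norm_ge_zero order_trans)
    have sums: "(\<lambda>n. d n z) sums f z" if "z \<in> ball z0 r" for z
      unfolding f_def by (intro summable_sums summable_comparison_test'[OF c(1)] c(2) that)
    have unif: "\<forall>\<^sub>F n in sequentially. \<forall>z\<in>ball z0 r. norm ((\<Sum>i<n. d i z) - f z) < e" if "e > 0" for e
      using uniform_limitD[OF ul that] by (simp only: f_def dist_norm)
    have part: "\<And>z. z \<in> S \<Longrightarrow> has_mderiv (d i) (case i of 0 \<Rightarrow> 0 | Suc n \<Rightarrow> A z ** d n z) z" for i
      using dd by (cases i) (auto simp: d0 has_mderiv_const)
    have "\<exists>g. \<forall>x\<in>ball z0 r. (\<lambda>n. d n x) sums g x \<and> (g has_derivative (\<lambda>h. h *m (A x ** f x))) (at x within ball z0 r)"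
    proof (rule has_derivative_series)
      show "convex (ball z0 r)" by simp
      show "(d n has_derivative (\<lambda>h. h *m (case n of 0 \<Rightarrow> 0 | Suc n \<Rightarrow> A z ** d n z))) (at z within ball z0 r)"
        if "z \<in> ball z0 r" for n z
        using part[OF subsetD[OF r(2) that], of n] unfolding has_mderiv_def by (rule has_derivative_at_withinI)
      show "z0 \<in> ball z0 r" using r by simp
      show "(\<lambda>n. d n z0) sums f z0" using sums r by simp
      fix e :: real assume "e > 0"
      then have "\<forall>\<^sub>F n in sequentially. \<forall>z\<in>ball z0 r. norm ((\<Sum>i<n. d i z) - f z) < e / (B + 1)"
        using B0 by (intro unif) auto
      \<comment> \<open>The derivative of the partial sum with \<open>n\<close> terms is
        \<open>A\<close> times the one with \<open>n - 1\<close> terms, because \<open>d 0\<close>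
        is constant.\<close>
      then have "\<forall>\<^sub>F n in sequentially. \<forall>z\<in>ball z0 r. norm ((\<Sum>i<n - 1. d i z) - f z) < e / (B + 1)"
        by (rule eventually_compose_filterlim[OF _ filterlim_minus_const_nat_at_top])
      with eventually_gt_at_top[of 0]
      show "\<forall>\<^sub>F n in sequentially. \<forall>x\<in>ball z0 r. \<forall>h. norm ((\<Sum>i<n. h *m (case i of 0 \<Rightarrow> 0 | Suc n \<Rightarrow> A x ** d n x)) - h *m (A x ** f x)) \<le> e * norm h"
      proof eventually_elim
        case (elim n)
        show ?case
        proof (intro ballI allI)
          fix x h assume x: "x \<in> ball z0 r"
          obtain m where m: "n = Suc m" using elim(1) by (cases n) auto
          have "(\<Sum>i<n. h *m (case i of 0 \<Rightarrow> 0 | Suc n \<Rightarrow> A x ** d n x)) = (\<Sum>i<m. h *m (A x ** d i x))"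
            unfolding m by (subst sum.lessThan_Suc_shift) simp
          also have "\<dots> = h *m (A x ** (\<Sum>i<m. d i x))"
            by (simp add: cscale.sum_right cmult.sum_right)
          finally have "norm ((\<Sum>i<n. h *m (case i of 0 \<Rightarrow> 0 | Suc n \<Rightarrow> A x ** d n x)) - h *m (A x ** f x))
             = norm (h *m (A x ** ((\<Sum>i<m. d i x) - f x)))" by (simp add: cscale.diff_right cmult.diff_right)
          also have "\<dots> \<le> norm h * (B * (e / (B + 1)))"
            unfolding norm_cscale using B[OF x] bspec[OF elim(2) x] B0 m
            by (intro mult_left_mono order_trans[OF norm_cmat2_mult mult_mono]) auto
          also have "\<dots> \<le> norm h * e"
            using B0 \<open>e > 0\<close> by (intro mult_left_mono) (auto simp: field_simps)
          finally show "norm ((\<Sum>i<n. h *m (case i of 0 \<Rightarrow> 0 | Suc n \<Rightarrow> A x ** d n x)) - h *m (A x ** f x)) \<le> e * norm h"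
            by (simp add: mult.commute)
        qed
      qed
    qed
    then obtain g where g: "\<And>x. x \<in> ball z0 r \<Longrightarrow> (\<lambda>n. d n x) sums g x"
       "\<And>x. x \<in> ball z0 r \<Longrightarrow> (g has_derivative (\<lambda>h. h *m (A x ** f x))) (at x within ball z0 r)" by blast
    have gf: "g x = f x" if "x \<in> ball z0 r" for x using g(1)[OF that] sums[OF that] by (rule sums_unique2)
    have "has_mderiv g (A z0 ** f z0) z0"
      using g(2)[of z0] r(1) unfolding has_mderiv_def by (simp only: at_within_open[of z0 "ball z0 r"] centre_in_ball open_ball)
    then show ?thesis by (rule has_mderiv_transform[OF _ open_ball[of z0 r]]) (use r(1) gf in auto)
  qed
  moreover have "f a = mat 1"
  proof -
    have "(\<lambda>n. d n a) sums d 0 a"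
      using sums_finite[of "{0}" "\<lambda>n. d n a"] da by (metis (mono_tags, lifting) finite.emptyI finite.insertI insertCI not0_implies_Suc sum.empty sum.insert add.right_neutral empty_iff)
    then show ?thesis by (simp add: f_def sums_iff d0)
  qed
  ultimately show ?thesis unfolding msol_def by blast
qed

text \<open>The initial condition is moved from the centre \<open>b\<close> to the point
  \<open>a\<close> by a constant right factor.\<close>

corollary linear_ode_exists_SL2:
  assumes S: "open S" "b \<in> S" "\<And>z. z \<in> S \<Longrightarrow> closed_segment b z \<subseteq> S" and A: "mhol A S"
    "\<And>z. z \<in> S \<Longrightarrow> trace (A z) = 0" and "a \<in> S" "det C = 1"
  shows "\<exists>f. f a = C \<and> msol A S f \<and> (\<forall>z\<in>S. det (f z) = 1)"
proof -
  obtain f where f: "f b = mat 1" "msol A S f" using linear_ode_exists[OF S A(1)] by auto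
  have conn: "connected S" using S by (meson starlike_imp_connected starlike_def)
  obtain e where "\<And>z. z \<in> S \<Longrightarrow> det (f z) = e" using det_msol_constant[OF S(1) conn f(2) A(2)] by auto
  then have det: "det (f z) = 1" if "z \<in> S" for z
    using that f(1) S(2) by (metis det_I)
  then show ?thesis using msol_mult_const[OF f(2), of "adj2 (f a) ** C"] assms(6,7)
    by (intro exI[of _ "\<lambda>z. f z ** (adj2 (f a) ** C)"]) (auto simp: adj2_cancel det_mul)
qed


section \<open>Analytic continuation along lassos\<close>

lemma eventually_nhds_eq_analytic:
  fixes f g :: "complex \<Rightarrow> complex"
  assumes "f holomorphic_on ball a r" "g holomorphic_on ball a r" "b \<in> ball a r"
    "\<forall>\<^sub>F z in nhds b. f z = g z" "z \<in> ball a r"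
  shows "f z = g z"
proof -
  obtain U where U: "open U" "b \<in> U" "\<And>z. z \<in> U \<Longrightarrow> f z = g z"
    using assms(4) unfolding eventually_nhds by auto
  show ?thesis
    by (rule analytic_continuation_open[of "U \<inter> ball a r" "ball a r" f g])
       (use assms U in \<open>auto\<close>)
qed

lemma cmat2_analytic_ball:
  fixes f :: "complex \<Rightarrow> cmat2"
  assumes "\<forall>i j. (\<lambda>z. f z $ i $ j) analytic_on {a}"
  shows "\<exists>r>0. \<forall>i j. (\<lambda>z. f z $ i $ j) holomorphic_on ball a r"
proof -
  have "\<exists>r>0. (\<lambda>z. f z $ i $ j) holomorphic_on ball a r" for i j
    using assms unfolding analytic_on_def by auto
  then obtain r where r: "\<And>i j. r i j > (0::real)" "\<And>i j. (\<lambda>z. f z $ i $ j) holomorphic_on ball a (r i j)"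
    by metis
  define \<rho> where "\<rho> = min (min (r 1 1) (r 1 2)) (min (r 2 1) (r 2 2))"
  have "\<rho> \<le> r i j" for i j using exhaust_2[of i] exhaust_2[of j] by (auto simp: \<rho>_def)
  then have "(\<lambda>z. f z $ i $ j) holomorphic_on ball a \<rho>" for i j
    by (intro holomorphic_on_subset[OF r(2)] subset_ball)
  moreover have "\<rho> > 0" using r(1) by (simp add: \<rho>_def)
  ultimately show ?thesis by blast
qed

text \<open>Agreement of the two germs propagates along the parameter interval in both directions:
  on a disc on which both members at \<open>s\<close> are holomorphic, equality near one point is
  equality on the disc.\<close>

lemma continues_along_unique:
  assumes "path \<gamma>" "continues_along \<gamma> f g" "continues_along \<gamma> f h"
  shows "\<forall>\<^sub>F z in nhds (pathfinish \<gamma>). g z = h z"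
proof -
  obtain F where F: "\<And>s i j. s \<in> {0..1} \<Longrightarrow> (\<lambda>z. F s z $ i $ j) analytic_on {\<gamma> s}"
    "\<And>s. s \<in> {0..1} \<Longrightarrow> \<forall>\<^sub>F s' in at s within {0..1}. \<forall>\<^sub>F z in nhds (\<gamma> s'). F s' z = F s z"
    "\<forall>\<^sub>F z in nhds (pathstart \<gamma>). F 0 z = f z" "\<forall>\<^sub>F z in nhds (pathfinish \<gamma>). F 1 z = g z"
    using assms(2) unfolding continues_along_def by blast
  obtain G where G: "\<And>s i j. s \<in> {0..1} \<Longrightarrow> (\<lambda>z. G s z $ i $ j) analytic_on {\<gamma> s}"
    "\<And>s. s \<in> {0..1} \<Longrightarrow> \<forall>\<^sub>F s' in at s within {0..1}. \<forall>\<^sub>F z in nhds (\<gamma> s'). G s' z = G s z"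
    "\<forall>\<^sub>F z in nhds (pathstart \<gamma>). G 0 z = f z" "\<forall>\<^sub>F z in nhds (pathfinish \<gamma>). G 1 z = h z"
    using assms(3) unfolding continues_along_def by blast
  define P where "P s \<longleftrightarrow> (\<forall>\<^sub>F z in nhds (\<gamma> s). F s z = G s z)" for s
  have "P 1"
  proof (rule connected_induction_simple[of "{0..1::real}" 0 1 P])
    show "P 0" using F(3) G(3) unfolding P_def pathstart_def by (rule eventually_elim2) simp
    fix s :: real assume s: "s \<in> {0..1}"
    obtain r1 where r1: "r1 > 0" "\<And>i j. (\<lambda>z. F s z $ i $ j) holomorphic_on ball (\<gamma> s) r1"
      using cmat2_analytic_ball[of "F s" "\<gamma> s"] F(1)[OF s] by blast
    obtain r2 where r2: "r2 > 0" "\<And>i j. (\<lambda>z. G s z $ i $ j) holomorphic_on ball (\<gamma> s) r2"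
      using cmat2_analytic_ball[of "G s" "\<gamma> s"] G(1)[OF s] by blast
    define r where "r = min r1 r2"
    have r: "r > 0" "\<And>i j. (\<lambda>z. F s z $ i $ j) holomorphic_on ball (\<gamma> s) r" 
      "\<And>i j. (\<lambda>z. G s z $ i $ j) holomorphic_on ball (\<gamma> s) r"
      using r1(1) r2(1) by (simp_all add: r_def holomorphic_on_subset[OF r1(2) subset_ball] holomorphic_on_subset[OF r2(2) subset_ball])
    have "(\<gamma> \<longlongrightarrow> \<gamma> s) (at s within {0..1})"
      using assms(1) s by (simp add: path_def continuous_on_def)
    then have "\<forall>\<^sub>F s' in at s within {0..1}. \<gamma> s' \<in> ball (\<gamma> s) r"
      using r(1) by (intro topological_tendstoD) auto
    define Q where "Q s' \<longleftrightarrow> \<gamma> s' \<in> ball (\<gamma> s) r \<and>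
       (\<forall>\<^sub>F z in nhds (\<gamma> s'). F s' z = F s z) \<and> (\<forall>\<^sub>F z in nhds (\<gamma> s'). G s' z = G s z)" for s'
    from \<open>\<forall>\<^sub>F s' in at s within {0..1}. \<gamma> s' \<in> ball (\<gamma> s) r\<close> F(2)[OF s] G(2)[OF s]
    have "\<forall>\<^sub>F s' in at s within {0..1}. Q s'"
      by eventually_elim (simp add: Q_def)
    then obtain U where U: "open U" "s \<in> U" "\<And>s'. s' \<in> U \<Longrightarrow> s' \<noteq> s \<Longrightarrow> s' \<in> {0..1} \<Longrightarrow> Q s'"
      unfolding eventually_at_topological by blast
    have "Q s" using r(1) by (simp add: Q_def)
    then have U': "\<gamma> s' \<in> ball (\<gamma> s) r" "\<forall>\<^sub>F z in nhds (\<gamma> s'). F s' z = F s z" 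
      "\<forall>\<^sub>F z in nhds (\<gamma> s'). G s' z = G s z" if "s' \<in> {0..1} \<inter> U" for s'
      using U(3)[of s'] that unfolding Q_def by blast+
    show "\<exists>T. openin (top_of_set {0..1}) T \<and> s \<in> T \<and> (\<forall>x\<in>T. \<forall>y\<in>T. P x \<longrightarrow> P y)"
    proof (intro exI[of _ "{0..1} \<inter> U"] conjI ballI impI)
      show "openin (top_of_set {0..1}) ({0..1} \<inter> U)" using U(1) by (rule openin_open_Int)
      show "s \<in> {0..1} \<inter> U" using U s by simp
      fix x y assume x: "x \<in> {0..1} \<inter> U" and y: "y \<in> {0..1} \<inter> U" and Px: "P x"
      from Px[unfolded P_def] U'(2,3)[OF x] have "\<forall>\<^sub>F z in nhds (\<gamma> x). F s z = G s z"
        by eventually_elim simp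
      then have "\<forall>\<^sub>F z in nhds (\<gamma> x). F s z $ i $ j = G s z $ i $ j" for i j
        by eventually_elim simp
      then have "F s z $ i $ j = G s z $ i $ j" if "z \<in> ball (\<gamma> s) r" for z i j
        using eventually_nhds_eq_analytic[OF r(2,3) U'(1)[OF x] _ that] by blast
      then have "\<forall>\<^sub>F z in nhds (\<gamma> y). F s z = G s z"
        using U'(1)[OF y] unfolding eventually_nhds by (intro exI[of _ "ball (\<gamma> s) r"]) (simp add: cmat2_eq_iff)
      with U'(2,3)[OF y] show "P y" unfolding P_def by eventually_elim simp
    qed
  qed auto
  from this[unfolded P_def] F(4)[unfolded pathfinish_def] G(4)[unfolded pathfinish_def]
  show ?thesis unfolding pathfinish_def by eventually_elim simp
qed

text \<open>The family of germs is \<open>f1\<close> up to \<open>s0\<close> and \<open>f2\<close>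
  afterwards. Compatibility at the switch is the agreement on \<open>V\<close>, and
  \<open>s0 < 1\<close> makes \<open>f2\<close> the germ at the end.\<close>

lemma continues_along_two_charts:
  assumes "path \<gamma>" "0 \<le> s0" "s0 \<le> 1" "open D1" "open D2" "mhol f1 D1" "mhol f2 D2"
    "\<And>s. s \<in> {0..s0} \<Longrightarrow> \<gamma> s \<in> D1" "\<And>s. s \<in> {s0..1} \<Longrightarrow> \<gamma> s \<in> D2"
    "open V" "\<gamma> s0 \<in> V" "\<And>z. z \<in> V \<Longrightarrow> f1 z = f2 z"
    "\<forall>\<^sub>F z in nhds (pathstart \<gamma>). f1 z = f z" "\<forall>\<^sub>F z in nhds (pathfinish \<gamma>). f2 z = g z" "s0 < 1"
  shows "continues_along \<gamma> f g"
  unfolding continues_along_def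
proof (intro exI[of _ "\<lambda>s. if s \<le> s0 then f1 else f2"] conjI ballI allI)
  fix s :: real and i j :: 2 assume s: "s \<in> {0..1}"
  show "(\<lambda>z. (if s \<le> s0 then f1 else f2) z $ i $ j) analytic_on {\<gamma> s}"
    using assms(4-9) s by (auto simp: mhol_def intro!: holomorphic_on_imp_analytic_at)
next
  fix s :: real assume s: "s \<in> {0..1}"
  let ?F = "\<lambda>s. if s \<le> s0 then f1 else f2"
  show "\<forall>\<^sub>F s' in at s within {0..1}. \<forall>\<^sub>F z in nhds (\<gamma> s'). ?F s' z = ?F s z"
  proof -
    consider "s < s0" | "s > s0" | "s = s0" by linarith
    then show ?thesis
    proof cases
      case 1
      have "\<forall>\<^sub>F s' in at s within {0..1}. s' < s0"
        by (rule order_tendstoD(2)[OF _ 1]) simp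
      then show ?thesis by eventually_elim (use 1 in auto)
    next
      case 2
      have "\<forall>\<^sub>F s' in at s within {0..1}. s' > s0"
        by (rule order_tendstoD(1)[OF _ 2]) simp
      then show ?thesis by eventually_elim (use 2 in auto)
    next
      case 3
      have "(\<gamma> \<longlongrightarrow> \<gamma> s) (at s within {0..1})"
        using assms(1) s by (simp add: path_def continuous_on_def)
      then have "\<forall>\<^sub>F s' in at s within {0..1}. \<gamma> s' \<in> V"
        using assms(10,11) 3 by (intro topological_tendstoD) auto
      then show ?thesis
      proof eventually_elim
        case (elim s')
        show ?case unfolding eventually_nhds
          by (rule exI[of _ V]) (use elim assms(10,12) 3 in auto)
      qed
    qed
  qed
qed (use assms in auto)

lemma lasso_path: "path (lasso P a \<epsilon>)"
  by (simp add: lasso_def Let_def cis_conv_exp exp_add distrib_left exp_eq_1 exp_minus)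

lemma lasso_unfold:
  "lasso P a \<epsilon> s = (let q = a + of_real \<epsilon> * cis (Arg (P - a)) in
     if s \<le> 1/2 then P + of_real (2 * s) * (q - P)
     else if s \<le> 3/4 then a + of_real \<epsilon> * cis (Arg (P - a) + 2 * pi * (4 * s - 2))
     else q + of_real (4 * s - 3) * (P - q))"
  unfolding lasso_def Let_def joinpaths_def linepath_def part_circlepath_def cis_conv_exp
  by (auto simp: scaleR_conv_of_real algebra_simps)

text \<open>A lasso around \<open>exp (\<i> \<phi>) a\<close>, with \<open>a\<close> real, whose base point lies in the rotated upper half plane. The
  charts are described in the coordinate \<open>\<eta> = exp (- \<i> \<phi>) \<zeta>\<close>; the loop runs from the first to the second
  where it passes below \<open>a\<close>.\<close>

lemma continues_along_lasso:
  fixes a :: real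
  assumes "0 < \<epsilon>" "\<epsilon> < 1" "Im (cis (- \<phi>) * P) > 0"
    and D: "open D1" "open D2" "\<And>\<eta>. Im \<eta> \<noteq> 0 \<Longrightarrow> \<eta> \<in> D1 \<inter> D2"
      "\<And>x. a - 1 < x \<Longrightarrow> x < a \<Longrightarrow> of_real x \<in> D1" "\<And>x. a < x \<Longrightarrow> x < a + 1 \<Longrightarrow> of_real x \<in> D2"
    and f: "mhol f1 D1" "mhol f2 D2" "\<And>\<eta>. Im \<eta> < 0 \<Longrightarrow> f1 \<eta> = f2 \<eta>"
    and start: "\<forall>\<^sub>F \<zeta> in nhds P. f1 (cis (- \<phi>) * \<zeta>) = f \<zeta>" "\<forall>\<^sub>F \<zeta> in nhds P. f2 (cis (- \<phi>) * \<zeta>) = g \<zeta>"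
  shows "continues_along (lasso P (cis \<phi> * of_real a) \<epsilon>) f g"
proof -
  let ?a = "cis \<phi> * of_real a" and ?c = "cis (- \<phi>)"
  define p where "p = ?c * P"
  define \<alpha> where "\<alpha> = Arg (P - ?a)"
  define \<beta> where "\<beta> = Arg (p - of_real a)"
  have cc: "?c * cis \<phi> = 1" by (simp add: cis_mult)
  have pP: "p - of_real a = ?c * (P - ?a)" unfolding p_def by (simp add: algebra_simps cis_mult)
  have "p - of_real a \<noteq> 0" using assms(3) by (auto simp: p_def complex_eq_iff)
  then have "P - ?a \<noteq> 0" using pP by auto
  have b: "0 < \<beta>" "\<beta> < pi"
    using assms(3) Arg_lt_pi[of "p - of_real a"] by (auto simp: \<beta>_def p_def)
  have cisb: "cis \<beta> = (p - of_real a) /\<^sub>R norm (p - of_real a)"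
    using \<open>p - of_real a \<noteq> 0\<close> by (simp add: \<beta>_def cis_Arg sgn_div_norm)
  have "cis \<alpha> = (P - ?a) /\<^sub>R norm (P - ?a)"
    using \<open>P - ?a \<noteq> 0\<close> by (simp add: \<alpha>_def cis_Arg sgn_div_norm)
  then have ca: "?c * cis \<alpha> = cis \<beta>"
    unfolding cisb pP by (simp add: norm_mult)
  have ca': "?c * cis (\<alpha> + t) = cis (\<beta> + t)" for t
    unfolding cis_mult[of \<alpha> t, symmetric] cis_mult[of \<beta> t, symmetric] mult.assoc[symmetric] ca ..
  define q where "q = of_real a + of_real \<epsilon> * cis \<beta>"
  define \<gamma> where "\<gamma> = lasso P ?a \<epsilon>"
  have ea: "?c * ?a = of_real a" using cc by (metis mult.assoc mult.left_neutral)
  have eq: "?c * (?a + of_real \<epsilon> * cis (\<alpha> + t)) = of_real a + of_real \<epsilon> * cis (\<beta> + t)" for t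
    by (simp only: distrib_left ea mult.left_commute[of ?c "of_real \<epsilon>"] ca')
  have eq0: "?c * (?a + of_real \<epsilon> * cis \<alpha>) = q" using eq[of 0] by (simp only: q_def add_0_right)
  have eql: "?c * (x + of_real t * (y - x)) = ?c * x + of_real t * (?c * y - ?c * x)" for t x y
    by (simp add: algebra_simps)
  have e8: "\<beta> + 2 * pi * (4 * s - 2) = \<beta> + 8 * (pi * s) - 4 * pi" for s by (simp add: algebra_simps)
  have \<gamma>: "?c * \<gamma> s = (if s \<le> 1/2 then p + of_real (2 * s) * (q - p)
     else if s \<le> 3/4 then of_real a + of_real \<epsilon> * cis (\<beta> + 2 * pi * (4 * s - 2))
     else q + of_real (4 * s - 3) * (p - q))" for s
    unfolding \<gamma>_def lasso_unfold Let_def \<alpha>_def[symmetric]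
    by (simp only: if_distrib[of "(*) ?c"] eq eql eq0 p_def[symmetric])
  have Imq: "Im q > 0" using b \<open>0 < \<epsilon>\<close> by (simp add: q_def sin_gt_zero)
  have Imp: "Im p > 0" using assms(3) by (simp add: p_def)
  have line: "Im (p + of_real t * (q - p)) > 0" "Im (q + of_real t * (p - q)) > 0" if "t \<in> {0..1}" for t
  proof -
    have *: "(1 - t) * Im p + t * Im q > 0" "t * Im p + (1 - t) * Im q > 0"
      using that Imp Imq by (cases "t = 0"; cases "t = 1"; simp add: add_pos_pos add_pos_nonneg)+
    show "Im (p + of_real t * (q - p)) > 0" "Im (q + of_real t * (p - q)) > 0"
      using * by (simp_all add: algebra_simps)
  qed
  \<comment> \<open>The circle is at angle \<open>\<beta> + 8 * pi * (s - 1 / 2)\<close>; at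
    \<open>s0\<close> this is \<open>3 * pi / 2\<close>, the lowest point, where the charts are
    exchanged.\<close>
  define s0 where "s0 = 1/2 + (3 * pi / 2 - \<beta>) / (8 * pi)"
  have s0: "1/2 < s0" "s0 < 3/4" "\<beta> + 2 * pi * (4 * s0 - 2) = 3 * pi / 2"
    using b by (auto simp: s0_def field_simps)
  have cis32: "cis (3 * pi / 2) = - \<i>"
    using cos_add[of pi "pi/2"] sin_add[of pi "pi/2"] by (simp add: complex_eq_iff)
  \<comment> \<open>Before the lowest point the circle meets the real axis only at angle
    \<open>pi\<close>, left of \<open>a\<close>; after it, in \<open>circ2\<close>, only at angle
    \<open>2 * pi\<close>, right of \<open>a\<close>.\<close>
  have circ1: "of_real a + of_real \<epsilon> * cis t \<in> D1" if "0 < t" "t \<le> 3 * pi / 2" for t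
  proof (cases "sin t = 0")
    case True
    then obtain n :: int where n: "t = of_int n * pi" by (auto simp: sin_zero_iff_int2)
    then have "0 < real_of_int n" "real_of_int n < 2" using that by (auto simp: zero_less_mult_iff field_simps)
    then have "n = 1" by linarith
    then have "of_real a + of_real \<epsilon> * cis t = of_real (a - \<epsilon>)" using n by (simp add: complex_eq_iff)
    then show ?thesis using D(4)[of "a - \<epsilon>"] assms(1,2) by simp
  next
    case False
    then show ?thesis using D(3) assms(1) by (auto)
  qed
  have circ2: "of_real a + of_real \<epsilon> * cis t \<in> D2" if "3 * pi / 2 \<le> t" "t < 3 * pi" for t
  proof (cases "sin t = 0")
    case True
    then obtain n :: int where n: "t = of_int n * pi" by (auto simp: sin_zero_iff_int2)
    then have "1 < real_of_int n" "real_of_int n < 3" using that by (auto simp: field_simps)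
    then have "n = 2" by linarith
    then have "of_real a + of_real \<epsilon> * cis t = of_real (a + \<epsilon>)" using n by (simp add: complex_eq_iff)
    then show ?thesis using D(5)[of "a + \<epsilon>"] assms(1,2) by simp
  next
    case False
    then show ?thesis using D(3) assms(1) by (auto)
  qed
  have opn: "open {\<zeta>. ?c * \<zeta> \<in> X}" if "open X" for X
    using open_vimage[OF that, of "\<lambda>\<zeta>. ?c * \<zeta>"] by (simp add: vimage_def continuous_intros)
  have hol: "mhol (\<lambda>\<zeta>. h (?c * \<zeta>)) {\<zeta>. ?c * \<zeta> \<in> X}" if "mhol h X" for h X
    using that unfolding mhol_def
    by (auto intro!: holomorphic_on_compose_gen[of "\<lambda>\<zeta>. ?c * \<zeta>" _ _ X, unfolded o_def] holomorphic_intros)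
  have ends: "pathstart \<gamma> = P" "pathfinish \<gamma> = P"
    by (simp_all add: \<gamma>_def lasso_def Let_def)
  have "continues_along \<gamma> f g"
  proof (rule continues_along_two_charts[of \<gamma> s0 "{\<zeta>. ?c * \<zeta> \<in> D1}" "{\<zeta>. ?c * \<zeta> \<in> D2}"
      "\<lambda>\<zeta>. f1 (?c * \<zeta>)" "\<lambda>\<zeta>. f2 (?c * \<zeta>)" "{\<zeta>. ?c * \<zeta> \<in> {\<eta>. Im \<eta> < 0}}"])
    show "path \<gamma>" by (simp add: \<gamma>_def lasso_path)
    show "open {\<zeta>. ?c * \<zeta> \<in> {\<eta>. Im \<eta> < 0}}" by (intro opn open_halfspace_Im_lt)
    show "\<gamma> s0 \<in> {\<zeta>. ?c * \<zeta> \<in> {\<eta>. Im \<eta> < 0}}"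
      unfolding mem_Collect_eq \<gamma> s0(3) using s0(1,2) \<open>0 < \<epsilon>\<close> by (simp add: cis32)
    show "\<gamma> s \<in> {\<zeta>. ?c * \<zeta> \<in> D1}" if "s \<in> {0..s0}" for s
    proof (cases "s \<le> 1/2")
      case True
      then show ?thesis using line(1)[of "2 * s"] that D(3)[of "?c * \<gamma> s"] by (auto simp: \<gamma>)
    next
      case False
      have "pi * s \<le> pi * s0" using that by (intro mult_left_mono) auto
      then have "\<beta> + 2 * pi * (4 * s - 2) \<le> 3 * pi / 2" using s0(3) unfolding e8 by linarith
      moreover have "0 < \<beta> + 2 * pi * (4 * s - 2)" using b False by (intro add_pos_nonneg) auto
      ultimately show ?thesis using circ1 that False s0 by (auto simp: \<gamma>)
    qed
    show "\<gamma> s \<in> {\<zeta>. ?c * \<zeta> \<in> D2}" if "s \<in> {s0..1}" for s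
    proof (cases "s \<le> 3/4")
      case True
      have "pi * s0 \<le> pi * s" "pi * s \<le> pi * (3/4)" using that True by (auto intro!: mult_left_mono)
      then have "3 * pi / 2 \<le> \<beta> + 2 * pi * (4 * s - 2)" "\<beta> + 2 * pi * (4 * s - 2) < 3 * pi"
        using s0(3) b unfolding e8 by linarith+
      then show ?thesis using circ2 that True s0 by (auto simp: \<gamma>)
    next
      case False
      then show ?thesis using line(2)[of "4 * s - 3"] that D(3)[of "?c * \<gamma> s"] by (auto simp: \<gamma>)
    qed
    show "\<forall>\<^sub>F z in nhds (pathstart \<gamma>). f1 (?c * z) = f z" "\<forall>\<^sub>F z in nhds (pathfinish \<gamma>). f2 (?c * z) = g z"
      unfolding ends by (fact start)+
  qed (use s0 f opn hol D in auto)
  then show ?thesis by (simp add: \<gamma>_def)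
qed


section \<open>The linear system in symmetric coordinates\<close>

text \<open>The coordinate is \<open>\<eta> = 2 \<xi> - 1\<close>, with singular points \<open>\<plusminus>1\<close>, and \<open>e = ln \<eta>\<close>. In contrast to the variable
  lambda, \<open>\<eta>\<close> does not depend on \<open>x\<close>, so that one choice of cuts serves the whole covering.\<close>

definition eta_coeff :: "complex \<Rightarrow> cmat2 \<Rightarrow> cmat2 \<Rightarrow> complex \<Rightarrow> cmat2" where
  "eta_coeff x P Q \<eta> = (x / 4) *m sigma3 + (1 / (\<eta> + 1)) *m P + (1 / (\<eta> - 1)) *m Q"

text \<open>The exponent \<open>(t lambda - 2 th ln lambda) / 4\<close> of the canonical solution
  plus the exponent of the factor between \<open>Y\<close> and \<open>\<Xi>\<close>. In the sum the
  terms with \<open>Im w\<close> cancel, so that it is holomorphic in \<open>w\<close>.\<close>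

definition canon_exponent :: "complex \<Rightarrow> complex \<Rightarrow> complex \<Rightarrow> complex" where
  "canon_exponent th w e = exp w * (exp e + 1) / 4 - th / 2 * (e - of_real (ln 2))"

text \<open>\<open>Im (e + w)\<close> is the argument of lambda. Put in this way the sector follows
  \<open>w\<close>, and the definition makes sense on the whole covering.\<close>

definition canon :: "complex \<Rightarrow> complex \<Rightarrow> cmat2 \<Rightarrow> cmat2 \<Rightarrow> int \<Rightarrow> (complex \<Rightarrow> cmat2) \<Rightarrow> bool" where
  "canon th w P Q k X \<longleftrightarrow>
     msol (\<lambda>e. exp e *m eta_coeff (exp w) P Q (exp e)) {e. 0 < Re e} X \<and>
     (\<forall>\<delta>>0. \<exists>C R. \<forall>e. Re e > R \<and> \<bar>Im (e + w) - pi / 2 - (of_int k - 2) * pi\<bar> \<le> pi - \<delta> \<longrightarrow>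
        norm (X e ** exp_sigma3 (- canon_exponent th w e) - mat 1) \<le> C * exp (- Re e))"

text \<open>All three cut planes contain both open half planes, joined through one of the three
  intervals into which -1 and 1 divide the real line. Solutions on them with common values above the
  axis differ below it by monodromy.\<close>

definition cutL :: "complex set" where "cutL = {\<eta>. Im \<eta> \<noteq> 0 \<or> Re \<eta> < -1}"
definition cutM :: "complex set" where "cutM = {\<eta>. Im \<eta> \<noteq> 0 \<or> (-1 < Re \<eta> \<and> Re \<eta> < 1)}"
definition cutR :: "complex set" where "cutR = {\<eta>. Im \<eta> \<noteq> 0 \<or> 1 < Re \<eta>}"

definition ustrip :: "complex set" where "ustrip = {e. 0 < Re e \<and> 0 < Im e \<and> Im e < pi}"

text \<open>A loop about -1 from the upper half plane descends on \<open>fL\<close> and returns on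
  \<open>fM\<close>, whence \<open>fL = fM ** fst N\<close> below the axis; likewise with
  \<open>fM\<close> and \<open>fR\<close> for the loop about 1.\<close>

definition sheets :: "complex \<Rightarrow> cmat2 \<Rightarrow> cmat2 \<Rightarrow> (complex \<Rightarrow> cmat2) \<Rightarrow> cmat2 \<times> cmat2 \<Rightarrow>
    (complex \<Rightarrow> cmat2) \<Rightarrow> (complex \<Rightarrow> cmat2) \<Rightarrow> (complex \<Rightarrow> cmat2) \<Rightarrow> bool" where
  "sheets x P Q X N fL fM fR \<longleftrightarrow>
     msol (eta_coeff x P Q) cutL fL \<and> msol (eta_coeff x P Q) cutM fM \<and> msol (eta_coeff x P Q) cutR fR \<and>
     (\<forall>e\<in>ustrip. fL (exp e) = X e \<and> fM (exp e) = X e \<and> fR (exp e) = X e) \<and>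
     (\<forall>\<eta>. Im \<eta> < 0 \<longrightarrow> fL \<eta> = fM \<eta> ** fst N \<and> fM \<eta> = fR \<eta> ** snd N)"

definition mono_rep :: "complex \<Rightarrow> complex \<Rightarrow> cmat2 \<Rightarrow> cmat2 \<Rightarrow> cmat2 \<times> cmat2 \<Rightarrow> bool" where
  "mono_rep th w P Q N \<longleftrightarrow> (\<exists>X fL fM fR. canon th w P Q 2 X \<and> sheets (exp w) P Q X N fL fM fR)"

lemma exp_sigma3_add: "exp_sigma3 a ** exp_sigma3 b = exp_sigma3 (a + b)"
  unfolding exp_sigma3_def mat2_mult minus_add_distrib exp_add by simp

lemma exp_sigma3_0 [simp]: "exp_sigma3 0 = mat 1"
  by (simp add: exp_sigma3_def mat2_one)

lemma exp_sigma3_cancel: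
  "exp_sigma3 a ** exp_sigma3 (- a) = mat 1" "exp_sigma3 (- a) ** exp_sigma3 a = mat 1"
  "exp_sigma3 a ** (exp_sigma3 (- a) ** B) = B" "exp_sigma3 (- a) ** (exp_sigma3 a ** B) = B"
  by (simp_all add: matrix_mul_assoc exp_sigma3_add)

lemma det_exp_sigma3 [simp]: "det (exp_sigma3 a) = 1"
  by (simp add: exp_sigma3_def det_2 flip: exp_add)

lemma open_cuts: "open cutL" "open cutM" "open cutR"
proof -
  have 1: "open {\<eta>. Im \<eta> \<noteq> 0}"
    using open_Collect_neq[of Im "\<lambda>_. 0"] by (simp add: continuous_intros)
  have *: "cutL = {\<eta>. Im \<eta> \<noteq> 0} \<union> {\<eta>. Re \<eta> < -1}" "cutR = {\<eta>. Im \<eta> \<noteq> 0} \<union> {\<eta>. 1 < Re \<eta>}"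
    "cutM = {\<eta>. Im \<eta> \<noteq> 0} \<union> ({\<eta>. -1 < Re \<eta>} \<inter> {\<eta>. Re \<eta> < 1})"
    by (auto simp: cutL_def cutM_def cutR_def)
  show "open cutL" "open cutM" "open cutR"
    unfolding * by (intro 1 open_Un open_Int open_halfspace_Re_lt open_halfspace_Re_gt)+
qed

lemma cut_star_aux:
  fixes c :: real
  assumes "x \<in> closed_segment (of_real c) z" "x \<noteq> of_real c"
  shows "(Im x = 0 \<longrightarrow> Im z = 0) \<and> (\<exists>t. 0 \<le> t \<and> t \<le> 1 \<and> Re x = (1 - t) * c + t * Re z)"
  using assms by (auto simp: in_segment)

lemma star_cuts:
  "z \<in> cutL \<Longrightarrow> closed_segment (of_real (-3)) z \<subseteq> cutL"
  "z \<in> cutM \<Longrightarrow> closed_segment (of_real 0) z \<subseteq> cutM"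
  "z \<in> cutR \<Longrightarrow> closed_segment (of_real 3) z \<subseteq> cutR"
proof -
  have conv: "(1 - t) * a + t * b < c" if "0 \<le> t" "t \<le> 1" "a < c" "b < c" for t a b c :: real
    using convex_bound_lt[of a c b "1 - t" t] that by simp
  have conv': "c < (1 - t) * a + t * b" if "0 \<le> t" "t \<le> 1" "c < a" "c < b" for t a b c :: real
    using conv[of t "-a" "-c" "-b"] that by simp
  show "closed_segment (of_real (-3)) z \<subseteq> cutL" if "z \<in> cutL"
  proof
    fix x assume "x \<in> closed_segment (complex_of_real (-3)) z"
    then show "x \<in> cutL" using that cut_star_aux[of x "-3" z] conv[of _ "-3" "-1" "Re z"]
      by (cases "x = of_real (-3)") (auto simp: cutL_def)
  qed
  show "closed_segment (of_real 0) z \<subseteq> cutM" if "z \<in> cutM"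
  proof
    fix x assume "x \<in> closed_segment (complex_of_real 0) z"
    then show "x \<in> cutM" using that cut_star_aux[of x "0" z] conv[of _ "0" "1" "Re z"] conv'[of _ "-1" "0" "Re z"]
      by (cases "x = of_real 0") (auto simp: cutM_def)
  qed
  show "closed_segment (of_real 3) z \<subseteq> cutR" if "z \<in> cutR"
  proof
    fix x assume "x \<in> closed_segment (complex_of_real 3) z"
    then show "x \<in> cutR" using that cut_star_aux[of x "3" z] conv'[of _ "1" "3" "Re z"]
      by (cases "x = of_real 3") (auto simp: cutR_def)
  qed
qed

lemma cut_base: "of_real (-3) \<in> cutL" "of_real 0 \<in> cutM" "of_real 3 \<in> cutR"
  by (auto simp: cutL_def cutM_def cutR_def)

lemma connected_cuts: "connected cutL" "connected cutM" "connected cutR"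
  by (rule starlike_imp_connected; unfold starlike_def; use star_cuts cut_base in blast)+

lemma cuts_avoid: "cutL \<subseteq> - {1, -1}" "cutM \<subseteq> - {1, -1}" "cutR \<subseteq> - {1, -1}"
  by (auto simp: cutL_def cutM_def cutR_def)

lemma cuts_upper_lower: "Im \<eta> \<noteq> 0 \<Longrightarrow> \<eta> \<in> cutL" "Im \<eta> \<noteq> 0 \<Longrightarrow> \<eta> \<in> cutM" "Im \<eta> \<noteq> 0 \<Longrightarrow> \<eta> \<in> cutR"
  by (auto simp: cutL_def cutM_def cutR_def)

lemma mhol_eta_coeff: "mhol (eta_coeff x P Q) (- {1, -1})"
  unfolding eta_coeff_def
  by (intro mhol_intros) (auto intro!: holomorphic_intros simp: add_eq_0_iff2)

lemma trace_eta_coeff: "trace P = 0 \<Longrightarrow> trace Q = 0 \<Longrightarrow> trace (eta_coeff x P Q \<eta>) = 0"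
  by (auto simp: eta_coeff_def trace_def sum_2 sigma3_def algebra_simps add_eq_0_iff2 simp flip: add_divide_distrib)

lemma trace_cscale: "trace (c *m A) = c * trace A"
  by (simp add: trace_def sum_2 algebra_simps)

lemma open_convex_RH: "open {e. 0 < Re e}" "convex {e. 0 < Re e}"
  by (simp_all add: open_halfspace_Re_gt convex_halfspace_Re_gt)

section \<open>Canonical solutions and their sheets\<close>

lemma canon_limit:
  fixes k :: int and w :: complex
  defines "c \<equiv> pi / 2 + (of_int k - 2) * pi - Im w"
  assumes "canon th w P Q k X"
  shows "((\<lambda>t. X (Complex t c) ** exp_sigma3 (- canon_exponent th w (Complex t c))) \<longlongrightarrow> mat 1) at_top"
proof -
  define F where "F e = X e ** exp_sigma3 (- canon_exponent th w e)" for e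
  obtain C R where CR: "\<And>e. Re e > R \<Longrightarrow> \<bar>Im (e + w) - pi / 2 - (of_int k - 2) * pi\<bar> \<le> pi - 1 \<Longrightarrow>
     norm (F e - mat 1) \<le> C * exp (- Re e)"
    using assms(2) unfolding canon_def F_def by (meson zero_less_one)
  have "((\<lambda>t. F (Complex t c)) \<longlongrightarrow> mat 1) at_top"
  proof (rule Lim_transform_bound[where g = "\<lambda>t. C * exp (- t)", THEN LIM_zero_cancel])
    show "\<forall>\<^sub>F t in at_top. norm (F (Complex t c) - mat 1) \<le> norm (C * exp (- t))"
      using eventually_gt_at_top[of R]
    proof eventually_elim
      case (elim t)
      have "norm (F (Complex t c) - mat 1) \<le> C * exp (- t)"
        using CR[of "Complex t c"] elim pi_ge_two by (simp add: c_def)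
      then show ?case by simp
    qed
    show "((\<lambda>t. C * exp (- t)) \<longlongrightarrow> 0) at_top"
      by (rule tendsto_mult_right_zero) (rule filterlim_compose[OF exp_at_bot filterlim_uminus_at_bot_at_top])
  qed
  then show ?thesis by (simp add: F_def)
qed

text \<open>The determinant is constant by Liouville's formula, and the constant is read off in the
  limit along the middle of the sector.\<close>

lemma canon_det:
  assumes "canon th w P Q k X" "trace P = 0" "trace Q = 0" "0 < Re e"
  shows "det (X e) = 1"
proof -
  let ?A = "\<lambda>e. exp e *m eta_coeff (exp w) P Q (exp e)"
  have "msol ?A {e. 0 < Re e} X" using assms(1) by (simp add: canon_def)
  from det_msol_constant[OF open_convex_RH(1) convex_connected[OF open_convex_RH(2)] this]
  obtain d where d: "\<And>e. 0 < Re e \<Longrightarrow> det (X e) = d"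
    using trace_eta_coeff[OF assms(2,3)] by (auto simp: trace_cscale)
  define c where "c = pi / 2 + (of_int k - 2) * pi - Im w"
  define F where "F e = X e ** exp_sigma3 (- canon_exponent th w e)" for e
  have lim: "((\<lambda>t. F (Complex t c)) \<longlongrightarrow> mat 1) at_top"
    unfolding F_def c_def by (rule canon_limit[OF assms(1)])
  have "((\<lambda>t. det (F (Complex t c))) \<longlongrightarrow> det (mat 1 :: cmat2)) at_top"
    unfolding det_2 by (intro tendsto_intros lim tendsto_vec_nth)
  moreover have "\<forall>\<^sub>F t in at_top. det (F (Complex t c)) = d"
    using eventually_gt_at_top[of 0] by eventually_elim (simp add: F_def det_mul d)
  ultimately have "((\<lambda>t::real. d) \<longlongrightarrow> 1) at_top"
    by (simp add: tendsto_cong)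
  then have "d = 1" by (simp add: tendsto_const_iff)
  then show ?thesis using d assms(4) by simp
qed

lemma msol_exp:
  assumes "msol A D f" "\<And>e. e \<in> S \<Longrightarrow> exp e \<in> D"
  shows "msol (\<lambda>e. exp e *m A (exp e)) S (\<lambda>e. f (exp e))"
  using has_mderiv_compose[OF _ DERIV_exp] assms unfolding msol_def by (simp add: cscale_mult)

lemma ustrip: "open ustrip" "convex ustrip" "e \<in> ustrip \<Longrightarrow> Im (exp e) > 0" "Ln (2 * \<i>) \<in> ustrip"
proof -
  have *: "ustrip = {e. 0 < Re e} \<inter> ({e. 0 < Im e} \<inter> {e. Im e < pi})" by (auto simp: ustrip_def)
  show "open ustrip" "convex ustrip"
    unfolding * by (intro open_Int open_halfspace_Re_gt open_halfspace_Im_lt open_halfspace_Im_gt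
        convex_Int convex_halfspace_Re_gt convex_halfspace_Im_lt convex_halfspace_Im_gt)+
  show "e \<in> ustrip \<Longrightarrow> Im (exp e) > 0" by (simp add: ustrip_def Im_exp sin_gt_zero)
  have "Re (Ln (2 * \<i>)) = ln 2" by (simp add: norm_mult)
  moreover have "0 < Im (Ln (2 * \<i>)) \<and> Im (Ln (2 * \<i>)) < pi" by (simp add: Im_Ln_pos_lt_imp)
  ultimately show "Ln (2 * \<i>) \<in> ustrip" by (simp add: ustrip_def)
qed

text \<open>The value of \<open>X\<close> over the point \<open>2 * \<i>\<close> is the initial
  condition; agreement with \<open>X\<close> over the upper half plane outside the unit disc is then
  uniqueness.\<close>

lemma sheet_exists:
  assumes "canon th w P Q k X" "trace P = 0" "trace Q = 0"
    and D: "open D" "b \<in> D" "\<And>z. z \<in> D \<Longrightarrow> closed_segment b z \<subseteq> D" "D \<subseteq> - {1, -1}" "\<And>\<eta>. Im \<eta> \<noteq> 0 \<Longrightarrow> \<eta> \<in> D"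
  shows "\<exists>f. msol (eta_coeff (exp w) P Q) D f \<and> (\<forall>z\<in>D. det (f z) = 1) \<and> (\<forall>e\<in>ustrip. f (exp e) = X e)"
proof -
  let ?A = "eta_coeff (exp w) P Q"
  have X: "msol (\<lambda>e. exp e *m ?A (exp e)) {e. 0 < Re e} X" using assms(1) by (simp add: canon_def)
  have det: "det (X e) = 1" if "e \<in> ustrip" for e
    using canon_det[OF assms(1-3)] that by (simp add: ustrip_def)
  have "mhol ?A D" using mhol_subset[OF mhol_eta_coeff D(4)] .
  from linear_ode_exists_SL2[OF D(1-3) this trace_eta_coeff[OF assms(2,3)] D(5)[of "2 * \<i>"], of "X (Ln (2 * \<i>))"]
  obtain f where f: "f (2 * \<i>) = X (Ln (2 * \<i>))" "msol ?A D f" "\<And>z. z \<in> D \<Longrightarrow> det (f z) = 1"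
    using det ustrip(4) by auto
  have "f (exp e) = X e" if "e \<in> ustrip" for e
  proof (rule msol_eqI[OF ustrip(1) convex_connected[OF ustrip(2)] msol_exp[OF f(2)] msol_subset[OF X] _ _ ustrip(4) _ that])
    show "\<And>e. e \<in> ustrip \<Longrightarrow> exp e \<in> D" using D(5) ustrip(3) by (metis less_irrefl)
    then show "\<And>e. e \<in> ustrip \<Longrightarrow> det (f (exp e)) = 1" using f(3) by blast
    show "ustrip \<subseteq> {e. 0 < Re e}" by (auto simp: ustrip_def)
  qed (use f trace_eta_coeff[OF assms(2,3)] in \<open>auto simp: trace_cscale\<close>)
  then show ?thesis using f by blast
qed

lemma sheets_exist:
  assumes "canon th w P Q k X" "trace P = 0" "trace Q = 0"
  shows "\<exists>N fL fM fR. sheets (exp w) P Q X N fL fM fR"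
proof -
  let ?A = "eta_coeff (exp w) P Q"
  obtain fL where L: "msol ?A cutL fL" "\<And>z. z \<in> cutL \<Longrightarrow> det (fL z) = 1" "\<And>e. e \<in> ustrip \<Longrightarrow> fL (exp e) = X e"
    using sheet_exists[OF assms open_cuts(1) cut_base(1) star_cuts(1) cuts_avoid(1) cuts_upper_lower(1)] by blast
  obtain fM where M: "msol ?A cutM fM" "\<And>z. z \<in> cutM \<Longrightarrow> det (fM z) = 1" "\<And>e. e \<in> ustrip \<Longrightarrow> fM (exp e) = X e"
    using sheet_exists[OF assms open_cuts(2) cut_base(2) star_cuts(2) cuts_avoid(2) cuts_upper_lower(2)] by blast
  obtain fR where R: "msol ?A cutR fR" "\<And>z. z \<in> cutR \<Longrightarrow> det (fR z) = 1" "\<And>e. e \<in> ustrip \<Longrightarrow> fR (exp e) = X e"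
    using sheet_exists[OF assms open_cuts(3) cut_base(3) star_cuts(3) cuts_avoid(3) cuts_upper_lower(3)] by blast
  let ?H = "{\<eta>. Im \<eta> < 0}"
  have sub: "?H \<subseteq> cutL" "?H \<subseteq> cutM" "?H \<subseteq> cutR" by (auto intro: cuts_upper_lower)
  have H: "open ?H" "connected ?H" by (simp_all add: open_halfspace_Im_lt convex_connected convex_halfspace_Im_lt)
  obtain N0 where "\<And>\<eta>. \<eta> \<in> ?H \<Longrightarrow> fL \<eta> = fM \<eta> ** N0"
    using msol_quotient_constant[OF H msol_subset[OF M(1) sub(2)] msol_subset[OF L(1) sub(1)]
       trace_eta_coeff[OF assms(2,3)]] M(2) sub by blast
  moreover obtain N1 where "\<And>\<eta>. \<eta> \<in> ?H \<Longrightarrow> fM \<eta> = fR \<eta> ** N1"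
    using msol_quotient_constant[OF H msol_subset[OF R(1) sub(3)] msol_subset[OF M(1) sub(2)]
       trace_eta_coeff[OF assms(2,3)]] R(2) sub by blast
  ultimately have "sheets (exp w) P Q X (N0, N1) fL fM fR"
    using L M R by (simp add: sheets_def)
  then show ?thesis by blast
qed

section \<open>Comparison with the definition of the monodromy data\<close>

definition Y_exponent :: "complex \<Rightarrow> complex \<Rightarrow> complex" where
  "Y_exponent th w = exp w / 4 + th / 2 * (\<i> * of_real (Im w) + of_real (ln 2))"

text \<open>The shift by \<open>\<i> * Im w\<close> turns \<open>ln \<eta>\<close> into the
  logarithm of lambda, which is \<open>cis (Im w) * \<eta>\<close>.\<close>

definition Xi_of_Y :: "complex \<Rightarrow> complex \<Rightarrow> (complex \<Rightarrow> cmat2) \<Rightarrow> complex \<Rightarrow> cmat2" where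
  "Xi_of_Y th w Y e = exp_sigma3 (Y_exponent th w) ** Y (e + \<i> * of_real (Im w))"

definition Y_of_Xi :: "complex \<Rightarrow> complex \<Rightarrow> (complex \<Rightarrow> cmat2) \<Rightarrow> complex \<Rightarrow> cmat2" where
  "Y_of_Xi th w X v = exp_sigma3 (- Y_exponent th w) ** X (v - \<i> * of_real (Im w))"

lemma Xi_of_Y_of_Xi [simp]: "Xi_of_Y th w (Y_of_Xi th w X) = X"
  by (simp add: fun_eq_iff Xi_of_Y_def Y_of_Xi_def exp_sigma3_cancel)

lemma trace_A_mats [simp]: "trace (A0_mat \<theta>0 z u) = 0" "trace (A1_mat \<theta>0 \<theta>1 \<theta>i y z u) = 0"
  by (simp_all add: A0_mat_def A1_mat_def trace_def sum_2)

lemma Y_coeff_eq: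
  assumes "v = e + \<i> * of_real (Im w)"
  shows "exp v *m Y_coeff \<theta>0 \<theta>1 \<theta>i w y z u (exp v) =
    exp_sigma3 (- Y_exponent \<theta>i w) ** (exp e *m eta_coeff (exp w) (A0_mat \<theta>0 z u) (A1_mat \<theta>0 \<theta>1 \<theta>i y z u) (exp e))
      ** exp_sigma3 (Y_exponent \<theta>i w)"
proof -
  have v: "exp v = exp e * cis (Im w)" by (simp add: assms exp_add cis_conv_exp)
  have cv: "cis (- Im w) * exp v = exp e" by (simp add: v cis_mult)
  have c2: "exp v * cis (- Im w) = exp e" using cv by (simp only: mult.commute)
  let ?P = "A0_mat \<theta>0 z u" and ?Q = "A1_mat \<theta>0 \<theta>1 \<theta>i y z u"
  have X: "Xi_coeff \<theta>0 \<theta>1 \<theta>i (exp w) y z u ((exp e + 1) / 2) = 2 *m eta_coeff (exp w) ?P ?Q (exp e)"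
  proof -
    \<comment> \<open>Valid also at \<open>exp e = 1\<close>, where both sides are 0 by the
      convention for division.\<close>
    have "1 / ((exp e + 1) / 2 - 1) = 2 / (exp e - 1)"
      by (cases "exp e = 1") (simp_all add: field_simps)
    then show ?thesis
      unfolding Xi_coeff_def eta_coeff_def mat_mult_eq_cscale by (simp add: cscale.add_right)
  qed
  show ?thesis
    unfolding Y_coeff_def Let_def cv X Y_exponent_def[symmetric] mat_mult_eq_cscale
    by (simp add: cscale_mult c2 mult.assoc[symmetric]) 
qed

text \<open>The two remainders \<open>F\<close> and \<open>G\<close> are conjugate by a diagonal
  matrix that does not depend on the spectral variable; so a bound for one is a bound for the other,
  up to the constant \<open>?K\<close>.\<close>

lemma canonical_solution_iff:
  "canonical_solution \<theta>0 \<theta>1 \<theta>i w y z u k Y \<longleftrightarrow>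
     canon \<theta>i w (A0_mat \<theta>0 z u) (A1_mat \<theta>0 \<theta>1 \<theta>i y z u) k (Xi_of_Y \<theta>i w Y)"
proof -
  let ?P = "A0_mat \<theta>0 z u" and ?Q = "A1_mat \<theta>0 \<theta>1 \<theta>i y z u"
  let ?E = "exp_sigma3 (Y_exponent \<theta>i w)" and ?E' = "exp_sigma3 (- Y_exponent \<theta>i w)"
  let ?s = "\<i> * of_real (Im w)"
  let ?X = "Xi_of_Y \<theta>i w Y"
  have 1: "has_mderiv Y (exp (e + ?s) *m Y_coeff \<theta>0 \<theta>1 \<theta>i w y z u (exp (e + ?s)) ** Y (e + ?s)) (e + ?s)
     \<longleftrightarrow> has_mderiv ?X (exp e *m eta_coeff (exp w) ?P ?Q (exp e) ** ?X e) e" (is "?l \<longleftrightarrow> ?r") for e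
  proof
    assume ?l
    have d: "((\<lambda>e. e + ?s) has_field_derivative 1) (at e)" by (auto intro!: derivative_eq_intros)
    have "has_mderiv ?X (0 ** Y (e + ?s) + ?E ** (1 *m (exp (e + ?s) *m Y_coeff \<theta>0 \<theta>1 \<theta>i w y z u (exp (e + ?s)) ** Y (e + ?s)))) e"
      unfolding Xi_of_Y_def
      by (intro has_mderiv_mult has_mderiv_const has_mderiv_compose[OF \<open>?l\<close> d])
    then show ?r
      by (simp only: cmat2_mult_algebra add_0_left cscale_simps Y_coeff_eq[OF refl] matrix_mul_assoc exp_sigma3_cancel matrix_mul_lid)
         (simp add: Xi_of_Y_def matrix_mul_assoc)
  next
    assume ?r
    have Y: "Y = (\<lambda>v. ?E' ** ?X (v - ?s))" by (simp add: Xi_of_Y_def exp_sigma3_cancel)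
    have d: "((\<lambda>v. v - ?s) has_field_derivative 1) (at (e + ?s))" by (auto intro!: derivative_eq_intros)
    have r: "has_mderiv ?X (exp e *m eta_coeff (exp w) ?P ?Q (exp e) ** ?X e) (e + ?s - ?s)" using \<open>?r\<close> by simp
    have "has_mderiv (\<lambda>v. ?E' ** ?X (v - ?s)) (0 ** ?X (e + ?s - ?s) + ?E' ** (1 *m (exp e *m eta_coeff (exp w) ?P ?Q (exp e) ** ?X e))) (e + ?s)"
      by (intro has_mderiv_mult has_mderiv_const has_mderiv_compose[OF r d])
    moreover have "0 ** ?X (e + ?s - ?s) + ?E' ** (1 *m (exp e *m eta_coeff (exp w) ?P ?Q (exp e) ** ?X e)) =
       exp (e + ?s) *m Y_coeff \<theta>0 \<theta>1 \<theta>i w y z u (exp (e + ?s)) ** Y (e + ?s)"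
      by (simp only: cmat2_mult_algebra add_0_left cscale_simps Y_coeff_eq[OF refl])
         (simp add: Xi_of_Y_def matrix_mul_assoc)
    ultimately show ?l unfolding Y[symmetric] by simp
  qed
  have 2: "(\<forall>v. Re v > 0 \<longrightarrow> (\<forall>i j. ((\<lambda>v. Y v $ i $ j) has_field_derivative
           exp v * (Y_coeff \<theta>0 \<theta>1 \<theta>i w y z u (exp v) ** Y v) $ i $ j) (at v))) \<longleftrightarrow>
     msol (\<lambda>e. exp e *m eta_coeff (exp w) ?P ?Q (exp e)) {e. 0 < Re e} ?X"
  proof -
    have "(\<forall>v. Re v > 0 \<longrightarrow> (\<forall>i j. ((\<lambda>v. Y v $ i $ j) has_field_derivative
           exp v * (Y_coeff \<theta>0 \<theta>1 \<theta>i w y z u (exp v) ** Y v) $ i $ j) (at v))) \<longleftrightarrow>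
        (\<forall>v. Re v > 0 \<longrightarrow> has_mderiv Y (exp v *m Y_coeff \<theta>0 \<theta>1 \<theta>i w y z u (exp v) ** Y v) v)"
      by (simp add: has_mderiv_iff cscale_mult)
    also have "\<dots> \<longleftrightarrow> (\<forall>e. Re e > 0 \<longrightarrow> has_mderiv Y (exp (e + ?s) *m Y_coeff \<theta>0 \<theta>1 \<theta>i w y z u (exp (e + ?s)) ** Y (e + ?s)) (e + ?s))"
    proof (intro iffI allI impI)
      fix v assume *: "\<forall>e. Re e > 0 \<longrightarrow> has_mderiv Y (exp (e + ?s) *m Y_coeff \<theta>0 \<theta>1 \<theta>i w y z u (exp (e + ?s)) ** Y (e + ?s)) (e + ?s)" "Re v > 0"
      then show "has_mderiv Y (exp v *m Y_coeff \<theta>0 \<theta>1 \<theta>i w y z u (exp v) ** Y v) v"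
        using *(1)[rule_format, of "v - ?s"] by simp
    qed simp
    also have "\<dots> \<longleftrightarrow> msol (\<lambda>e. exp e *m eta_coeff (exp w) ?P ?Q (exp e)) {e. 0 < Re e} ?X"
      unfolding 1 msol_def by simp
    finally show ?thesis .
  qed
  have T: "canon_exponent \<theta>i w e = Y_exponent \<theta>i w + (of_real (exp (Re w)) * exp (e + ?s) - 2 * \<theta>i * (e + ?s)) / 4" for e
  proof -
    have "exp w = of_real (exp (Re w)) * exp ?s"
      by (simp add: exp_eq_polar[of w] cis_conv_exp)
    then have "of_real (exp (Re w)) * exp (e + ?s) = exp w * exp e" by (simp add: exp_add algebra_simps)
    then show ?thesis by (simp add: canon_exponent_def Y_exponent_def) (simp add: field_simps)
  qed
  define G where "G v = Y v ** exp_sigma3 (- ((of_real (exp (Re w)) * exp v - 2 * \<theta>i * v) / 4)) - mat 1" for v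
  define F where "F e = ?X e ** exp_sigma3 (- canon_exponent \<theta>i w e) - mat 1" for e
  have FG: "F e = ?E ** G (e + ?s) ** ?E'" for e
  proof -
    have "exp_sigma3 (- canon_exponent \<theta>i w e) = exp_sigma3 (- ((of_real (exp (Re w)) * exp (e + ?s) - 2 * \<theta>i * (e + ?s)) / 4)) ** ?E'"
      unfolding exp_sigma3_add T by (rule arg_cong[of _ _ exp_sigma3]) simp
    then show ?thesis
      unfolding F_def G_def Xi_of_Y_def by (simp add: cmat2_mult_algebra matrix_mul_assoc exp_sigma3_cancel)
  qed
  have GF: "G (e + ?s) = ?E' ** F e ** ?E" for e
    by (simp add: FG matrix_mul_assoc[symmetric] exp_sigma3_cancel)
  have nFG: "norm (F e) \<le> norm ?E * norm ?E' * norm (G (e + ?s))" for e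
    unfolding FG using norm_cmat2_mult[of "?E ** G (e + ?s)" ?E'] mult_right_mono[OF norm_cmat2_mult[of ?E "G (e + ?s)"], of "norm ?E'"]
    by (simp add: mult.commute mult.left_commute)
  have nGF: "norm (G (e + ?s)) \<le> norm ?E * norm ?E' * norm (F e)" for e
    unfolding GF using norm_cmat2_mult[of "?E' ** F e" ?E] mult_right_mono[OF norm_cmat2_mult[of ?E' "F e"], of "norm ?E"]
    by (simp add: mult.commute mult.left_commute)
  let ?K = "norm ?E * norm ?E'"
  have 3: "(\<forall>\<delta>>0. \<exists>C R. \<forall>v. Re v > R \<and> \<bar>Im v - pi / 2 - (of_int k - 2) * pi\<bar> \<le> pi - \<delta> \<longrightarrow> norm (G v) \<le> C * exp (- Re v))
     \<longleftrightarrow> (\<forall>\<delta>>0. \<exists>C R. \<forall>e. Re e > R \<and> \<bar>Im (e + w) - pi / 2 - (of_int k - 2) * pi\<bar> \<le> pi - \<delta> \<longrightarrow> norm (F e) \<le> C * exp (- Re e))"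
    (is "?l \<longleftrightarrow> ?r")
  proof
    assume l: ?l
    show ?r
    proof (intro allI impI)
      fix \<delta> :: real assume "\<delta> > 0"
      then obtain C R where *: "\<And>v. Re v > R \<Longrightarrow> \<bar>Im v - pi / 2 - (of_int k - 2) * pi\<bar> \<le> pi - \<delta> \<Longrightarrow> norm (G v) \<le> C * exp (- Re v)"
        using l by meson
      show "\<exists>C R. \<forall>e. Re e > R \<and> \<bar>Im (e + w) - pi / 2 - (of_int k - 2) * pi\<bar> \<le> pi - \<delta> \<longrightarrow> norm (F e) \<le> C * exp (- Re e)"
      proof (rule exI[of _ "?K * C"], rule exI[of _ R], intro allI impI)
        fix e assume "Re e > R \<and> \<bar>Im (e + w) - pi / 2 - (of_int k - 2) * pi\<bar> \<le> pi - \<delta>"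
        then have "norm (G (e + ?s)) \<le> C * exp (- Re e)" using *[of "e + ?s"] by simp
        then have "?K * norm (G (e + ?s)) \<le> ?K * (C * exp (- Re e))" by (intro mult_left_mono) auto
        then show "norm (F e) \<le> ?K * C * exp (- Re e)" using nFG[of e] by (simp only: mult.assoc)
      qed
    qed
  next
    assume r: ?r
    show ?l
    proof (intro allI impI)
      fix \<delta> :: real assume "\<delta> > 0"
      then obtain C R where *: "\<And>e. Re e > R \<Longrightarrow> \<bar>Im (e + w) - pi / 2 - (of_int k - 2) * pi\<bar> \<le> pi - \<delta> \<Longrightarrow> norm (F e) \<le> C * exp (- Re e)"
        using r by meson
      show "\<exists>C R. \<forall>v. Re v > R \<and> \<bar>Im v - pi / 2 - (of_int k - 2) * pi\<bar> \<le> pi - \<delta> \<longrightarrow> norm (G v) \<le> C * exp (- Re v)"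
      proof (rule exI[of _ "?K * C"], rule exI[of _ R], intro allI impI)
        fix v assume "Re v > R \<and> \<bar>Im v - pi / 2 - (of_int k - 2) * pi\<bar> \<le> pi - \<delta>"
        then have "norm (F (v - ?s)) \<le> C * exp (- Re v)" using *[of "v - ?s"] by simp
        then have "?K * norm (F (v - ?s)) \<le> ?K * (C * exp (- Re v))" by (intro mult_left_mono) auto
        then show "norm (G v) \<le> ?K * C * exp (- Re v)" using nGF[of "v - ?s"] by (simp add: mult.assoc)
      qed
    qed
  qed
  show ?thesis
    unfolding canonical_solution_def canon_def 2 3[unfolded G_def F_def] ..
qed

text \<open>Near the base point both principal logarithms \<open>Ln \<zeta>\<close> and
  \<open>Ln \<eta>\<close> have imaginary parts between 0 and \<open>pi\<close>. For
  \<open>\<bar>Im w\<bar> < pi / 2\<close> the difference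
  \<open>Ln \<eta> + \<i> * Im w - Ln \<zeta>\<close> is therefore too small to be a nonzero
  multiple of \<open>2 * pi * \<i>\<close>. The same condition puts the rotated base point into the
  upper half plane.\<close>

lemma Y_Ln_eq_sheet:
  assumes "\<bar>Im w\<bar> < pi / 2" "r > 1"
    and "\<And>e. e \<in> ustrip \<Longrightarrow> f (exp e) = Xi_of_Y th w Y e"
  shows "\<forall>\<^sub>F \<zeta> in nhds (\<i> * of_real r). exp_sigma3 (- Y_exponent th w) ** f (cis (- Im w) * \<zeta>) = Y (Ln \<zeta>)"
proof -
  let ?c = "cis (- Im w)"
  have cosp: "cos (Im w) > 0" using assms(1) by (intro cos_gt_zero_pi) auto
  have "open {\<zeta>. Im (?c * \<zeta>) > 0}" "open {\<zeta>. Im \<zeta> > 0}" "open {\<zeta>. norm \<zeta> > 1}"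
    by (intro open_Collect_less continuous_intros)+
  then have "open ({\<zeta>. Im (?c * \<zeta>) > 0} \<inter> ({\<zeta>. Im \<zeta> > 0} \<inter> {\<zeta>. norm \<zeta> > 1}))" by (intro open_Int)
  moreover have "\<i> * of_real r \<in> {\<zeta>. Im (?c * \<zeta>) > 0} \<inter> ({\<zeta>. Im \<zeta> > 0} \<inter> {\<zeta>. norm \<zeta> > 1})"
    using assms(2) cosp by (simp add: norm_mult)
  ultimately have "\<forall>\<^sub>F \<zeta> in nhds (\<i> * of_real r). \<zeta> \<in> {\<zeta>. Im (?c * \<zeta>) > 0} \<inter> ({\<zeta>. Im \<zeta> > 0} \<inter> {\<zeta>. norm \<zeta> > 1})"
    by (rule eventually_nhds_in_open)
  then show ?thesis
  proof eventually_elim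
    case (elim \<zeta>)
    define \<eta> where "\<eta> = ?c * \<zeta>"
    have \<eta>: "Im \<eta> > 0" "norm \<eta> > 1" "Im \<zeta> > 0" "\<zeta> \<noteq> 0" "\<eta> \<noteq> 0"
      using elim by (auto simp: \<eta>_def norm_mult)
    have "Ln \<eta> \<in> ustrip"
      using \<eta> by (simp add: ustrip_def Im_Ln_pos_lt_imp)
    then have f: "f \<eta> = Xi_of_Y th w Y (Ln \<eta>)" using assms(3)[of "Ln \<eta>"] \<eta> by simp
    have "exp (Ln \<eta> + \<i> * of_real (Im w)) = exp (Ln \<zeta>)"
      using \<eta> by (simp add: exp_add \<eta>_def cis_mult flip: cis_conv_exp)
    then obtain n :: int where n: "Ln \<eta> + \<i> * of_real (Im w) = Ln \<zeta> + of_int (2 * n) * (of_real pi * \<i>)"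
      by (auto simp: exp_eq mult.assoc)
    have "Im (Ln \<eta>) + Im w = Im (Ln \<zeta>) + 2 * of_int n * pi"
      using arg_cong[OF n, of Im] by simp
    moreover have "0 < Im (Ln \<eta>)" "Im (Ln \<eta>) < pi" "0 < Im (Ln \<zeta>)" "Im (Ln \<zeta>) < pi"
      using \<eta> by (auto simp: Im_Ln_pos_lt_imp)
    ultimately have "\<bar>2 * of_int n * pi\<bar> < 2 * pi" using assms(1) by linarith
    then have "\<bar>real_of_int n\<bar> < 1" by (simp add: abs_mult)
    then have "n = 0" by linarith
    then show ?case using n f by (simp add: Xi_of_Y_def exp_sigma3_cancel \<eta>_def)
  qed
qed

lemma sheets_continue_lassos:
  assumes "\<bar>Im w\<bar> < pi / 2" "100 < r" "0 < \<epsilon>" "\<epsilon> < 1"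
    and "sheets (exp w) P Q (Xi_of_Y th w Y) N fL fM fR"
  shows "continues_along (lasso (\<i> * of_real r) (- cis (Im w)) \<epsilon>) (\<lambda>\<zeta>. Y (Ln \<zeta>)) (\<lambda>\<zeta>. Y (Ln \<zeta>) ** fst N)"
    "continues_along (lasso (\<i> * of_real r) (cis (Im w)) \<epsilon>) (\<lambda>\<zeta>. Y (Ln \<zeta>)) (\<lambda>\<zeta>. Y (Ln \<zeta>) ** snd N)"
proof -
  let ?E = "exp_sigma3 (- Y_exponent th w)"
  note s = assms(5)[unfolded sheets_def]
  have hol: "mhol (\<lambda>\<eta>. ?E ** f \<eta> ** C) D" if "msol A D f" "open D" for A f D C
    using msol_mhol[OF that(2,1)] by (intro mhol_intros)
  have Im: "Im (cis (- Im w) * (\<i> * of_real r)) > 0"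
    using assms(1,2) cos_gt_zero_pi[of "Im w"] by simp
  have ev: "\<forall>\<^sub>F \<zeta> in nhds (\<i> * of_real r). ?E ** f (cis (- Im w) * \<zeta>) ** C = Y (Ln \<zeta>) ** C"
    if "\<And>e. e \<in> ustrip \<Longrightarrow> f (exp e) = Xi_of_Y th w Y e" for f C
    using Y_Ln_eq_sheet[OF assms(1) _ that, of r] assms(2) by (auto elim: eventually_mono)
  have "continues_along (lasso (\<i> * of_real r) (cis (Im w) * of_real (-1)) \<epsilon>) (\<lambda>\<zeta>. Y (Ln \<zeta>) ** mat 1) (\<lambda>\<zeta>. Y (Ln \<zeta>) ** fst N)"
    by (rule continues_along_lasso[OF assms(3,4) Im open_cuts(1,2) _ _ _ hol hol _ ev ev])
       (use s open_cuts in \<open>auto simp: cutL_def cutM_def matrix_mul_assoc\<close>)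
  then show "continues_along (lasso (\<i> * of_real r) (- cis (Im w)) \<epsilon>) (\<lambda>\<zeta>. Y (Ln \<zeta>)) (\<lambda>\<zeta>. Y (Ln \<zeta>) ** fst N)"
    by simp
  have "continues_along (lasso (\<i> * of_real r) (cis (Im w) * of_real 1) \<epsilon>) (\<lambda>\<zeta>. Y (Ln \<zeta>) ** mat 1) (\<lambda>\<zeta>. Y (Ln \<zeta>) ** snd N)"
    by (rule continues_along_lasso[OF assms(3,4) Im open_cuts(2,3) _ _ _ hol hol _ ev ev])
       (use s open_cuts in \<open>auto simp: cutR_def cutM_def matrix_mul_assoc\<close>)
  then show "continues_along (lasso (\<i> * of_real r) (cis (Im w)) \<epsilon>) (\<lambda>\<zeta>. Y (Ln \<zeta>)) (\<lambda>\<zeta>. Y (Ln \<zeta>) ** snd N)"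
    by simp
qed

text \<open>From left to right, sheets are built on the given solution; their matrices and the given
  ones come from continuation along the same lassos, so uniqueness of continuation identifies them
  at the base point.\<close>

theorem monodromy_data_iff:
  assumes "\<bar>Im w\<bar> < pi / 2"
  shows "monodromy_data \<theta>0 \<theta>1 \<theta>i w y z u N \<longleftrightarrow>
    mono_rep \<theta>i w (A0_mat \<theta>0 z u) (A1_mat \<theta>0 \<theta>1 \<theta>i y z u) N" (is "?l \<longleftrightarrow> ?r")
proof
  let ?P = "A0_mat \<theta>0 z u" and ?Q = "A1_mat \<theta>0 \<theta>1 \<theta>i y z u"
  assume ?r
  then obtain X fL fM fR where X: "canon \<theta>i w ?P ?Q 2 X" "sheets (exp w) ?P ?Q X N fL fM fR"
    by (auto simp: mono_rep_def)
  define Y where "Y = Y_of_Xi \<theta>i w X"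
  have XY: "Xi_of_Y \<theta>i w Y = X" by (simp add: Y_def)
  have "canonical_solution \<theta>0 \<theta>1 \<theta>i w y z u 2 Y" using X(1) by (simp add: canonical_solution_iff XY)
  with sheets_continue_lassos[of w 101 "1/2" ?P ?Q \<theta>i Y N fL fM fR] show ?l
    unfolding monodromy_data_def case_prod_beta
    by (intro exI[of _ Y] exI[of _ 101] exI[of _ "1/2"]) (use X(2) XY assms in auto)
next
  let ?P = "A0_mat \<theta>0 z u" and ?Q = "A1_mat \<theta>0 \<theta>1 \<theta>i y z u"
  assume ?l
  then obtain Y r \<epsilon> where Y: "canonical_solution \<theta>0 \<theta>1 \<theta>i w y z u 2 Y" "100 < r" "0 < \<epsilon>" "\<epsilon> < 1"
       "continues_along (lasso (\<i> * of_real r) (- cis (Im w)) \<epsilon>) (\<lambda>\<zeta>. Y (Ln \<zeta>)) (\<lambda>\<zeta>. Y (Ln \<zeta>) ** fst N)"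
       "continues_along (lasso (\<i> * of_real r) (cis (Im w)) \<epsilon>) (\<lambda>\<zeta>. Y (Ln \<zeta>)) (\<lambda>\<zeta>. Y (Ln \<zeta>) ** snd N)"
    by (auto simp: monodromy_data_def case_prod_beta)
  define X where "X = Xi_of_Y \<theta>i w Y"
  have X: "canon \<theta>i w ?P ?Q 2 X" using Y(1) by (simp add: canonical_solution_iff X_def)
  obtain N' fL fM fR where s: "sheets (exp w) ?P ?Q X N' fL fM fR"
    using sheets_exist[OF X] by auto
  note c = sheets_continue_lassos[OF assms Y(2-4) s[unfolded X_def]]
  have det: "det (Y (Ln (\<i> * of_real r))) \<noteq> 0"
  proof -
    have "Re (Ln (\<i> * of_real r) - \<i> * of_real (Im w)) > 0" using Y(2) by (simp add: norm_mult)
    from canon_det[OF X _ _ this] show ?thesis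
      by (auto simp: X_def Xi_of_Y_def det_mul)
  qed
  have fin: "pathfinish (lasso P a \<epsilon>') = P" for P a \<epsilon>' by (simp add: lasso_def Let_def)
  have "fst N = fst N'"
    using eventually_nhds_x_imp_x[OF continues_along_unique[OF lasso_path Y(5) c(1)]] 
    unfolding fin by (rule cmat2_left_cancel) (rule det)
  moreover have "snd N = snd N'"
    using eventually_nhds_x_imp_x[OF continues_along_unique[OF lasso_path Y(6) c(2)]] 
    unfolding fin by (rule cmat2_left_cancel) (rule det)
  ultimately have "N = N'" by (simp add: prod_eq_iff)
  then show ?r using X s by (auto simp: mono_rep_def)
qed


section \<open>Growth estimates\<close>

text \<open>Damping by \<open>exp (- d * exp (3 / 2 * (e - \<i> * c)))\<close> beats growth of order
  \<open>exp (K * exp (Re e))\<close>, as 3/2 > 1. In a strip of half width \<open>pi / 4\<close>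
  the angle stays within \<open>3 * pi / 8\<close>, less than \<open>pi / 2\<close>, so the damping
  factor is at most 1 in modulus.\<close>

lemma phragmen_lindelof_strip:
  fixes h :: "complex \<Rightarrow> complex" and c R M K :: real
  defines "S \<equiv> {e. R \<le> Re e \<and> \<bar>Im e - c\<bar> \<le> pi / 4}"
  assumes hol: "open U" "h holomorphic_on U" "S \<subseteq> U" and "0 < M"
    and side: "\<And>e. e \<in> S \<Longrightarrow> \<bar>Im e - c\<bar> = pi / 4 \<or> Re e = R \<Longrightarrow> norm (h e) \<le> M"
    and growth: "\<And>e. e \<in> S \<Longrightarrow> norm (h e) \<le> exp (K * exp (Re e))" and "0 \<le> K" and e0: "e0 \<in> S"
  shows "norm (h e0) \<le> M"
proof -
  define E where "E e = exp (3 / 2 * (e - \<i> * of_real c))" for e :: complex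
  define k where "k = cos (3 * pi / 8)"
  have k: "k > 0" unfolding k_def by (rule cos_gt_zero_pi) auto
  have ReE: "Re (E e) \<ge> exp (3 / 2 * Re e) * k" if "e \<in> S" for e
  proof -
    have i: "\<bar>Im e - c\<bar> \<le> pi / 4" using that by (simp add: S_def)
    have "cos (3 * pi / 8) \<le> cos (3 / 2 * \<bar>Im e - c\<bar>)"
      using i pi_gt_zero by (intro cos_monotone_0_pi_le) (linarith | simp)+
    also have "\<dots> = cos (3 / 2 * (Im e - c))"
      by (metis abs_mult abs_of_nonneg cos_abs_real divide_nonneg_nonneg zero_le_numeral)
    finally have "k \<le> cos (3 / 2 * (Im e - c))" by (simp add: k_def)
    then show ?thesis by (simp add: E_def Re_exp)
  qed
  have ReE0: "Re (E e) \<ge> 0" if "e \<in> S" for e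
    using order_trans[OF _ ReE[OF that]] k by simp
  have main: "norm (h e0 * exp (- of_real d * E e0)) \<le> M" if "d > 0" for d :: real
  proof -
    \<comment> \<open>Beyond \<open>e0\<close>, and so far to the right that on the edge
      \<open>Re e = L\<close> the damping outweighs both the growth of \<open>h\<close> and
      \<open>ln M\<close>.\<close>
    define L where "L = max (Re e0 + 1) (max 0 (2 * ln ((K + \<bar>ln M\<bar> + 1) / (d * k))))"
    have L: "L > Re e0" "L \<ge> 0" "L / 2 \<ge> ln ((K + \<bar>ln M\<bar> + 1) / (d * k))" by (auto simp: L_def)
    have "exp (L / 2) \<ge> (K + \<bar>ln M\<bar> + 1) / (d * k)"
    proof -
      have "0 < (K + \<bar>ln M\<bar> + 1) / (d * k)" using that k \<open>0 \<le> K\<close> by (simp add: add_nonneg_pos)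
      then show ?thesis using L(3) by (metis exp_le_cancel_iff exp_ln)
    qed
    then have "d * k * exp (L / 2) \<ge> K + \<bar>ln M\<bar> + 1"
      using that k by (simp add: divide_le_eq mult.commute)
    then have "exp L * (d * k * exp (L / 2)) \<ge> exp L * (K + \<bar>ln M\<bar> + 1)" by simp
    moreover have "exp L * exp (L / 2) = exp (3 / 2 * L)" by (simp flip: exp_add)
    moreover have "exp L * (\<bar>ln M\<bar> + 1) \<ge> 1 * (\<bar>ln M\<bar> + 1)" using L(2) by (intro mult_right_mono) auto
    ultimately have far: "K * exp L - d * (exp (3 / 2 * L) * k) \<le> ln M"
      by (simp add: algebra_simps)
    define B where "B = cbox (Complex R (c - pi / 4)) (Complex L (c + pi / 4))"
    have BS: "B \<subseteq> S" unfolding B_def S_def in_cbox_complex_iff[abs_def] abs_le_iff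
      by (auto simp: in_cbox_complex_iff)
    let ?g = "\<lambda>e. h e * exp (- of_real d * E e)"
    have gU: "?g holomorphic_on U" unfolding E_def by (intro holomorphic_intros hol)
    have le: "norm (?g e) \<le> norm (h e)" if "e \<in> S" for e
      using ReE0[OF that] \<open>d > 0\<close> by (simp add: norm_mult mult_left_le)
    show ?thesis
    proof (rule maximum_modulus_frontier[of ?g B])
      show "?g holomorphic_on interior B"
        using gU by (rule holomorphic_on_subset) (use BS hol(3) interior_subset in blast)
      show "continuous_on (closure B) ?g"
        unfolding B_def using gU BS hol(3) B_def by (intro holomorphic_on_imp_continuous_on) (auto intro: holomorphic_on_subset)
      show "bounded B" by (simp add: B_def)
      show "e0 \<in> B" using e0 L(1) unfolding S_def abs_le_iff by (auto simp: B_def in_cbox_complex_iff)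
      fix e assume "e \<in> frontier B"
      then have e: "e \<in> B" "\<not> (R < Re e \<and> Re e < L \<and> c - pi / 4 < Im e \<and> Im e < c + pi / 4)"
        by (auto simp: B_def frontier_cbox in_box_complex_iff)
      then have eS: "e \<in> S" using BS by auto
      show "norm (?g e) \<le> M"
      proof (cases "Re e = L")
        case True
        have "norm (?g e) = norm (h e) * exp (- d * Re (E e))" by (simp add: norm_mult)
        also have "\<dots> \<le> exp (K * exp L) * exp (- d * (exp (3 / 2 * L) * k))"
          using growth[OF eS] ReE[OF eS] True \<open>d > 0\<close> by (intro mult_mono) auto
        also have "\<dots> = exp (K * exp L - d * (exp (3 / 2 * L) * k))" by (simp flip: exp_add)
        also have "\<dots> \<le> exp (ln M)" using far by (simp only: exp_le_cancel_iff)
        finally show ?thesis using \<open>0 < M\<close> by simp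
      next
        case False
        then have "\<bar>Im e - c\<bar> = pi / 4 \<or> Re e = R"
          using e by (auto simp: B_def in_cbox_complex_iff)
        then show ?thesis using side[OF eS] le[OF eS] by linarith
      qed
    qed
  qed
  \<comment> \<open>The bound is uniform in \<open>d\<close>; letting \<open>d\<close> tend to 0
    removes the damping.\<close>
  have "((\<lambda>d. norm (h e0 * exp (- of_real d * E e0))) \<longlongrightarrow> norm (h e0 * exp (- of_real 0 * E e0))) (at_right 0)"
    by (intro tendsto_intros)
  moreover have "\<forall>\<^sub>F d in at_right 0. norm (h e0 * exp (- of_real d * E e0)) \<le> M"
    using eventually_at_right_less[of "0::real"] by eventually_elim (rule main)
  ultimately have "norm (h e0 * exp (- of_real 0 * E e0)) \<le> M"
    by (rule tendsto_upperbound) simp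
  then show ?thesis by simp
qed

lemma compact_segment_bound:
  fixes f :: "complex \<Rightarrow> cmat2"
  assumes "continuous_on {e. 0 < Re e} f" "0 < r"
  shows "\<exists>C>0. \<forall>e. Re e = r \<and> a \<le> Im e \<and> Im e \<le> b \<longrightarrow> norm (f e) \<le> C"
proof -
  have "compact (cbox (Complex r a) (Complex r b))" by simp
  then have "bounded (f ` cbox (Complex r a) (Complex r b))"
    using assms by (intro compact_imp_bounded compact_continuous_image) (auto simp: in_cbox_complex_iff intro: continuous_on_subset)
  then obtain C where "C > 0" "\<And>e. e \<in> cbox (Complex r a) (Complex r b) \<Longrightarrow> norm (f e) \<le> C"
    by (auto simp: bounded_pos)
  then show ?thesis by (auto simp: in_cbox_complex_iff)
qed

text \<open>The previous estimate, applied to the entries of \<open>D\<close> times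
  \<open>exp (m * e)\<close>. The case \<open>m = 1\<close> serves the Stokes phenomenon,
  \<open>m = 0\<close> the boundedness of the quotient of two solutions.\<close>

lemma strip_decay:
  fixes D :: "complex \<Rightarrow> cmat2" and c m :: real
  assumes D: "mhol D {e. 0 < Re e}"
    and side: "\<exists>C R. \<forall>e. R < Re e \<and> \<bar>Im e - c\<bar> = pi / 4 \<longrightarrow> norm (D e) \<le> C * exp (- m * Re e)"
    and growth: "\<exists>K. \<forall>e. 1 \<le> Re e \<and> \<bar>Im e - c\<bar> \<le> pi / 4 \<longrightarrow> norm (D e) \<le> exp (K * exp (Re e))"
  shows "\<exists>C R. \<forall>e. R < Re e \<and> \<bar>Im e - c\<bar> \<le> pi / 4 \<longrightarrow> norm (D e) \<le> C * exp (- m * Re e)"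
proof -
  obtain C R where C: "\<And>e. R < Re e \<Longrightarrow> \<bar>Im e - c\<bar> = pi / 4 \<Longrightarrow> norm (D e) \<le> C * exp (- m * Re e)"
    using side by blast
  obtain K where K: "\<And>e. 1 \<le> Re e \<Longrightarrow> \<bar>Im e - c\<bar> \<le> pi / 4 \<Longrightarrow> norm (D e) \<le> exp (K * exp (Re e))"
    using growth by blast
  define R' where "R' = max 1 (R + 1)"
  have R': "1 \<le> R'" "R < R'" by (auto simp: R'_def)
  have cont: "continuous_on {e. 0 < Re e} D" using mhol_continuous_on[OF open_convex_RH(1) D] .
  obtain B where B: "B > 0" "\<And>e. Re e = R' \<Longrightarrow> \<bar>Im e - c\<bar> \<le> pi / 4 \<Longrightarrow> norm (D e) \<le> B"
  proof -
    obtain B where B: "B > 0" "\<And>e. Re e = R' \<Longrightarrow> c - pi / 4 \<le> Im e \<Longrightarrow> Im e \<le> c + pi / 4 \<Longrightarrow> norm (D e) \<le> B"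
      using compact_segment_bound[OF cont, of R' "c - pi / 4" "c + pi / 4"] R' by auto
    show ?thesis by (rule that[OF B(1)], rule B(2)) (unfold abs_le_iff, auto)
  qed
  define M where "M = max C 0 + B * exp (\<bar>m\<bar> * R')"
  have M: "M > 0" using B(1) by (simp add: M_def add_nonneg_pos)
  have Dij: "norm (D e $ i $ j) \<le> M * exp (- m * Re e)" if e: "R' \<le> Re e" "\<bar>Im e - c\<bar> \<le> pi / 4" for e i j
  proof -
    have *: "norm (exp (of_real m * e) * D e $ i $ j) \<le> M"
    proof (rule phragmen_lindelof_strip[of "{e. 0 < Re e}" "\<lambda>e. exp (of_real m * e) * D e $ i $ j" R' c M "\<bar>m\<bar> + \<bar>K\<bar>" e])
      show "(\<lambda>e. exp (of_real m * e) * D e $ i $ j) holomorphic_on {e. 0 < Re e}"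
        using D by (auto simp: mhol_def intro!: holomorphic_intros)
    next
      fix e assume e: "e \<in> {e. R' \<le> Re e \<and> \<bar>Im e - c\<bar> \<le> pi / 4}" "\<bar>Im e - c\<bar> = pi / 4 \<or> Re e = R'"
      have n: "norm (exp (of_real m * e) * D e $ i $ j) \<le> exp (m * Re e) * norm (D e)"
        using norm_cmat2_entry[of "D e" i j] by (simp add: norm_mult)
      from e(2) show "norm (exp (of_real m * e) * D e $ i $ j) \<le> M"
      proof
        assume s: "\<bar>Im e - c\<bar> = pi / 4"
        have "exp (m * Re e) * norm (D e) \<le> exp (m * Re e) * (C * exp (- m * Re e))"
          using C[OF _ s] e(1) R' by (intro mult_left_mono) auto
        also have "\<dots> = C" by (simp add: exp_minus)
        also have "\<dots> \<le> M" using B(1) by (simp add: M_def add_increasing2)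
        finally show ?thesis using n by linarith
      next
        assume s: "Re e = R'"
        have "exp (m * Re e) * norm (D e) \<le> exp (\<bar>m\<bar> * R') * B"
          using B(2)[OF s] e(1) R' s by (intro mult_mono) (auto intro: mult_right_mono)
        also have "\<dots> \<le> M" by (simp add: M_def mult.commute)
        finally show ?thesis using n by linarith
      qed
    next
      fix e assume e: "e \<in> {e. R' \<le> Re e \<and> \<bar>Im e - c\<bar> \<le> pi / 4}"
      then have r: "1 \<le> Re e" using R' by auto
      have "norm (exp (of_real m * e) * D e $ i $ j) \<le> exp (m * Re e) * norm (D e)"
        using norm_cmat2_entry[of "D e" i j] by (simp add: norm_mult)
      also have "\<dots> \<le> exp (\<bar>m\<bar> * exp (Re e)) * exp (\<bar>K\<bar> * exp (Re e))"
      proof (rule mult_mono)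
        have "m * Re e \<le> \<bar>m\<bar> * exp (Re e)"
          using r order_trans[OF _ exp_ge_add_one_self[of "Re e"], of "Re e"] by (intro mult_mono) auto
        then show "exp (m * Re e) \<le> exp (\<bar>m\<bar> * exp (Re e))" by simp
        show "norm (D e) \<le> exp (\<bar>K\<bar> * exp (Re e))"
          using K[OF r] e by (rule_tac order_trans) (auto intro: mult_right_mono)
      qed auto
      also have "\<dots> = exp ((\<bar>m\<bar> + \<bar>K\<bar>) * exp (Re e))" by (simp add: distrib_right exp_add)
      finally show "norm (exp (of_real m * e) * D e $ i $ j) \<le> exp ((\<bar>m\<bar> + \<bar>K\<bar>) * exp (Re e))" .
    qed (use e R' M open_convex_RH in auto)
    have "exp (m * Re e) * norm (D e $ i $ j) \<le> M" using * by (simp add: norm_mult)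
    then have "exp (- m * Re e) * (exp (m * Re e) * norm (D e $ i $ j)) \<le> exp (- m * Re e) * M"
      by (intro mult_left_mono) auto
    moreover have "exp (- m * Re e) * (exp (m * Re e) * norm (D e $ i $ j)) = norm (D e $ i $ j)"
      by (simp flip: exp_add mult.assoc)
    ultimately show ?thesis by (simp only: mult.commute)
  qed
  show ?thesis
  proof (rule exI[of _ "4 * M"], rule exI[of _ R'], intro allI impI)
    fix e assume "R' < Re e \<and> \<bar>Im e - c\<bar> \<le> pi / 4"
    then show "norm (D e) \<le> 4 * M * exp (- m * Re e)"
      using norm_cmat2_le_sum[of "D e"] Dij[of e 1 1] Dij[of e 1 2] Dij[of e 2 1] Dij[of e 2 2] by simp
  qed
qed

lemma norm_mat_1_le: "norm (mat 1 :: cmat2) \<le> 2"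
  using norm_cmat2_le_sum[of "mat 1"] by simp

lemma norm_eta_coeff_le:
  assumes "2 \<le> norm \<eta>"
  shows "norm (eta_coeff x P Q \<eta>) \<le> norm x * norm sigma3 + norm P + norm Q"
proof -
  have 1: "norm (1 / (\<eta> + 1)) \<le> 1" "norm (1 / (\<eta> - 1)) \<le> 1"
    using assms norm_triangle_ineq2[of \<eta> 1] norm_triangle_ineq2[of \<eta> "-1"]
    by (simp_all add: norm_divide divide_le_eq_1)
  have "norm (eta_coeff x P Q \<eta>) \<le> norm ((x / 4) *m sigma3) + norm ((1 / (\<eta> + 1)) *m P) + norm ((1 / (\<eta> - 1)) *m Q)"
    unfolding eta_coeff_def by (rule norm_triangle_le, rule add_right_mono, rule norm_triangle_ineq)
  also have "\<dots> \<le> norm x * norm sigma3 + 1 * norm P + 1 * norm Q"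
    unfolding norm_cscale using 1 by (intro add_mono mult_right_mono) (auto simp: norm_divide)
  finally show ?thesis by simp
qed

text \<open>With \<open>\<rho> = norm \<eta>\<close> as parameter on a ray the coefficient is
  bounded for \<open>\<rho> \<ge> 2\<close>, and Gronwall's inequality yields growth at most
  exponential in \<open>\<rho> = exp (Re e)\<close>. The ray starts at \<open>exp 1\<close>, which
  exceeds 2.\<close>

lemma solution_growth:
  assumes "msol (\<lambda>e. exp e *m eta_coeff x P Q (exp e)) {e. 0 < Re e} X"
  shows "\<exists>K. \<forall>e. 1 \<le> Re e \<and> a \<le> Im e \<and> Im e \<le> b \<longrightarrow> norm (X e) \<le> exp (K * exp (Re e))"
proof -
  have cont: "continuous_on {e. 0 < Re e} X"
    using mhol_continuous_on[OF open_convex_RH(1) msol_mhol[OF open_convex_RH(1) assms]] .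
  obtain C where C: "C > 0" "\<And>e. Re e = 1 \<Longrightarrow> a \<le> Im e \<Longrightarrow> Im e \<le> b \<Longrightarrow> norm (X e) \<le> C"
    using compact_segment_bound[OF cont, of 1 a b] by auto
  define L where "L = norm x * norm sigma3 + norm P + norm Q"
  have "norm (X e) \<le> exp ((C + L) * exp (Re e))" if e: "1 \<le> Re e" "a \<le> Im e" "Im e \<le> b" for e
  proof -
    let ?g = "\<lambda>\<rho>. Complex (ln \<rho>) (Im e)"
    have eg: "exp (?g \<rho>) = of_real \<rho> * cis (Im e)" if "\<rho> > 0" for \<rho>
      using that by (simp add: exp_eq_polar)
    have e1: "exp (1::real) \<ge> 2" using exp_ge_add_one_self[of 1] by simp
    have "norm (X (?g (exp (Re e)))) \<le> norm (X (?g (exp 1))) * exp (L * (exp (Re e) - exp 1))"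
    proof (rule gronwall)
      fix \<rho> assume r: "\<rho> \<in> {exp 1..exp (Re e)}"
      have r0: "\<rho> \<ge> 2" using r e1 by auto
      have gd: "(?g has_vector_derivative Complex (1 / \<rho>) 0) (at \<rho> within {exp 1..exp (Re e)})"
      proof -
        have "?g = (\<lambda>\<rho>. of_real (ln \<rho>) + \<i> * of_real (Im e))" by (auto simp: complex_eq_iff)
        moreover have "((\<lambda>\<rho>. of_real (ln \<rho>) + \<i> * of_real (Im e)) has_vector_derivative of_real (1 / \<rho>) + 0) (at \<rho> within {exp 1..exp (Re e)})"
          using r0 by (intro has_vector_derivative_add has_vector_derivative_const has_vector_derivative_of_real)
            (auto intro!: derivative_eq_intros)
        ultimately show ?thesis by (simp add: complex_of_real_def)
      qed
      have "0 < Re (?g \<rho>)" using r0 by simp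
      with assms have "has_mderiv X (exp (?g \<rho>) *m eta_coeff x P Q (exp (?g \<rho>)) ** X (?g \<rho>)) (?g \<rho>)" 
        by (simp only: msol_def mem_Collect_eq)
      from has_mderiv_curve[OF this gd]
      show "((\<lambda>\<rho>. X (?g \<rho>)) has_vector_derivative Complex (1 / \<rho>) 0 *m (exp (?g \<rho>) *m eta_coeff x P Q (exp (?g \<rho>)) ** X (?g \<rho>)))
        (at \<rho> within {exp 1..exp (Re e)})" .
      have "norm (Complex (1 / \<rho>) 0 *m (exp (?g \<rho>) *m eta_coeff x P Q (exp (?g \<rho>)) ** X (?g \<rho>)))
          = norm (eta_coeff x P Q (exp (?g \<rho>)) ** X (?g \<rho>))"
        using r0 by (simp add: cscale_mult eg norm_mult cmod_def)
      also have "\<dots> \<le> L * norm (X (?g \<rho>))"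
        by (rule order_trans[OF norm_cmat2_mult], rule mult_right_mono, unfold L_def, rule norm_eta_coeff_le)
           (use r0 in \<open>auto simp: eg norm_mult\<close>)
      finally show "norm (Complex (1 / \<rho>) 0 *m (exp (?g \<rho>) *m eta_coeff x P Q (exp (?g \<rho>)) ** X (?g \<rho>))) \<le> L * norm (X (?g \<rho>))" .
    qed (use e in auto)
    also have "\<dots> \<le> C * exp (L * exp (Re e))"
    proof (rule mult_mono)
      have "L \<ge> 0" by (simp add: L_def)
      then show "exp (L * (exp (Re e) - exp 1)) \<le> exp (L * exp (Re e))" by (simp add: mult_left_mono)
    qed (use C(1) C(2)[of "?g (exp 1)"] e in auto)
    also have "\<dots> \<le> exp (C * exp (Re e)) * exp (L * exp (Re e))"
    proof (rule mult_right_mono)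
      have "C * 1 \<le> C * exp (Re e)" using C(1) e by (intro mult_left_mono) auto
      then show "C \<le> exp (C * exp (Re e))" using exp_ge_add_one_self[of "C * exp (Re e)"] by linarith
    qed auto
    also have "\<dots> = exp ((C + L) * exp (Re e))" by (simp add: distrib_right exp_add)
    finally show ?thesis by (simp add: Complex_eq[symmetric])
  qed
  then show ?thesis by blast
qed

lemma canon_exponent_bound:
  "\<exists>K\<ge>0. \<forall>e. 1 \<le> Re e \<and> a \<le> Im e \<and> Im e \<le> b \<longrightarrow> norm (canon_exponent th w e) \<le> K * exp (Re e)"
proof -
  define B where "B = \<bar>a\<bar> + \<bar>b\<bar> + 1"
  have "norm (canon_exponent th w e) \<le> (norm (exp w) + norm th * (1 + B)) * exp (Re e)"
    if e: "1 \<le> Re e" "a \<le> Im e" "Im e \<le> b" for e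
  proof -
    have E: "1 \<le> exp (Re e)" "Re e \<le> exp (Re e)"
      using e exp_ge_add_one_self[of "Re e"] by linarith+
    have "norm (exp e + 1) \<le> exp (Re e) + 1" using norm_triangle_ineq[of "exp e" 1] by simp
    then have 1: "norm (exp w * (exp e + 1) / 4) \<le> norm (exp w) * exp (Re e)"
      using mult_left_mono[of "norm (exp e + 1)" "4 * exp (Re e)" "norm (exp w)"] E(1) by (simp add: norm_mult norm_divide del: one_le_exp_iff)
    have "ln (2::real) \<le> 1" using ln_2_less_1 by simp
    have "\<bar>Im e\<bar> \<le> \<bar>a\<bar> + \<bar>b\<bar>" using e by auto
    then have "norm (e - of_real (ln 2)) \<le> Re e + B"
      using norm_triangle_ineq4[of e "of_real (ln 2)"] cmod_le[of e] e \<open>ln 2 \<le> 1\<close> by (simp add: B_def)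
    also have "\<dots> \<le> exp (Re e) + B * exp (Re e)"
      using E mult_left_mono[OF E(1), of B] by (intro add_mono) (auto simp: B_def)
    finally have "norm th * norm (e - of_real (ln 2)) \<le> norm th * (exp (Re e) + B * exp (Re e))"
      by (intro mult_left_mono) auto
    then have 2: "norm (th / 2 * (e - of_real (ln 2))) \<le> norm th * (1 + B) * exp (Re e)"
      using mult_nonneg_nonneg[of "norm th" "norm (e - of_real (ln 2))"]
      unfolding norm_mult norm_divide by (simp add: ring_distribs mult.assoc del: mult_nonneg_nonneg)
    show ?thesis
      unfolding canon_exponent_def using norm_triangle_ineq4[of "exp w * (exp e + 1) / 4" "th / 2 * (e - of_real (ln 2))"] 1 2
      by (simp add: algebra_simps)
  qed
  moreover have "norm (exp w) + norm th * (1 + B) \<ge> 0" by (simp add: B_def)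
  ultimately show ?thesis by blast
qed

lemma norm_exp_sigma3_le: "norm (exp_sigma3 a) \<le> exp (norm a + 1)"
proof -
  have "norm (exp_sigma3 a) \<le> exp (Re a) + exp (- Re a)"
    using norm_cmat2_le_sum[of "exp_sigma3 a"] by (simp add: exp_sigma3_def)
  also have "\<dots> \<le> exp (norm a) + exp (norm a)"
    using complex_Re_le_cmod[of a] complex_Re_le_cmod[of "-a"] by (intro add_mono) auto
  also have "\<dots> = 2 * exp (norm a)" by simp
  also have "\<dots> \<le> exp 1 * exp (norm a)" using exp_ge_add_one_self[of 1] by (intro mult_right_mono) auto
  finally show ?thesis by (simp add: exp_add mult.commute)
qed

text \<open>The factor decays doubly exponentially in \<open>Re e\<close>; only the bound
  \<open>exp (- Re e)\<close>, the order of the error of a canonical solution, is kept. The sign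
  \<open>s\<close> distinguishes the upper from the lower triangular entry.\<close>

lemma exp_canon_exponent_decay:
  assumes "0 < \<kappa>" "0 \<le> B" "\<bar>s\<bar> = 1"
  shows "\<exists>C\<ge>0. \<forall>e. 0 < Re e \<and> \<bar>Im e\<bar> \<le> B \<and> s * cos (Im (e + w)) \<le> - \<kappa> \<longrightarrow>
     norm (exp (of_real s * (2 * canon_exponent th w e))) \<le> C * exp (- Re e)"
proof -
  define x where "x = exp (Re w)"
  define a where "a = norm th + 1"
  define b where "b = \<kappa> * x / 2"
  have b: "b > 0" using assms by (simp add: b_def x_def)
  have "norm (exp (of_real s * (2 * canon_exponent th w e))) \<le> exp (x / 2 + norm th * (B + 1) + a\<^sup>2 / (2 * b)) * exp (- Re e)"
    if e: "0 < Re e" "\<bar>Im e\<bar> \<le> B" "s * cos (Im (e + w)) \<le> - \<kappa>" for e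
  proof -
    have R1: "Re (exp w * exp e) = x * exp (Re e) * cos (Im (e + w))"
      unfolding x_def exp_add[symmetric] Re_exp by (simp add: add.commute mult_exp_exp)
    have "s * Re (exp w * exp e) = x * exp (Re e) * (s * cos (Im (e + w)))" using R1 by simp
    also have "\<dots> \<le> x * exp (Re e) * (- \<kappa>)" using e by (intro mult_left_mono) (auto simp: x_def)
    finally have 1: "s * Re (exp w * exp e) \<le> - \<kappa> * x * exp (Re e)" by (simp add: mult_ac)
    have sle: "s * r \<le> \<bar>r\<bar>" for r using abs_ge_self[of "s * r"] assms(3) by (simp add: abs_mult)
    have "\<bar>Re (exp w)\<bar> \<le> x" using abs_Re_le_cmod[of "exp w"] by (simp add: x_def)
    then have 2: "s * Re (exp w) \<le> x" using sle[of "Re (exp w)"] by linarith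
    have "\<bar>Re (th * (e - of_real (ln 2)))\<bar> \<le> norm th * norm (e - of_real (ln 2))"
      using abs_Re_le_cmod[of "th * (e - of_real (ln 2))"] by (simp add: norm_mult)
    also have "norm (e - of_real (ln 2)) \<le> Re e + B + 1"
      using norm_triangle_ineq4[of e "of_real (ln 2)"] cmod_le[of e] e ln_2_less_1 by simp
    finally have "\<bar>Re (th * (e - of_real (ln 2)))\<bar> \<le> norm th * (Re e + B + 1)"
      by (simp add: mult_left_mono)
    then have 3: "- (s * Re (th * (e - of_real (ln 2)))) \<le> norm th * (Re e + B + 1)"
      using sle[of "- Re (th * (e - of_real (ln 2)))"] by (simp only: mult_minus_right abs_minus_cancel)
    have "exp (Re e) \<ge> (Re e)\<^sup>2 / 2" using exp_lower_Taylor_quadratic[of "Re e"] e by simp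
    then have "b * exp (Re e) \<ge> b * ((Re e)\<^sup>2 / 2)" using b by simp
    \<comment> \<open>Completing the square, against the quadratic lower bound of the exponential
      function.\<close>
    moreover have "a * Re e \<le> b * ((Re e)\<^sup>2 / 2) + a\<^sup>2 / (2 * b)"
    proof -
      have "0 \<le> (b * Re e - a)\<^sup>2 / (2 * b)" using b by simp
      also have "\<dots> = b * ((Re e)\<^sup>2 / 2) + a\<^sup>2 / (2 * b) - a * Re e"
        using b by (simp add: power2_eq_square field_simps)
      finally show ?thesis by simp
    qed
    ultimately have 4: "a * Re e - b * exp (Re e) \<le> a\<^sup>2 / (2 * b)" by linarith
    have "2 * canon_exponent th w e = (exp w * exp e + exp w) / 2 - th * (e - of_real (ln 2))"
      by (simp add: canon_exponent_def field_simps)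
    then have "s * Re (2 * canon_exponent th w e) =
        (s * Re (exp w * exp e) + s * Re (exp w)) / 2 - s * Re (th * (e - of_real (ln 2)))"
      by (simp only: minus_complex.sel plus_complex.sel Re_divide_numeral right_diff_distrib distrib_left
          times_divide_eq_right)
    also have "\<dots> \<le> x / 2 + norm th * (B + 1) + a\<^sup>2 / (2 * b) - Re e"
    proof -
      have "a * Re e - b * exp (Re e) = norm th * Re e + Re e - \<kappa> * x * exp (Re e) / 2"
        by (simp add: a_def b_def algebra_simps)
      moreover have "norm th * (Re e + B + 1) = norm th * Re e + norm th * (B + 1)" by (simp add: algebra_simps)
      ultimately show ?thesis using 1 2 3 4 by argo
    qed
    finally show ?thesis by (simp flip: exp_add)
  qed
  then show ?thesis by (intro exI[of _ "exp (x / 2 + norm th * (B + 1) + a\<^sup>2 / (2 * b))"]) auto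
qed


section \<open>Stokes matrices\<close>

text \<open>The error of \<open>X ** U\<close> splits into that of \<open>X\<close> and that of
  \<open>U\<close> conjugated by \<open>exp_sigma3 T\<close>; the latter is small where the
  conjugated off-diagonal entry decays.\<close>

lemma canon_mult_eq:
  "X ** U ** exp_sigma3 (- T) - mat 1
     = (X ** exp_sigma3 (- T) - mat 1) + (X ** exp_sigma3 (- T)) ** (exp_sigma3 T ** U ** exp_sigma3 (- T) - mat 1)"
proof -
  have "(X ** exp_sigma3 (- T)) ** (exp_sigma3 T ** U ** exp_sigma3 (- T)) = X ** U ** exp_sigma3 (- T)"
    by (simp add: matrix_mul_assoc[symmetric] exp_sigma3_cancel)
  then show ?thesis by (simp add: cmat2_mult_algebra)
qed

lemma conj_exp_sigma3_upper:
  "norm (exp_sigma3 T ** mat2 1 s 0 1 ** exp_sigma3 (- T) - mat 1) \<le> norm s * norm (exp (2 * T))"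
proof -
  have "exp T * exp (- (- T)) = exp (2 * T)" by (simp flip: exp_add)
  then have "exp_sigma3 T ** mat2 1 s 0 1 ** exp_sigma3 (- T) - mat 1 = mat2 0 (s * exp (2 * T)) 0 0"
    unfolding exp_sigma3_def mat2_mult by (simp add: cmat2_eq_iff mult.assoc mult.left_commute flip: exp_add)
  then show ?thesis using norm_cmat2_le_sum[of "mat2 0 (s * exp (2 * T)) 0 0"] by (simp add: norm_mult)
qed

lemma conj_exp_sigma3_lower:
  "norm (exp_sigma3 T ** mat2 1 0 s 1 ** exp_sigma3 (- T) - mat 1) \<le> norm s * norm (exp (- (2 * T)))"
proof -
  have "exp_sigma3 T ** mat2 1 0 s 1 ** exp_sigma3 (- T) - mat 1 = mat2 0 0 (s * exp (- (2 * T))) 0"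
    unfolding exp_sigma3_def mat2_mult by (simp add: cmat2_eq_iff mult.assoc mult.left_commute flip: exp_add)
  then show ?thesis using norm_cmat2_le_sum[of "mat2 0 0 (s * exp (- (2 * T))) 0"] by (simp add: norm_mult)
qed

lemma canon_perturb:
  fixes D W :: cmat2
  assumes "norm D \<le> C * r" "norm W \<le> a * (C' * r)" "0 \<le> r" "r \<le> 1" "0 \<le> C'" "0 \<le> a"
  shows "norm (D + (D + mat 1) ** W) \<le> (\<bar>C\<bar> + (\<bar>C\<bar> + 2) * (a * C')) * r"
proof -
  have D: "norm D \<le> \<bar>C\<bar> * r" using assms by (meson abs_ge_self mult_right_mono order_trans)
  have "\<bar>C\<bar> * r \<le> \<bar>C\<bar> * 1" using assms by (intro mult_left_mono) auto
  then have "norm (D + mat 1) \<le> \<bar>C\<bar> + 2" using D norm_triangle_ineq[of D "mat 1"] norm_mat_1_le by simp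
  then have "norm ((D + mat 1) ** W) \<le> (\<bar>C\<bar> + 2) * (a * (C' * r))"
    using assms by (intro order_trans[OF norm_cmat2_mult mult_mono]) auto
  then show ?thesis using D norm_triangle_ineq[of D "(D + mat 1) ** W"] by (simp add: algebra_simps)
qed

text \<open>Conjugated by \<open>exp (T \<sigma>\<^sub>3)\<close>, the upper triangular factor tends to \<open>1\<close> exponentially in one half of the new sector
  and the lower triangular one in the other half; the strip between them is filled by the Phragmen-Lindeloef
  principle.\<close>

lemma stokes_step:
  assumes X: "canon th w P Q k X" and X': "canon th w P Q (k + 2) X'" and "even k"
    and UV: "\<And>e. 0 < Re e \<Longrightarrow> X e ** mat2 1 s 0 1 = X' e ** mat2 1 0 s' 1"
  shows "canon th w P Q (k + 1) (\<lambda>e. X e ** mat2 1 s 0 1)"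
proof -
  let ?U = "mat2 1 s 0 1" and ?V = "mat2 1 0 s' 1"
  let ?T = "canon_exponent th w"
  define D where "D e = X e ** ?U ** exp_sigma3 (- ?T e) - mat 1" for e
  \<comment> \<open>The argument of lambda measured from the middle of the sector of
    \<open>X\<close>; in these terms the new sector is \<open>0 < t < 2 * pi\<close>, with middle
    \<open>pi\<close>.\<close>
  define t where "t e = Im (e + w) - pi / 2 - (of_int k - 2) * pi" for e
  define F where "F e = X e ** exp_sigma3 (- ?T e) - mat 1" for e
  define F' where "F' e = X' e ** exp_sigma3 (- ?T e) - mat 1" for e
  have sol: "msol (\<lambda>e. exp e *m eta_coeff (exp w) P Q (exp e)) {e. 0 < Re e} (\<lambda>e. X e ** ?U)"
    using X by (simp add: canon_def msol_mult_const)
  \<comment> \<open>As \<open>k\<close> is even, \<open>(k - 2) * pi\<close> is a period. So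
    \<open>exp (2 * ?T e)\<close> decays for \<open>0 < t < pi\<close> and its inverse for
    \<open>pi < t < 2 * pi\<close>.\<close>
  have cost: "cos (Im (e + w)) = - sin (t e)" for e
  proof -
    obtain j where k: "k = 2 * j" using \<open>even k\<close> by blast
    have "Im (e + w) = pi / 2 + t e + 2 * pi * of_int (j - 1)" by (simp add: t_def k algebra_simps)
    moreover have "cos (pi / 2 + t e + 2 * pi * of_int (j - 1)) = cos (pi / 2 + t e)"
      unfolding cos_add[of "pi / 2 + t e"] cos_int_2pin sin_int_2pin by simp
    ultimately have "cos (Im (e + w)) = cos (pi / 2 + t e)" by (simp only:)
    then show ?thesis by (simp add: cos_add)
  qed
  have Im_bound: "\<bar>Im e\<bar> \<le> \<bar>Im w\<bar> + \<bar>of_int k - 2\<bar> * pi + 3 * pi" if "0 \<le> t e" "t e \<le> 2 * pi" for e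
  proof -
    have "Im e = t e - Im w + pi / 2 + (of_int k - 2) * pi" by (simp add: t_def)
    moreover have "\<bar>(of_int k - 2) * pi\<bar> = \<bar>of_int k - 2\<bar> * pi" by (simp add: abs_mult)
    ultimately show ?thesis using that pi_gt_zero by linarith
  qed
  have main: "\<exists>C R. \<forall>e. R < Re e \<and> \<delta> \<le> t e \<and> t e \<le> 2 * pi - \<delta> \<longrightarrow> norm (D e) \<le> C * exp (- Re e)"
    if \<delta>: "0 < \<delta>" "\<delta> \<le> pi / 4" for \<delta>
  proof -
    have sind: "sin \<delta> > 0" using \<delta> by (intro sin_gt_zero) auto
    have sinb: "sin \<delta> \<le> sin y" if "\<delta> \<le> y" "y \<le> 3 * pi / 4" for y
    proof (cases "y \<le> pi / 2")
      case True
      then show ?thesis using that \<delta> by (intro sin_monotone_2pi_le) auto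
    next
      case False
      then have "sin \<delta> \<le> sin (pi - y)" using that \<delta> by (intro sin_monotone_2pi_le) auto
      then show ?thesis by simp
    qed
    \<comment> \<open>The margin \<open>pi / 4\<close> inside the sectors of \<open>X\<close> and
      \<open>X'\<close> leaves uncovered a strip of half width \<open>pi / 4\<close> about
      \<open>t = pi\<close>, just what \<open>strip_decay\<close> admits.\<close>
    obtain C1 R1 where F: "\<And>e. R1 < Re e \<Longrightarrow> \<bar>t e\<bar> \<le> pi - pi / 4 \<Longrightarrow> norm (F e) \<le> C1 * exp (- Re e)"
      using X pi_gt_zero unfolding canon_def F_def t_def by (meson divide_pos_pos zero_less_numeral)
    have t': "Im (e + w) - pi / 2 - (of_int (k + 2) - 2) * pi = t e - 2 * pi" for e
      by (simp add: t_def algebra_simps)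
    obtain C2 R2 where F': "\<And>e. R2 < Re e \<Longrightarrow> \<bar>t e - 2 * pi\<bar> \<le> pi - pi / 4 \<Longrightarrow> norm (F' e) \<le> C2 * exp (- Re e)"
      using X' pi_gt_zero unfolding canon_def F'_def t' by (meson divide_pos_pos zero_less_numeral)
    define B where "B = \<bar>Im w\<bar> + \<bar>of_int k - 2\<bar> * pi + 3 * pi"
    have B: "0 \<le> B" by (simp add: B_def)
    obtain C3 where C3: "C3 \<ge> 0" "\<And>e. 0 < Re e \<Longrightarrow> \<bar>Im e\<bar> \<le> B \<Longrightarrow> 1 * cos (Im (e + w)) \<le> - sin \<delta> \<Longrightarrow>
       norm (exp (of_real 1 * (2 * ?T e))) \<le> C3 * exp (- Re e)"
      using exp_canon_exponent_decay[OF sind B, of 1 w th] by auto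
    obtain C4 where C4: "C4 \<ge> 0" "\<And>e. 0 < Re e \<Longrightarrow> \<bar>Im e\<bar> \<le> B \<Longrightarrow> -1 * cos (Im (e + w)) \<le> - sin \<delta> \<Longrightarrow>
       norm (exp (of_real (-1) * (2 * ?T e))) \<le> C4 * exp (- Re e)"
      using exp_canon_exponent_decay[OF sind B, of "-1" w th] by auto
    define K1 where "K1 = \<bar>C1\<bar> + (\<bar>C1\<bar> + 2) * (norm s * C3)"
    define K2 where "K2 = \<bar>C2\<bar> + (\<bar>C2\<bar> + 2) * (norm s' * C4)"
    have reg1: "norm (D e) \<le> K1 * exp (- Re e)" if e: "max R1 0 < Re e" "\<delta> \<le> t e" "t e \<le> 3 * pi / 4" for e
    proof -
      have c3: "1 * cos (Im (e + w)) \<le> - sin \<delta>" using sinb[of "t e"] e unfolding cost by simp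
      have "norm (exp_sigma3 (?T e) ** ?U ** exp_sigma3 (- ?T e) - mat 1) \<le> norm s * norm (exp (2 * ?T e))"
        by (rule conj_exp_sigma3_upper)
      also have "\<dots> \<le> norm s * (C3 * exp (- Re e))"
        using C3(2)[OF _ _ c3] e Im_bound[of e] \<delta> by (intro mult_left_mono) (auto simp: B_def)
      finally show ?thesis
        using canon_perturb[of "F e" C1 "exp (- Re e)" _ "norm s" C3] F[of e] e C3(1) \<delta>
        unfolding D_def K1_def canon_mult_eq[of "X e"] by (simp add: F_def)
    qed
    have reg2: "norm (D e) \<le> K2 * exp (- Re e)" if e: "max R2 0 < Re e" "5 * pi / 4 \<le> t e" "t e \<le> 2 * pi - \<delta>" for e
    proof -
      have "sin \<delta> \<le> sin (2 * pi - t e)" using e by (intro sinb) auto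
      then have "sin \<delta> \<le> - sin (t e)" by (simp add: sin_diff)
      then have c4: "-1 * cos (Im (e + w)) \<le> - sin \<delta>" unfolding cost by simp
      have "norm (exp_sigma3 (?T e) ** ?V ** exp_sigma3 (- ?T e) - mat 1) \<le> norm s' * norm (exp (- (2 * ?T e)))"
        by (rule conj_exp_sigma3_lower)
      also have "\<dots> \<le> norm s' * (C4 * exp (- Re e))"
        using C4(2)[OF _ _ c4] e Im_bound[of e] \<delta> by (intro mult_left_mono) (auto simp: B_def)
      finally show ?thesis
        using canon_perturb[of "F' e" C2 "exp (- Re e)" _ "norm s'" C4] F'[of e] e C4(1) \<delta>
        unfolding D_def K2_def UV[of e, OF order.strict_trans1[OF max.cobounded2 e(1)]] canon_mult_eq[of "X' e"]
        by (simp add: F'_def)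
    qed
    define c where "c = pi - Im w + pi / 2 + (of_int k - 2) * pi"
    have tc: "Im e - c = t e - pi" for e by (simp add: c_def t_def)
    have "\<exists>C R. \<forall>e. R < Re e \<and> \<bar>Im e - c\<bar> \<le> pi / 4 \<longrightarrow> norm (D e) \<le> C * exp (- 1 * Re e)"
    proof (rule strip_decay)
      have "(\<lambda>e. exp_sigma3 (- ?T e) $ i $ j) holomorphic_on {e. 0 < Re e}" for i j
        using exhaust_2[of i] exhaust_2[of j] unfolding exp_sigma3_def canon_exponent_def
        by (auto intro!: holomorphic_intros)
      then have "mhol (\<lambda>e. exp_sigma3 (- ?T e)) {e. 0 < Re e}" by (simp add: mhol_def)
      then show "mhol D {e. 0 < Re e}"
        unfolding D_def by (intro mhol_intros(3) mhol_intros(4)[OF msol_mhol[OF open_convex_RH(1) sol]] mhol_intros(1))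
      show "\<exists>C R. \<forall>e. R < Re e \<and> \<bar>Im e - c\<bar> = pi / 4 \<longrightarrow> norm (D e) \<le> C * exp (- 1 * Re e)"
      proof (rule exI[of _ "max K1 K2"], rule exI[of _ "max (max R1 R2) 0"], intro allI impI)
        fix e assume e: "max (max R1 R2) 0 < Re e \<and> \<bar>Im e - c\<bar> = pi / 4"
        then consider "t e = 3 * pi / 4" | "t e = 5 * pi / 4" unfolding tc by linarith
        then show "norm (D e) \<le> max K1 K2 * exp (- 1 * Re e)"
        proof cases
          case 1
          then show ?thesis using reg1[of e] e \<delta> by (simp add: max_mult_distrib_right) 
        next
          case 2
          then show ?thesis using reg2[of e] e \<delta> by (simp add: max_mult_distrib_right)
        qed
      qed
      obtain G1 where G1: "\<And>e. 1 \<le> Re e \<Longrightarrow> c - pi / 4 \<le> Im e \<Longrightarrow> Im e \<le> c + pi / 4 \<Longrightarrow> norm (X e ** ?U) \<le> exp (G1 * exp (Re e))"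
        using solution_growth[OF sol, of "c - pi / 4" "c + pi / 4"] by blast
      obtain G2 where G2: "G2 \<ge> 0" "\<And>e. 1 \<le> Re e \<Longrightarrow> c - pi / 4 \<le> Im e \<Longrightarrow> Im e \<le> c + pi / 4 \<Longrightarrow> norm (?T e) \<le> G2 * exp (Re e)"
        using canon_exponent_bound[of "c - pi / 4" "c + pi / 4" th w] by blast
      show "\<exists>K. \<forall>e. 1 \<le> Re e \<and> \<bar>Im e - c\<bar> \<le> pi / 4 \<longrightarrow> norm (D e) \<le> exp (K * exp (Re e))"
      proof (intro exI[of _ "\<bar>G1\<bar> + G2 + 3"] allI impI)
        fix e assume "1 \<le> Re e \<and> \<bar>Im e - c\<bar> \<le> pi / 4"
        then have e: "1 \<le> Re e" "c - pi / 4 \<le> Im e" "Im e \<le> c + pi / 4" unfolding abs_le_iff by auto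
        define E where "E = exp (Re e)"
        have E: "E \<ge> 1" using e by (simp add: E_def)
        have "norm (X e ** ?U ** exp_sigma3 (- ?T e)) \<le> exp (G1 * E) * exp (G2 * E + 1)"
        proof (rule order_trans[OF norm_cmat2_mult mult_mono])
          show "norm (X e ** ?U) \<le> exp (G1 * E)" using G1 e by (simp add: E_def)
          show "norm (exp_sigma3 (- ?T e)) \<le> exp (G2 * E + 1)"
            using norm_exp_sigma3_le[of "- ?T e"] G2(2) e unfolding E_def by (rule_tac order_trans) auto
        qed auto
        also have "\<dots> = exp (G1 * E + G2 * E + 1)" by (simp flip: exp_add add: algebra_simps)
        also have "\<dots> \<le> exp (\<bar>G1\<bar> * E + G2 * E + 1)" using E by (simp add: mult_right_mono)
        finally have 1: "norm (X e ** ?U ** exp_sigma3 (- ?T e)) \<le> exp (\<bar>G1\<bar> * E + G2 * E + 1)" .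
        have "norm (D e) \<le> norm (X e ** ?U ** exp_sigma3 (- ?T e)) + norm (mat 1 :: cmat2)"
          unfolding D_def by (rule norm_triangle_ineq4)
        also have "\<dots> \<le> exp (\<bar>G1\<bar> * E + G2 * E + 1) + 2" using 1 norm_mat_1_le by (rule add_mono)
        also have "\<dots> \<le> exp (\<bar>G1\<bar> * E + G2 * E + 1) * 3"
          using E G2(1) by simp
        also have "\<dots> \<le> exp (\<bar>G1\<bar> * E + G2 * E + 1) * exp 2"
          using exp_ge_add_one_self[of 2] by (intro mult_left_mono) auto
        also have "\<dots> = exp (\<bar>G1\<bar> * E + G2 * E + 3)" by (simp flip: exp_add)
        also have "\<dots> \<le> exp ((\<bar>G1\<bar> + G2 + 3) * E)" using E by (simp add: algebra_simps)
        finally show "norm (D e) \<le> exp ((\<bar>G1\<bar> + G2 + 3) * exp (Re e))" by (simp only: E_def)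
      qed
    qed
    then obtain K3 R3 where reg3: "\<And>e. R3 < Re e \<Longrightarrow> \<bar>t e - pi\<bar> \<le> pi / 4 \<Longrightarrow> norm (D e) \<le> K3 * exp (- Re e)"
      unfolding tc by (auto simp: mult_minus1)
    show ?thesis
    proof (rule exI[of _ "max K1 (max K2 K3)"], rule exI[of _ "max (max R1 R2) (max R3 0)"], intro allI impI)
      fix e assume e: "max (max R1 R2) (max R3 0) < Re e \<and> \<delta> \<le> t e \<and> t e \<le> 2 * pi - \<delta>"
      consider "t e \<le> 3 * pi / 4" | "t e \<ge> 5 * pi / 4" | "\<bar>t e - pi\<bar> \<le> pi / 4" unfolding abs_le_iff by linarith
      then show "norm (D e) \<le> max K1 (max K2 K3) * exp (- Re e)"
        using reg1[of e] reg2[of e] reg3[of e] e by cases (simp_all add: max_mult_distrib_right)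
    qed
  qed
  show ?thesis
    unfolding canon_def
  proof (intro conjI allI impI sol)
    fix \<delta> :: real assume "0 < \<delta>"
    obtain C R where CR: "\<And>e. R < Re e \<Longrightarrow> min \<delta> (pi / 4) \<le> t e \<Longrightarrow> t e \<le> 2 * pi - min \<delta> (pi / 4) \<Longrightarrow> norm (D e) \<le> C * exp (- Re e)"
    proof -
      have "0 < min \<delta> (pi / 4)" "min \<delta> (pi / 4) \<le> pi / 4" using \<open>0 < \<delta>\<close> by auto
      from main[OF this] show ?thesis using that by blast
    qed
    show "\<exists>C R. \<forall>e. Re e > R \<and> \<bar>Im (e + w) - pi / 2 - (of_int (k + 1) - 2) * pi\<bar> \<le> pi - \<delta> \<longrightarrow>
       norm (X e ** ?U ** exp_sigma3 (- ?T e) - mat 1) \<le> C * exp (- Re e)"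
    proof (rule exI[of _ C], rule exI[of _ R], intro allI impI)
      fix e assume e: "Re e > R \<and> \<bar>Im (e + w) - pi / 2 - (of_int (k + 1) - 2) * pi\<bar> \<le> pi - \<delta>"
      have "Im (e + w) - pi / 2 - (of_int (k + 1) - 2) * pi = t e - pi" by (simp add: t_def algebra_simps)
      then have "\<bar>t e - pi\<bar> \<le> pi - \<delta>" using e by simp
      then have "min \<delta> (pi / 4) \<le> t e" "t e \<le> 2 * pi - min \<delta> (pi / 4)" unfolding abs_le_iff by linarith+
      then show "norm (X e ** ?U ** exp_sigma3 (- ?T e) - mat 1) \<le> C * exp (- Re e)"
        using CR[of e] e by (simp add: D_def)
    qed
  qed
qed

text \<open>Shifting \<open>e\<close> by \<open>2 * pi * \<i> * j\<close> changes the logarithmic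
  part of the exponent by the constant \<open>pi * \<i> * th * j\<close>, for which the right factor
  compensates.\<close>

lemma canon_shift:
  assumes "canon th w P Q k X"
  shows "canon th w P Q (k + 2 * j) (\<lambda>e. X (e - of_int j * (2 * of_real pi * \<i>)) ** exp_sigma3 (- of_int j * (of_real pi * \<i> * th)))"
    (is "canon _ _ _ _ _ (\<lambda>e. X (e - ?s) ** exp_sigma3 ?c)")
proof -
  let ?A = "\<lambda>e. exp e *m eta_coeff (exp w) P Q (exp e)"
  have ex: "exp (e - ?s) = exp e" for e
    using exp_plus_2pin[of e "-j"] by (simp add: algebra_simps)
  have "msol ?A {e. 0 < Re e} (\<lambda>e. X (e - ?s))"
    unfolding msol_def
  proof
    fix e assume e: "e \<in> {e. 0 < Re e}"
    have d: "((\<lambda>e. e - ?s) has_field_derivative 1) (at e)" by (auto intro!: derivative_eq_intros)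
    have "has_mderiv X (?A (e - ?s) ** X (e - ?s)) (e - ?s)"
      using assms e by (simp add: canon_def msol_def)
    from has_mderiv_compose[OF this d] show "has_mderiv (\<lambda>e. X (e - ?s)) (?A e ** X (e - ?s)) e" by (simp add: ex)
  qed
  moreover have "X (e - ?s) ** exp_sigma3 ?c ** exp_sigma3 (- canon_exponent th w e) = X (e - ?s) ** exp_sigma3 (- canon_exponent th w (e - ?s))" for e
  proof -
    have "?c - canon_exponent th w e = - canon_exponent th w (e - ?s)"
      by (simp add: canon_exponent_def ex) (simp add: algebra_simps)
    then show ?thesis by (simp add: matrix_mul_assoc[symmetric] exp_sigma3_add)
  qed
  moreover have "\<exists>C R. \<forall>e. Re e > R \<and> \<bar>Im (e + w) - pi / 2 - (of_int (k + 2 * j) - 2) * pi\<bar> \<le> pi - \<delta> \<longrightarrow>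
       norm (X (e - ?s) ** exp_sigma3 (- canon_exponent th w (e - ?s)) - mat 1) \<le> C * exp (- Re e)" if d: "\<delta> > 0" for \<delta>
  proof -
    obtain C R where CR: "\<And>e. Re e > R \<Longrightarrow> \<bar>Im (e + w) - pi / 2 - (of_int k - 2) * pi\<bar> \<le> pi - \<delta> \<Longrightarrow>
       norm (X e ** exp_sigma3 (- canon_exponent th w e) - mat 1) \<le> C * exp (- Re e)"
      using assms d unfolding canon_def by meson
    have Im: "Im (e - ?s + w) - pi / 2 - (of_int k - 2) * pi = Im (e + w) - pi / 2 - (of_int (k + 2 * j) - 2) * pi" for e
      by (simp add: algebra_simps)
    show ?thesis
    proof (rule exI[of _ C], rule exI[of _ R], intro allI impI)
      fix e assume e: "Re e > R \<and> \<bar>Im (e + w) - pi / 2 - (of_int (k + 2 * j) - 2) * pi\<bar> \<le> pi - \<delta>"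
      have "Re (e - ?s) > R" "\<bar>Im (e - ?s + w) - pi / 2 - (of_int k - 2) * pi\<bar> \<le> pi - \<delta>"
        using e unfolding Im[of e] by simp_all
      from CR[OF this] show "norm (X (e - ?s) ** exp_sigma3 (- canon_exponent th w (e - ?s)) - mat 1) \<le> C * exp (- Re e)" by simp
    qed
  qed
  ultimately show ?thesis
    unfolding canon_def by (simp add: msol_mult_const)
qed

text \<open>A turn about infinity is a turn about both finite points. Over the lower half plane
  \<open>X e\<close> is \<open>fR\<close>, reached across the axis right of 1, and \<open>X\<close>
  one turn later is \<open>fL\<close>, reached left of -1; there
  \<open>fL = fR ** (snd N ** fst N)\<close>.\<close>

lemma sheets_full_turn:
  assumes X: "canon th w P Q k X" "trace P = 0" "trace Q = 0" and s: "sheets (exp w) P Q X N fL fM fR" and e: "0 < Re e"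
  shows "X (e + 2 * of_real pi * \<i>) = X e ** (snd N ** fst N)"
proof -
  let ?A = "eta_coeff (exp w) P Q" and ?s = "2 * of_real pi * \<i>"
  let ?B = "\<lambda>e. exp e *m ?A (exp e)"
  have sol: "msol ?B {e. 0 < Re e} X" using X(1) by (simp add: canon_def)
  have tr: "trace (?B e) = 0" for e by (simp add: trace_cscale trace_eta_coeff X)
  have det: "\<And>e. 0 < Re e \<Longrightarrow> det (X e) = 1" using canon_det[OF X] .
  note s' = s[unfolded sheets_def]
  have per: "exp (e + ?s) = exp e" for e :: complex by (simp add: exp_add)
  define SR where "SR = {e. 0 < Re e \<and> - pi < Im e \<and> Im e < pi}"
  define SL where "SL = {e. 0 < Re e \<and> 0 < Im e \<and> Im e < 2 * pi}"
  have "SR = {e. 0 < Re e} \<inter> ({e. - pi < Im e} \<inter> {e. Im e < pi})" "SL = {e. 0 < Re e} \<inter> ({e. 0 < Im e} \<inter> {e. Im e < 2 * pi})"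
    by (auto simp: SR_def SL_def)
  then have oc: "open SR" "convex SR" "open SL" "convex SL"
    by (auto intro!: open_Int open_halfspace_Re_gt open_halfspace_Im_lt open_halfspace_Im_gt
        convex_Int convex_halfspace_Re_gt convex_halfspace_Im_lt convex_halfspace_Im_gt)
  have sinpos: "sin t = 0 \<Longrightarrow> -pi < t \<Longrightarrow> t < pi \<Longrightarrow> t = 0" for t :: real
    using sin_eq_0_pi by blast
  have R: "exp e \<in> cutR" if "e \<in> SR" for e
  proof (cases "Im e = 0")
    case True
    then show ?thesis using that by (simp add: SR_def cutR_def Re_exp)
  next
    case False
    then show ?thesis using that sinpos[of "Im e"] by (auto simp: SR_def cutR_def Im_exp)
  qed
  have L: "exp e \<in> cutL" if "e \<in> SL" for e
  proof (cases "Im e = pi")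
    case True
    then show ?thesis using that by (simp add: SL_def cutL_def Re_exp)
  next
    case False
    then show ?thesis using that sinpos[of "Im e - pi"] by (auto simp: SL_def cutL_def Im_exp)
  qed
  have uR: "ustrip \<subseteq> SR" and uL: "ustrip \<subseteq> SL" and RH: "SR \<subseteq> {e. 0 < Re e}" "SL \<subseteq> {e. 0 < Re e}"
    by (auto simp: ustrip_def SR_def SL_def)
  have fR: "X e = fR (exp e)" if "e \<in> SR" for e
    by (rule msol_eqI[OF oc(1) convex_connected[OF oc(2)] msol_subset[OF sol RH(1)] msol_exp[of ?A cutR fR] tr det _ _ that,
       where a = "Ln (2 * \<i>)"]) (use s' R uR ustrip(4) RH in auto)
  have fL: "X e = fL (exp e)" if "e \<in> SL" for e
    by (rule msol_eqI[OF oc(3) convex_connected[OF oc(4)] msol_subset[OF sol RH(2)] msol_exp[of ?A cutL fL] tr det _ _ that,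
       where a = "Ln (2 * \<i>)"]) (use s' L uL ustrip(4) RH in auto)
  define a where "a = Complex 1 (- (pi / 2))"
  have "- (pi / 2) < pi" using pi_gt_zero by linarith
  then have a: "a \<in> SR" "a + ?s \<in> SL" "0 < Re a" "Im (exp a) < 0" by (auto simp: a_def SR_def SL_def Im_exp)
  have eqa: "X a ** (snd N ** fst N) = X (a + ?s)"
    using fL[OF a(2)] fR[OF a(1)] s' a(4) by (simp add: per matrix_mul_assoc)
  have sh: "msol ?B {e. 0 < Re e} (\<lambda>e. X (e + ?s))"
    unfolding msol_def
  proof
    fix e assume e: "e \<in> {e. 0 < Re e}"
    have d: "((\<lambda>e. e + ?s) has_field_derivative 1) (at e)" by (auto intro!: derivative_eq_intros)
    have "has_mderiv X (?B (e + ?s) ** X (e + ?s)) (e + ?s)"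
      using sol e by (simp add: msol_def)
    from has_mderiv_compose[OF this d] show "has_mderiv (\<lambda>e. X (e + ?s)) (?B e ** X (e + ?s)) e" by (simp add: per)
  qed
  have dsh: "det (X (e + ?s)) = 1" if "e \<in> {e. 0 < Re e}" for e using det[of "e + ?s"] that by simp
  show ?thesis
    by (rule msol_eqI[OF open_convex_RH(1) convex_connected[OF open_convex_RH(2)] sh msol_mult_const[OF sol] tr dsh _ eqa[symmetric]])
       (use e a in auto)
qed

section \<open>Conjugation by sigma1 and half turns\<close>

lemma sheets_mult_const:
  assumes "sheets x P Q X N fL fM fR" "det C = 1"
  shows "sheets x P Q (\<lambda>e. X e ** C) (adj2 C ** fst N ** C, adj2 C ** snd N ** C)
    (\<lambda>\<eta>. fL \<eta> ** C) (\<lambda>\<eta>. fM \<eta> ** C) (\<lambda>\<eta>. fR \<eta> ** C)"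
  using assms by (simp add: sheets_def msol_mult_const matrix_mul_assoc[symmetric] adj2_cancel)

lemma conj_sigma1_nth [simp]:
  "conj_sigma1 A $ 1 $ 1 = A $ 2 $ 2" "conj_sigma1 A $ 1 $ 2 = A $ 2 $ 1"
  "conj_sigma1 A $ 2 $ 1 = A $ 1 $ 2" "conj_sigma1 A $ 2 $ 2 = A $ 1 $ 1"
  by (simp_all add: conj_sigma1_def sigma1_def cmat2_mult_nth)

lemma conj_sigma1_simps:
  "conj_sigma1 (A ** B) = conj_sigma1 A ** conj_sigma1 B" "conj_sigma1 (c *m A) = c *m conj_sigma1 A"
  "conj_sigma1 (conj_sigma1 A) = A" "conj_sigma1 (A - B) = conj_sigma1 A - conj_sigma1 B"
  "conj_sigma1 (mat 1) = mat 1" "conj_sigma1 (exp_sigma3 a) = exp_sigma3 (- a)" "trace (conj_sigma1 A) = trace A"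
  by (simp_all add: cmat2_simps exp_sigma3_def trace_def sum_2 algebra_simps)

lemma norm_conj_sigma1 [simp]: "norm (conj_sigma1 A) = norm A"
proof -
  have "(norm (conj_sigma1 A))\<^sup>2 = (norm A)\<^sup>2" unfolding norm_cmat2_sq by simp
  then show ?thesis by simp
qed

lemma has_mderiv_conj_sigma1: "has_mderiv f D z \<Longrightarrow> has_mderiv (\<lambda>z. conj_sigma1 (f z)) (conj_sigma1 D) z"
  unfolding has_mderiv_iff by (simp add: forall_2)

lemma eta_coeff_conj_sigma1:
  "conj_sigma1 (eta_coeff x P Q \<eta>) = eta_coeff (- x) (conj_sigma1 P) (conj_sigma1 Q) \<eta>"
  by (simp add: eta_coeff_def cmat2_eq_iff sigma3_def)

lemma sheets_conj_sigma1:
  assumes "sheets x P Q X N fL fM fR"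
  shows "sheets (- x) (conj_sigma1 P) (conj_sigma1 Q) (\<lambda>e. conj_sigma1 (X e)) (conj_sigma1 (fst N), conj_sigma1 (snd N))
    (\<lambda>\<eta>. conj_sigma1 (fL \<eta>)) (\<lambda>\<eta>. conj_sigma1 (fM \<eta>)) (\<lambda>\<eta>. conj_sigma1 (fR \<eta>))"
  using assms has_mderiv_conj_sigma1 
  by (fastforce simp: sheets_def msol_def eta_coeff_conj_sigma1[symmetric] conj_sigma1_simps(1))

text \<open>\<open>sigma1\<close> reverses the sign of \<open>sigma3\<close>, so \<open>x\<close>
  and \<open>th\<close> are replaced by their negatives and the exponent changes sign. The sector
  stays where it is in \<open>e\<close> while \<open>Im w\<close> moves by \<open>s * pi\<close>, so
  its index moves by \<open>s\<close>.\<close>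

lemma canon_conj_sigma1:
  assumes "canon th w P Q k X" "\<bar>s\<bar> = 1"
  shows "canon (- th) (w + of_int s * of_real pi * \<i>) (conj_sigma1 P) (conj_sigma1 Q) (k + s) (\<lambda>e. conj_sigma1 (X e))"
proof -
  have s: "s = 1 \<or> s = -1" using assms(2) by linarith
  let ?w = "w + of_int s * of_real pi * \<i>"
  have x: "exp ?w = - exp w" using s by (auto simp: exp_add exp_minus)
  have T: "canon_exponent (- th) ?w e = - canon_exponent th w e" for e
    unfolding canon_exponent_def x by simp
  have Im: "Im (e + ?w) - pi / 2 - (of_int (k + s) - 2) * pi = Im (e + w) - pi / 2 - (of_int k - 2) * pi" for e
    by (simp add: algebra_simps)
  have "conj_sigma1 (X e) ** exp_sigma3 (- (- canon_exponent th w e)) - mat 1 = conj_sigma1 (X e ** exp_sigma3 (- canon_exponent th w e) - mat 1)" for e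
    by (simp add: conj_sigma1_simps)
  then have n: "norm (conj_sigma1 (X e) ** exp_sigma3 (- (- canon_exponent th w e)) - mat 1) = norm (X e ** exp_sigma3 (- canon_exponent th w e) - mat 1)" for e
    by (simp only: norm_conj_sigma1)
  have "msol (\<lambda>e. exp e *m eta_coeff (- exp w) (conj_sigma1 P) (conj_sigma1 Q) (exp e)) {e. 0 < Re e} (\<lambda>e. conj_sigma1 (X e))"
    using assms(1) has_mderiv_conj_sigma1
    by (fastforce simp: canon_def msol_def eta_coeff_conj_sigma1[symmetric] conj_sigma1_simps)
  then show ?thesis using assms(1) unfolding canon_def T Im n x by simp
qed

text \<open>A half turn makes \<open>Y3 = Y2 ** S2\<close>, or \<open>Y1\<close>, which is
  \<open>Y2\<close> times the inverse of \<open>S1\<close>, the new canonical solution of index 2.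
  The names refer to the argument of \<open>y\<close> in \<open>PV_solutions_half_turn\<close>; the
  point at which the linear system is taken moves the opposite way.\<close>

definition turn_up :: "complex \<Rightarrow> cmat2 \<times> cmat2 \<Rightarrow> cmat2 \<times> cmat2" where
  "turn_up th N = (let S = stokes2 th N in
     (conj_sigma1 (adj2 S ** fst N ** S), conj_sigma1 (adj2 S ** snd N ** S)))"

definition turn_down :: "complex \<Rightarrow> cmat2 \<times> cmat2 \<Rightarrow> cmat2 \<times> cmat2" where
  "turn_down th N = (let S = stokes1 th N in
     (conj_sigma1 (S ** fst N ** adj2 S), conj_sigma1 (S ** snd N ** adj2 S)))"

lemma det_stokes [simp]: "det (stokes1 th N) = 1" "det (stokes2 th N) = 1"
  by (simp_all add: stokes1_def stokes2_def case_prod_beta det_2)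

text \<open>The factorisation of \<open>M1 ** M0\<close> into triangular and diagonal parts,
  together with \<open>sheets_full_turn\<close>, exhibits \<open>X ** S2\<close> as \<open>X\<close>
  times an upper and as the canonical solution of index 4 times a lower triangular matrix. This is
  the hypothesis of \<open>stokes_step\<close>; index 0 plays the same part in the other
  direction.\<close>

theorem mono_rep_turn:
  assumes "mono_rep th w P Q N" "trace P = 0" "trace Q = 0" "N \<in> monodromy_pairs \<theta>0 \<theta>1 th"
  shows "mono_rep (- th) (w - of_real pi * \<i>) (conj_sigma1 P) (conj_sigma1 Q) (turn_up th N)"
    "mono_rep (- th) (w + of_real pi * \<i>) (conj_sigma1 P) (conj_sigma1 Q) (turn_down th N)"
proof -
  obtain X fL fM fR where X: "canon th w P Q 2 X" and s: "sheets (exp w) P Q X N fL fM fR"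
    using assms(1) by (auto simp: mono_rep_def)
  define S1 S2 where "S1 = stokes1 th N" and "S2 = stokes2 th N"
  define Pm where "Pm = snd N ** fst N"
  define a where "a = of_real pi * \<i> * th"
  obtain s1 where s1: "S1 = mat2 1 0 s1 1" by (auto simp: S1_def stokes1_def case_prod_beta)
  obtain s2 where s2: "S2 = mat2 1 s2 0 1" by (auto simp: S2_def stokes2_def case_prod_beta)
  have det: "det S1 = 1" "det S2 = 1" by (simp_all add: S1_def S2_def)
  have Pm: "Pm = adj2 S1 ** exp_sigma3 (- a) ** adj2 S2"
    using monodromy_factorization[OF assms(4)] by (simp add: Pm_def S1_def S2_def matrix_inv_eq_adj2 a_def)
  have turn: "X (e + 2 * of_real pi * \<i>) = X e ** Pm" if "0 < Re e" for e
    unfolding Pm_def by (rule sheets_full_turn[OF X assms(2,3) s that])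
  have Sx: "adj2 S1 = mat2 1 0 (- s1) 1" "adj2 S2 = mat2 1 (- s2) 0 1" by (simp_all add: s1 s2 cmat2_eq_iff)
  have conjl: "exp_sigma3 b ** mat2 1 0 c 1 ** exp_sigma3 (- b) = mat2 1 0 (c * exp (- (2 * b))) 1" for b c
    unfolding exp_sigma3_def mat2_mult by (simp add: cmat2_eq_iff mult.assoc mult.left_commute flip: exp_add)
  have conju: "exp_sigma3 (- b) ** mat2 1 c 0 1 ** exp_sigma3 b = mat2 1 (c * exp (- (2 * b))) 0 1" for b c
    unfolding exp_sigma3_def mat2_mult by (simp add: cmat2_eq_iff mult.assoc mult.left_commute flip: exp_add)
  \<comment> \<open>In spite of the numeral this is the canonical solution of index 4, obtained from
    \<open>X\<close> by a full turn.\<close>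
  define X3 where "X3 e = X (e - of_int 1 * (2 * of_real pi * \<i>)) ** exp_sigma3 (- of_int 1 * (of_real pi * \<i> * th))" for e
  have c4: "canon th w P Q (2 + 2) X3" using canon_shift[OF X, of 1] unfolding X3_def by simp
  have "X e ** mat2 1 s2 0 1 = X3 e ** mat2 1 0 (- s1 * exp (- (2 * a))) 1" if "0 < Re e" for e
  proof -
    have "X e = X (e - 2 * of_real pi * \<i>) ** Pm" using turn[of "e - 2 * of_real pi * \<i>"] that by simp
    then have "X e ** S2 = X (e - 2 * of_real pi * \<i>) ** (adj2 S1 ** exp_sigma3 (- a))"
      unfolding Pm by (simp add: matrix_mul_assoc[symmetric] adj2_cancel det)
    moreover have "X3 e ** mat2 1 0 (- s1 * exp (- (2 * a))) 1 = X (e - 2 * of_real pi * \<i>) ** (adj2 S1 ** exp_sigma3 (- a))"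
      unfolding conjl[symmetric] Sx[symmetric] X3_def
      by (simp add: a_def matrix_mul_assoc[symmetric] exp_sigma3_cancel)
    ultimately show ?thesis by (simp add: s2)
  qed
  from stokes_step[OF X c4 _ this] have c3: "canon th w P Q 3 (\<lambda>e. X e ** S2)" by (simp add: s2)
  have "canon (- th) (w - of_real pi * \<i>) (conj_sigma1 P) (conj_sigma1 Q) 2 (\<lambda>e. conj_sigma1 (X e ** S2))"
    using canon_conj_sigma1[OF c3, of "-1"] by simp
  moreover have "exp (w - of_real pi * \<i>) = - exp w" "exp (w + of_real pi * \<i>) = - exp w" by (simp_all add: exp_diff exp_add)
  ultimately show "mono_rep (- th) (w - of_real pi * \<i>) (conj_sigma1 P) (conj_sigma1 Q) (turn_up th N)"
    using sheets_conj_sigma1[OF sheets_mult_const[OF s det(2)]]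
    unfolding mono_rep_def turn_up_def Let_def S2_def by auto
  define X0 where "X0 e = X (e - of_int (-1) * (2 * of_real pi * \<i>)) ** exp_sigma3 (- of_int (-1) * (of_real pi * \<i> * th))" for e
  have c0: "canon th w P Q 0 X0" using canon_shift[OF X, of "-1"] unfolding X0_def by simp
  have X0: "X0 e ** mat2 1 (s2 * exp (- (2 * a))) 0 1 = X e ** adj2 S1" if "0 < Re e" for e
  proof -
    have "X0 e = X e ** Pm ** exp_sigma3 a" using turn[OF that] by (simp add: X0_def a_def)
    then have "X0 e ** mat2 1 (s2 * exp (- (2 * a))) 0 1 = X e ** (Pm ** (exp_sigma3 a ** mat2 1 (s2 * exp (- (2 * a))) 0 1))"
      by (simp add: matrix_mul_assoc)
    also have "exp_sigma3 a ** mat2 1 (s2 * exp (- (2 * a))) 0 1 = S2 ** exp_sigma3 a"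
      unfolding conju[symmetric] s2 by (simp add: matrix_mul_assoc[symmetric] exp_sigma3_cancel)
    also have "Pm ** (S2 ** exp_sigma3 a) = adj2 S1"
      unfolding Pm by (simp add: matrix_mul_assoc[symmetric] adj2_cancel det exp_sigma3_cancel)
    finally show ?thesis .
  qed
  have c2: "canon th w P Q (0 + 2) X" using X by simp
  have "canon th w P Q (0 + 1) (\<lambda>e. X0 e ** mat2 1 (s2 * exp (- (2 * a))) 0 1)"
    by (rule stokes_step[OF c0 c2, where s' = "- s1"]) (use X0 Sx in auto)
  \<comment> \<open>Agreement of the two functions is known for \<open>Re e > 0\<close>; this is all
    that the conditions of \<open>canon\<close> see once \<open>R\<close> is replaced by
    \<open>max R 0\<close>.\<close>
  then have "canon th w P Q 1 (\<lambda>e. X e ** adj2 S1)"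
    unfolding canon_def msol_def
  proof (elim conjE, intro conjI ballI)
    fix e assume *: "\<forall>e\<in>{e. 0 < Re e}. has_mderiv (\<lambda>e. X0 e ** mat2 1 (s2 * exp (- (2 * a))) 0 1)
       (exp e *m eta_coeff (exp w) P Q (exp e) ** (X0 e ** mat2 1 (s2 * exp (- (2 * a))) 0 1)) e" and e: "e \<in> {e. 0 < Re e}"
    show "has_mderiv (\<lambda>e. X e ** adj2 S1) (exp e *m eta_coeff (exp w) P Q (exp e) ** (X e ** adj2 S1)) e"
      using has_mderiv_transform[OF bspec[OF * e] open_convex_RH(1) e, of "\<lambda>e. X e ** adj2 S1"] X0 e by simp
  next
    assume *: "\<forall>\<delta>>0. \<exists>C R. \<forall>e. R < Re e \<and> \<bar>Im (e + w) - pi / 2 - (real_of_int (0 + 1) - 2) * pi\<bar> \<le> pi - \<delta> \<longrightarrow>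
          norm (X0 e ** mat2 1 (s2 * exp (- (2 * a))) 0 1 ** exp_sigma3 (- canon_exponent th w e) - mat 1) \<le> C * exp (- Re e)"
    show "\<forall>\<delta>>0. \<exists>C R. \<forall>e. R < Re e \<and> \<bar>Im (e + w) - pi / 2 - (real_of_int 1 - 2) * pi\<bar> \<le> pi - \<delta> \<longrightarrow>
          norm (X e ** adj2 S1 ** exp_sigma3 (- canon_exponent th w e) - mat 1) \<le> C * exp (- Re e)"
    proof (intro allI impI)
      fix \<delta> :: real assume "\<delta> > 0"
      then obtain C R where CR: "\<And>e. R < Re e \<Longrightarrow> \<bar>Im (e + w) - pi / 2 - (real_of_int (0 + 1) - 2) * pi\<bar> \<le> pi - \<delta> \<Longrightarrow>
          norm (X0 e ** mat2 1 (s2 * exp (- (2 * a))) 0 1 ** exp_sigma3 (- canon_exponent th w e) - mat 1) \<le> C * exp (- Re e)"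
        using * by meson
      show "\<exists>C R. \<forall>e. R < Re e \<and> \<bar>Im (e + w) - pi / 2 - (real_of_int 1 - 2) * pi\<bar> \<le> pi - \<delta> \<longrightarrow>
          norm (X e ** adj2 S1 ** exp_sigma3 (- canon_exponent th w e) - mat 1) \<le> C * exp (- Re e)"
      proof (rule exI[of _ C], rule exI[of _ "max R 0"], intro allI impI)
        fix e assume e: "max R 0 < Re e \<and> \<bar>Im (e + w) - pi / 2 - (real_of_int 1 - 2) * pi\<bar> \<le> pi - \<delta>"
        then show "norm (X e ** adj2 S1 ** exp_sigma3 (- canon_exponent th w e) - mat 1) \<le> C * exp (- Re e)"
          using CR[of e] X0[of e] by simp
      qed
    qed
  qed
  then have "canon (- th) (w + of_real pi * \<i>) (conj_sigma1 P) (conj_sigma1 Q) 2 (\<lambda>e. conj_sigma1 (X e ** adj2 S1))"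
    using canon_conj_sigma1[of th w P Q 1 _ 1] by simp
  moreover have "adj2 (adj2 S1) = S1" by (simp add: cmat2_eq_iff)
  ultimately show "mono_rep (- th) (w + of_real pi * \<i>) (conj_sigma1 P) (conj_sigma1 Q) (turn_down th N)"
    using sheets_conj_sigma1[OF sheets_mult_const[OF s, of "adj2 S1"]] det \<open>exp (w + of_real pi * \<i>) = - exp w\<close>
    unfolding mono_rep_def turn_down_def Let_def S1_def by auto
qed


section \<open>Isomonodromy\<close>

text \<open>As \<open>(\<eta> + 1) / 2 = \<xi>\<close>, the first term is
  \<open>x * \<xi> / 2\<close> times \<open>sigma3\<close>. For the residues of the Painleve system
  and \<open>Z = (th / 2) *m sigma3\<close> the second is the off-diagonal part of
  \<open>P + Q\<close>.\<close>

definition deform_coeff :: "complex \<Rightarrow> cmat2 \<Rightarrow> cmat2 \<Rightarrow> cmat2 \<Rightarrow> complex \<Rightarrow> cmat2" where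
  "deform_coeff x Z P Q \<eta> = (x * (\<eta> + 1) / 4) *m sigma3 + (P + Q + Z)"

text \<open>Compatibility of the two linear equations: the right-hand side is the derivative of
  \<open>deform_coeff\<close> in \<open>\<eta>\<close>, and the first group of terms is that of
  \<open>eta_coeff\<close> in \<open>w\<close> when \<open>P\<close> and \<open>Q\<close> obey the
  equations assumed in \<open>isomonodromy\<close>.\<close>

lemma zero_curvature:
  fixes P Q Z W :: cmat2
  assumes "\<eta> \<noteq> 1" "\<eta> \<noteq> -1" "Z = z *m sigma3" and W_def: "W = P + Q + Z"
  shows "((x / 4) *m sigma3 + (1 / (\<eta> + 1)) *m (W ** P - P ** W)
      + (1 / (\<eta> - 1)) *m (((x / 2) *m sigma3 + W) ** Q - Q ** ((x / 2) *m sigma3 + W)))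
     + eta_coeff x P Q \<eta> ** deform_coeff x Z P Q \<eta> - deform_coeff x Z P Q \<eta> ** eta_coeff x P Q \<eta> = (x / 4) *m sigma3"
proof -
  define a b g e where "a = 1 / (\<eta> + 1)" and "b = 1 / (\<eta> - 1)" and "g = x / 4" and "e = \<eta> + 1"
  have ae: "a * e = 1" using assms(2) by (simp add: a_def e_def add_eq_0_iff2)
  \<comment> \<open>From \<open>\<eta> + 1 = (\<eta> - 1) + 2\<close>; together with
    \<open>ae\<close> it clears the denominators and leaves a polynomial identity.\<close>
  have be: "b * e = 1 + 2 * b" using assms(1) by (simp add: b_def e_def field_simps)
  have ae': "a * (e * X) = X" "a * e = 1" for X using ae by (simp_all flip: mult.assoc)
  have be': "b * (e * X) = X + 2 * (b * X)" "b * e = 1 + 2 * b" for X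
    using be by (simp_all add: distrib_right flip: mult.assoc)
  have x: "x / 4 = g" "x / 2 = 2 * g" "x * (\<eta> + 1) / 4 = g * e" by (simp_all add: g_def e_def)
  have w: "W $ 1 $ 1 = P $ 1 $ 1 + Q $ 1 $ 1 + z" "W $ 1 $ 2 = P $ 1 $ 2 + Q $ 1 $ 2"
     "W $ 2 $ 1 = P $ 2 $ 1 + Q $ 2 $ 1" "W $ 2 $ 2 = P $ 2 $ 2 + Q $ 2 $ 2 - z"
    by (simp_all add: W_def assms(3) sigma3_def)
  have s: "sigma3 $ 1 $ 1 = 1" "sigma3 $ 2 $ 2 = -1" "sigma3 $ 1 $ 2 = 0" "sigma3 $ 2 $ 1 = 0"
    by (simp_all add: sigma3_def)
  show ?thesis
    unfolding eta_coeff_def deform_coeff_def W_def[symmetric] x a_def[symmetric] b_def[symmetric] cmat2_eq_iff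
    unfolding vector_add_component vector_minus_component cmat2_mult_nth cscale_nth w s
    by (simp add: algebra_simps ae' be')
qed

lemma has_mderiv_quadratic:
  assumes "\<And>h. norm h \<le> 1 \<Longrightarrow> norm (f (z + h) - f z - h *m D) \<le> C * (norm h)\<^sup>2"
  shows "has_mderiv f D z"
  unfolding has_mderiv_def
proof (rule has_derivativeI_sandwich[of 1 _ _ _ _ "\<lambda>y. C * norm (y - z)"])
  show "bounded_linear (\<lambda>h. h *m D)" by (rule cscale.bounded_linear_left)
  show "((\<lambda>y. C * norm (y - z)) \<longlongrightarrow> 0) (at z)"
    by (auto intro!: tendsto_eq_intros)
  fix y assume "y \<noteq> z" "dist y z < 1"
  then show "norm (f y - f z - (y - z) *m D) / norm (y - z) \<le> C * norm (y - z)"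
    using assms[of "y - z"] by (simp add: dist_norm divide_le_eq power2_eq_square mult.assoc)
qed auto

lemma has_vector_derivative_quadratic_zero:
  fixes g :: "real \<Rightarrow> cmat2"
  assumes "s \<in> T" "\<And>r. r \<in> T \<Longrightarrow> norm (g r) \<le> C * (r - s)\<^sup>2"
  shows "(g has_vector_derivative 0) (at s within T)"
  unfolding has_vector_derivative_def
proof (rule has_derivativeI_sandwich[of 1 _ _ _ _ "\<lambda>r. C * \<bar>r - s\<bar>"])
  show "bounded_linear (\<lambda>h. h *\<^sub>R (0 :: cmat2))" by simp
  show "((\<lambda>r. C * \<bar>r - s\<bar>) \<longlongrightarrow> 0) (at s within T)"
    by (auto intro!: tendsto_eq_intros)
  fix r assume r: "r \<in> T" "r \<noteq> s"
  have "g s = 0" using assms(2)[OF assms(1)] by simp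
  moreover have "norm (g r) \<le> C * \<bar>r - s\<bar> * \<bar>r - s\<bar>"
    using assms(2)[OF r(1)] by (simp add: power2_eq_square mult.assoc)
  ultimately show "norm (g r - g s - (r - s) *\<^sub>R 0) / norm (r - s) \<le> C * \<bar>r - s\<bar>"
    using r(2) by (simp add: divide_le_eq)
qed auto

lemma norm_deform_coeff_le:
  assumes "norm x \<le> K" "norm P \<le> K" "norm Q \<le> K" "norm Z \<le> K" "norm \<eta> \<le> \<rho>" "0 \<le> K" "0 \<le> \<rho>"
  shows "norm (deform_coeff x Z P Q \<eta>) \<le> K * (\<rho> + 1) * norm sigma3 + 3 * K"
proof -
  have "norm (x * (\<eta> + 1) / 4) \<le> K * (\<rho> + 1)"
  proof -
    have "norm (\<eta> + 1) \<le> \<rho> + 1" using norm_triangle_ineq[of \<eta> 1] assms by simp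
    then have "norm x * norm (\<eta> + 1) \<le> K * (\<rho> + 1)" using assms by (intro mult_mono) auto
    moreover have "0 \<le> K * (\<rho> + 1)" using assms by simp
    ultimately show ?thesis unfolding norm_mult norm_divide by simp
  qed
  then have 1: "norm ((x * (\<eta> + 1) / 4) *m sigma3) \<le> K * (\<rho> + 1) * norm sigma3"
    unfolding norm_cscale by (rule mult_right_mono) simp
  have 2: "norm (P + Q + Z) \<le> 3 * K"
    using norm_triangle_ineq[of "P + Q" Z] norm_triangle_ineq[of P Q] assms by linarith
  show ?thesis unfolding deform_coeff_def using norm_triangle_ineq[of "(x * (\<eta> + 1) / 4) *m sigma3" "P + Q + Z"] 1 2 by linarith
qed

text \<open>The isomonodromic family is \<open>U(\<eta>, w) X(\<eta>)\<close>, where \<open>U\<close> solves the deformation equation in \<open>w\<close> with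
  \<open>U(\<eta>, w0) = 1\<close>. It is entire in \<open>\<eta>\<close>, so that left multiplication by it does not affect the monodromy. For
  its behaviour at infinity the product is followed along curves on which \<open>x \<eta>\<close> is constant, where the
  coefficient of the equation is diagonal up to terms of order \<open>1/\<eta>\<close>.\<close>

locale isomonodromy =
  fixes S :: "complex set" and w0 w1 th :: complex and P Q :: "complex \<Rightarrow> cmat2"
  assumes S: "open S" "convex S" "w0 \<in> S" "w1 \<in> S"
    and P: "\<And>w. w \<in> S \<Longrightarrow> has_mderiv P ((P w + Q w + (th / 2) *m sigma3) ** P w - P w ** (P w + Q w + (th / 2) *m sigma3)) w"
    and Q: "\<And>w. w \<in> S \<Longrightarrow> has_mderiv Q (((exp w / 2) *m sigma3 + (P w + Q w + (th / 2) *m sigma3)) ** Q w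
         - Q w ** ((exp w / 2) *m sigma3 + (P w + Q w + (th / 2) *m sigma3))) w"
    and trace0: "\<And>w. w \<in> S \<Longrightarrow> trace (P w) = 0" "\<And>w. w \<in> S \<Longrightarrow> trace (Q w) = 0"
begin

abbreviation "A \<eta> w \<equiv> eta_coeff (exp w) (P w) (Q w) \<eta>"
abbreviation "B \<eta> w \<equiv> deform_coeff (exp w) ((th / 2) *m sigma3) (P w) (Q w) \<eta>"

definition d where "d = w1 - w0"
definition path_w where "path_w s = w0 + of_real s * d"

lemma path_w_in: "s \<in> {0..1} \<Longrightarrow> path_w s \<in> S"
  using convexD_alt[OF S(2,3,4), of s] by (simp add: path_w_def d_def scaleR_conv_of_real algebra_simps)

lemma path_w_ends [simp]: "path_w 0 = w0" "path_w 1 = w1" by (simp_all add: path_w_def d_def)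

lemma path_w_deriv: "(path_w has_vector_derivative d) (at s within T)"
  unfolding path_w_def
  by (auto intro!: derivative_eq_intros has_vector_derivative_real_field simp: has_vector_derivative_def scaleR_conv_of_real)

lemma mhol_PQ: "mhol P S" "mhol Q S"
  using P Q by (auto simp: mhol_iff[OF S(1)])

lemma mhol_B: "mhol (B \<eta>) S"
  unfolding deform_coeff_def by (intro mhol_intros mhol_PQ holomorphic_intros) auto

lemma bounds: "\<exists>K\<ge>1. norm d \<le> K \<and> norm ((th / 2) *m sigma3) \<le> K \<and> (\<forall>s\<in>{0..1}. norm (exp (path_w s)) \<le> K \<and> norm (P (path_w s)) \<le> K \<and> norm (Q (path_w s)) \<le> K)"
proof -
  have c: "continuous_on {0..1} path_w" unfolding path_w_def by (intro continuous_intros)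
  have im: "path_w ` {0..1} \<subseteq> S" using path_w_in by auto
  have b: "\<exists>K. \<forall>s\<in>{0..1}. norm (f (path_w s)) \<le> K" if "continuous_on S f" for f :: "complex \<Rightarrow> cmat2"
  proof -
    have "continuous_on {0..1} (\<lambda>s. f (path_w s))"
      using continuous_on_compose2[OF that c im] .
    then have "bounded ((\<lambda>s. f (path_w s)) ` {0..1})" by (intro compact_imp_bounded compact_continuous_image) auto
    then show ?thesis by (auto simp: bounded_iff)
  qed
  obtain K1 where K1: "\<And>s. s \<in> {0..1} \<Longrightarrow> norm (P (path_w s)) \<le> K1" using b[OF mhol_continuous_on[OF S(1) mhol_PQ(1)]] by blast
  obtain K2 where K2: "\<And>s. s \<in> {0..1} \<Longrightarrow> norm (Q (path_w s)) \<le> K2" using b[OF mhol_continuous_on[OF S(1) mhol_PQ(2)]] by blast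
  have K3: "norm (exp (path_w s)) \<le> exp (norm w0 + norm d)" if "s \<in> {0..1}" for s
  proof -
    have "Re (path_w s) \<le> norm (path_w s)" by (rule complex_Re_le_cmod)
    also have "\<dots> \<le> norm w0 + norm (of_real s * d)" unfolding path_w_def by (rule norm_triangle_ineq)
    also have "norm (of_real s * d) \<le> norm d" using that by (simp add: norm_mult mult_left_le_one_le)
    finally show ?thesis by simp
  qed
  let ?K = "Max {1, norm d, norm ((th / 2) *m sigma3), K1, K2, exp (norm w0 + norm d)}"
  have le: "x \<le> ?K" if "x \<in> {1, norm d, norm ((th / 2) *m sigma3), K1, K2, exp (norm w0 + norm d)}" for x
    by (rule Max_ge[OF _ that]) simp
  show ?thesis
    by (rule exI[of _ ?K], intro conjI ballI)
      (use le K1 K2 K3 in \<open>(blast intro: order_trans)+\<close>)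
qed

text \<open>Chosen for each \<open>\<eta>\<close> on its own; how it depends on
  \<open>\<eta>\<close> is found afterwards from the deformation equation.\<close>

definition U where "U \<eta> = (SOME f. f w0 = mat 1 \<and> msol (B \<eta>) S f)"

lemma U: "U \<eta> w0 = mat 1" "\<And>w. w \<in> S \<Longrightarrow> has_mderiv (U \<eta>) (B \<eta> w ** U \<eta> w) w"
proof -
  have "closed_segment w0 z \<subseteq> S" if "z \<in> S" for z using S(2,3) that by (rule closed_segment_subset[rotated 2])
  from linear_ode_exists[OF S(1,3) this mhol_B[of \<eta>]]
  have "U \<eta> w0 = mat 1 \<and> msol (B \<eta>) S (U \<eta>)" unfolding U_def by (rule someI_ex)
  then show "U \<eta> w0 = mat 1" "\<And>w. w \<in> S \<Longrightarrow> has_mderiv (U \<eta>) (B \<eta> w ** U \<eta> w) w" by (auto simp: msol_def)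
qed

text \<open>The \<open>\<eta>\<close>-derivative that \<open>U\<close> must have in order that
  multiplication by \<open>U\<close> takes solutions at \<open>w0\<close> to solutions at
  \<open>w\<close>.\<close>

definition W where "W \<eta> w = A \<eta> w ** U \<eta> w - U \<eta> w ** A \<eta> w0"

lemma has_mderiv_A:
  assumes "w \<in> S"
  shows "has_mderiv (A \<eta>) ((exp w / 4) *m sigma3
     + (1 / (\<eta> + 1)) *m ((P w + Q w + (th / 2) *m sigma3) ** P w - P w ** (P w + Q w + (th / 2) *m sigma3))
     + (1 / (\<eta> - 1)) *m (((exp w / 2) *m sigma3 + (P w + Q w + (th / 2) *m sigma3)) ** Q w
         - Q w ** ((exp w / 2) *m sigma3 + (P w + Q w + (th / 2) *m sigma3)))) w"
proof -
  have 1: "((\<lambda>w. exp w / 4) has_field_derivative exp w / 4) (at w)" by (auto intro!: derivative_eq_intros)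
  have 2: "has_mderiv (\<lambda>w. c *m f w) (c *m D) w" if "has_mderiv f D w" for c f D
    using has_mderiv_cscale[OF DERIV_const that, of c] by simp
  have 3: "has_mderiv (\<lambda>w. (exp w / 4) *m sigma3) ((exp w / 4) *m sigma3) w"
    using has_mderiv_cscale[OF 1 has_mderiv_const[of sigma3]] by simp
  show ?thesis unfolding eta_coeff_def
    by (intro has_mderiv_add 3 2 P Q assms)
qed

text \<open>By \<open>zero_curvature\<close>, \<open>W\<close> solves the equation that results from
  differentiating the one for \<open>U\<close> formally in \<open>\<eta>\<close>.\<close>

lemma W_deriv:
  assumes "w \<in> S" "\<eta> \<noteq> 1" "\<eta> \<noteq> -1"
  shows "has_mderiv (W \<eta>) (((exp w / 4) *m sigma3) ** U \<eta> w + B \<eta> w ** W \<eta> w) w"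
proof -
  let ?A' = "(exp w / 4) *m sigma3
     + (1 / (\<eta> + 1)) *m ((P w + Q w + (th / 2) *m sigma3) ** P w - P w ** (P w + Q w + (th / 2) *m sigma3))
     + (1 / (\<eta> - 1)) *m (((exp w / 2) *m sigma3 + (P w + Q w + (th / 2) *m sigma3)) ** Q w
         - Q w ** ((exp w / 2) *m sigma3 + (P w + Q w + (th / 2) *m sigma3)))"
  have "has_mderiv (W \<eta>) ((?A' ** U \<eta> w + A \<eta> w ** (B \<eta> w ** U \<eta> w)) - ((B \<eta> w ** U \<eta> w) ** A \<eta> w0 + U \<eta> w ** 0)) w"
    unfolding W_def by (intro has_mderiv_diff has_mderiv_mult has_mderiv_A U has_mderiv_const assms)
  moreover have "?A' ** U \<eta> w + A \<eta> w ** (B \<eta> w ** U \<eta> w) - ((B \<eta> w ** U \<eta> w) ** A \<eta> w0 + U \<eta> w ** 0)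
      = ((?A' + A \<eta> w ** B \<eta> w - B \<eta> w ** A \<eta> w)) ** U \<eta> w + B \<eta> w ** W \<eta> w"
    unfolding W_def by (simp only: cmat2_mult_algebra matrix_mul_assoc) (simp add: cmat2_mult_algebra)
  ultimately show ?thesis
    using zero_curvature[OF assms(2,3) refl refl, of "exp w" "P w" "Q w" "th / 2"] by simp
qed

section \<open>Dependence of the deformation on the spectral variable\<close>

lemma gronwall_path:
  assumes "\<And>s. s \<in> {0..1} \<Longrightarrow> has_mderiv f (f' s) (path_w s)"
    "\<And>s. s \<in> {0..1} \<Longrightarrow> norm (f' s) \<le> L * norm (f (path_w s)) + c" "0 \<le> L" "0 \<le> c" "norm d \<le> K" "s \<in> {0..1}"
  shows "norm (f (path_w s)) \<le> (norm (f w0) + K * c) * exp (K * L + 1)"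
proof -
  have K: "0 \<le> K" using assms(5) norm_ge_zero[of d] by linarith
  have "norm (f (path_w s)) \<le> (norm (f (path_w 0)) + K * c) * exp ((K * L + 1) * (s - 0))"
  proof (rule gronwall_inhom)
    fix r assume r: "r \<in> {0..s}"
    then have r': "r \<in> {0..1}" using assms(6) by auto
    show "((\<lambda>s. f (path_w s)) has_vector_derivative d *m f' r) (at r within {0..s})"
      by (rule has_mderiv_curve[OF assms(1)[OF r'] path_w_deriv])
    have "norm (d *m f' r) \<le> K * (L * norm (f (path_w r)) + c)"
      unfolding norm_cscale using assms(2)[OF r'] assms(5) K by (intro mult_mono) auto
    then show "norm (d *m f' r) \<le> K * L * norm (f (path_w r)) + K * c" by (simp add: algebra_simps)
  qed (use assms K in auto)
  also have "\<dots> \<le> (norm (f (path_w 0)) + K * c) * exp (K * L + 1)"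
    using assms K by (intro mult_left_mono) (auto simp: mult_left_le)
  finally show ?thesis by simp
qed

text \<open>Gronwall's inequality twice: the difference \<open>E\<close> is of order
  \<open>h\<close>, and with this the remainder \<open>D\<close> is of order
  \<open>h\<^sup>2\<close>. Both vanish at \<open>w0\<close>, where \<open>U\<close> is 1 and
  \<open>W\<close> is 0. The bound is uniform along the path, as \<open>U_path_deriv\<close>
  requires.\<close>

lemma U_quadratic:
  assumes "\<eta> \<noteq> 1" "\<eta> \<noteq> -1" "0 \<le> \<rho>" "norm \<eta> \<le> \<rho>"
  shows "\<exists>C\<ge>0. \<forall>h s. norm (\<eta> + h) \<le> \<rho> \<longrightarrow> s \<in> {0..1} \<longrightarrow>
     norm (U (\<eta> + h) (path_w s) - U \<eta> (path_w s) - h *m W \<eta> (path_w s)) \<le> C * (norm h)\<^sup>2"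
proof -
  obtain K where K: "K \<ge> 1" "norm d \<le> K" "norm ((th / 2) *m sigma3) \<le> K" "\<And>s. s \<in> {0..1} \<Longrightarrow> norm (exp (path_w s)) \<le> K"
     "\<And>s. s \<in> {0..1} \<Longrightarrow> norm (P (path_w s)) \<le> K" "\<And>s. s \<in> {0..1} \<Longrightarrow> norm (Q (path_w s)) \<le> K"
    using bounds by auto
  define L where "L = K * (\<rho> + 1) * norm sigma3 + 3 * K"
  have L: "L \<ge> 0" using K(1) assms(3) by (auto simp: L_def intro!: add_nonneg_nonneg)
  have B: "norm (B \<zeta> (path_w s)) \<le> L" if "norm \<zeta> \<le> \<rho>" "s \<in> {0..1}" for \<zeta> s
    unfolding L_def using K that assms by (intro norm_deform_coeff_le) auto
  define X where "X = exp (K * L + 1)"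
  have X: "X \<ge> 0" by (simp add: X_def)
  define K1 where "K1 = K * norm sigma3"
  have K1: "norm ((exp (path_w s) / 4) *m sigma3) \<le> K1" if "s \<in> {0..1}" for s
    unfolding norm_cscale K1_def using K(4)[OF that] K(1) by (intro mult_right_mono) (auto simp: norm_divide)
  have K10: "K1 \<ge> 0" using K(1) by (simp add: K1_def)
  have BU: "norm (U \<eta> (path_w s)) \<le> 2 * X" if "s \<in> {0..1}" for s
  proof -
    have "norm (U \<eta> (path_w s)) \<le> (norm (U \<eta> w0) + K * 0) * exp (K * L + 1)"
    proof (rule gronwall_path[OF U(2)[OF path_w_in] _ L _ K(2) that])
      fix r :: real assume r: "r \<in> {0..1}"
      show "norm (B \<eta> (path_w r) ** U \<eta> (path_w r)) \<le> L * norm (U \<eta> (path_w r)) + 0"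
        using order_trans[OF norm_cmat2_mult mult_right_mono[OF B[OF assms(4) r] norm_ge_zero]] by simp
    qed auto
    also have "\<dots> \<le> 2 * X" unfolding U(1) X_def using norm_mat_1_le by (simp add: mult_right_mono)
    finally show ?thesis .
  qed
  define B1 where "B1 s = (exp (path_w s) / 4) *m sigma3" for s
  have Bdiff: "B (\<eta> + h) (path_w s) = B \<eta> (path_w s) + h *m B1 s" for h s
    by (simp add: deform_coeff_def B1_def cmat2_eq_iff algebra_simps add_divide_distrib)
  define E where "E h w = U (\<eta> + h) w - U \<eta> w" for h w
  define C1 where "C1 = K * (K1 * (2 * X)) * X"
  have E: "norm (E h (path_w s)) \<le> norm h * C1" if h: "norm (\<eta> + h) \<le> \<rho>" and "s \<in> {0..1}" for h s
  proof -
    have "norm (E h (path_w s)) \<le> (norm (E h w0) + K * (norm h * (K1 * (2 * X)))) * exp (K * L + 1)"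
    proof (rule gronwall_path[OF _ _ L _ K(2) that(2)])
      fix r :: real assume r: "r \<in> {0..1}"
      let ?w = "path_w r"
      have "has_mderiv (E h) (B (\<eta> + h) ?w ** U (\<eta> + h) ?w - B \<eta> ?w ** U \<eta> ?w) ?w"
        unfolding E_def by (intro has_mderiv_diff U path_w_in r)
      moreover have "B (\<eta> + h) ?w ** U (\<eta> + h) ?w - B \<eta> ?w ** U \<eta> ?w = B (\<eta> + h) ?w ** E h ?w + h *m (B1 r ** U \<eta> ?w)"
        unfolding E_def Bdiff by (simp add: cmat2_mult_algebra cscale_mult cscale.diff_right)
      ultimately show "has_mderiv (E h) (B (\<eta> + h) ?w ** E h ?w + h *m (B1 r ** U \<eta> ?w)) ?w" by simp
      have "norm (B1 r ** U \<eta> ?w) \<le> K1 * (2 * X)"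
        unfolding B1_def using K10 by (intro order_trans[OF norm_cmat2_mult] mult_mono K1 BU r) auto
      then have "norm (h *m (B1 r ** U \<eta> ?w)) \<le> norm h * (K1 * (2 * X))" by (simp add: mult_left_mono)
      moreover have "norm (B (\<eta> + h) ?w ** E h ?w) \<le> L * norm (E h ?w)"
        by (intro order_trans[OF norm_cmat2_mult] mult_right_mono B h r) auto
      ultimately show "norm (B (\<eta> + h) ?w ** E h ?w + h *m (B1 r ** U \<eta> ?w)) \<le> L * norm (E h ?w) + norm h * (K1 * (2 * X))"
        by (intro norm_triangle_le) linarith
    qed (use K10 X in auto)
    also have "\<dots> = norm h * C1" by (simp add: E_def U(1) C1_def X_def)
    finally show ?thesis .
  qed
  have C1: "C1 \<ge> 0" using K(1) K10 X by (simp add: C1_def)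
  define D where "D h w = U (\<eta> + h) w - U \<eta> w - h *m W \<eta> w" for h w
  have "norm (D h (path_w s)) \<le> (K * (K1 * C1) * X) * (norm h)\<^sup>2" if h: "norm (\<eta> + h) \<le> \<rho>" and "s \<in> {0..1}" for h s
  proof -
    have "norm (D h (path_w s)) \<le> (norm (D h w0) + K * (norm h * (K1 * (norm h * C1)))) * exp (K * L + 1)"
    proof (rule gronwall_path[OF _ _ L _ K(2) that(2)])
      fix r :: real assume r: "r \<in> {0..1}"
      let ?w = "path_w r"
      have "has_mderiv (\<lambda>w. h *m W \<eta> w) (h *m (((exp ?w / 4) *m sigma3) ** U \<eta> ?w + B \<eta> ?w ** W \<eta> ?w)) ?w"
        using has_mderiv_cscale[OF DERIV_const W_deriv[OF path_w_in[OF r] assms(1,2)], of h] by simp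
      then have "has_mderiv (D h) ((B (\<eta> + h) ?w ** U (\<eta> + h) ?w - B \<eta> ?w ** U \<eta> ?w) - h *m (((exp ?w / 4) *m sigma3) ** U \<eta> ?w + B \<eta> ?w ** W \<eta> ?w)) ?w"
        unfolding D_def by (intro has_mderiv_diff U path_w_in r)
      moreover have "(B (\<eta> + h) ?w ** U (\<eta> + h) ?w - B \<eta> ?w ** U \<eta> ?w) - h *m (((exp ?w / 4) *m sigma3) ** U \<eta> ?w + B \<eta> ?w ** W \<eta> ?w)
          = B \<eta> ?w ** D h ?w + h *m (B1 r ** E h ?w)"
        unfolding D_def E_def Bdiff B1_def[symmetric] by (simp add: cmat2_mult_algebra cscale_mult cscale.add_right cscale.diff_right)
      ultimately show "has_mderiv (D h) (B \<eta> ?w ** D h ?w + h *m (B1 r ** E h ?w)) ?w" by simp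
      have "norm (B1 r ** E h ?w) \<le> K1 * (norm h * C1)"
        unfolding B1_def using K10 by (intro order_trans[OF norm_cmat2_mult] mult_mono K1 E h r) auto
      then have "norm (h *m (B1 r ** E h ?w)) \<le> norm h * (K1 * (norm h * C1))" by (simp add: mult_left_mono)
      moreover have "norm (B \<eta> ?w ** D h ?w) \<le> L * norm (D h ?w)"
        by (intro order_trans[OF norm_cmat2_mult] mult_right_mono B assms r) auto
      ultimately show "norm (B \<eta> ?w ** D h ?w + h *m (B1 r ** E h ?w)) \<le> L * norm (D h ?w) + norm h * (K1 * (norm h * C1))"
        by (intro norm_triangle_le) linarith
    qed (use K10 C1 in auto)
    also have "\<dots> = (K * (K1 * C1) * X) * (norm h)\<^sup>2"
      by (simp add: D_def U(1) X_def W_def power2_eq_square)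
    finally show ?thesis .
  qed
  moreover have "K * (K1 * C1) * X \<ge> 0" using K(1) K10 C1 X by simp
  ultimately show ?thesis unfolding D_def by blast
qed

lemma U_eta_deriv:
  assumes "\<eta> \<noteq> 1" "\<eta> \<noteq> -1"
  shows "has_mderiv (\<lambda>\<eta>. U \<eta> w1) (W \<eta> w1) \<eta>"
proof -
  obtain C where "\<And>h s. norm (\<eta> + h) \<le> norm \<eta> + 1 \<Longrightarrow> s \<in> {0..1} \<Longrightarrow>
     norm (U (\<eta> + h) (path_w s) - U \<eta> (path_w s) - h *m W \<eta> (path_w s)) \<le> C * (norm h)\<^sup>2"
    using U_quadratic[OF assms, of "norm \<eta> + 1"] by auto
  from this[of _ 1] show ?thesis
    by (intro has_mderiv_quadratic[of _ _ _ C]) (simp add: norm_triangle_le)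
qed

section \<open>Transport of solutions and of their asymptotics\<close>

lemma msol_transport:
  assumes "msol (\<lambda>\<eta>. A \<eta> w0) D f" "D \<subseteq> - {1, -1}"
  shows "msol (\<lambda>\<eta>. A \<eta> w1) D (\<lambda>\<eta>. U \<eta> w1 ** f \<eta>)"
  unfolding msol_def
proof
  fix \<eta> assume e: "\<eta> \<in> D"
  have "has_mderiv (\<lambda>\<eta>. U \<eta> w1 ** f \<eta>) (W \<eta> w1 ** f \<eta> + U \<eta> w1 ** (A \<eta> w0 ** f \<eta>)) \<eta>"
    using assms e by (intro has_mderiv_mult U_eta_deriv) (auto simp: msol_def)
  then show "has_mderiv (\<lambda>\<eta>. U \<eta> w1 ** f \<eta>) (A \<eta> w1 ** (U \<eta> w1 ** f \<eta>)) \<eta>"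
    by (simp add: W_def cmat2_mult_algebra matrix_mul_assoc)
qed

definition eta_path where "eta_path \<tau> s = exp (\<tau> - path_w s)"

lemma eta_path_deriv: "(eta_path \<tau> has_vector_derivative - d * eta_path \<tau> s) (at s within T)"
proof -
  have "((\<lambda>s. \<tau> - path_w s) has_vector_derivative 0 - d) (at s within T)"
    by (intro has_vector_derivative_diff has_vector_derivative_const path_w_deriv)
  from field_vector_diff_chain_within[OF this DERIV_exp[THEN has_field_derivative_at_within]]
  show ?thesis by (simp add: o_def eta_path_def[abs_def])
qed

lemma Re_path_bound:
  assumes "s \<in> {0..1}"
  shows "\<bar>Re (e + w1 - path_w s) - Re e\<bar> \<le> norm d"
proof -
  have "e + w1 - path_w s - e = of_real (1 - s) * d" by (simp add: path_w_def d_def algebra_simps)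
  then have "Re (e + w1 - path_w s) - Re e = (1 - s) * Re d"
    by (metis Re_complex_of_real minus_complex.sel(1) scaleR_complex.sel(1) scaleR_conv_of_real)
  moreover have "(1 - s) * \<bar>Re d\<bar> \<le> 1 * norm d" using assms abs_Re_le_cmod[of d] by (intro mult_mono) auto
  ultimately show ?thesis using assms by (simp add: abs_mult)
qed

text \<open>Here \<open>\<eta>\<close> and \<open>w\<close> move together. The function is expanded
  to first order about the fixed value \<open>?\<eta> s\<close>, with an error quadratic in
  \<open>r - s\<close> uniformly in \<open>w\<close>; the expansion itself is then differentiated by
  the product rule.\<close>

lemma U_path_deriv:
  assumes "s \<in> {0..1}" "\<And>r. r \<in> {0..1} \<Longrightarrow> 2 \<le> norm (eta_path (e + w1) r)"
  shows "((\<lambda>r. U (eta_path (e + w1) r) (path_w r)) has_vector_derivative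
     d *m (B (eta_path (e + w1) s) (path_w s) ** U (eta_path (e + w1) s) (path_w s))
     + (- d * eta_path (e + w1) s) *m W (eta_path (e + w1) s) (path_w s)) (at s within {0..1})"
proof -
  let ?\<eta> = "eta_path (e + w1)"
  define \<rho> where "\<rho> = exp (Re e + norm d)"
  have \<eta>: "norm (?\<eta> r) \<le> \<rho>" if "r \<in> {0..1}" for r
    using Re_path_bound[OF that, of e] unfolding eta_path_def \<rho>_def norm_exp_eq_Re by (simp add: abs_le_iff)
  have ne: "?\<eta> s \<noteq> 1" "?\<eta> s \<noteq> -1" using assms(2)[OF assms(1)] by auto
  have "norm (?\<eta> s) \<le> \<rho>" "0 \<le> \<rho>" using \<eta>[OF assms(1)] by (auto simp: \<rho>_def)
  from U_quadratic[OF ne this(2,1)] obtain C where C: "C \<ge> 0"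
    "\<And>h r. norm (?\<eta> s + h) \<le> \<rho> \<Longrightarrow> r \<in> {0..1} \<Longrightarrow> norm (U (?\<eta> s + h) (path_w r) - U (?\<eta> s) (path_w r) - h *m W (?\<eta> s) (path_w r)) \<le> C * (norm h)\<^sup>2"
    by auto
  have lip: "norm (?\<eta> r - ?\<eta> s) \<le> \<rho> * norm d * \<bar>r - s\<bar>" if r: "r \<in> {0..1}" for r
  proof -
    have "norm (exp (e + w1 - path_w r) - exp (e + w1 - path_w s)) \<le> \<rho> * norm ((e + w1 - path_w r) - (e + w1 - path_w s))"
    proof (rule field_differentiable_bound[of "{z. Re z \<le> Re e + norm d}" exp exp])
      show "convex {z. Re z \<le> Re e + norm d}" by (rule convex_halfspace_Re_le)
      show "norm (exp z) \<le> \<rho>" if "z \<in> {z. Re z \<le> Re e + norm d}" for z :: complex using that by (simp add: \<rho>_def)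
      show "e + w1 - path_w r \<in> {z. Re z \<le> Re e + norm d}" "e + w1 - path_w s \<in> {z. Re z \<le> Re e + norm d}"
        using Re_path_bound[OF r, of e] Re_path_bound[OF assms(1), of e] by (simp_all add: abs_le_iff)
    qed (auto intro: has_field_derivative_at_within)
    also have "(e + w1 - path_w r) - (e + w1 - path_w s) = of_real (s - r) * d" by (simp add: path_w_def algebra_simps)
    finally show ?thesis by (simp add: eta_path_def norm_mult abs_minus_commute mult_ac del: of_real_diff)
  qed
  define h where "h r = ?\<eta> r - ?\<eta> s" for r
  define g where "g r = U (?\<eta> r) (path_w r) - U (?\<eta> s) (path_w r) - h r *m W (?\<eta> s) (path_w r)" for r
  have "(g has_vector_derivative 0) (at s within {0..1})"
  proof (rule has_vector_derivative_quadratic_zero[OF assms(1)])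
    fix r :: real assume r: "r \<in> {0..1}"
    have "norm (g r) \<le> C * (norm (h r))\<^sup>2"
      using C(2)[of "h r" r] \<eta>[OF r] r by (simp add: g_def h_def)
    also have "\<dots> \<le> C * (\<rho> * norm d * \<bar>r - s\<bar>)\<^sup>2"
      using lip[OF r] C(1) by (intro mult_left_mono power_mono) (auto simp: h_def)
    also have "\<dots> = C * (\<rho> * norm d)\<^sup>2 * (r - s)\<^sup>2" by (simp add: power_mult_distrib)
    finally show "norm (g r) \<le> C * (\<rho> * norm d)\<^sup>2 * (r - s)\<^sup>2" .
  qed
  moreover have "((\<lambda>r. U (?\<eta> s) (path_w r)) has_vector_derivative d *m (B (?\<eta> s) (path_w s) ** U (?\<eta> s) (path_w s))) (at s within {0..1})"
    by (rule has_mderiv_curve[OF U(2)[OF path_w_in[OF assms(1)]] path_w_deriv])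
  moreover have "((\<lambda>r. h r *m W (?\<eta> s) (path_w r)) has_vector_derivative
      h s *m (d *m (((exp (path_w s) / 4) *m sigma3) ** U (?\<eta> s) (path_w s) + B (?\<eta> s) (path_w s) ** W (?\<eta> s) (path_w s)))
      + (- d * ?\<eta> s) *m W (?\<eta> s) (path_w s)) (at s within {0..1})"
  proof (rule cscale.has_vector_derivative)
    show "(h has_vector_derivative - d * ?\<eta> s) (at s within {0..1})"
      unfolding h_def using has_vector_derivative_diff[OF eta_path_deriv has_vector_derivative_const] by simp
    show "((\<lambda>r. W (?\<eta> s) (path_w r)) has_vector_derivative
        d *m (((exp (path_w s) / 4) *m sigma3) ** U (?\<eta> s) (path_w s) + B (?\<eta> s) (path_w s) ** W (?\<eta> s) (path_w s))) (at s within {0..1})"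
      by (rule has_mderiv_curve[OF W_deriv[OF path_w_in[OF assms(1)] ne] path_w_deriv])
  qed
  ultimately have "((\<lambda>r. U (?\<eta> s) (path_w r) + h r *m W (?\<eta> s) (path_w r) + g r) has_vector_derivative
     (d *m (B (?\<eta> s) (path_w s) ** U (?\<eta> s) (path_w s)) + (h s *m (d *m (((exp (path_w s) / 4) *m sigma3) ** U (?\<eta> s) (path_w s) + B (?\<eta> s) (path_w s) ** W (?\<eta> s) (path_w s)))
      + (- d * ?\<eta> s) *m W (?\<eta> s) (path_w s)) + 0)) (at s within {0..1})"
    by (intro has_vector_derivative_add)
  then show ?thesis by (simp add: g_def h_def)
qed

text \<open>Along the curve \<open>e + w\<close> is constant, so the sector is not left. There the
  error \<open>F\<close> of the transported solution obeys a linear equation with bounded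
  coefficients and an inhomogeneity of order \<open>1 / norm \<eta>\<close>, and Gronwall's
  inequality carries the bound from \<open>w0\<close> to \<open>w1\<close>.\<close>

lemma canon_transport:
  assumes X: "canon th w0 (P w0) (Q w0) k X"
  shows "canon th w1 (P w1) (Q w1) k (\<lambda>e. U (exp e) w1 ** X e)"
  unfolding canon_def
proof (intro conjI allI impI)
  have sol: "msol (\<lambda>e. exp e *m A (exp e) w0) {e. 0 < Re e} X" using X by (simp add: canon_def)
  have ne: "exp e \<noteq> 1 \<and> exp e \<noteq> -1" if "0 < Re e" for e
    using that by (metis norm_exp_eq_Re norm_minus_cancel norm_one one_less_exp_iff less_irrefl)
  show "msol (\<lambda>e. exp e *m A (exp e) w1) {e. 0 < Re e} (\<lambda>e. U (exp e) w1 ** X e)"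
    unfolding msol_def
  proof
    fix e assume e: "e \<in> {e. 0 < Re e}"
    have "has_mderiv (\<lambda>e. U (exp e) w1 ** X e) ((exp e *m W (exp e) w1) ** X e + U (exp e) w1 ** (exp e *m A (exp e) w0 ** X e)) e"
      using sol e ne[of e] by (intro has_mderiv_mult has_mderiv_compose[OF U_eta_deriv DERIV_exp]) (auto simp: msol_def)
    then show "has_mderiv (\<lambda>e. U (exp e) w1 ** X e) (exp e *m A (exp e) w1 ** (U (exp e) w1 ** X e)) e"
      by (simp add: W_def cmat2_mult_algebra cscale_mult cscale.diff_right matrix_mul_assoc)
  qed
  fix \<delta> :: real assume "\<delta> > 0"
  then obtain C R where CR: "\<And>e. R < Re e \<Longrightarrow> \<bar>Im (e + w0) - pi / 2 - (of_int k - 2) * pi\<bar> \<le> pi - \<delta> \<Longrightarrow>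
        norm (X e ** exp_sigma3 (- canon_exponent th w0 e) - mat 1) \<le> C * exp (- Re e)"
    using X unfolding canon_def by meson
  obtain K where K: "K \<ge> 1" "norm d \<le> K" "norm ((th / 2) *m sigma3) \<le> K" "\<And>s. s \<in> {0..1} \<Longrightarrow> norm (exp (path_w s)) \<le> K"
     "\<And>s. s \<in> {0..1} \<Longrightarrow> norm (P (path_w s)) \<le> K" "\<And>s. s \<in> {0..1} \<Longrightarrow> norm (Q (path_w s)) \<le> K"
    using bounds by auto
  define k1 where "k1 = 4 * K * exp (norm d)"
  have k1: "k1 \<ge> 0" using K(1) by (simp add: k1_def)
  define L where "L = norm d * (2 * (K * norm sigma3 + K) + k1)"
  have L: "L \<ge> 0" unfolding L_def using K(1) k1 by (intro mult_nonneg_nonneg add_nonneg_nonneg) auto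
  define C' where "C' = (\<bar>C\<bar> * exp (norm d) + norm d * (k1 * 2)) * exp (L + 1)"
  show "\<exists>C R. \<forall>e. R < Re e \<and> \<bar>Im (e + w1) - pi / 2 - (of_int k - 2) * pi\<bar> \<le> pi - \<delta> \<longrightarrow>
        norm (U (exp e) w1 ** X e ** exp_sigma3 (- canon_exponent th w1 e) - mat 1) \<le> C * exp (- Re e)"
  \<comment> \<open>The margin \<open>norm d + 1\<close> keeps the real part at least 1 on the whole
    curve, hence \<open>norm \<eta> \<ge> 2\<close>, away from the singular points.\<close>
  proof (rule exI[of _ C'], rule exI[of _ "max R 0 + norm d + 1"], intro allI impI)
    fix e assume e: "max R 0 + norm d + 1 < Re e \<and> \<bar>Im (e + w1) - pi / 2 - (of_int k - 2) * pi\<bar> \<le> pi - \<delta>"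
    let ?\<tau> = "e + w1"
    let ?\<eta> = "eta_path ?\<tau>"
    have e1d: "1 \<le> Re e - norm d" "R < Re e - norm d" "0 \<le> Re e" using e norm_ge_zero[of d] by linarith+
    have Re: "Re e - norm d \<le> Re (?\<tau> - path_w s)" if "s \<in> {0..1}" for s
      using Re_path_bound[OF that, of e] by (simp add: abs_le_iff)
    have pos: "0 < Re (?\<tau> - path_w s)" if "s \<in> {0..1}" for s using Re[OF that] e by linarith
    have n\<eta>: "exp (Re e - norm d) \<le> norm (?\<eta> s)" if "s \<in> {0..1}" for s
      using Re[OF that] by (simp only: eta_path_def norm_exp_eq_Re exp_le_cancel_iff)
    have n2: "2 \<le> norm (?\<eta> s)" if "s \<in> {0..1}" for s
    proof -
      have "2 \<le> exp (1 :: real)" using exp_ge_add_one_self[of 1] by simp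
      also have "\<dots> \<le> exp (Re e - norm d)" using e1d by simp
      finally show ?thesis using n\<eta>[OF that] by linarith
    qed
    define \<Phi> where "\<Phi> s = U (?\<eta> s) (path_w s) ** X (?\<tau> - path_w s)" for s
    define T where "T s = canon_exponent th (path_w s) (?\<tau> - path_w s)" for s
    \<comment> \<open>The derivative of the exponent \<open>T\<close> with respect to
      \<open>w\<close> on the curve, where \<open>exp (e + w)\<close> is constant.\<close>
    define c where "c s = exp (path_w s) / 4 + th / 2" for s
    define E where "E s = (1 / (?\<eta> s + 1)) *m P (path_w s) - (1 / (?\<eta> s - 1)) *m Q (path_w s)" for s
    have d\<Phi>: "(\<Phi> has_vector_derivative d *m ((c s *m sigma3 + E s) ** \<Phi> s)) (at s within {0..1})" if s: "s \<in> {0..1}" for s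
    proof -
      let ?e = "?\<tau> - path_w s" and ?w = "path_w s"
      have "((\<lambda>s. ?\<tau> - path_w s) has_vector_derivative 0 - d) (at s within {0..1})"
        by (intro has_vector_derivative_diff has_vector_derivative_const path_w_deriv)
      from has_mderiv_curve[OF _ this, of X] sol pos[OF s]
      have dX: "((\<lambda>s. X (?\<tau> - path_w s)) has_vector_derivative (0 - d) *m (exp ?e *m A (exp ?e) w0 ** X ?e)) (at s within {0..1})"
        by (simp add: msol_def)
      have ne1: "?\<eta> s + 1 \<noteq> 0" "?\<eta> s - 1 \<noteq> 0" using n2[OF s] by (auto simp: add_eq_0_iff2)
      \<comment> \<open>The terms linear in \<open>\<eta>\<close> cancel; this is the gain from
        moving along the curve.\<close>
      have BA: "B (?\<eta> s) ?w - ?\<eta> s *m A (?\<eta> s) ?w = c s *m sigma3 + E s"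
      proof -
        have f: "1 - ?\<eta> s * (1 / (?\<eta> s + 1)) = 1 / (?\<eta> s + 1)" "1 - ?\<eta> s * (1 / (?\<eta> s - 1)) = - (1 / (?\<eta> s - 1))"
          using ne1 by (simp_all add: field_simps)
        have "B (?\<eta> s) ?w - ?\<eta> s *m A (?\<eta> s) ?w = c s *m sigma3 + ((1 - ?\<eta> s * (1 / (?\<eta> s + 1))) *m P ?w + (1 - ?\<eta> s * (1 / (?\<eta> s - 1))) *m Q ?w)"
          by (simp add: deform_coeff_def eta_coeff_def c_def cmat2_eq_iff algebra_simps add_divide_distrib)
        then show ?thesis unfolding f E_def by (simp add: cmat2_eq_iff)
      qed
      have "(\<Phi> has_vector_derivative U (?\<eta> s) ?w ** ((0 - d) *m (exp ?e *m A (exp ?e) w0 ** X ?e)) +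
          (d *m (B (?\<eta> s) ?w ** U (?\<eta> s) ?w) + (- d * ?\<eta> s) *m W (?\<eta> s) ?w) ** X ?e) (at s within {0..1})"
        unfolding \<Phi>_def by (rule cmult.has_vector_derivative[OF U_path_deriv[OF s n2] dX])
      moreover have "U (?\<eta> s) ?w ** ((0 - d) *m (exp ?e *m A (exp ?e) w0 ** X ?e)) +
          (d *m (B (?\<eta> s) ?w ** U (?\<eta> s) ?w) + (- d * ?\<eta> s) *m W (?\<eta> s) ?w) ** X ?e
          = d *m ((B (?\<eta> s) ?w - ?\<eta> s *m A (?\<eta> s) ?w) ** \<Phi> s)"
      proof -
        have ex: "exp ?e = ?\<eta> s" by (simp add: eta_path_def)
        have "U' ** ((0 - d) *m (y *m A0 ** X')) + (d *m (B' ** U') + (- d * y) *m (A' ** U' - U' ** A0)) ** X'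
           = d *m ((B' - y *m A') ** (U' ** X'))" for U' A0 X' B' A' :: cmat2 and y
        proof -
          have "((0 - d) :: complex) = - d" by simp
          have m: "(- a) *m M = - (a *m M)" for a M by (simp add: cmat2_eq_iff)
          show ?thesis
            by (simp add: m cmat2_mult_algebra cscale_mult cscale.add_right cscale.diff_right matrix_mul_assoc)
        qed
        then show ?thesis unfolding ex W_def \<Phi>_def by blast
      qed
      ultimately show ?thesis by (simp add: BA)
    qed
    have Teq: "T s = (exp ?\<tau> + exp (path_w s)) / 4 - th / 2 * (?\<tau> - path_w s - of_real (ln 2))" for s
      by (simp add: T_def canon_exponent_def exp_diff field_simps)
    have dT: "(T has_vector_derivative c s * d) (at s within {0..1})" for s
    proof -
      have "((\<lambda>w. (exp ?\<tau> + exp w) / 4 - th / 2 * (?\<tau> - w - of_real (ln 2))) has_field_derivative c s) (at (path_w s) within path_w ` {0..1})"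
        unfolding c_def by (auto intro!: derivative_eq_intros)
      from field_vector_diff_chain_within[OF path_w_deriv this] show ?thesis
        by (simp add: o_def Teq[abs_def] mult.commute)
    qed
    have dE: "((\<lambda>s. exp_sigma3 (- T s)) has_vector_derivative (c s * d) *m (- (sigma3 ** exp_sigma3 (- T s)))) (at s within {0..1})" for s
    proof -
      have "has_mderiv (\<lambda>a. exp_sigma3 (- a)) (- (sigma3 ** exp_sigma3 (- T s))) (T s)"
        unfolding has_mderiv_iff forall_2 by (auto simp: exp_sigma3_def sigma3_def cmat2_mult_nth intro!: derivative_eq_intros)
      from has_mderiv_curve[OF this dT] show ?thesis .
    qed
    define F where "F s = \<Phi> s ** exp_sigma3 (- T s) - mat 1" for s
    have comm: "sigma3 ** exp_sigma3 a = exp_sigma3 a ** sigma3" for a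
      by (simp add: sigma3_def exp_sigma3_def mat2_mult)
    \<comment> \<open>The exponential factor on the right contributes
      \<open>- (F s ** sigma3)\<close>, so the diagonal part enters only through a commutator, which
      annihilates \<open>mat 1\<close>.\<close>
    have dF: "(F has_vector_derivative d *m (c s *m (sigma3 ** F s - F s ** sigma3) + E s ** (F s + mat 1))) (at s within {0..1})"
      if s: "s \<in> {0..1}" for s
    proof -
      have "(F has_vector_derivative (\<Phi> s ** ((c s * d) *m (- (sigma3 ** exp_sigma3 (- T s)))) + d *m ((c s *m sigma3 + E s) ** \<Phi> s) ** exp_sigma3 (- T s)) - 0) (at s within {0..1})"
        unfolding F_def by (intro has_vector_derivative_diff has_vector_derivative_const cmult.has_vector_derivative[OF d\<Phi>[OF s] dE])
      moreover have "(\<Phi> s ** ((c s * d) *m (- (sigma3 ** exp_sigma3 (- T s)))) + d *m ((c s *m sigma3 + E s) ** \<Phi> s) ** exp_sigma3 (- T s)) - 0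
         = d *m (c s *m (sigma3 ** F s - F s ** sigma3) + E s ** (F s + mat 1))"
      proof -
        have "\<Phi> s ** ((c s * d) *m (- (sigma3 ** exp_sigma3 (- T s)))) = (c s * d) *m (- (\<Phi> s ** exp_sigma3 (- T s) ** sigma3))"
          by (simp add: comm cscale_mult cmat2_mult_algebra matrix_mul_assoc)
        then show ?thesis
          unfolding F_def by (simp add: cscale_mult cmat2_mult_algebra cscale.add_right cscale.diff_right matrix_mul_assoc cscale.minus_right mult.commute)
      qed
      ultimately show ?thesis by simp
    qed
    have nE: "norm (E s) \<le> k1 * exp (- Re e)" if s: "s \<in> {0..1}" for s
    proof -
      have h: "norm (?\<eta> s) / 2 \<le> norm (?\<eta> s + 1)" "norm (?\<eta> s) / 2 \<le> norm (?\<eta> s - 1)"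
        using n2[OF s] norm_triangle_ineq2[of "?\<eta> s" "-1"] norm_triangle_ineq2[of "?\<eta> s" 1] by auto
      have pos2: "0 < norm (?\<eta> s) / 2" using n2[OF s] by linarith
      have i: "norm (1 / (?\<eta> s + 1)) \<le> 2 / norm (?\<eta> s)" "norm (1 / (?\<eta> s - 1)) \<le> 2 / norm (?\<eta> s)"
      proof -
        have p: "0 < norm (?\<eta> s + 1)" "0 < norm (?\<eta> s - 1)" using h pos2 by linarith+
        show "norm (1 / (?\<eta> s + 1)) \<le> 2 / norm (?\<eta> s)" "norm (1 / (?\<eta> s - 1)) \<le> 2 / norm (?\<eta> s)"
          using divide_left_mono[OF h(1) zero_le_one mult_pos_pos[OF p(1) pos2]]
            divide_left_mono[OF h(2) zero_le_one mult_pos_pos[OF p(2) pos2]] by (simp_all add: norm_divide)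
      qed
      have "norm (E s) \<le> norm (1 / (?\<eta> s + 1)) * norm (P (path_w s)) + norm (1 / (?\<eta> s - 1)) * norm (Q (path_w s))"
        unfolding E_def using norm_triangle_ineq4[of "(1 / (?\<eta> s + 1)) *m P (path_w s)" "(1 / (?\<eta> s - 1)) *m Q (path_w s)"] by simp
      also have "\<dots> \<le> 2 / norm (?\<eta> s) * K + 2 / norm (?\<eta> s) * K"
        using i K(5,6)[OF s] by (intro add_mono mult_mono) auto
      also have "\<dots> = 4 * K * (1 / norm (?\<eta> s))" by simp
      also have "\<dots> \<le> 4 * K * (1 / exp (Re e - norm d))"
        using n\<eta>[OF s] K(1) pos2 by (intro mult_left_mono divide_left_mono) auto
      also have "\<dots> = k1 * exp (- Re e)" by (simp add: k1_def exp_diff exp_minus field_simps)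
      finally show ?thesis .
    qed
    have e1: "exp (- Re e) \<le> 1" using e1d(3) by simp
    have "norm (F 1) \<le> (norm (F 0) + norm d * (k1 * 2 * exp (- Re e))) * exp ((L + 1) * (1 - 0))"
    proof (rule gronwall_inhom[OF _ dF])
      fix s :: real assume s: "s \<in> {0..1}"
      have "norm (c s *m (sigma3 ** F s - F s ** sigma3)) \<le> 2 * (K * norm sigma3 + K) * norm (F s)"
      proof -
        have "norm ((c s *m sigma3) ** F s - F s ** (c s *m sigma3)) \<le> 2 * (norm (c s *m sigma3) * norm (F s))"
          using norm_triangle_ineq4[of "(c s *m sigma3) ** F s" "F s ** (c s *m sigma3)"]
            norm_cmat2_mult[of "c s *m sigma3" "F s"] norm_cmat2_mult[of "F s" "c s *m sigma3"]
          by (simp add: mult.commute)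
        moreover have "norm (c s *m sigma3) \<le> K * norm sigma3 + K"
        proof -
          have "c s *m sigma3 = (exp (path_w s) / 4) *m sigma3 + (th / 2) *m sigma3" by (simp add: c_def cscale.add_left)
          then have "norm (c s *m sigma3) \<le> norm (exp (path_w s) / 4) * norm sigma3 + norm ((th / 2) *m sigma3)"
            by (metis norm_triangle_ineq norm_cscale)
          also have "\<dots> \<le> K * norm sigma3 + K"
            using K(3) K(4)[OF s] K(1) by (intro add_mono mult_right_mono) (auto simp: norm_divide)
          finally show ?thesis .
        qed
        ultimately have "norm ((c s *m sigma3) ** F s - F s ** (c s *m sigma3)) \<le> 2 * ((K * norm sigma3 + K) * norm (F s))"
          by (meson mult_left_mono mult_right_mono norm_ge_zero order_trans zero_le_numeral)
        then show ?thesis by (simp only: cscale_mult cscale.diff_right mult.assoc)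
      qed
      moreover have "norm (E s ** (F s + mat 1)) \<le> k1 * exp (- Re e) * norm (F s) + k1 * exp (- Re e) * 2"
      proof -
        have "norm (E s ** (F s + mat 1)) \<le> k1 * exp (- Re e) * (norm (F s) + 2)"
          using nE[OF s] k1 norm_triangle_ineq[of "F s" "mat 1"] norm_mat_1_le
          by (intro order_trans[OF norm_cmat2_mult] mult_mono) auto
        then show ?thesis by (simp add: distrib_left)
      qed
      moreover have "k1 * exp (- Re e) * norm (F s) \<le> k1 * norm (F s)"
        using e1 k1 by (intro mult_right_mono) (auto intro: mult_left_le)
      ultimately have "norm (c s *m (sigma3 ** F s - F s ** sigma3) + E s ** (F s + mat 1)) \<le>
         2 * (K * norm sigma3 + K) * norm (F s) + k1 * norm (F s) + k1 * 2 * exp (- Re e)"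
        by (intro norm_triangle_le) (simp add: mult_ac)
      then have "norm d * norm (c s *m (sigma3 ** F s - F s ** sigma3) + E s ** (F s + mat 1)) \<le>
         norm d * (2 * (K * norm sigma3 + K) * norm (F s) + k1 * norm (F s) + k1 * 2 * exp (- Re e))"
        by (rule mult_left_mono) simp
      then show "norm (d *m (c s *m (sigma3 ** F s - F s ** sigma3) + E s ** (F s + mat 1))) \<le> L * norm (F s) + norm d * (k1 * 2 * exp (- Re e))"
        by (simp add: L_def algebra_simps)
    qed (use L k1 in auto)
    moreover have "norm (F 0) \<le> \<bar>C\<bar> * exp (norm d) * exp (- Re e)"
    proof -
      have "norm (F 0) = norm (X (?\<tau> - w0) ** exp_sigma3 (- canon_exponent th w0 (?\<tau> - w0)) - mat 1)"
        by (simp add: F_def \<Phi>_def T_def U(1))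
      also have "\<dots> \<le> C * exp (- Re (?\<tau> - w0))"
      proof (rule CR)
        show "R < Re (?\<tau> - w0)" using Re[of 0] e1d(2) by simp
        show "\<bar>Im (?\<tau> - w0 + w0) - pi / 2 - (of_int k - 2) * pi\<bar> \<le> pi - \<delta>" using e by simp
      qed
      also have "\<dots> \<le> \<bar>C\<bar> * exp (norm d - Re e)"
        using Re[of 0] by (intro mult_mono) auto
      also have "\<dots> = \<bar>C\<bar> * exp (norm d) * exp (- Re e)" by (simp add: exp_diff exp_minus divide_inverse)
      finally show ?thesis .
    qed
    ultimately have "norm (F 1) \<le> (\<bar>C\<bar> * exp (norm d) * exp (- Re e) + norm d * (k1 * 2 * exp (- Re e))) * exp (L + 1)"
      by (simp add: order_trans mult_right_mono)
    also have "\<dots> = C' * exp (- Re e)" by (simp add: C'_def algebra_simps)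
    finally have "norm (F 1) \<le> C' * exp (- Re e)" .
    then show "norm (U (exp e) w1 ** X e ** exp_sigma3 (- canon_exponent th w1 e) - mat 1) \<le> C' * exp (- Re e)"
      by (simp add: F_def \<Phi>_def T_def eta_path_def)
  qed
qed

theorem mono_rep_transport:
  assumes "mono_rep th w0 (P w0) (Q w0) N"
  shows "mono_rep th w1 (P w1) (Q w1) N"
proof -
  obtain X fL fM fR where X: "canon th w0 (P w0) (Q w0) 2 X" and s: "sheets (exp w0) (P w0) (Q w0) X N fL fM fR"
    using assms by (auto simp: mono_rep_def)
  have "sheets (exp w1) (P w1) (Q w1) (\<lambda>e. U (exp e) w1 ** X e) N (\<lambda>\<eta>. U \<eta> w1 ** fL \<eta>) (\<lambda>\<eta>. U \<eta> w1 ** fM \<eta>) (\<lambda>\<eta>. U \<eta> w1 ** fR \<eta>)"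
    using s msol_transport[OF _ cuts_avoid(1)] msol_transport[OF _ cuts_avoid(2)] msol_transport[OF _ cuts_avoid(3)]
    unfolding sheets_def by (auto simp: matrix_mul_assoc)
  with canon_transport[OF X] show ?thesis unfolding mono_rep_def by blast
qed

end

text \<open>Transport works in convex sets, hence between any two points of a small ball;
  connectedness does the rest. No path is singled out, so the statement covers domains that are not
  simply connected.\<close>

theorem mono_rep_constant:
  assumes G: "open G" "connected G"
    and P: "\<And>w. w \<in> G \<Longrightarrow> has_mderiv P ((P w + Q w + (th / 2) *m sigma3) ** P w - P w ** (P w + Q w + (th / 2) *m sigma3)) w"
    and Q: "\<And>w. w \<in> G \<Longrightarrow> has_mderiv Q (((exp w / 2) *m sigma3 + (P w + Q w + (th / 2) *m sigma3)) ** Q w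
         - Q w ** ((exp w / 2) *m sigma3 + (P w + Q w + (th / 2) *m sigma3))) w"
    and "\<And>w. w \<in> G \<Longrightarrow> trace (P w) = 0" "\<And>w. w \<in> G \<Longrightarrow> trace (Q w) = 0"
    and "a \<in> G" "b \<in> G" "mono_rep th a (P a) (Q a) N"
  shows "mono_rep th b (P b) (Q b) N"
proof (rule connected_induction_simple[where S = G and P = "\<lambda>w. mono_rep th w (P w) (Q w) N", OF G(2) assms(7-9)])
  fix w assume "w \<in> G"
  then obtain r where r: "r > 0" "ball w r \<subseteq> G" using G(1) openE by blast
  show "\<exists>T. openin (top_of_set G) T \<and> w \<in> T \<and> (\<forall>x\<in>T. \<forall>y\<in>T. mono_rep th x (P x) (Q x) N \<longrightarrow> mono_rep th y (P y) (Q y) N)"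
  proof (intro exI[of _ "ball w r"] conjI ballI impI)
    show "openin (top_of_set G) (ball w r)" using r(2) by (simp add: openin_open_eq G(1))
    show "w \<in> ball w r" using r by simp
    fix x y assume xy: "x \<in> ball w r" "y \<in> ball w r" and m: "mono_rep th x (P x) (Q x) N"
    interpret isomonodromy "ball w r" x y th P Q
      by unfold_locales (use xy r P Q assms(5,6) in auto)
    show "mono_rep th y (P y) (Q y) N" by (rule mono_rep_transport[OF m])
  qed
qed


section \<open>The symmetry of the fifth Painleve equation under half turns\<close>

lemma exp_mult_ddx: "exp w * ddx f w = deriv f w"
  by (simp add: ddx_def)

lemma ddx_reciprocal_shift:
  assumes "exp c = -1" "y field_differentiable at (w + c)" "y (w + c) \<noteq> 0"
  shows "ddx (\<lambda>w. 1 / y (w + c)) w = ddx y (w + c) / (y (w + c))\<^sup>2"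
proof -
  have "(y has_field_derivative deriv y (w + c)) (at (w + c))"
    using assms(2) by (simp add: field_differentiable_derivI)
  then have "((\<lambda>w. y (w + c)) has_field_derivative deriv y (w + c)) (at w)" by (simp add: DERIV_shift)
  then have "((\<lambda>w. 1 / y (w + c)) has_field_derivative - deriv y (w + c) / (y (w + c))\<^sup>2) (at w)"
    using assms(3) by (auto intro!: derivative_eq_intros simp: power2_eq_square)
  then show ?thesis using assms(1) by (simp add: ddx_def DERIV_imp_deriv exp_add)
qed

lemma ddx_ddx_reciprocal_shift:
  assumes "exp c = -1" "open G" "y holomorphic_on G" "\<And>w. w \<in> G \<Longrightarrow> y w \<noteq> 0" "w + c \<in> G"
  shows "ddx (ddx (\<lambda>w. 1 / y (w + c))) w
    = - (ddx (ddx y) (w + c) / (y (w + c))\<^sup>2 - 2 * (ddx y (w + c))\<^sup>2 / (y (w + c))^3)"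
proof -
  have dy: "(y has_field_derivative deriv y v) (at v)" if "v \<in> G" for v
    using holomorphic_derivI[OF assms(3,2) that] .
  have "(\<lambda>v. deriv y v / exp v) holomorphic_on G" using assms(2,3) by (intro holomorphic_intros) auto
  then have hd: "ddx y holomorphic_on G" by (simp add: ddx_def[abs_def])
  have ev: "\<forall>\<^sub>F v in nhds w. ddx (\<lambda>w. 1 / y (w + c)) v = ddx y (v + c) / (y (v + c))\<^sup>2"
  proof -
    have "open ((\<lambda>v. v + c) -` G)" by (rule open_vimage[OF assms(2)]) (intro continuous_intros)
    then have "\<forall>\<^sub>F v in nhds w. v \<in> (\<lambda>v. v + c) -` G" using assms(5) by (intro eventually_nhds_in_open) auto
    then show ?thesis
    proof eventually_elim
      case (elim v)
      then show ?case
        using assms dy by (intro ddx_reciprocal_shift) (auto simp: field_differentiable_def)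
    qed
  qed
  have "(ddx y has_field_derivative deriv (ddx y) (w + c)) (at (w + c))"
    by (rule holomorphic_derivI[OF hd assms(2,5)])
  then have "((\<lambda>v. ddx y (v + c)) has_field_derivative deriv (ddx y) (w + c)) (at w)"
    by (simp add: DERIV_shift)
  moreover have "((\<lambda>v. y (v + c)) has_field_derivative deriv y (w + c)) (at w)"
    using dy[OF assms(5)] by (simp add: DERIV_shift)
  ultimately have "((\<lambda>v. ddx y (v + c) / (y (v + c))\<^sup>2) has_field_derivative
      deriv (ddx y) (w + c) / (y (w + c))\<^sup>2 - 2 * ddx y (w + c) * deriv y (w + c) / (y (w + c))^3) (at w)"
    using assms(4)[OF assms(5)]
    by (auto intro!: derivative_eq_intros simp: power2_eq_square power3_eq_cube field_simps)
  then have "deriv (ddx (\<lambda>w. 1 / y (w + c))) w = deriv (ddx y) (w + c) / (y (w + c))\<^sup>2 - 2 * ddx y (w + c) * deriv y (w + c) / (y (w + c))^3"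
    unfolding deriv_cong_ev[OF ev refl] by (rule DERIV_imp_deriv)
  moreover have "exp (w + c) = - exp w" using assms(1) by (simp add: exp_add)
  ultimately show ?thesis
    by (simp add: ddx_def field_simps power2_eq_square)
qed

text \<open>Inverting \<open>y\<close> exchanges \<open>a\<close> and \<open>b\<close> and reverses
  the sign of \<open>c\<close>, which \<open>x \<mapsto> - x\<close> restores; and exchanging
  \<open>a\<close> and \<open>b\<close> is the same as reversing the sign of
  \<open>\<theta>i\<close>.\<close>

lemma PV_equation_half_turn:
  assumes "exp c = -1" "open G" "y holomorphic_on G" "\<And>w. w \<in> G \<Longrightarrow> y w \<noteq> 0" "w + c \<in> G" "y (w + c) \<noteq> 1"
    "PV_equation \<theta>0 \<theta>1 \<theta>i y (w + c)"
  shows "PV_equation \<theta>0 \<theta>1 (- \<theta>i) (\<lambda>w. 1 / y (w + c)) w"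
proof -
  define Y Y' Y'' X where "Y = y (w + c)" and "Y' = ddx y (w + c)" and "Y'' = ddx (ddx y) (w + c)" and "X = exp (w + c)"
  define a b c' where "a = (\<theta>0 - \<theta>1 + \<theta>i)\<^sup>2 / 8" and "b = (\<theta>0 - \<theta>1 - \<theta>i)\<^sup>2 / 8" and "c' = 1 - \<theta>0 - \<theta>1"
  have Y: "Y \<noteq> 0" "Y - 1 \<noteq> 0" using assms by (auto simp: Y_def)
  have X: "X \<noteq> 0" "exp w = - X" using assms(1) by (simp_all add: X_def exp_add)
  have 1: "ddx (\<lambda>w. 1 / y (w + c)) w = Y' / Y\<^sup>2"
    unfolding Y_def Y'_def using assms holomorphic_on_imp_differentiable_at[OF assms(3,2,5)]
    by (intro ddx_reciprocal_shift) auto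
  have 2: "ddx (ddx (\<lambda>w. 1 / y (w + c))) w = - (Y'' / Y\<^sup>2 - 2 * Y'\<^sup>2 / Y^3)"
    unfolding Y_def Y'_def Y''_def by (rule ddx_ddx_reciprocal_shift[OF assms(1-5)])
  have e: "Y'' = (1 / (2 * Y) + 1 / (Y - 1)) * Y'\<^sup>2 - Y' / X + (Y - 1)\<^sup>2 / X\<^sup>2 * (a * Y - b / Y) + c' * Y / X - Y * (Y + 1) / (2 * (Y - 1))"
    using assms(7) by (simp add: PV_equation_def Let_def Y_def Y'_def Y''_def X_def a_def b_def c'_def)
  have i: "1 / Y - 1 = - ((Y - 1) / Y)" using Y by (simp add: field_simps)
  have "- (Y'' / Y\<^sup>2 - 2 * Y'\<^sup>2 / Y^3) = (1 / (2 * (1 / Y)) + 1 / (1 / Y - 1)) * (Y' / Y\<^sup>2)\<^sup>2 - (Y' / Y\<^sup>2) / (- X)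
       + (1 / Y - 1)\<^sup>2 / (- X)\<^sup>2 * (b * (1 / Y) - a / (1 / Y)) + c' * (1 / Y) / (- X) - 1 / Y * (1 / Y + 1) / (2 * (1 / Y - 1))"
  proof -
    define k where "k = Y - 1"
    have k: "k \<noteq> 0" "Y = k + 1" using Y by (auto simp: k_def)
    \<comment> \<open>The five terms are matched one by one. Only the first mixes with the quadratic
      term in the second derivative of \<open>1 / y\<close>.\<close>
    have t1: "- ((1 / (2 * Y) + 1 / k) * Y'\<^sup>2 / Y\<^sup>2 - 2 * Y'\<^sup>2 / Y^3) = (Y / 2 - Y / k) * (Y' / Y\<^sup>2)\<^sup>2"
    proof -
      define r where "r = 1 / k"
      have r: "Y * r = 1 + r" "Y / k = Y * r" using k by (auto simp: r_def field_simps)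
      show ?thesis unfolding r(2) r_def[symmetric] using Y(1) 
        by (simp add: field_simps power2_eq_square power3_eq_cube) (insert r(1), algebra)
    qed
    have t2: "- ((k\<^sup>2 / X\<^sup>2 * (a * Y - b / Y)) / Y\<^sup>2) = (k / Y)\<^sup>2 / X\<^sup>2 * (b / Y - a * Y)"
      using Y(1) X(1) by (simp add: field_simps power2_eq_square)
    have t3: "- (- (Y' / X) / Y\<^sup>2) = (Y' / Y\<^sup>2) / X" by simp
    have t4: "- (c' * Y / X / Y\<^sup>2) = - (c' / Y / X)" using Y(1) X(1) by (simp add: field_simps power2_eq_square)
    have t5: "- (- (Y * (Y + 1) / (2 * k)) / Y\<^sup>2) = 1 / Y * (1 / Y + 1) / (2 * (k / Y))"
      using Y(1) k by (simp add: field_simps power2_eq_square)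
    have L: "- (Y'' / Y\<^sup>2 - 2 * Y'\<^sup>2 / Y^3) = - ((1 / (2 * Y) + 1 / k) * Y'\<^sup>2 / Y\<^sup>2 - 2 * Y'\<^sup>2 / Y^3)
       + - ((k\<^sup>2 / X\<^sup>2 * (a * Y - b / Y)) / Y\<^sup>2) + - (- (Y' / X) / Y\<^sup>2) + - (c' * Y / X / Y\<^sup>2) + - (- (Y * (Y + 1) / (2 * k)) / Y\<^sup>2)"
      unfolding e k_def[symmetric] by (simp only: add_divide_distrib diff_divide_distrib) (simp add: algebra_simps)
    show ?thesis
      unfolding L t1 t2 t3 t4 t5 i k_def[symmetric] using Y(1) by (simp add: algebra_simps)
  qed
  then show ?thesis
    unfolding PV_equation_def Let_def 1 2 X(2) Y_def[symmetric] a_def b_def c'_def by simp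
qed


text \<open>The companions of \<open>1 / y\<close> are dictated by conjugating the residues with
  \<open>sigma1\<close>: the diagonal entry \<open>z + \<theta>0 / 2\<close> changes sign and the
  off-diagonal entries are exchanged, see \<open>A_mats_half_turn\<close>.\<close>

lemma PV_system_half_turn:
  assumes "exp c = -1" "y field_differentiable at (w + c)" "z field_differentiable at (w + c)"
    "u field_differentiable at (w + c)" "y (w + c) \<noteq> 0" "u (w + c) \<noteq> 0" "PV_system \<theta>0 \<theta>1 \<theta>i y z u (w + c)"
  shows "PV_system \<theta>0 \<theta>1 (- \<theta>i) (\<lambda>w. 1 / y (w + c)) (\<lambda>w. - z (w + c) - \<theta>0) (\<lambda>w. 1 / u (w + c)) w"
proof -
  define Y Z U' X where "Y = y (w + c)" and "Z = z (w + c)" and "U' = u (w + c)" and "X = exp (w + c)"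
  define y' z' u' where "y' = deriv y (w + c)" and "z' = deriv z (w + c)" and "u' = deriv u (w + c)"
  have X: "exp w = - X" using assms(1) by (simp add: X_def exp_add)
  have nz: "Y \<noteq> 0" "U' \<noteq> 0" using assms by (auto simp: Y_def U'_def)
  have d: "deriv (\<lambda>w. 1 / y (w + c)) w = - y' / Y\<^sup>2" "deriv (\<lambda>w. 1 / u (w + c)) w = - u' / U'\<^sup>2"
    "deriv (\<lambda>w. - z (w + c) - \<theta>0) w = - z'"
  proof -
    have *: "((\<lambda>w. f (w + c)) has_field_derivative deriv f (w + c)) (at w)" if "f field_differentiable at (w + c)" for f
      using that by (simp add: DERIV_shift[symmetric] field_differentiable_derivI)
    show "deriv (\<lambda>w. 1 / y (w + c)) w = - y' / Y\<^sup>2" "deriv (\<lambda>w. 1 / u (w + c)) w = - u' / U'\<^sup>2"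
      "deriv (\<lambda>w. - z (w + c) - \<theta>0) w = - z'"
      using nz *[OF assms(2)] *[OF assms(3)] *[OF assms(4)] unfolding Y_def U'_def y'_def u'_def z'_def
      by (intro DERIV_imp_deriv; auto intro!: derivative_eq_intros simp: power2_eq_square)+
  qed
  have s: "y' = X * Y - 2 * Z * (Y - 1)\<^sup>2 - (Y - 1) * ((\<theta>0 - \<theta>1 + \<theta>i) / 2 * Y - (3 * \<theta>0 + \<theta>1 + \<theta>i) / 2)"
    "z' = Y * Z * (Z + (\<theta>0 - \<theta>1 + \<theta>i) / 2) - (Z + \<theta>0) * (Z + (\<theta>0 + \<theta>1 + \<theta>i) / 2) / Y"
    "u' / U' = - 2 * Z - \<theta>0 + Y * (Z + (\<theta>0 - \<theta>1 + \<theta>i) / 2) + (Z + (\<theta>0 + \<theta>1 + \<theta>i) / 2) / Y"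
    using assms(7) unfolding PV_system_def by (simp_all add: exp_mult_ddx Y_def Z_def U'_def X_def y'_def z'_def u'_def)
  have u1: "- u' / U'\<^sup>2 / (1 / U') = - (u' / U')" using nz by (simp add: power2_eq_square)
  have e3: "exp w * (ddx (\<lambda>w. 1 / u (w + c)) w / (1 / U')) = - (u' / U')"
    unfolding times_divide_eq_right exp_mult_ddx d by (rule u1)
  show ?thesis
    unfolding PV_system_def exp_mult_ddx d
    unfolding Y_def[symmetric] Z_def[symmetric] U'_def[symmetric] e3 unfolding X
  proof (intro conjI, goal_cases)
    case 1 show ?case
      unfolding s(1) using nz(1) by (simp add: field_simps power2_eq_square)
  next
    case 2 show ?case
      unfolding s(2) using nz(1) by (simp add: field_simps power2_eq_square)
  next
    case 3 show ?case
      unfolding s(3) using nz(1) by (simp add: field_simps power2_eq_square)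
  qed
qed

lemma A_mats_half_turn:
  assumes "y \<noteq> 0" "u \<noteq> 0"
  shows "A0_mat \<theta>0 (- z - \<theta>0) (1 / u) = conj_sigma1 (A0_mat \<theta>0 z u)"
    "A1_mat \<theta>0 \<theta>1 (- \<theta>i) (1 / y) (- z - \<theta>0) (1 / u) = conj_sigma1 (A1_mat \<theta>0 \<theta>1 \<theta>i y z u)"
  using assms by (simp_all add: A0_mat_def A1_mat_def cmat2_eq_iff field_simps)

text \<open>The link between the scalar system and the matrix equations that
  \<open>isomonodromy\<close> presupposes.\<close>

lemma PV_system_imp_Lax:
  assumes "y field_differentiable at w" "z field_differentiable at w" "u field_differentiable at w"
    "y w \<noteq> 0" "u w \<noteq> 0" "PV_system \<theta>0 \<theta>1 \<theta>i y z u w"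
  defines "P \<equiv> \<lambda>w. A0_mat \<theta>0 (z w) (u w)" and "Q \<equiv> \<lambda>w. A1_mat \<theta>0 \<theta>1 \<theta>i (y w) (z w) (u w)"
  shows "has_mderiv P ((P w + Q w + (\<theta>i / 2) *m sigma3) ** P w - P w ** (P w + Q w + (\<theta>i / 2) *m sigma3)) w" (is ?P)
    "has_mderiv Q (((exp w / 2) *m sigma3 + (P w + Q w + (\<theta>i / 2) *m sigma3)) ** Q w
         - Q w ** ((exp w / 2) *m sigma3 + (P w + Q w + (\<theta>i / 2) *m sigma3))) w" (is ?Q)
proof -
  define Y Z V X where "Y = y w" and "Z = z w" and "V = u w" and "X = exp w"
  define y' z' u' where "y' = deriv y w" and "z' = deriv z w" and "u' = deriv u w"
  have nz: "Y \<noteq> 0" "V \<noteq> 0" using assms by (auto simp: Y_def V_def)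
  have D: "(y has_field_derivative y') (at w)" "(z has_field_derivative z') (at w)" "(u has_field_derivative u') (at w)"
    using assms by (auto simp: y'_def z'_def u'_def field_differentiable_derivI)
  have s: "y' = X * Y - 2 * Z * (Y - 1)\<^sup>2 - (Y - 1) * ((\<theta>0 - \<theta>1 + \<theta>i) / 2 * Y - (3 * \<theta>0 + \<theta>1 + \<theta>i) / 2)"
    "z' = Y * Z * (Z + (\<theta>0 - \<theta>1 + \<theta>i) / 2) - (Z + \<theta>0) * (Z + (\<theta>0 + \<theta>1 + \<theta>i) / 2) / Y"
    "u' / V = - 2 * Z - \<theta>0 + Y * (Z + (\<theta>0 - \<theta>1 + \<theta>i) / 2) + (Z + (\<theta>0 + \<theta>1 + \<theta>i) / 2) / Y"
    using assms(6) unfolding PV_system_def by (simp_all add: exp_mult_ddx Y_def Z_def V_def X_def y'_def z'_def u'_def)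
  have u': "u' = V * (- 2 * Z - \<theta>0 + Y * (Z + (\<theta>0 - \<theta>1 + \<theta>i) / 2) + (Z + (\<theta>0 + \<theta>1 + \<theta>i) / 2) / Y)"
    using s(3) nz by (simp add: field_simps)
  note nz' = assms(4,5)
  \<comment> \<open>With these \<open>\<theta>i = a0 + a1 - \<theta>0\<close>, so the halves
    disappear from all but the diagonal entries.\<close>
  define a0 a1 where "a0 = (\<theta>0 - \<theta>1 + \<theta>i) / 2" and "a1 = (\<theta>0 + \<theta>1 + \<theta>i) / 2"
  have th: "\<theta>i = a0 + a1 - \<theta>0" by (simp add: a0_def a1_def field_simps)
  have M: "P w = mat2 (Z + \<theta>0 / 2) (- V * (Z + \<theta>0)) (Z / V) (- Z - \<theta>0 / 2)"
    "Q w = mat2 (- Z - (a0 + a1) / 2) (V * Y * (Z + a0)) (- (Z + a1) / (V * Y)) (Z + (a0 + a1) / 2)"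
    by (simp_all add: P_def Q_def A0_mat_def A1_mat_def Y_def Z_def V_def flip: a0_def a1_def) (simp add: th)
  have W: "P w + Q w + (\<theta>i / 2) *m sigma3 = mat2 0 (- V * (Z + \<theta>0) + V * Y * (Z + a0)) (Z / V - (Z + a1) / (V * Y)) 0"
    unfolding M by (simp add: cmat2_eq_iff sigma3_def th add_divide_distrib diff_divide_distrib)
  have P': "has_mderiv P (mat2 z' (- u' * (Z + \<theta>0) - V * z') ((z' * V - Z * u') / V\<^sup>2) (- z')) w"
    unfolding P_def A0_mat_def has_mderiv_iff forall_2 mat2_nth Z_def V_def
    using nz'(2) by (intro conjI; auto intro!: derivative_eq_intros D simp: power2_eq_square)
  have Q': "has_mderiv Q (mat2 (- z') (u' * Y * (Z + a0) + V * y' * (Z + a0) + V * Y * z')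
     (- z' / (V * Y) + (Z + a1) * (u' * Y + V * y') / (V * Y)\<^sup>2) z') w"
    unfolding Q_def A1_mat_def has_mderiv_iff forall_2 mat2_nth Z_def V_def Y_def a0_def a1_def
    using nz' by (intro conjI; auto intro!: derivative_eq_intros D simp: power2_eq_square field_simps)
  have "mat2 z' (- u' * (Z + \<theta>0) - V * z') ((z' * V - Z * u') / V\<^sup>2) (- z')
     = ((P w + Q w + (\<theta>i / 2) *m sigma3) ** P w - P w ** (P w + Q w + (\<theta>i / 2) *m sigma3))"
    unfolding W unfolding M mat2_mult cmat2_eq_iff vector_minus_component mat2_nth u' s(2) a0_def[symmetric] a1_def[symmetric]
    using nz by (intro conjI; simp add: field_simps power2_eq_square)
  with P' show ?P by simp
  \<comment> \<open>The equation for \<open>y\<close> is solved for \<open>X\<close>, so that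
    \<open>y'\<close> remains as an indeterminate and the equation for \<open>Q\<close> becomes a
    rational identity.\<close>
  have "X * Y = y' + 2 * Z * (Y - 1)\<^sup>2 + (Y - 1) * (a0 * Y - (\<theta>0 + a1))"
    unfolding s(1) a0_def a1_def by (simp add: field_simps)
  then have X: "X = (y' + 2 * Z * (Y - 1)\<^sup>2 + (Y - 1) * (a0 * Y - (\<theta>0 + a1))) / Y"
    using nz by (simp add: field_simps)

  have "mat2 (- z') (u' * Y * (Z + a0) + V * y' * (Z + a0) + V * Y * z')
     (- z' / (V * Y) + (Z + a1) * (u' * Y + V * y') / (V * Y)\<^sup>2) z' =
    (((exp w / 2) *m sigma3 + (P w + Q w + (\<theta>i / 2) *m sigma3)) ** Q w
         - Q w ** ((exp w / 2) *m sigma3 + (P w + Q w + (\<theta>i / 2) *m sigma3)))"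
    unfolding W unfolding M X_def[symmetric] cmat2_eq_iff cmat2_mult_nth vector_minus_component vector_add_component mat2_nth cscale_nth sigma3_def
      u' s(2) a0_def[symmetric] a1_def[symmetric] X
    using nz by (intro conjI; simp add: field_simps power2_eq_square)
  with Q' show ?Q by simp
qed


section \<open>Monodromy classes\<close>

lemma pow_sigma3_mult: "pow_sigma3 a ** pow_sigma3 b = pow_sigma3 (a * b)"
  by (simp add: pow_sigma3_def mat2_mult)

lemma pow_sigma3_one [simp]: "pow_sigma3 1 = mat 1"
  by (simp add: pow_sigma3_def mat2_one)

lemma exp_sigma3_eq_pow: "exp_sigma3 a = pow_sigma3 (exp a)" "exp_sigma3 (- a) = pow_sigma3 (inverse (exp a))"
  by (simp_all add: exp_sigma3_def pow_sigma3_def exp_minus)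

lemma pow_sigma3_cancel:
  assumes "c \<noteq> 0"
  shows "pow_sigma3 c ** pow_sigma3 (inverse c) = mat 1" "pow_sigma3 (inverse c) ** pow_sigma3 c = mat 1"
    "pow_sigma3 c ** (pow_sigma3 (inverse c) ** A) = A" "pow_sigma3 (inverse c) ** (pow_sigma3 c ** A) = A"
  using assms by (simp_all add: matrix_mul_assoc pow_sigma3_mult)

definition conj_pair :: "complex \<Rightarrow> cmat2 \<times> cmat2 \<Rightarrow> cmat2 \<times> cmat2" where
  "conj_pair c N = (pow_sigma3 c ** fst N ** pow_sigma3 (inverse c), pow_sigma3 c ** snd N ** pow_sigma3 (inverse c))"

lemma monodromy_class_eq: "monodromy_class N = {conj_pair c N | c. c \<noteq> 0}"
  by (simp add: monodromy_class_def conj_pair_def case_prod_beta)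

lemma conj_pair_conj_pair: "conj_pair a (conj_pair b N) = conj_pair (a * b) N"
proof -
  have "X ** pow_sigma3 (inverse b) ** pow_sigma3 (inverse a) = X ** pow_sigma3 (inverse (a * b))" for X :: cmat2
    by (simp add: pow_sigma3_mult mult.commute matrix_mul_assoc[symmetric])
  then show ?thesis by (simp only: conj_pair_def fst_conv snd_conv matrix_mul_assoc pow_sigma3_mult)
qed

lemma monodromy_class_conj_pair:
  assumes "c \<noteq> 0"
  shows "monodromy_class (conj_pair c N) = monodromy_class N"
proof -
  have *: "conj_pair a N = conj_pair (a / c) (conj_pair c N)" "a \<noteq> 0 \<Longrightarrow> a / c \<noteq> 0" for a
    using assms by (simp_all add: conj_pair_conj_pair)
  show ?thesis
  proof (intro equalityI subsetI)
    fix K assume "K \<in> monodromy_class (conj_pair c N)"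
    then show "K \<in> monodromy_class N" using assms by (auto simp: monodromy_class_eq conj_pair_conj_pair)
  next
    fix K assume "K \<in> monodromy_class N"
    then show "K \<in> monodromy_class (conj_pair c N)" using * unfolding monodromy_class_eq by blast
  qed
qed

lemma conj_pair_nth:
  "fst (conj_pair c N) $ 1 $ 1 = c * fst N $ 1 $ 1 * inverse c" "fst (conj_pair c N) $ 1 $ 2 = c * fst N $ 1 $ 2 * c"
  "fst (conj_pair c N) $ 2 $ 1 = inverse c * fst N $ 2 $ 1 * inverse c" "fst (conj_pair c N) $ 2 $ 2 = inverse c * fst N $ 2 $ 2 * c"
  "snd (conj_pair c N) $ 1 $ 1 = c * snd N $ 1 $ 1 * inverse c" "snd (conj_pair c N) $ 1 $ 2 = c * snd N $ 1 $ 2 * c"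
  "snd (conj_pair c N) $ 2 $ 1 = inverse c * snd N $ 2 $ 1 * inverse c" "snd (conj_pair c N) $ 2 $ 2 = inverse c * snd N $ 2 $ 2 * c"
  by (simp_all add: conj_pair_def pow_sigma3_def cmat2_mult_nth)

lemma conj_pair_in_pairs:
  assumes "N \<in> monodromy_pairs \<theta>0 \<theta>1 \<theta>i" "c \<noteq> 0"
  shows "conj_pair c N \<in> monodromy_pairs \<theta>0 \<theta>1 \<theta>i"
proof -
  have r: "c * x * inverse c = x" "inverse c * x * c = x" "(inverse c * x * inverse c) * (c * y * c) = x * y"
    "(c * x * c) * (inverse c * y * inverse c) = x * y" for x y
    using assms(2) by (simp_all add: field_simps)
  show ?thesis using assms(1)
    by (simp only: monodromy_pairs_def case_prod_beta mem_Collect_eq conj_pair_nth det_2 trace_def sum_2 r)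
qed

text \<open>The defining equations of the manifold are invariant under conjugation by
  \<open>pow_sigma3\<close>, so they hold for every representative of a class.\<close>

lemma in_manifold_imp_pairs:
  assumes "monodromy_class M \<in> monodromy_manifold \<theta>0 \<theta>1 \<theta>i"
  shows "M \<in> monodromy_pairs \<theta>0 \<theta>1 \<theta>i"
proof -
  obtain N where N: "N \<in> monodromy_pairs \<theta>0 \<theta>1 \<theta>i" "monodromy_class M = monodromy_class N"
    using assms by (auto simp: monodromy_manifold_def)
  have "conj_pair 1 M = M" by (simp add: conj_pair_def)
  then have "M \<in> monodromy_class M" unfolding monodromy_class_eq by (auto intro: exI[of _ 1])
  then have "M \<in> monodromy_class N" using N(2) by simp
  then obtain c where "c \<noteq> 0" "M = conj_pair c N" unfolding monodromy_class_eq by auto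
  then show ?thesis using conj_pair_in_pairs[OF N(1)] by simp
qed

definition stokes_lower :: "complex \<Rightarrow> cmat2 \<Rightarrow> cmat2" where
  "stokes_lower th P = mat2 1 0 (- exp (of_real pi * \<i> * th) * P $ 2 $ 1) 1"

definition stokes_upper :: "complex \<Rightarrow> cmat2 \<Rightarrow> cmat2" where
  "stokes_upper th P = mat2 1 (- exp (of_real pi * \<i> * th) * P $ 1 $ 2) 0 1"

text \<open>The Stokes multipliers are entries of \<open>M1 ** M0\<close> up to a factor; that is
  why they are the same along the whole orbit.\<close>

lemma stokes_eq: "stokes1 th N = stokes_lower th (snd N ** fst N)" "stokes2 th N = stokes_upper th (snd N ** fst N)"
  by (simp_all add: stokes1_def stokes2_def stokes_lower_def stokes_upper_def case_prod_beta cmat2_eq_iff cmat2_mult_nth algebra_simps)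

lemma stokes_conj_pair:
  assumes "c \<noteq> 0"
  shows "stokes1 th (conj_pair c N) = pow_sigma3 c ** stokes1 th N ** pow_sigma3 (inverse c)"
    "stokes2 th (conj_pair c N) = pow_sigma3 c ** stokes2 th N ** pow_sigma3 (inverse c)"
  using assms by (simp_all add: stokes1_def stokes2_def case_prod_beta conj_pair_nth pow_sigma3_def mat2_mult cmat2_eq_iff field_simps)

lemma adj2_pow_sigma3: "adj2 (pow_sigma3 c) = pow_sigma3 (inverse c)" "adj2 (pow_sigma3 (inverse c)) = pow_sigma3 c"
  by (simp_all add: pow_sigma3_def cmat2_eq_iff)

lemma conj_sigma1_pow_sigma3:
  "conj_sigma1 (pow_sigma3 c) = pow_sigma3 (inverse c)" "conj_sigma1 (pow_sigma3 (inverse c)) = pow_sigma3 c"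
  by (simp_all add: pow_sigma3_def cmat2_eq_iff)

text \<open>\<open>sigma1\<close> inverts \<open>pow_sigma3\<close>; the half turns therefore act on
  classes.\<close>

lemma turn_conj_pair:
  assumes "c \<noteq> 0"
  shows "turn_up th (conj_pair c N) = conj_pair (inverse c) (turn_up th N)"
    "turn_down th (conj_pair c N) = conj_pair (inverse c) (turn_down th N)"
  unfolding turn_up_def turn_down_def Let_def stokes_conj_pair[OF assms]
  unfolding conj_pair_def fst_conv snd_conv adj2_mult adj2_pow_sigma3 
  by (simp_all add: matrix_mul_assoc[symmetric] pow_sigma3_cancel[OF assms] conj_sigma1_simps conj_sigma1_pow_sigma3)

section \<open>Half turns of solutions\<close>

lemma eventually_cosparse_translate:
  fixes c :: complex
  assumes "\<forall>\<^sub>\<approx>w\<in>UNIV. P w"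
  shows "\<forall>\<^sub>\<approx>w\<in>UNIV. P (w + c)"
  unfolding eventually_cosparse_open_eq[OF open_UNIV]
proof
  fix x :: complex
  have "eventually P (at (x + c))" using assms by (simp add: eventually_cosparse_open_eq)
  then have "eventually P (filtermap (\<lambda>w. w - (- c)) (at x))" unfolding filtermap_at_shift by simp
  then show "\<forall>\<^sub>F w in at x. P (w + c)" by (simp add: eventually_filtermap)
qed

lemma eventually_cosparse_UNIV_subset:
  fixes S :: "complex set"
  assumes "\<forall>\<^sub>\<approx>w\<in>UNIV. P w" "open S"
  shows "\<forall>\<^sub>\<approx>w\<in>S. P w"
  using assms by (simp add: eventually_cosparse_open_eq)

definition base_strip :: "complex set" where "base_strip = {w. \<bar>Im w\<bar> < pi / 2}"

lemma base_strip: "open base_strip" "base_strip \<noteq> {}"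
proof -
  show "open base_strip" unfolding base_strip_def by (intro open_Collect_less continuous_intros)
  have "0 \<in> base_strip" by (simp add: base_strip_def)
  then show "base_strip \<noteq> {}" by auto
qed

lemma PV_solutions_iff:
  "y \<in> PV_solutions \<theta>0 \<theta>1 \<theta>i N \<longleftrightarrow> y nicely_meromorphic_on UNIV \<and>
     (\<forall>\<^sub>\<approx>w\<in>UNIV. y w \<noteq> 0 \<and> y w \<noteq> 1 \<and> PV_equation \<theta>0 \<theta>1 \<theta>i y w) \<and>
     (\<exists>z u. z meromorphic_on UNIV \<and> u meromorphic_on UNIV \<and>
        (\<forall>\<^sub>\<approx>w\<in>UNIV. u w \<noteq> 0 \<and> PV_system \<theta>0 \<theta>1 \<theta>i y z u w) \<and>
        (\<forall>\<^sub>\<approx>w\<in>base_strip. \<exists>N'\<in>monodromy_class N.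
           mono_rep \<theta>i w (A0_mat \<theta>0 (z w) (u w)) (A1_mat \<theta>0 \<theta>1 \<theta>i (y w) (z w) (u w)) N'))"
proof -
  have "(\<forall>\<^sub>\<approx>w\<in>base_strip. \<exists>N'\<in>monodromy_class N. monodromy_data \<theta>0 \<theta>1 \<theta>i w (y w) (z w) (u w) N') \<longleftrightarrow>
    (\<forall>\<^sub>\<approx>w\<in>base_strip. \<exists>N'\<in>monodromy_class N.
           mono_rep \<theta>i w (A0_mat \<theta>0 (z w) (u w)) (A1_mat \<theta>0 \<theta>1 \<theta>i (y w) (z w) (u w)) N')" for z u
    unfolding eventually_cosparse_open_eq[OF base_strip(1)]
  proof (intro ball_cong refl eventually_cong)
    fix x assume "x \<in> base_strip"
    then show "\<forall>\<^sub>F w in at x. w \<in> base_strip" using base_strip(1) by (intro eventually_at_in_open') auto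
  qed (auto simp: base_strip_def monodromy_data_iff)
  then show ?thesis by (simp add: PV_solutions_def base_strip_def)
qed

lemma PV_solutions_class_cong:
  "monodromy_class M = monodromy_class N \<Longrightarrow> PV_solutions \<theta>0 \<theta>1 \<theta>i M = PV_solutions \<theta>0 \<theta>1 \<theta>i N"
  by (simp add: PV_solutions_def)

text \<open>A single representative of the class serves at all regular points of the covering,
  whereas \<open>PV_solutions\<close> allows one that varies with \<open>w\<close> and speaks of the
  strip only.\<close>

definition regular_solution :: "complex \<Rightarrow> complex \<Rightarrow> complex \<Rightarrow> cmat2 \<times> cmat2 \<Rightarrow> complex set \<Rightarrow>
    (complex \<Rightarrow> complex) \<Rightarrow> (complex \<Rightarrow> complex) \<Rightarrow> (complex \<Rightarrow> complex) \<Rightarrow> bool" where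
  "regular_solution \<theta>0 \<theta>1 \<theta>i N G y z u \<longleftrightarrow> open G \<and> (\<forall>\<^sub>\<approx>w\<in>UNIV. w \<in> G) \<and>
     y holomorphic_on G \<and> z holomorphic_on G \<and> u holomorphic_on G \<and>
     (\<forall>w\<in>G. y w \<noteq> 0 \<and> y w \<noteq> 1 \<and> u w \<noteq> 0 \<and> PV_equation \<theta>0 \<theta>1 \<theta>i y w \<and> PV_system \<theta>0 \<theta>1 \<theta>i y z u w \<and>
       mono_rep \<theta>i w (A0_mat \<theta>0 (z w) (u w)) (A1_mat \<theta>0 \<theta>1 \<theta>i (y w) (z w) (u w)) N)"

text \<open>The exceptional points form a closed discrete set, so the remaining set \<open>G\<close>
  is connected. The representative found at one point of the strip is carried over \<open>G\<close>
  by \<open>mono_rep_constant\<close>.\<close>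

lemma PV_solutions_regular:
  assumes "y \<in> PV_solutions \<theta>0 \<theta>1 \<theta>i N"
  shows "\<exists>z u G N'. z meromorphic_on UNIV \<and> u meromorphic_on UNIV \<and> N' \<in> monodromy_class N \<and> regular_solution \<theta>0 \<theta>1 \<theta>i N' G y z u"
proof -
  obtain z u where y: "y nicely_meromorphic_on UNIV" "\<forall>\<^sub>\<approx>w\<in>UNIV. y w \<noteq> 0 \<and> y w \<noteq> 1 \<and> PV_equation \<theta>0 \<theta>1 \<theta>i y w"
    and z: "z meromorphic_on UNIV" "u meromorphic_on UNIV" "\<forall>\<^sub>\<approx>w\<in>UNIV. u w \<noteq> 0 \<and> PV_system \<theta>0 \<theta>1 \<theta>i y z u w"
    and m: "\<forall>\<^sub>\<approx>w\<in>base_strip. \<exists>N'\<in>monodromy_class N.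
           mono_rep \<theta>i w (A0_mat \<theta>0 (z w) (u w)) (A1_mat \<theta>0 \<theta>1 \<theta>i (y w) (z w) (u w)) N'"
    using assms unfolding PV_solutions_iff by blast
  have ym: "y meromorphic_on UNIV" using y(1) by (simp add: nicely_meromorphic_on_def)
  define G where "G = {w. y analytic_on {w} \<and> z analytic_on {w} \<and> u analytic_on {w} \<and> y w \<noteq> 0 \<and> y w \<noteq> 1 \<and> u w \<noteq> 0 \<and>
     PV_equation \<theta>0 \<theta>1 \<theta>i y w \<and> PV_system \<theta>0 \<theta>1 \<theta>i y z u w}"
  have ev: "\<forall>\<^sub>\<approx>w\<in>UNIV. w \<in> G"
    using y(2) z(3) meromorphic_on_imp_analytic_cosparse[OF ym] meromorphic_on_imp_analytic_cosparse[OF z(1)]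
      meromorphic_on_imp_analytic_cosparse[OF z(2)]
    by eventually_elim (simp add: G_def)
  then have sp: "- G sparse_in UNIV" by (simp add: eventually_cosparse Compl_eq)
  have G: "open G" using sparse_in_UNIV_imp_closed[OF sp] by (simp add: closed_def)
  have "connected (UNIV - (- G))" by (rule sparse_imp_connected[OF _ connected_UNIV open_UNIV sp]) simp
  then have conn: "connected G" by (simp add: Diff_eq)
  have an: "y holomorphic_on G" "z holomorphic_on G" "u holomorphic_on G"
    by (intro analytic_imp_holomorphic, subst analytic_on_analytic_at, simp add: G_def)+
  have diff: "y field_differentiable at w" "z field_differentiable at w" "u field_differentiable at w" if "w \<in> G" for w
    using an G that by (auto intro: holomorphic_on_imp_differentiable_at)
  have "\<forall>\<^sub>\<approx>w\<in>base_strip. w \<in> G" by (rule eventually_cosparse_UNIV_subset[OF ev base_strip(1)])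
  with m eventually_in_cosparse[OF subset_refl base_strip(1)]
  have "\<forall>\<^sub>\<approx>w\<in>base_strip. w \<in> G \<and> (\<exists>N'\<in>monodromy_class N. mono_rep \<theta>i w (A0_mat \<theta>0 (z w) (u w)) (A1_mat \<theta>0 \<theta>1 \<theta>i (y w) (z w) (u w)) N')"
    by eventually_elim simp
  then obtain a N' where a: "a \<in> G" "N' \<in> monodromy_class N" "mono_rep \<theta>i a (A0_mat \<theta>0 (z a) (u a)) (A1_mat \<theta>0 \<theta>1 \<theta>i (y a) (z a) (u a)) N'"
    using eventually_happens'[of "cosparse base_strip"] base_strip(2) unfolding cosparse_eq_bot_iff' by blast
  have "mono_rep \<theta>i w (A0_mat \<theta>0 (z w) (u w)) (A1_mat \<theta>0 \<theta>1 \<theta>i (y w) (z w) (u w)) N'" if w: "w \<in> G" for w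
  proof (rule mono_rep_constant[OF G conn, of "\<lambda>w. A0_mat \<theta>0 (z w) (u w)" "\<lambda>w. A1_mat \<theta>0 \<theta>1 \<theta>i (y w) (z w) (u w)"])
    show "has_mderiv (\<lambda>w. A0_mat \<theta>0 (z w) (u w))
          ((A0_mat \<theta>0 (z v) (u v) + A1_mat \<theta>0 \<theta>1 \<theta>i (y v) (z v) (u v) + (\<theta>i / 2) *m sigma3) ** A0_mat \<theta>0 (z v) (u v) -
           A0_mat \<theta>0 (z v) (u v) ** (A0_mat \<theta>0 (z v) (u v) + A1_mat \<theta>0 \<theta>1 \<theta>i (y v) (z v) (u v) + (\<theta>i / 2) *m sigma3)) v"
      "has_mderiv (\<lambda>w. A1_mat \<theta>0 \<theta>1 \<theta>i (y w) (z w) (u w))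
          (((exp v / 2) *m sigma3 + (A0_mat \<theta>0 (z v) (u v) + A1_mat \<theta>0 \<theta>1 \<theta>i (y v) (z v) (u v) + (\<theta>i / 2) *m sigma3)) ** A1_mat \<theta>0 \<theta>1 \<theta>i (y v) (z v) (u v) -
           A1_mat \<theta>0 \<theta>1 \<theta>i (y v) (z v) (u v) ** ((exp v / 2) *m sigma3 + (A0_mat \<theta>0 (z v) (u v) + A1_mat \<theta>0 \<theta>1 \<theta>i (y v) (z v) (u v) + (\<theta>i / 2) *m sigma3))) v"
      if "v \<in> G" for v
      using that by (intro PV_system_imp_Lax diff; simp add: G_def)+
  qed (use a w in auto)
  then have "regular_solution \<theta>0 \<theta>1 \<theta>i N' G y z u"
    unfolding regular_solution_def using G ev an by (auto simp: G_def)
  then show ?thesis using z(1,2) a(2) by blast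
qed

lemma meromorphic_translate:
  fixes f :: "complex \<Rightarrow> complex"
  shows "f meromorphic_on UNIV \<Longrightarrow> (\<lambda>w. f (w + c)) meromorphic_on UNIV"
  by (rule meromorphic_on_compose[of f UNIV]) (auto intro!: analytic_intros)

lemma nicely_meromorphic_translate:
  fixes f :: "complex \<Rightarrow> complex"
  assumes "f nicely_meromorphic_on UNIV"
  shows "(\<lambda>w. f (w + c)) nicely_meromorphic_on UNIV"
proof -
  have "is_pole (\<lambda>w. f (w + c)) w \<and> f (w + c) = 0 \<or> (\<lambda>w. f (w + c)) \<midarrow>w\<rightarrow> f (w + c)" for w
  proof -
    have f: "filtermap (\<lambda>w. w + c) (at w) = at (w + c)" using filtermap_at_shift[of "-c" w] by simp
    have "is_pole f (w + c) \<and> f (w + c) = 0 \<or> f \<midarrow>w + c\<rightarrow> f (w + c)"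
      using assms by (simp add: nicely_meromorphic_on_def)
    then show ?thesis unfolding is_pole_def f[symmetric] filterlim_filtermap .
  qed
  then show ?thesis using assms meromorphic_translate[of f c] by (auto simp: nicely_meromorphic_on_def)
qed

text \<open>Treats both half turns, \<open>c = pi * \<i>\<close> and \<open>c = - pi * \<i>\<close>;
  what differs between them is the assumption \<open>turn\<close>.\<close>

lemma PV_solutions_half_turn_aux:
  assumes y: "y \<in> PV_solutions \<theta>0 \<theta>1 \<theta>i N" and c: "exp c = -1"
    and turn: "\<And>w P Q N'. N' \<in> monodromy_class N \<Longrightarrow> trace P = 0 \<Longrightarrow> trace Q = 0 \<Longrightarrow> mono_rep \<theta>i (w + c) P Q N' \<Longrightarrow>
         \<exists>K\<in>monodromy_class N1. mono_rep (- \<theta>i) w (conj_sigma1 P) (conj_sigma1 Q) K"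
  shows "(\<lambda>w. 1 / y (w + c)) \<in> PV_solutions \<theta>0 \<theta>1 (- \<theta>i) N1"
proof -
  obtain z u G N' where z: "z meromorphic_on UNIV" "u meromorphic_on UNIV" "N' \<in> monodromy_class N"
    and r: "regular_solution \<theta>0 \<theta>1 \<theta>i N' G y z u"
    using PV_solutions_regular[OF y] by blast
  have G: "open G" "y holomorphic_on G" "z holomorphic_on G" "u holomorphic_on G" using r by (auto simp: regular_solution_def)
  have diff: "y field_differentiable at w" "z field_differentiable at w" "u field_differentiable at w" if "w \<in> G" for w
    using G that by (auto intro: holomorphic_on_imp_differentiable_at)
  have g: "y w \<noteq> 0" "y w \<noteq> 1" "u w \<noteq> 0" "PV_equation \<theta>0 \<theta>1 \<theta>i y w" "PV_system \<theta>0 \<theta>1 \<theta>i y z u w"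
       "mono_rep \<theta>i w (A0_mat \<theta>0 (z w) (u w)) (A1_mat \<theta>0 \<theta>1 \<theta>i (y w) (z w) (u w)) N'" if "w \<in> G" for w
    using r that by (auto simp: regular_solution_def)
  have ev: "\<forall>\<^sub>\<approx>w\<in>UNIV. w + c \<in> G"
    using r by (intro eventually_cosparse_translate) (simp add: regular_solution_def)
  let ?y = "\<lambda>w. 1 / y (w + c)" and ?z = "\<lambda>w. - z (w + c) - \<theta>0" and ?u = "\<lambda>w. 1 / u (w + c)"
  have yn: "y nicely_meromorphic_on UNIV" using y by (simp add: PV_solutions_iff)
  show ?thesis
    unfolding PV_solutions_iff
  proof (intro conjI; (rule exI[of _ ?z], rule exI[of _ ?u], intro conjI)?)
    show "?y nicely_meromorphic_on UNIV"
      using nicely_meromorphic_on_inverse[OF nicely_meromorphic_translate[OF yn, of c]] by (simp add: field_simps)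
    show "\<forall>\<^sub>\<approx>w\<in>UNIV. ?y w \<noteq> 0 \<and> ?y w \<noteq> 1 \<and> PV_equation \<theta>0 \<theta>1 (- \<theta>i) ?y w"
      using ev
    proof eventually_elim
      case (elim w)
      then show ?case using g[OF elim] PV_equation_half_turn[OF c G(1,2) g(1) elim] by simp
    qed
    show "?z meromorphic_on UNIV" "?u meromorphic_on UNIV"
      using meromorphic_translate[OF z(1), of c] meromorphic_translate[OF z(2), of c] by (auto intro!: meromorphic_intros)
    show "\<forall>\<^sub>\<approx>w\<in>UNIV. ?u w \<noteq> 0 \<and> PV_system \<theta>0 \<theta>1 (- \<theta>i) ?y ?z ?u w"
      using ev
    proof eventually_elim
      case (elim w)
      then show ?case using g[OF elim] PV_system_half_turn[OF c diff[OF elim] g(1,3,5)[OF elim]] by simp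
    qed
    have "\<forall>\<^sub>\<approx>w\<in>base_strip. w + c \<in> G" by (rule eventually_cosparse_UNIV_subset[OF ev base_strip(1)])
    then show "\<forall>\<^sub>\<approx>w\<in>base_strip. \<exists>K\<in>monodromy_class N1. mono_rep (- \<theta>i) w (A0_mat \<theta>0 (?z w) (?u w)) (A1_mat \<theta>0 \<theta>1 (- \<theta>i) (?y w) (?z w) (?u w)) K"
    proof eventually_elim
      case (elim w)
      then show ?case
        unfolding A_mats_half_turn[OF g(1,3)[OF elim]] by (intro turn[OF z(3)] g(6)) auto
    qed
  qed
qed

theorem PV_solutions_half_turn:
  assumes y: "y \<in> PV_solutions \<theta>0 \<theta>1 \<theta>i N" and N: "N \<in> monodromy_pairs \<theta>0 \<theta>1 \<theta>i"
  shows "(\<lambda>w. 1 / y (w + of_real pi * \<i>)) \<in> PV_solutions \<theta>0 \<theta>1 (- \<theta>i) (turn_up \<theta>i N)"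
    "(\<lambda>w. 1 / y (w - of_real pi * \<i>)) \<in> PV_solutions \<theta>0 \<theta>1 (- \<theta>i) (turn_down \<theta>i N)"
proof -
  show "(\<lambda>w. 1 / y (w + of_real pi * \<i>)) \<in> PV_solutions \<theta>0 \<theta>1 (- \<theta>i) (turn_up \<theta>i N)"
  proof (rule PV_solutions_half_turn_aux[OF y])
    fix w :: complex and P Q N' assume "N' \<in> monodromy_class N" and t: "trace P = 0" "trace Q = 0" and m: "mono_rep \<theta>i (w + of_real pi * \<i>) P Q N'"
    then obtain c where c: "c \<noteq> 0" "N' = conj_pair c N" by (auto simp: monodromy_class_eq)
    have "mono_rep (- \<theta>i) w (conj_sigma1 P) (conj_sigma1 Q) (turn_up \<theta>i N')"
      using mono_rep_turn(1)[OF m t conj_pair_in_pairs[OF N c(1), folded c(2)]] by simp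
    moreover have "turn_up \<theta>i N' \<in> monodromy_class (turn_up \<theta>i N)"
      using c by (auto simp: turn_conj_pair monodromy_class_eq)
    ultimately show "\<exists>K\<in>monodromy_class (turn_up \<theta>i N). mono_rep (- \<theta>i) w (conj_sigma1 P) (conj_sigma1 Q) K" by blast
  qed simp
  have "(\<lambda>w. 1 / y (w + - (of_real pi * \<i>))) \<in> PV_solutions \<theta>0 \<theta>1 (- \<theta>i) (turn_down \<theta>i N)"
  proof (rule PV_solutions_half_turn_aux[OF y])
    fix w :: complex and P Q N' assume "N' \<in> monodromy_class N" and t: "trace P = 0" "trace Q = 0" and m: "mono_rep \<theta>i (w + - (of_real pi * \<i>)) P Q N'"
    then obtain c where c: "c \<noteq> 0" "N' = conj_pair c N" by (auto simp: monodromy_class_eq)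
    have "mono_rep (- \<theta>i) w (conj_sigma1 P) (conj_sigma1 Q) (turn_down \<theta>i N')"
      using mono_rep_turn(2)[OF m t conj_pair_in_pairs[OF N c(1), folded c(2)]] by simp
    moreover have "turn_down \<theta>i N' \<in> monodromy_class (turn_down \<theta>i N)"
      using c by (auto simp: turn_conj_pair monodromy_class_eq)
    ultimately show "\<exists>K\<in>monodromy_class (turn_down \<theta>i N). mono_rep (- \<theta>i) w (conj_sigma1 P) (conj_sigma1 Q) K" by blast
  qed (simp add: exp_minus)
  then show "(\<lambda>w. 1 / y (w - of_real pi * \<i>)) \<in> PV_solutions \<theta>0 \<theta>1 (- \<theta>i) (turn_down \<theta>i N)" by simp
qed

section \<open>The orbits\<close>

context
  fixes M :: "cmat2 \<times> cmat2" and \<theta>0 \<theta>1 \<theta>i :: complex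
  assumes M: "M \<in> monodromy_pairs \<theta>0 \<theta>1 \<theta>i"
begin

private definition "Pm = snd M ** fst M"
private definition "h = of_real pi * \<i> / 2 * \<theta>i"
private abbreviation "S1 \<equiv> stokes1 \<theta>i M"
private abbreviation "S2 \<equiv> stokes2 \<theta>i M"

private lemma SL2: "det (fst M) = 1" "det (snd M) = 1" "det Pm = 1"
  using monodromy_pairs_SL2[OF M] by (simp_all add: Pm_def det_mul)

private lemma Pm_eq: "Pm = adj2 S1 ** exp_sigma3 (- (2 * h)) ** adj2 S2"
  using monodromy_factorization[OF M] by (simp add: Pm_def matrix_inv_eq_adj2 h_def)

private lemma orbit_shift:
  "orbit_mat M (p + 1) A = Pm ** orbit_mat M p A ** adj2 Pm" "orbit_mat M (p - 1) A = adj2 Pm ** orbit_mat M p A ** Pm"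
  using orbit_mat_add_1[OF SL2(1,2)] orbit_mat_diff_1[OF SL2(1,2)] SL2(3) by (simp_all add: Pm_def matrix_inv_eq_adj2)

private lemma orbit_product: "snd (mono_orbit M p) ** fst (mono_orbit M p) = Pm"
proof -
  have 1: "mat_powi Pm (- p) ** mat_powi Pm p = mat 1" using mat_powi_minus[OF SL2(3), of "- p"] by simp
  have "snd (mono_orbit M p) ** fst (mono_orbit M p) = mat_powi Pm p ** snd M ** (mat_powi Pm (- p) ** mat_powi Pm p) ** fst M ** mat_powi Pm (- p)"
    by (simp add: mono_orbit_def orbit_mat_def case_prod_beta Pm_def matrix_mul_assoc)
  also have "\<dots> = mat_powi Pm p ** (snd M ** fst M) ** mat_powi Pm (- p)"
    by (simp only: 1 matrix_mul_rid matrix_mul_assoc)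
  also have "\<dots> = mat_powi Pm p ** Pm ** mat_powi Pm (- p)" by (simp only: Pm_def)
  also have "\<dots> = Pm ** (mat_powi Pm p ** mat_powi Pm (- p))" using mat_powi_comm[OF SL2(3)] by (simp add: matrix_mul_assoc)
  finally show ?thesis by (simp add: mat_powi_minus[OF SL2(3)])
qed

lemma mono_orbit_in_pairs: "mono_orbit M p \<in> monodromy_pairs \<theta>0 \<theta>1 \<theta>i"
proof -
  have pp: "mat_powi Pm p ** mat_powi Pm (- p) = mat 1" "mat_powi Pm (- p) ** mat_powi Pm p = mat 1"
    using mat_powi_minus[OF SL2(3), of p] mat_powi_minus[OF SL2(3), of "- p"] by simp_all
  have o: "orbit_mat M p A = mat_powi Pm p ** A ** mat_powi Pm (- p)" for A
    by (simp add: orbit_mat_def case_prod_beta Pm_def)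
  have tr: "trace (orbit_mat M p A) = trace A" for A
  proof -
    have "trace (orbit_mat M p A) = trace (mat_powi Pm (- p) ** (mat_powi Pm p ** A))" unfolding o by (rule trace_mul_sym)
    then show ?thesis by (simp add: matrix_mul_assoc pp)
  qed
  have "det (mat_powi Pm p) * det (mat_powi Pm (- p)) = 1" using pp(1) by (metis det_mul det_I)
  then have dt: "det (orbit_mat M p A) = det A" for A unfolding o by (simp add: det_mul mult_ac)
  have "(snd (mono_orbit M p) ** fst (mono_orbit M p)) $ 1 $ 1 = (snd M ** fst M) $ 1 $ 1"
    unfolding orbit_product Pm_def ..
  then show ?thesis using M
    by (auto simp: monodromy_pairs_def mono_orbit_def tr dt cmat2_mult_nth algebra_simps)
qed

private lemma stokes_orbit: "stokes1 \<theta>i (mono_orbit M p) = S1" "stokes2 \<theta>i (mono_orbit M p) = S2"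
  by (simp_all add: stokes_eq orbit_product Pm_def)

private lemma hat_eq: "hat_mat \<theta>i M A = exp_sigma3 (- h) ** adj2 S2 ** A ** S2 ** exp_sigma3 h"
  by (simp add: hat_mat_def h_def matrix_inv_eq_adj2)

private lemmas cancels = matrix_mul_assoc[symmetric] adj2_cancel[OF det_stokes(1)] adj2_cancel[OF det_stokes(2)]
  exp_sigma3_cancel

private lemma exp_h_conj: "conj_pair (exp a) N = (exp_sigma3 a ** fst N ** exp_sigma3 (- a), exp_sigma3 a ** snd N ** exp_sigma3 (- a))"
  by (simp only: conj_pair_def exp_sigma3_eq_pow(2)) (simp only: exp_sigma3_eq_pow(1))

private lemma exp_sigma3_add3: "exp_sigma3 a ** (exp_sigma3 b ** A) = exp_sigma3 (a + b) ** A"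
  by (simp add: matrix_mul_assoc exp_sigma3_add)

text \<open>\<open>hat_orbit\<close> contains an extra conjugation by \<open>exp_sigma3\<close>,
  which passing to classes removes.\<close>

lemma turn_up_mono_orbit: "monodromy_class (turn_up \<theta>i (mono_orbit M p)) = monodromy_class (hat_orbit \<theta>i M p)"
proof -
  have "conj_sigma1 (hat_mat \<theta>i M A) = exp_sigma3 h ** conj_sigma1 (adj2 S2 ** A ** S2) ** exp_sigma3 (- h)" for A
    unfolding hat_eq by (simp add: conj_sigma1_simps matrix_mul_assoc)
  then have "hat_orbit \<theta>i M p = conj_pair (exp h) (turn_up \<theta>i (mono_orbit M p))"
    unfolding hat_orbit_def turn_up_def Let_def stokes_orbit exp_h_conj by (simp add: mono_orbit_def)
  then show ?thesis by (simp add: monodromy_class_conj_pair)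
qed

text \<open>By the factorisation of \<open>Pm\<close>, the inverse of \<open>S2\<close> times the
  inverse of \<open>Pm\<close> is \<open>exp_sigma3 (2 * h) ** S1\<close>. So conjugation by
  \<open>S1\<close> is, up to a diagonal factor, the hat operation one step earlier in the
  orbit.\<close>

lemma turn_down_mono_orbit: "monodromy_class (turn_down \<theta>i (mono_orbit M p)) = monodromy_class (hat_orbit \<theta>i M (p - 1))"
proof -
  have "hat_mat \<theta>i M (orbit_mat M (p - 1) A) = exp_sigma3 h ** (S1 ** orbit_mat M p A ** adj2 S1) ** exp_sigma3 (- h)" for A
  proof -
    have a: "adj2 (adj2 C) = C" "adj2 (exp_sigma3 b) = exp_sigma3 (- b)" for C b by (simp_all add: cmat2_eq_iff exp_sigma3_def)
    show ?thesis
      unfolding orbit_shift hat_eq Pm_eq adj2_mult a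
      by (simp add: cancels exp_sigma3_add3 exp_sigma3_add)
  qed
  then have "conj_sigma1 (hat_mat \<theta>i M (orbit_mat M (p - 1) A)) = exp_sigma3 (- h) ** conj_sigma1 (S1 ** orbit_mat M p A ** adj2 S1) ** exp_sigma3 h" for A
    by (simp add: conj_sigma1_simps)
  then have "hat_orbit \<theta>i M (p - 1) = conj_pair (exp (- h)) (turn_down \<theta>i (mono_orbit M p))"
    unfolding hat_orbit_def turn_down_def Let_def stokes_orbit exp_h_conj by (simp add: mono_orbit_def)
  then show ?thesis by (simp add: monodromy_class_conj_pair)
qed

private lemma hat_product:
  "snd (hat_orbit \<theta>i M p) ** fst (hat_orbit \<theta>i M p) = conj_sigma1 (exp_sigma3 (- h) ** adj2 S2 ** adj2 S1 ** exp_sigma3 (- h))"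
proof -
  have "snd (hat_orbit \<theta>i M p) ** fst (hat_orbit \<theta>i M p)
      = conj_sigma1 (exp_sigma3 (- h) ** adj2 S2 ** (snd (mono_orbit M p) ** fst (mono_orbit M p)) ** S2 ** exp_sigma3 h)"
    by (simp add: hat_orbit_def mono_orbit_def hat_eq cancels flip: conj_sigma1_simps(1))
  then show ?thesis
    unfolding orbit_product Pm_eq by (simp add: cancels exp_sigma3_add)
qed

text \<open>Conjugation by \<open>sigma1\<close> exchanges upper and lower triangular matrices, so
  the two Stokes matrices change places.\<close>

private lemma stokes_hat:
  "stokes1 (- \<theta>i) (hat_orbit \<theta>i M p) = conj_sigma1 (exp_sigma3 (- h) ** S2 ** exp_sigma3 h)"
  "stokes2 (- \<theta>i) (hat_orbit \<theta>i M p) = conj_sigma1 (exp_sigma3 h ** S1 ** exp_sigma3 (- h))"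
proof -
  have e: "exp (of_real pi * \<i> * (- \<theta>i)) = exp (- h) * exp (- h)" by (simp add: h_def mult_ac flip: exp_add)
  obtain s1 where s1: "S1 = mat2 1 0 s1 1" by (auto simp: stokes1_def case_prod_beta)
  obtain s2 where s2: "S2 = mat2 1 s2 0 1" by (auto simp: stokes2_def case_prod_beta)
  have ee: "exp h * exp (- h) = 1" "exp (- h) * exp h = 1" by (simp_all flip: exp_add)
  have a: "adj2 S1 = mat2 1 0 (- s1) 1" "adj2 S2 = mat2 1 (- s2) 0 1" by (simp_all add: s1 s2 cmat2_eq_iff)
  show "stokes1 (- \<theta>i) (hat_orbit \<theta>i M p) = conj_sigma1 (exp_sigma3 (- h) ** S2 ** exp_sigma3 h)"
    "stokes2 (- \<theta>i) (hat_orbit \<theta>i M p) = conj_sigma1 (exp_sigma3 h ** S1 ** exp_sigma3 (- h))"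
    unfolding stokes_eq[of "- \<theta>i"] hat_product stokes_lower_def stokes_upper_def e a
    unfolding s1 s2 exp_sigma3_def mat2_mult using ee by (simp_all add: cmat2_eq_iff mult_ac)
qed

private lemma adj2_conj_sigma1: "adj2 (conj_sigma1 A) = conj_sigma1 (adj2 A)"
  by (simp add: cmat2_eq_iff)

private lemma adj2_adj2: "adj2 (adj2 C) = C" "adj2 (exp_sigma3 b) = exp_sigma3 (- b)"
  by (simp_all add: cmat2_eq_iff exp_sigma3_def)

text \<open>The second of two half turns: the inverse of \<open>S1\<close>,
  \<open>exp_sigma3 (- (2 * h))\<close> and the inverse of \<open>S2\<close> combine to
  \<open>Pm\<close>, and the index rises by one.\<close>

lemma turn_up_hat_orbit: "monodromy_class (turn_up (- \<theta>i) (hat_orbit \<theta>i M p)) = monodromy_class (mono_orbit M (p + 1))"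
proof -
  have "conj_sigma1 (adj2 (stokes2 (- \<theta>i) (hat_orbit \<theta>i M p)) ** conj_sigma1 (hat_mat \<theta>i M A) ** stokes2 (- \<theta>i) (hat_orbit \<theta>i M p))
      = exp_sigma3 h ** (Pm ** A ** adj2 Pm) ** exp_sigma3 (- h)" for A
    unfolding stokes_hat adj2_conj_sigma1 conj_sigma1_simps adj2_mult adj2_adj2 hat_eq Pm_eq
    by (simp add: cancels exp_sigma3_add3 exp_sigma3_add)
  then have "turn_up (- \<theta>i) (hat_orbit \<theta>i M p) = conj_pair (exp h) (mono_orbit M (p + 1))"
    unfolding turn_up_def Let_def exp_h_conj by (simp add: mono_orbit_def orbit_shift hat_orbit_def)
  then show ?thesis by (simp add: monodromy_class_conj_pair)
qed

lemma turn_down_hat_orbit: "monodromy_class (turn_down (- \<theta>i) (hat_orbit \<theta>i M p)) = monodromy_class (mono_orbit M p)"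
proof -
  have "conj_sigma1 (stokes1 (- \<theta>i) (hat_orbit \<theta>i M p) ** conj_sigma1 (hat_mat \<theta>i M A) ** adj2 (stokes1 (- \<theta>i) (hat_orbit \<theta>i M p)))
      = exp_sigma3 (- h) ** A ** exp_sigma3 (- (- h))" for A
    unfolding stokes_hat adj2_conj_sigma1 conj_sigma1_simps adj2_mult adj2_adj2 hat_eq
    by (simp add: cancels)
  then have "turn_down (- \<theta>i) (hat_orbit \<theta>i M p) = conj_pair (exp (- h)) (mono_orbit M p)"
    unfolding turn_down_def Let_def exp_h_conj by (simp add: mono_orbit_def hat_orbit_def)
  then show ?thesis by (simp add: monodromy_class_conj_pair)
qed

lemma PV_solutions_orbit_turns:
  "y \<in> PV_solutions \<theta>0 \<theta>1 \<theta>i (mono_orbit M p) \<Longrightarrow> (\<lambda>w. 1 / y (w + of_real pi * \<i>)) \<in> PV_solutions \<theta>0 \<theta>1 (- \<theta>i) (hat_orbit \<theta>i M p)"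
  "y \<in> PV_solutions \<theta>0 \<theta>1 \<theta>i (mono_orbit M p) \<Longrightarrow> (\<lambda>w. 1 / y (w - of_real pi * \<i>)) \<in> PV_solutions \<theta>0 \<theta>1 (- \<theta>i) (hat_orbit \<theta>i M (p - 1))"
  "y \<in> PV_solutions \<theta>0 \<theta>1 (- \<theta>i) (hat_orbit \<theta>i M p) \<Longrightarrow> (\<lambda>w. 1 / y (w + of_real pi * \<i>)) \<in> PV_solutions \<theta>0 \<theta>1 \<theta>i (mono_orbit M (p + 1))"
  "y \<in> PV_solutions \<theta>0 \<theta>1 (- \<theta>i) (hat_orbit \<theta>i M p) \<Longrightarrow> (\<lambda>w. 1 / y (w - of_real pi * \<i>)) \<in> PV_solutions \<theta>0 \<theta>1 \<theta>i (mono_orbit M p)"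
  using PV_solutions_half_turn[OF _ mono_orbit_in_pairs] PV_solutions_half_turn[OF _ hat_orbit_in_pairs[OF M]]
    PV_solutions_class_cong[OF turn_up_mono_orbit] PV_solutions_class_cong[OF turn_down_mono_orbit]
    PV_solutions_class_cong[OF turn_up_hat_orbit] PV_solutions_class_cong[OF turn_down_hat_orbit] by force+

text \<open>The inclusion in the other direction is the opposite half turn, applied to the other
  set.\<close>

lemma PV_solutions_orbit_half_turn_images:
  "(\<lambda>y w. y (w + of_real pi * \<i>)) ` PV_solutions \<theta>0 \<theta>1 \<theta>i (mono_orbit M p) = (\<lambda>y w. 1 / y w) ` PV_solutions \<theta>0 \<theta>1 (- \<theta>i) (hat_orbit \<theta>i M p)"
  "(\<lambda>y w. y (w - of_real pi * \<i>)) ` PV_solutions \<theta>0 \<theta>1 \<theta>i (mono_orbit M p) = (\<lambda>y w. 1 / y w) ` PV_solutions \<theta>0 \<theta>1 (- \<theta>i) (hat_orbit \<theta>i M (p - 1))"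
  "(\<lambda>y w. y (w + of_real pi * \<i>)) ` PV_solutions \<theta>0 \<theta>1 (- \<theta>i) (hat_orbit \<theta>i M p) = (\<lambda>y w. 1 / y w) ` PV_solutions \<theta>0 \<theta>1 \<theta>i (mono_orbit M (p + 1))"
  "(\<lambda>y w. y (w - of_real pi * \<i>)) ` PV_solutions \<theta>0 \<theta>1 (- \<theta>i) (hat_orbit \<theta>i M p) = (\<lambda>y w. 1 / y w) ` PV_solutions \<theta>0 \<theta>1 \<theta>i (mono_orbit M p)"
proof -
  have *: "(\<lambda>y w. y (w + c)) ` A = (\<lambda>y w. 1 / y w) ` B"
    if "\<And>y. y \<in> A \<Longrightarrow> (\<lambda>w. 1 / y (w + c)) \<in> B" "\<And>y. y \<in> B \<Longrightarrow> (\<lambda>w. 1 / y (w - c)) \<in> A"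
    for A B :: "(complex \<Rightarrow> complex) set" and c
  proof (intro equalityI subsetI)
    fix f assume "f \<in> (\<lambda>y w. y (w + c)) ` A"
    then obtain y where "y \<in> A" "f = (\<lambda>w. y (w + c))" by auto
    then show "f \<in> (\<lambda>y w. 1 / y w) ` B" using that(1)[of y] by (intro image_eqI[of _ _ "\<lambda>w. 1 / y (w + c)"]) auto
  next
    fix f assume "f \<in> (\<lambda>y w. 1 / y w) ` B"
    then obtain y where "y \<in> B" "f = (\<lambda>w. 1 / y w)" by auto
    then show "f \<in> (\<lambda>y w. y (w + c)) ` A" using that(2)[of y] by (intro image_eqI[of _ _ "\<lambda>w. 1 / y (w - c)"]) auto
  qed
  have **: "(\<lambda>y w. y (w - c)) ` A = (\<lambda>y w. 1 / y w) ` B"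
    if "\<And>y. y \<in> A \<Longrightarrow> (\<lambda>w. 1 / y (w - c)) \<in> B" "\<And>y. y \<in> B \<Longrightarrow> (\<lambda>w. 1 / y (w + c)) \<in> A"
    for A B :: "(complex \<Rightarrow> complex) set" and c
    using *[of A "- c" B] that by simp
  show "(\<lambda>y w. y (w + of_real pi * \<i>)) ` PV_solutions \<theta>0 \<theta>1 \<theta>i (mono_orbit M p) = (\<lambda>y w. 1 / y w) ` PV_solutions \<theta>0 \<theta>1 (- \<theta>i) (hat_orbit \<theta>i M p)"
    by (intro * PV_solutions_orbit_turns)
  show "(\<lambda>y w. y (w - of_real pi * \<i>)) ` PV_solutions \<theta>0 \<theta>1 \<theta>i (mono_orbit M p) = (\<lambda>y w. 1 / y w) ` PV_solutions \<theta>0 \<theta>1 (- \<theta>i) (hat_orbit \<theta>i M (p - 1))"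
    using PV_solutions_orbit_turns(3)[of _ "p - 1"] by (intro ** PV_solutions_orbit_turns(2)) simp_all
  show "(\<lambda>y w. y (w + of_real pi * \<i>)) ` PV_solutions \<theta>0 \<theta>1 (- \<theta>i) (hat_orbit \<theta>i M p) = (\<lambda>y w. 1 / y w) ` PV_solutions \<theta>0 \<theta>1 \<theta>i (mono_orbit M (p + 1))"
    using PV_solutions_orbit_turns(2)[of _ "p + 1"] by (intro * PV_solutions_orbit_turns(3)) simp_all
  show "(\<lambda>y w. y (w - of_real pi * \<i>)) ` PV_solutions \<theta>0 \<theta>1 (- \<theta>i) (hat_orbit \<theta>i M p) = (\<lambda>y w. 1 / y w) ` PV_solutions \<theta>0 \<theta>1 \<theta>i (mono_orbit M p)"
    by (intro ** PV_solutions_orbit_turns)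
qed

lemma PV_solutions_orbit_full_turn_images:
  "(\<lambda>y w. y (w + 2 * of_real pi * \<i>)) ` PV_solutions \<theta>0 \<theta>1 \<theta>i (mono_orbit M p) = PV_solutions \<theta>0 \<theta>1 \<theta>i (mono_orbit M (p + 1))"
  "(\<lambda>y w. y (w + 2 * of_real pi * \<i>)) ` PV_solutions \<theta>0 \<theta>1 (- \<theta>i) (hat_orbit \<theta>i M p) = PV_solutions \<theta>0 \<theta>1 (- \<theta>i) (hat_orbit \<theta>i M (p + 1))"
proof -
  have *: "(\<lambda>y w. y (w + 2 * of_real pi * \<i>)) ` A = B"
    if up: "\<And>y. y \<in> A \<Longrightarrow> (\<lambda>w. 1 / y (w + of_real pi * \<i>)) \<in> C" "\<And>y. y \<in> C \<Longrightarrow> (\<lambda>w. 1 / y (w + of_real pi * \<i>)) \<in> B"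
      and down: "\<And>y. y \<in> B \<Longrightarrow> (\<lambda>w. 1 / y (w - of_real pi * \<i>)) \<in> C" "\<And>y. y \<in> C \<Longrightarrow> (\<lambda>w. 1 / y (w - of_real pi * \<i>)) \<in> A"
    for A B C :: "(complex \<Rightarrow> complex) set"
  proof (intro equalityI subsetI)
    fix f assume "f \<in> (\<lambda>y w. y (w + 2 * of_real pi * \<i>)) ` A"
    then obtain y where y: "y \<in> A" "f = (\<lambda>w. y (w + 2 * of_real pi * \<i>))" by auto
    have "w + of_real pi * \<i> + of_real pi * \<i> = w + 2 * of_real pi * \<i>" for w :: complex by simp
    then show "f \<in> B" using up(2)[OF up(1)[OF y(1)]] by (simp only: y(2)) simp
  next
    fix f assume f: "f \<in> B"
    have "w + 2 * of_real pi * \<i> - of_real pi * \<i> - of_real pi * \<i> = w" for w :: complex by simp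
    \<comment> \<open>Two half turns down give the preimage; \<open>1 / (1 / a) = a\<close> holds
      also for \<open>a = 0\<close>.\<close>
    then have "f = (\<lambda>w. (\<lambda>w. 1 / (1 / f (w - of_real pi * \<i> - of_real pi * \<i>))) (w + 2 * of_real pi * \<i>))" by (simp only:) simp
    then show "f \<in> (\<lambda>y w. y (w + 2 * of_real pi * \<i>)) ` A"
      using down(2)[OF down(1)[OF f]] by (rule image_eqI)
  qed
  show "(\<lambda>y w. y (w + 2 * of_real pi * \<i>)) ` PV_solutions \<theta>0 \<theta>1 \<theta>i (mono_orbit M p) = PV_solutions \<theta>0 \<theta>1 \<theta>i (mono_orbit M (p + 1))"
    using PV_solutions_orbit_turns(2)[of _ "p + 1"]
    by (intro *[where C = "PV_solutions \<theta>0 \<theta>1 (- \<theta>i) (hat_orbit \<theta>i M p)"] PV_solutions_orbit_turns) simp_all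
  show "(\<lambda>y w. y (w + 2 * of_real pi * \<i>)) ` PV_solutions \<theta>0 \<theta>1 (- \<theta>i) (hat_orbit \<theta>i M p) = PV_solutions \<theta>0 \<theta>1 (- \<theta>i) (hat_orbit \<theta>i M (p + 1))"
    using PV_solutions_orbit_turns(2)[of _ "p + 1"]
    by (intro *[where C = "PV_solutions \<theta>0 \<theta>1 \<theta>i (mono_orbit M (p + 1))"] PV_solutions_orbit_turns) simp_all
qed

end


section \<open>Fuchsian singularities\<close>

subsection \<open>Algebra of the residues\<close>

text \<open>If \<open>f\<close> and \<open>f'\<close> solve trace-free systems with residues
  \<open>A\<close> and \<open>A'\<close> at a point, this operator is the residue of the equation
  for \<open>f ** C ** adj2 f'\<close>; its eigenvalues are the possible orders there.\<close>

definition comm2 :: "cmat2 \<Rightarrow> cmat2 \<Rightarrow> cmat2 \<Rightarrow> cmat2" where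
  "comm2 A A' X = A ** X - X ** A'"

lemma cscale_eq_0_iff [simp]: "c *m X = 0 \<longleftrightarrow> c = 0 \<or> X = 0"
  by (auto simp: cmat2_eq_iff)

lemma comm2_linear:
  "comm2 A A' (X + Y) = comm2 A A' X + comm2 A A' Y" "comm2 A A' (X - Y) = comm2 A A' X - comm2 A A' Y"
  "comm2 A A' (c *m X) = c *m comm2 A A' X"
  by (simp_all add: comm2_def cmat2_mult_algebra cscale_mult cscale.diff_right)

text \<open>Left multiplication by \<open>A\<close> and right multiplication by \<open>A'\<close>
  commute, and both have square \<open>k\<close>; the cube of their difference is expanded.\<close>

lemma comm2_cube:
  assumes "A ** A = k *m mat 1" "A' ** A' = k *m mat 1"
  shows "comm2 A A' (comm2 A A' (comm2 A A' X)) = (4 * k) *m comm2 A A' X"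
proof -
  have AA: "A ** (A ** Y) = k *m Y" "Y ** A' ** A' = k *m Y" for Y :: cmat2
    by (simp_all only: matrix_mul_assoc assms cscale_mult matrix_mul_lid)
       (simp only: matrix_mul_assoc[symmetric] assms cscale_mult matrix_mul_rid)
  define Z where "Z = A ** X ** A'"
  have 2: "comm2 A A' (comm2 A A' X) = (2 * k) *m X - 2 *m Z"
    unfolding comm2_def Z_def cmat2_mult_algebra AA by (simp add: AA matrix_mul_assoc cmat2_eq_iff algebra_simps)
  have 1: "comm2 A A' Z = (- k) *m comm2 A A' X"
  proof -
    have "A ** Z = k *m (X ** A')" unfolding Z_def matrix_mul_assoc[symmetric] AA by (simp add: AA)
    moreover have "Z ** A' = k *m (A ** X)" unfolding Z_def by (simp add: AA)
    ultimately show ?thesis by (simp add: comm2_def cmat2_eq_iff algebra_simps)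
  qed
  show ?thesis
    unfolding 2 comm2_linear 1 by (simp add: cmat2_eq_iff algebra_simps)
qed

lemma comm2_eigenvalue:
  assumes "A ** A = (th\<^sup>2 / 4) *m mat 1" "A' ** A' = (th\<^sup>2 / 4) *m mat 1" "comm2 A A' X = n *m X" "X \<noteq> 0"
  shows "n = 0 \<or> n\<^sup>2 = th\<^sup>2"
proof -
  have "(n * (n * n)) *m X = (th\<^sup>2 * n) *m X"
    using comm2_cube[OF assms(1,2), of X] by (simp add: assms(3) comm2_linear mult.assoc)
  then have "(n * (n * n) - th\<^sup>2 * n) *m X = 0" by (simp only: cscale.diff_left diff_self)
  then have "n * (n * n) - th\<^sup>2 * n = 0" using assms(4) by (simp only: cscale_eq_0_iff simp_thms)
  then have "n * (n\<^sup>2 - th\<^sup>2) = 0" by (simp add: power2_eq_square algebra_simps)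
  then show ?thesis by simp
qed

text \<open>Left and right multiplication have only the eigenvalues \<open>th / 2\<close> and
  \<open>- th / 2\<close>, so that their difference attains \<open>th\<close> or \<open>- th\<close>
  just at opposite extremes.\<close>

lemma comm2_eigenvector:
  assumes "A ** A = (th\<^sup>2 / 4) *m mat 1" "A' ** A' = (th\<^sup>2 / 4) *m mat 1" "comm2 A A' X = n *m X" "n \<noteq> 0" "n\<^sup>2 = th\<^sup>2"
  shows "A ** X = (n / 2) *m X" "X ** A' = (- (n / 2)) *m X"
proof -
  have AA: "A ** (A ** X) = (th\<^sup>2 / 4) *m X" "X ** A' ** A' = (th\<^sup>2 / 4) *m X"
    by (simp_all only: matrix_mul_assoc assms cscale_mult matrix_mul_lid)
       (simp only: matrix_mul_assoc[symmetric] assms cscale_mult matrix_mul_rid)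
  have 1: "A ** X - X ** A' = n *m X" using assms(3) by (simp add: comm2_def)
  have "A ** (A ** X - X ** A') = n *m (A ** X)" unfolding 1 by (simp add: cscale_mult)
  then have a: "(th\<^sup>2 / 4) *m X - A ** X ** A' = n *m (A ** X)"
    by (simp only: cmat2_mult_algebra AA(1)) (simp only: matrix_mul_assoc)
  have "(A ** X - X ** A') ** A' = n *m (X ** A')" unfolding 1 by (simp add: cscale_mult)
  then have b: "A ** X ** A' - (th\<^sup>2 / 4) *m X = n *m (X ** A')" by (simp add: cmat2_mult_algebra AA)
  have "n *m (A ** X + X ** A') = 0" using a b by (simp add: cscale.add_right flip: a b)
  then have 2: "A ** X + X ** A' = 0" using assms(4) by (simp add: cmat2_eq_iff)
  have 3: "X ** A' = - (A ** X)" using 2 by (simp add: eq_neg_iff_add_eq_0 add.commute)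
  have 4: "2 *m (A ** X) = n *m X" using 1 unfolding 3 by (simp add: cmat2_eq_iff)
  have "(1 / 2) *m (2 *m (A ** X)) = (1 / 2) *m (n *m X)" unfolding 4 ..
  then show 5: "A ** X = (n / 2) *m X" by simp
  show "X ** A' = (- (n / 2)) *m X" unfolding 3 5 by (simp add: cmat2_eq_iff)
qed

text \<open>\<open>comm2 A A\<close> is annihilated by a polynomial with simple roots, as
  \<open>th\<close> is nonzero here; so it has no Jordan block at \<open>n\<close>.\<close>

lemma comm2_log_obstruction:
  assumes "A ** A = (th\<^sup>2 / 4) *m mat 1" "comm2 A A G = n *m G" "comm2 A A P + c *m G = n *m P"
    "n\<^sup>2 = th\<^sup>2" "n \<noteq> 0" "c \<noteq> 0"
  shows "G = 0"
proof -
  have 1: "comm2 A A P = n *m P - c *m G" using assms(3) by (simp add: algebra_simps)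
  have "comm2 A A (comm2 A A (comm2 A A P)) = th\<^sup>2 *m (n *m P - c *m G)"
    using comm2_cube[OF assms(1,1), of P] by (simp add: 1)
  then have "(n * (n * n)) *m P - (3 * n\<^sup>2 * c) *m G = n\<^sup>2 *m (n *m P - c *m G)"
    unfolding 1 comm2_linear assms(2) assms(4)[symmetric] by (simp add: cmat2_eq_iff power2_eq_square algebra_simps)
  then have "(2 * n\<^sup>2 * c) *m G = 0" by (simp add: cmat2_eq_iff power2_eq_square algebra_simps)
  then show ?thesis using assms(5,6) by simp
qed

text \<open>The anticommutator of trace-free 2 by 2 matrices is scalar, so here
  \<open>A ** G\<close> is scalar. Multiplication by \<open>G\<close> shows that this scalar or
  \<open>G\<close> vanishes, and \<open>A\<close> is invertible.\<close>

lemma nilpotent_commuting_zero: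
  fixes A G :: cmat2
  assumes "A ** A = k *m mat 1" "k \<noteq> 0" "trace A = 0" "trace G = 0" "G ** G = 0" "A ** G = G ** A"
  shows "G = 0"
proof -
  define s where "s = trace (A ** G)"
  have A: "A $ 2 $ 2 = - A $ 1 $ 1" and G: "G $ 2 $ 2 = - G $ 1 $ 1"
    using assms(3,4) by (simp_all add: trace_def sum_2 eq_neg_iff_add_eq_0 add.commute)
  have "A ** G + G ** A = s *m mat 1"
    by (simp add: s_def trace_def sum_2 cmat2_eq_iff cmat2_mult_nth A G algebra_simps)
  then have 2: "2 *m (A ** G) = s *m mat 1" using assms(6) by (simp add: cmat2_eq_iff algebra_simps)
  have "s *m G = (s *m mat 1) ** G" by (simp add: cscale_mult)
  also have "\<dots> = 2 *m (A ** (G ** G))" unfolding 2[symmetric] by (simp add: cscale_mult matrix_mul_assoc)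
  finally have "s *m G = 0" using assms(5) by (simp add: cmat2_mult_algebra)
  then have "s = 0 \<or> G = 0" by (auto simp: cmat2_eq_iff)
  then show ?thesis
  proof
    assume "s = 0"
    then have "A ** G = 0" using 2 by (simp add: cmat2_eq_iff)
    then have "A ** A ** G = 0" by (simp add: matrix_mul_assoc[symmetric] cmat2_mult_algebra)
    then show "G = 0" using assms(1,2) by (simp add: cscale_mult cmat2_eq_iff)
  qed
qed

text \<open>The rows of \<open>X\<close> are left and the columns of \<open>G\<close> right
  eigenvectors of \<open>A\<close> for \<open>m\<close>, a simple eigenvalue because the other one
  is \<open>- m\<close>. A left and a right eigenvector for the same simple eigenvalue have nonzero
  product.\<close>

lemma eigen_product_zero:
  fixes A X G :: cmat2
  assumes "trace A = 0" "X ** A = m *m X" "A ** G = m *m G" "X ** G = 0" "m \<noteq> 0"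
  shows "X = 0 \<or> G = 0"
proof (rule ccontr)
  assume "\<not> (X = 0 \<or> G = 0)"
  then obtain i j k l where ij: "X $ i $ j \<noteq> 0" "G $ k $ l \<noteq> 0" by (auto simp: vec_eq_iff)
  define x y u v p q r where "x = X $ i $ 1" and "y = X $ i $ 2" and "u = G $ 1 $ l" and "v = G $ 2 $ l"
    and "p = A $ 1 $ 1" and "q = A $ 1 $ 2" and "r = A $ 2 $ 1"
  have A: "A $ 2 $ 2 = - p" using assms(1) by (simp add: p_def trace_def sum_2 eq_neg_iff_add_eq_0 add.commute)
  have 1: "x * p + y * r = m * x" "x * q - y * p = m * y"
    using arg_cong[OF assms(2), of "\<lambda>M. M $ i $ 1"] arg_cong[OF assms(2), of "\<lambda>M. M $ i $ 2"]
    by (simp_all add: cmat2_mult_nth x_def y_def p_def q_def r_def A[unfolded p_def])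
  have 2: "p * u + q * v = m * u" "r * u - p * v = m * v"
    using arg_cong[OF assms(3), of "\<lambda>M. M $ 1 $ l"] arg_cong[OF assms(3), of "\<lambda>M. M $ 2 $ l"]
    by (simp_all add: cmat2_mult_nth u_def v_def p_def q_def r_def A[unfolded p_def])
  have 3: "x * u + y * v = 0"
    using arg_cong[OF assms(4), of "\<lambda>M. M $ i $ l"] by (simp add: cmat2_mult_nth x_def y_def u_def v_def)
  have "m * (x * v) = 0" "m * (y * u) = 0"
    using 1 2 3 by algebra+
  then have xv: "x * v = 0" "y * u = 0" using assms(5) by auto
  have "m * (x * u) = 0" using 1 2 3 xv by algebra
  then have "x * u = 0" "y * v = 0" using assms(5) 3 by auto
  moreover have "x \<noteq> 0 \<or> y \<noteq> 0" "u \<noteq> 0 \<or> v \<noteq> 0"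
    using ij exhaust_2[of j] exhaust_2[of k] by (auto simp: x_def y_def u_def v_def)
  ultimately show False using xv by auto
qed

subsection \<open>Leading terms\<close>

definition pball :: "complex \<Rightarrow> complex set" where "pball a = ball a 1 - {a}"

lemma open_pball: "open (pball a)" by (simp add: pball_def open_delete)

definition moderate :: "complex \<Rightarrow> (complex \<Rightarrow> cmat2) \<Rightarrow> bool" where
  "moderate a F \<longleftrightarrow> (\<exists>C K. \<forall>\<eta>. 0 < norm (\<eta> - a) \<and> norm (\<eta> - a) < 1 / 2 \<longrightarrow> norm (F \<eta>) * norm (\<eta> - a) ^ K \<le> C)"

lemma holomorphic_divide_zero:
  assumes "f holomorphic_on ball a 1" "f a = 0"
  shows "\<exists>g. g holomorphic_on ball a 1 \<and> (\<forall>z\<in>ball a 1. f z = (z - a) * g z)"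
  using pole_lemma_open[OF assms(1) open_ball, of a] assms(2)
  by (intro exI[of _ "\<lambda>z. if z = a then deriv f a else (f z - f a) / (z - a)"]) auto

lemma mhol_divide_zero:
  assumes "mhol f (ball a 1)" "f a = 0"
  shows "\<exists>g. mhol g (ball a 1) \<and> (\<forall>z\<in>ball a 1. f z = (z - a) *m g z)"
proof -
  have "\<exists>g. g holomorphic_on ball a 1 \<and> (\<forall>z\<in>ball a 1. f z $ i $ j = (z - a) * g z)" for i j
    using assms by (intro holomorphic_divide_zero) (auto simp: mhol_def)
  then obtain g where "\<And>i j. g i j holomorphic_on ball a 1" "\<And>i j z. z \<in> ball a 1 \<Longrightarrow> f z $ i $ j = (z - a) * g i j z"
    by metis
  then show ?thesis by (intro exI[of _ "\<lambda>z. \<chi> i j. g i j z"]) (simp add: mhol_def cmat2_eq_iff)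
qed

lemma mhol_zero_of_infinite_order:
  assumes "mhol f (ball a 1)" "\<And>n. \<exists>g. mhol g (ball a 1) \<and> (\<forall>z\<in>ball a 1. f z = (z - a) ^ n *m g z)" "z \<in> ball a 1"
  shows "f z = 0"
proof (rule ccontr)
  assume "f z \<noteq> 0"
  then obtain i j where ij: "f z $ i $ j \<noteq> 0" by (auto simp: vec_eq_iff)
  let ?h = "\<lambda>z. f z $ i $ j"
  obtain g1 where "\<forall>z\<in>ball a 1. f z = (z - a) ^ 1 *m g1 z" using assms(2) by blast
  then have ha: "?h a = 0" by simp
  have "?h holomorphic_on ball a 1" using assms(1) by (simp add: mhol_def)
  moreover have "\<not> ?h constant_on ball a 1"
    using ij ha assms(3) unfolding constant_on_def by (metis centre_in_ball zero_less_one)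
  ultimately obtain q r n where q: "0 < r" "ball a r \<subseteq> ball a 1" "q holomorphic_on ball a r"
    "\<And>w. w \<in> ball a r \<Longrightarrow> ?h w = (w - a) ^ n * q w" "\<And>w. w \<in> ball a r \<Longrightarrow> q w \<noteq> 0"
    using holomorphic_factor_zero_nonconstant[of ?h "ball a 1" a] ha by (metis centre_in_ball connected_ball open_ball zero_less_one)
  obtain g where g: "mhol g (ball a 1)" "\<And>z. z \<in> ball a 1 \<Longrightarrow> f z = (z - a) ^ Suc n *m g z" using assms(2)[of "Suc n"] by blast
  have ev: "q w = (w - a) * g w $ i $ j" if "w \<in> ball a r - {a}" for w
  proof -
    have "w \<in> ball a 1" "w \<noteq> a" using that q(2) by auto
    then have "(w - a) ^ n * q w = (w - a) ^ n * ((w - a) * g w $ i $ j)"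
      using q(4)[of w] g(2)[of w] that by simp
    then show ?thesis using \<open>w \<noteq> a\<close> by simp
  qed
  have "isCont q a" using holomorphic_on_imp_continuous_on[OF q(3)] q(1) by (simp add: continuous_on_eq_continuous_at)
  then have "q \<midarrow>a\<rightarrow> q a" by (simp add: isCont_def)
  moreover have "(\<lambda>w. (w - a) * g w $ i $ j) \<midarrow>a\<rightarrow> (a - a) * g a $ i $ j"
  proof -
    have "(\<lambda>w. g w $ i $ j) holomorphic_on ball a 1" using g(1) by (simp add: mhol_def)
    then have "isCont (\<lambda>w. g w $ i $ j) a"
      using holomorphic_on_imp_continuous_on by (fastforce simp: continuous_on_eq_continuous_at)
    then show ?thesis unfolding isCont_def by (intro tendsto_mult tendsto_diff tendsto_ident_at tendsto_const)
  qed
  moreover have "\<forall>\<^sub>F w in at a. q w = (w - a) * g w $ i $ j"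
    using eventually_at_in_open[of "ball a r" a] q(1) ev by (auto elim: eventually_mono)
  ultimately have "q a = (a - a) * g a $ i $ j"
    using Lim_transform_eventually[of q "q a" "at a" "\<lambda>w. (w - a) * g w $ i $ j"]
      tendsto_unique[OF trivial_limit_at, of "\<lambda>w. (w - a) * g w $ i $ j"] by blast
  then show False using q(1,5) by simp
qed

text \<open>A power of \<open>z - a\<close> removes the singularity, and the exact order is then
  split off from all entries together: \<open>Q a\<close> is nonzero but may well be
  singular.\<close>

lemma moderate_order:
  assumes F: "mhol F (pball a)" "moderate a F" and nz: "b \<in> pball a" "F b \<noteq> 0"
  shows "\<exists>n Q. mhol Q (ball a 1) \<and> Q a \<noteq> 0 \<and> (\<forall>z\<in>pball a. F z = (z - a) powi n *m Q z)"
proof -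
  obtain C K where CK: "\<And>\<eta>. 0 < norm (\<eta> - a) \<Longrightarrow> norm (\<eta> - a) < 1 / 2 \<Longrightarrow> norm (F \<eta>) * norm (\<eta> - a) ^ K \<le> C"
    using F(2) by (auto simp: moderate_def)
  have "\<exists>g. g holomorphic_on ball a 1 \<and> (\<forall>z\<in>ball a 1 - {a}. g z = (z - a) ^ K * F z $ i $ j)" for i j
  proof (rule holomorphic_on_extend_bounded[THEN iffD2])
    show "(\<lambda>z. (z - a) ^ K * F z $ i $ j) holomorphic_on ball a 1 - {a}"
      using F(1) by (auto simp: mhol_def pball_def intro!: holomorphic_intros)
    have "\<forall>\<^sub>F z in at a. 0 < norm (z - a) \<and> norm (z - a) < 1 / 2"
      using eventually_at_in_open[of "ball a (1/2)" a] by (auto elim!: eventually_mono simp: dist_norm norm_minus_commute)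
    then have "\<forall>\<^sub>F z in at a. norm ((z - a) ^ K * F z $ i $ j) \<le> C"
    proof eventually_elim
      case (elim z)
      have "norm ((z - a) ^ K * F z $ i $ j) \<le> norm (F z) * norm (z - a) ^ K"
        using norm_cmat2_entry[of "F z" i j] by (simp add: norm_mult norm_power mult.commute[of "norm (F z)"] mult_left_mono)
      then show ?case using CK[of z] elim by linarith
    qed
    then show "\<exists>B. \<forall>\<^sub>F z in at a. norm ((z - a) ^ K * F z $ i $ j) \<le> B" by blast
  qed auto
  then obtain g where g: "\<And>i j. g i j holomorphic_on ball a 1" "\<And>i j z. z \<in> pball a \<Longrightarrow> g i j z = (z - a) ^ K * F z $ i $ j"
    unfolding pball_def by metis
  define H where "H z = (\<chi> i j. g i j z)" for z
  have H: "mhol H (ball a 1)" "\<And>z. z \<in> pball a \<Longrightarrow> H z = (z - a) ^ K *m F z"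
    using g by (simp_all add: H_def mhol_def cmat2_eq_iff)
  define ok where "ok n \<longleftrightarrow> (\<exists>Q. mhol Q (ball a 1) \<and> (\<forall>z\<in>ball a 1. H z = (z - a) ^ n *m Q z))" for n
  have "H b \<noteq> 0" using H(2)[OF nz(1)] nz by (auto simp: pball_def cmat2_eq_iff)
  then have "\<not> (\<forall>n. ok n)"
    using mhol_zero_of_infinite_order[OF H(1), of b] nz(1) unfolding ok_def pball_def by blast
  moreover have "ok 0" unfolding ok_def using H(1) by (intro exI[of _ H]) simp
  ultimately obtain n where n: "ok n" "\<not> ok (Suc n)" by (metis nat_induct)
  then obtain Q where Q: "mhol Q (ball a 1)" "\<And>z. z \<in> ball a 1 \<Longrightarrow> H z = (z - a) ^ n *m Q z" by (auto simp: ok_def)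
  have "Q a \<noteq> 0"
  proof
    assume "Q a = 0"
    then obtain Q' where "mhol Q' (ball a 1)" "\<forall>z\<in>ball a 1. Q z = (z - a) *m Q' z" using mhol_divide_zero[OF Q(1)] by blast
    then have "ok (Suc n)" unfolding ok_def using Q(2) by (intro exI[of _ Q']) (simp add: mult.commute)
    then show False using n(2) by simp
  qed
  moreover have "F z = (z - a) powi (int n - int K) *m Q z" if z: "z \<in> pball a" for z
  proof -
    have za: "z - a \<noteq> 0" "z \<in> ball a 1" using z by (auto simp: pball_def)
    have "(z - a) ^ K *m F z = (z - a) ^ n *m Q z" using H(2)[OF z] Q(2)[OF za(2)] by simp
    then have "(inverse ((z - a) ^ K) * (z - a) ^ K) *m F z = (inverse ((z - a) ^ K) * (z - a) ^ n) *m Q z"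
      by (metis cscale_cscale)
    then show ?thesis using za(1) by (simp add: power_int_diff field_simps)
  qed
  ultimately show ?thesis using Q(1) by blast
qed

text \<open>Comparison of the coefficients of \<open>(z - a) powi (n - 1)\<close>. The term
  \<open>V\<close> is zero for a homogeneous equation; it is there for the logarithmic case.\<close>

lemma leading_coefficient:
  assumes F: "\<And>z. z \<in> pball a \<Longrightarrow> F z = (z - a) powi n *m Q z" and Q: "mhol Q (ball a 1)" and V: "mhol V (ball a 1)"
    and HH: "mhol H (ball a 1)" "mhol H' (ball a 1)"
    and ode: "\<And>z. z \<in> pball a \<Longrightarrow> has_mderiv F (((1 / (z - a)) *m A + H z) ** F z - F z ** ((1 / (z - a)) *m A' + H' z)
        + (1 / (z - a)) *m ((z - a) powi n *m V z)) z"
  shows "of_int n *m Q a = comm2 A A' (Q a) + V a"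
proof -
  define Q' where "Q' z = (\<chi> i j. deriv (\<lambda>z. Q z $ i $ j) z)" for z
  have Q': "has_mderiv Q (Q' z) z" if "z \<in> ball a 1" for z
    unfolding has_mderiv_iff Q'_def vec_lambda_beta using Q that
    by (intro allI holomorphic_derivI[OF _ open_ball]) (auto simp: mhol_def)
  have mQ': "mhol Q' (ball a 1)"
    using Q by (auto simp: mhol_def Q'_def intro!: holomorphic_deriv)
  \<comment> \<open>The equation divided by \<open>(z - a) powi (n - 1)\<close>: it vanishes off the
    centre, hence by continuity at the centre.\<close>
  define E where "E z = (of_int n *m Q z + (z - a) *m Q' z) - ((A + (z - a) *m H z) ** Q z - Q z ** (A' + (z - a) *m H' z) + V z)" for z
  have "E z = 0" if z: "z \<in> pball a" for z
  proof -
    have za: "z - a \<noteq> 0" "z \<in> ball a 1" using z by (auto simp: pball_def)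
    define p where "p = (z - a) powi (n - 1)"
    have p: "(z - a) powi n = p * (z - a)" "p \<noteq> 0" using za(1) by (simp_all add: p_def power_int_diff)
    have "((\<lambda>z. (z - a) powi n) has_field_derivative of_int n * p) (at z)"
      unfolding p_def using za by (auto intro!: derivative_eq_intros)
    from has_mderiv_cscale[OF this Q'[OF za(2)]]
    have 1: "has_mderiv F ((of_int n * p) *m Q z + (p * (z - a)) *m Q' z) z"
      unfolding p(1) by (rule has_mderiv_transform[OF _ open_pball z]) (simp add: F)
    have "(of_int n * p) *m Q z + (p * (z - a)) *m Q' z = ((1 / (z - a)) *m A + H z) ** F z - F z ** ((1 / (z - a)) *m A' + H' z)
        + (1 / (z - a)) *m ((z - a) powi n *m V z)"
      using has_mderiv_entry[OF 1] has_mderiv_entry[OF ode[OF z]] by (simp only: vec_eq_iff) (blast intro: DERIV_unique)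
    also have "\<dots> = p *m ((A + (z - a) *m H z) ** Q z - Q z ** (A' + (z - a) *m H' z) + V z)"
      unfolding F[OF z] p(1) using za(1)
      by (simp add: cmat2_mult_algebra cscale_mult cscale.add_right cscale.diff_right)
    finally have "p *m E z = 0"
      unfolding E_def cscale.diff_right by (simp add: cscale.add_right mult.commute)
    then show ?thesis using p(2) by (simp add: cmat2_eq_iff)
  qed
  moreover have "mhol E (ball a 1)"
    unfolding E_def by (intro mhol_intros Q mQ' HH V holomorphic_intros)
  then have "isCont E a" using mhol_continuous_on[of "ball a 1" E] by (simp add: continuous_on_eq_continuous_at)
  then have "E \<midarrow>a\<rightarrow> E a" by (simp add: isCont_def)
  moreover have "\<forall>\<^sub>F z in at a. E z = 0"
    using eventually_at_in_open[of "ball a 1" a] \<open>\<And>z. z \<in> pball a \<Longrightarrow> E z = 0\<close> by (auto elim!: eventually_mono simp: pball_def)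
  ultimately have "E a = 0" using tendsto_eventually[of E 0 "at a"] tendsto_unique[of "at a" E] by auto
  then show ?thesis by (simp add: E_def comm2_def)
qed


subsection \<open>Local solutions\<close>

text \<open>Near a singular point these are the traces of two neighbouring cut planes: the half
  discs are joined on the left of \<open>a\<close> in \<open>chart1\<close> and on its right in
  \<open>chart2\<close>.\<close>

definition chart1 :: "real \<Rightarrow> complex set" where "chart1 a = {z \<in> pball (of_real a). Im z \<noteq> 0 \<or> Re z < a}"
definition chart2 :: "real \<Rightarrow> complex set" where "chart2 a = {z \<in> pball (of_real a). Im z \<noteq> 0 \<or> a < Re z}"

lemma open_charts: "open (chart1 a)" "open (chart2 a)"
proof -
  have 1: "open {\<eta>. Im \<eta> \<noteq> 0}"
    using open_Collect_neq[of Im "\<lambda>_. 0"] by (simp add: continuous_intros)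
  have *: "chart1 a = pball (of_real a) \<inter> ({z. Im z \<noteq> 0} \<union> {z. Re z < a})"
    "chart2 a = pball (of_real a) \<inter> ({z. Im z \<noteq> 0} \<union> {z. a < Re z})"
    by (auto simp: chart1_def chart2_def)
  show "open (chart1 a)" "open (chart2 a)"
    unfolding * by (intro open_Int open_Un open_pball 1 open_halfspace_Re_lt open_halfspace_Re_gt)+
qed

lemma charts_subset: "chart1 a \<subseteq> pball (of_real a)" "chart2 a \<subseteq> pball (of_real a)"
  by (auto simp: chart1_def chart2_def)

lemma pball_charts: "z \<in> pball (of_real a) \<Longrightarrow> z \<in> chart1 a \<or> z \<in> chart2 a"
  by (auto simp: chart1_def chart2_def pball_def complex_eq_iff)

text \<open>Gronwall's inequality along the radius with parameter
  \<open>- ln (2 * norm (z - a))\<close>: the rate is \<open>norm (A z) * norm (z - a)\<close>, at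
  most \<open>K\<close>, which yields growth like the power \<open>- K\<close> of the distance. In
  the applications \<open>s\<close> is 1 or -1; a closed half disc contains its radii and has a
  compact outer arc.\<close>

lemma solution_moderate_half:
  fixes a :: complex and s :: real and K :: nat
  assumes sol: "msol A D f" and D: "open D" "\<And>z. z \<in> pball a \<Longrightarrow> 0 \<le> s * (Re z - Re a) \<Longrightarrow> z \<in> D"
    and A: "\<And>z. 0 < norm (z - a) \<Longrightarrow> norm (z - a) \<le> 1 / 2 \<Longrightarrow> norm (A z) * norm (z - a) \<le> K"
  shows "\<exists>C. \<forall>z. 0 < norm (z - a) \<and> norm (z - a) < 1 / 2 \<and> 0 \<le> s * (Re z - Re a) \<longrightarrow> norm (f z) * norm (z - a) ^ K \<le> C"
proof -
  define S where "S = sphere a (1 / 2) \<inter> {z. 0 \<le> s * (Re z - Re a)}"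
  have "closed {z. 0 \<le> s * (Re z - Re a)}" by (intro closed_Collect_le continuous_intros)
  then have "compact S" unfolding S_def by (rule compact_Int_closed[OF compact_sphere])
  have inD: "z \<in> D" if "0 < norm (z - a)" "norm (z - a) \<le> 1 / 2" "0 \<le> s * (Re z - Re a)" for z
    using that by (intro D(2)) (auto simp: pball_def dist_norm norm_minus_commute)
  have "S \<subseteq> D"
  proof
    fix x assume "x \<in> S"
    then have "norm (x - a) = 1 / 2" "0 \<le> s * (Re x - Re a)" by (auto simp: S_def dist_norm norm_minus_commute)
    then have "0 < norm (x - a)" "norm (x - a) \<le> 1 / 2" by linarith+
    then show "x \<in> D" using inD \<open>0 \<le> s * (Re x - Re a)\<close> by blast
  qed
  have "continuous_on D f" using mhol_continuous_on[OF D(1) msol_mhol[OF D(1) sol]] .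
  then have "bounded (f ` S)"
    using \<open>compact S\<close> \<open>S \<subseteq> D\<close> by (intro compact_imp_bounded compact_continuous_image) (auto intro: continuous_on_subset)
  then obtain C where C: "C > 0" "\<And>z. z \<in> S \<Longrightarrow> norm (f z) \<le> C" by (auto simp: bounded_pos)
  have "norm (f z) * norm (z - a) ^ K \<le> C" if z: "0 < norm (z - a)" "norm (z - a) < 1 / 2" "0 \<le> s * (Re z - Re a)" for z
  proof -
    define \<rho> where "\<rho> = norm (z - a)"
    define u where "u = (z - a) / of_real \<rho>"
    have \<rho>: "0 < \<rho>" "\<rho> < 1 / 2" using z by (auto simp: \<rho>_def)
    have u: "norm u = 1" "0 \<le> s * Re u"
      using z \<rho> by (simp_all add: u_def norm_divide \<rho>_def[symmetric])
    define T where "T = - ln (2 * \<rho>)"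
    have T: "0 \<le> T" "exp (- T) = 2 * \<rho>" using \<rho> by (simp_all add: T_def)
    define g where "g t = a + of_real (exp (- t) / 2) * u" for t :: real
    have gT: "g T = z" using \<rho> by (simp add: g_def T u_def)
    have gn: "norm (g t - a) = exp (- t) / 2" "s * (Re (g t) - Re a) = exp (- t) / 2 * (s * Re u)" for t
      using u by (simp_all add: g_def norm_mult)
    have gD: "g t \<in> D" if "0 \<le> t" for t
    proof (rule inD)
      have "exp (- t) \<le> 1" using that by simp
      then show "0 < norm (g t - a)" "norm (g t - a) \<le> 1 / 2" "0 \<le> s * (Re (g t) - Re a)" unfolding gn using u by auto
    qed
    have dg: "(g has_vector_derivative of_real (- (exp (- t) / 2)) * u) (at t within X)" for t X
    proof -
      have "((\<lambda>t. of_real (exp (- t) / 2)) has_vector_derivative of_real (- (exp (- t) / 2))) (at t within X)"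
        by (intro has_vector_derivative_of_real) (auto intro!: derivative_eq_intros simp: has_real_derivative_iff_has_vector_derivative[symmetric])
      from has_vector_derivative_add[OF has_vector_derivative_const has_vector_derivative_mult_left[OF this], of a u]
      show ?thesis unfolding g_def[abs_def] by (simp only: add_0_left)
    qed
    have "norm (f (g T)) \<le> norm (f (g 0)) * exp (real K * (T - 0))"
    proof (rule gronwall[OF T(1)])
      fix t assume t: "t \<in> {0..T}"
      have "has_mderiv f (A (g t) ** f (g t)) (g t)" using sol gD[of t] t by (auto simp: msol_def)
      from has_mderiv_curve[OF this dg]
      show "((\<lambda>t. f (g t)) has_vector_derivative (of_real (- (exp (- t) / 2)) * u) *m (A (g t) ** f (g t))) (at t within {0..T})" .
      have e: "norm (of_real (- (exp (- t) / 2)) * u) = norm (g t - a)" using u by (simp add: norm_mult gn)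
      have "exp (- t) \<le> 1" using t by simp
      then have "norm (A (g t)) * norm (g t - a) \<le> K" by (intro A) (auto simp: gn)
      then have "norm (g t - a) * norm (A (g t)) * norm (f (g t)) \<le> K * norm (f (g t))"
        by (intro mult_right_mono) (auto simp: mult.commute)
      moreover have "norm (g t - a) * norm (A (g t) ** f (g t)) \<le> norm (g t - a) * (norm (A (g t)) * norm (f (g t)))"
        by (intro mult_left_mono norm_cmat2_mult) auto
      ultimately show "norm ((of_real (- (exp (- t) / 2)) * u) *m (A (g t) ** f (g t))) \<le> K * norm (f (g t))"
        unfolding norm_cscale e by (simp add: mult.assoc)
    qed
    also have "\<dots> \<le> C * exp (real K * T)"
    proof -
      have "norm (g 0 - a) = 1 / 2" "0 \<le> s * (Re (g 0) - Re a)" unfolding gn using u by simp_all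
      then have "g 0 \<in> S" by (simp add: S_def dist_norm norm_minus_commute)
      then show ?thesis using C(2) by (simp add: mult_right_mono)
    qed
    finally have "norm (f z) * \<rho> ^ K \<le> C * exp (real K * T) * \<rho> ^ K" unfolding gT using \<rho> by (intro mult_right_mono) auto
    also have "\<dots> = C * (exp T * \<rho>) ^ K" by (simp add: exp_of_nat_mult power_mult_distrib)
    also have "exp T * \<rho> = 1 / 2" using T(2) \<rho> by (simp add: exp_minus field_simps)
    also have "C * (1 / 2) ^ K \<le> C * 1" using C(1) by (intro mult_left_mono power_le_one) auto
    finally show ?thesis by (simp add: \<rho>_def)
  qed
  then show ?thesis by blast
qed

definition fuchs_coeff :: "complex \<Rightarrow> cmat2 \<Rightarrow> (complex \<Rightarrow> cmat2) \<Rightarrow> complex \<Rightarrow> cmat2" where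
  "fuchs_coeff a A H z = (1 / (z - a)) *m A + H z"

text \<open>Two neighbouring sheets at a simple pole, abstracted so as to cover both singular
  points.\<close>

definition fuchs_pair :: "real \<Rightarrow> cmat2 \<Rightarrow> (complex \<Rightarrow> cmat2) \<Rightarrow> cmat2 \<Rightarrow> (complex \<Rightarrow> cmat2) \<Rightarrow> (complex \<Rightarrow> cmat2) \<Rightarrow> bool" where
  "fuchs_pair a A H N f1 f2 \<longleftrightarrow> mhol H (ball (of_real a) 1) \<and> trace A = 0 \<and> (\<forall>z. trace (H z) = 0) \<and>
     msol (fuchs_coeff (of_real a) A H) (chart1 a) f1 \<and> msol (fuchs_coeff (of_real a) A H) (chart2 a) f2 \<and>
     (\<forall>z\<in>chart1 a. det (f1 z) = 1) \<and> (\<forall>z\<in>chart2 a. det (f2 z) = 1) \<and>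
     (\<forall>z\<in>pball (of_real a). (0 < Im z \<longrightarrow> f1 z = f2 z) \<and> (Im z < 0 \<longrightarrow> f1 z = f2 z ** N))"

text \<open>Each solution is estimated only on the half disc opposite to its slit; the two halves
  together surround the point.\<close>

lemma fuchs_moderate:
  assumes "fuchs_pair a A H N f1 f2"
  shows "\<exists>C K. \<forall>z. 0 < norm (z - of_real a) \<and> norm (z - of_real a) < 1 / 2 \<longrightarrow>
     (Re z \<le> a \<longrightarrow> norm (f1 z) * norm (z - of_real a) ^ K \<le> C) \<and> (a \<le> Re z \<longrightarrow> norm (f2 z) * norm (z - of_real a) ^ K \<le> C)"
proof -
  note p = assms[unfolded fuchs_pair_def]
  have "continuous_on (ball (of_real a) 1) H" using p by (intro mhol_continuous_on) auto
  then have "continuous_on (cball (of_real a) (1 / 2)) H" by (rule continuous_on_subset) auto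
  then have "bounded (H ` cball (of_real a) (1 / 2))" by (intro compact_imp_bounded compact_continuous_image) auto
  then obtain h where h: "h > 0" "\<And>z. z \<in> cball (of_real a) (1 / 2) \<Longrightarrow> norm (H z) \<le> h" by (auto simp: bounded_pos)
  define K where "K = nat \<lceil>norm A + h\<rceil>"
  have K: "norm A + h \<le> real K" unfolding K_def by linarith
  have A: "norm (fuchs_coeff (of_real a) A H z) * norm (z - of_real a) \<le> K"
    if z: "0 < norm (z - of_real a)" "norm (z - of_real a) \<le> 1 / 2" for z
  proof -
    have "norm (fuchs_coeff (of_real a) A H z) \<le> norm A / norm (z - of_real a) + norm (H z)"
      unfolding fuchs_coeff_def using norm_triangle_ineq[of "(1 / (z - of_real a)) *m A" "H z"] by (simp add: norm_divide)
    then have "norm (fuchs_coeff (of_real a) A H z) * norm (z - of_real a) \<le> (norm A / norm (z - of_real a) + norm (H z)) * norm (z - of_real a)"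
      by (intro mult_right_mono) auto
    also have "\<dots> = norm A + norm (H z) * norm (z - of_real a)" using z by (simp add: distrib_right)
    also have "norm (H z) * norm (z - of_real a) \<le> h * 1"
      using h z by (intro mult_mono h(2)) (auto simp: dist_norm norm_minus_commute)
    finally show ?thesis using K by simp
  qed
  have m: "msol (fuchs_coeff (of_real a) A H) (chart1 a) f1" "msol (fuchs_coeff (of_real a) A H) (chart2 a) f2"
    using p by blast+
  have "z \<in> chart1 a" if "z \<in> pball (of_real a)" "0 \<le> (-1) * (Re z - Re (of_real a))" for z
    using that by (auto simp: chart1_def pball_def complex_eq_iff)
  from solution_moderate_half[OF m(1) open_charts(1) this A]
  obtain C1 where C1: "\<And>z. 0 < norm (z - of_real a) \<Longrightarrow> norm (z - of_real a) < 1 / 2 \<Longrightarrow> 0 \<le> (-1) * (Re z - Re (of_real a)) \<Longrightarrow> norm (f1 z) * norm (z - of_real a) ^ K \<le> C1"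
    by blast
  have "z \<in> chart2 a" if "z \<in> pball (of_real a)" "0 \<le> 1 * (Re z - Re (of_real a))" for z
    using that by (auto simp: chart2_def pball_def complex_eq_iff)
  from solution_moderate_half[OF m(2) open_charts(2) this A]
  obtain C2 where C2: "\<And>z. 0 < norm (z - of_real a) \<Longrightarrow> norm (z - of_real a) < 1 / 2 \<Longrightarrow> 0 \<le> 1 * (Re z - Re (of_real a)) \<Longrightarrow> norm (f2 z) * norm (z - of_real a) ^ K \<le> C2"
    by blast
  show ?thesis
  proof (rule exI[of _ "max C1 C2"], rule exI[of _ K], intro allI impI)
    fix z :: complex assume z: "0 < norm (z - of_real a) \<and> norm (z - of_real a) < 1 / 2"
    show "(Re z \<le> a \<longrightarrow> norm (f1 z) * norm (z - of_real a) ^ K \<le> max C1 C2) \<and> (a \<le> Re z \<longrightarrow> norm (f2 z) * norm (z - of_real a) ^ K \<le> max C1 C2)"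
      using C1[of z] C2[of z] z by (intro conjI impI) (simp_all add: le_max_iff_disj)
  qed
qed

definition glue :: "real \<Rightarrow> (complex \<Rightarrow> cmat2) \<Rightarrow> (complex \<Rightarrow> cmat2) \<Rightarrow> complex \<Rightarrow> cmat2" where
  "glue a g1 g2 z = (if Im z \<noteq> 0 \<or> Re z < a then g1 z else g2 z)"

lemma glue_eq:
  assumes "\<And>z. z \<in> pball (of_real a) \<Longrightarrow> Im z \<noteq> 0 \<Longrightarrow> g1 z = g2 z"
  shows "z \<in> chart1 a \<Longrightarrow> glue a g1 g2 z = g1 z" "z \<in> chart2 a \<Longrightarrow> glue a g1 g2 z = g2 z"
  using assms[of z] by (auto simp: glue_def chart1_def chart2_def)

lemma glue_has_mderiv:
  assumes "\<And>z. z \<in> pball (of_real a) \<Longrightarrow> Im z \<noteq> 0 \<Longrightarrow> g1 z = g2 z"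
    "\<And>z. z \<in> chart1 a \<Longrightarrow> has_mderiv g1 (D1 z) z" "\<And>z. z \<in> chart2 a \<Longrightarrow> has_mderiv g2 (D2 z) z"
    "\<And>z. z \<in> chart1 a \<Longrightarrow> D1 z = D z" "\<And>z. z \<in> chart2 a \<Longrightarrow> D2 z = D z" and z: "z \<in> pball (of_real a)"
  shows "has_mderiv (glue a g1 g2) (D z) z"
  using pball_charts[OF z]
proof
  assume c: "z \<in> chart1 a"
  show ?thesis
    by (rule has_mderiv_transform[OF assms(2)[OF c, unfolded assms(4)[OF c]] open_charts(1) c]) (simp add: glue_eq(1)[OF assms(1)])
next
  assume c: "z \<in> chart2 a"
  show ?thesis
    by (rule has_mderiv_transform[OF assms(3)[OF c, unfolded assms(5)[OF c]] open_charts(2) c]) (simp add: glue_eq(2)[OF assms(1)])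
qed

lemma conjugation_deriv:
  assumes "has_mderiv f (A ** f z) z" "has_mderiv f' (A' ** f' z) z" "trace A' = 0"
  shows "has_mderiv (\<lambda>z. f z ** C ** adj2 (f' z)) (A ** (f z ** C ** adj2 (f' z)) - (f z ** C ** adj2 (f' z)) ** A') z"
proof -
  have t: "adj2 A' = - A'" using assms(3) by (simp add: cmat2_eq_iff trace_def sum_2 eq_neg_iff_add_eq_0 add.commute)
  have "has_mderiv (\<lambda>z. f z ** C ** adj2 (f' z)) ((A ** f z ** C + f z ** 0) ** adj2 (f' z) + (f z ** C) ** adj2 (A' ** f' z)) z"
    by (intro has_mderiv_mult has_mderiv_const has_mderiv_adj2 assms)
  then show ?thesis by (simp add: adj2_mult t cmat2_mult_algebra matrix_mul_assoc)
qed

text \<open>Below the axis the change of chart replaces \<open>C\<close> by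
  \<open>N ** C ** adj2 N\<close>; the product is single valued if the two are equal. Used with
  \<open>C = mat 1\<close> for the quotient of two solutions and with the nilpotent part of the
  monodromy.\<close>

lemma fuchs_product:
  fixes a :: real
  assumes p: "fuchs_pair a A H N f1 f2" and p': "fuchs_pair a A' H' N f1' f2'" and C: "N ** C ** adj2 N = C"
  defines "F \<equiv> glue a (\<lambda>z. f1 z ** C ** adj2 (f1' z)) (\<lambda>z. f2 z ** C ** adj2 (f2' z))"
  shows "z \<in> chart1 a \<Longrightarrow> F z = f1 z ** C ** adj2 (f1' z)" "z \<in> chart2 a \<Longrightarrow> F z = f2 z ** C ** adj2 (f2' z)"
    "z \<in> pball (of_real a) \<Longrightarrow> has_mderiv F (fuchs_coeff (of_real a) A H z ** F z - F z ** fuchs_coeff (of_real a) A' H' z) z"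
    "moderate (of_real a) F"
proof -
  have eq: "f1 z ** C ** adj2 (f1' z) = f2 z ** C ** adj2 (f2' z)" if z: "z \<in> pball (of_real a)" "Im z \<noteq> 0" for z
  proof (cases "Im z > 0")
    case True
    then show ?thesis using p p' z by (simp add: fuchs_pair_def)
  next
    case False
    then have "f1 z = f2 z ** N" "f1' z = f2' z ** N" using p p' z by (simp_all add: fuchs_pair_def)
    then have "f1 z ** C ** adj2 (f1' z) = f2 z ** (N ** C ** adj2 N) ** adj2 (f2' z)" by (simp add: adj2_mult matrix_mul_assoc)
    then show ?thesis using C by simp
  qed
  show F1: "F z = f1 z ** C ** adj2 (f1' z)" if "z \<in> chart1 a" for z unfolding F_def by (rule glue_eq(1)[OF eq that])
  show F2: "F z = f2 z ** C ** adj2 (f2' z)" if "z \<in> chart2 a" for z unfolding F_def by (rule glue_eq(2)[OF eq that])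
  have tr: "trace (fuchs_coeff (of_real a) A' H' z) = 0" for z
    using p' by (simp add: fuchs_pair_def fuchs_coeff_def trace_def sum_2 add_eq_0_iff2 flip: add_divide_distrib) 
  show "has_mderiv F (fuchs_coeff (of_real a) A H z ** F z - F z ** fuchs_coeff (of_real a) A' H' z) z" if "z \<in> pball (of_real a)"
  proof (subst F_def, rule glue_has_mderiv[OF eq _ _ _ _ that])
    show "has_mderiv (\<lambda>z. f1 z ** C ** adj2 (f1' z)) (fuchs_coeff (of_real a) A H z ** (f1 z ** C ** adj2 (f1' z)) - (f1 z ** C ** adj2 (f1' z)) ** fuchs_coeff (of_real a) A' H' z) z"
      if "z \<in> chart1 a" for z
      using p p' that tr by (intro conjugation_deriv) (auto simp: fuchs_pair_def msol_def)
    show "has_mderiv (\<lambda>z. f2 z ** C ** adj2 (f2' z)) (fuchs_coeff (of_real a) A H z ** (f2 z ** C ** adj2 (f2' z)) - (f2 z ** C ** adj2 (f2' z)) ** fuchs_coeff (of_real a) A' H' z) z"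
      if "z \<in> chart2 a" for z
      using p p' that tr by (intro conjugation_deriv) (auto simp: fuchs_pair_def msol_def)
  qed (simp_all add: F1 F2)
  obtain C1 K1 where 1: "\<And>z. 0 < norm (z - of_real a) \<Longrightarrow> norm (z - of_real a) < 1 / 2 \<Longrightarrow>
     (Re z \<le> a \<longrightarrow> norm (f1 z) * norm (z - of_real a) ^ K1 \<le> C1) \<and> (a \<le> Re z \<longrightarrow> norm (f2 z) * norm (z - of_real a) ^ K1 \<le> C1)"
    using fuchs_moderate[OF p] by blast
  obtain C2 K2 where 2: "\<And>z. 0 < norm (z - of_real a) \<Longrightarrow> norm (z - of_real a) < 1 / 2 \<Longrightarrow>
     (Re z \<le> a \<longrightarrow> norm (f1' z) * norm (z - of_real a) ^ K2 \<le> C2) \<and> (a \<le> Re z \<longrightarrow> norm (f2' z) * norm (z - of_real a) ^ K2 \<le> C2)"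
    using fuchs_moderate[OF p'] by blast
  have prod: "norm (g ** C ** adj2 g') * r ^ (K1 + K2) \<le> C1 * norm C * C2"
    if "norm g * r ^ K1 \<le> C1" "norm g' * r ^ K2 \<le> C2" "0 \<le> r" for g g' :: cmat2 and r
  proof -
    have c1: "0 \<le> C1" "0 \<le> C2"
      using order_trans[OF _ that(1)] order_trans[OF _ that(2)] that(3) by auto
    have "norm (g ** C ** adj2 g') \<le> norm g * norm C * norm g'"
      using norm_cmat2_mult[of "g ** C" "adj2 g'"] mult_right_mono[OF norm_cmat2_mult[of g C], of "norm g'"] by simp
    then have "norm (g ** C ** adj2 g') * r ^ (K1 + K2) \<le> norm g * norm C * norm g' * r ^ (K1 + K2)"
      using that(3) by (intro mult_right_mono) auto
    also have "\<dots> = (norm g * r ^ K1) * norm C * (norm g' * r ^ K2)" by (simp add: power_add)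
    also have "\<dots> \<le> C1 * norm C * C2" using that c1 by (intro mult_mono) auto
    finally show ?thesis .
  qed
  show "moderate (of_real a) F"
    unfolding moderate_def
  proof (rule exI[of _ "C1 * norm C * C2"], rule exI[of _ "K1 + K2"], intro allI impI)
    fix z :: complex assume z: "0 < norm (z - of_real a) \<and> norm (z - of_real a) < 1 / 2"
    then have zp: "z \<in> pball (of_real a)" by (auto simp: pball_def dist_norm norm_minus_commute)
    show "norm (F z) * norm (z - of_real a) ^ (K1 + K2) \<le> C1 * norm C * C2"
    proof (cases "Re z \<le> a")
      case True
      then have "z \<in> chart1 a" using zp by (auto simp: chart1_def pball_def complex_eq_iff)
      then show ?thesis using 1[of z] 2[of z] z True F1 prod[of "f1 z" "norm (z - of_real a)" "f1' z"] by simp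
    next
      case False
      then have "z \<in> chart2 a" using zp by (auto simp: chart2_def)
      then show ?thesis using 1[of z] 2[of z] z False F2 prod[of "f2 z" "norm (z - of_real a)" "f2' z"] by simp
    qed
  qed
qed

subsection \<open>Logarithmic monodromy\<close>

text \<open>The branch with argument between 0 and \<open>2 * pi\<close>: it continues
  \<open>log2\<close> through the upper half plane to the left of \<open>a\<close>.\<close>

definition log1 :: "real \<Rightarrow> complex \<Rightarrow> complex" where "log1 a z = Ln (- (z - of_real a)) + \<i> * of_real pi"
definition log2 :: "real \<Rightarrow> complex \<Rightarrow> complex" where "log2 a z = Ln (z - of_real a)"

lemma log_deriv:
  "z \<in> chart1 a \<Longrightarrow> (log1 a has_field_derivative 1 / (z - of_real a)) (at z)"
  "z \<in> chart2 a \<Longrightarrow> (log2 a has_field_derivative 1 / (z - of_real a)) (at z)"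
proof -
  assume z: "z \<in> chart1 a"
  then have "- (z - of_real a) \<notin> \<real>\<^sub>\<le>\<^sub>0" by (auto simp: chart1_def complex_nonpos_Reals_iff)
  moreover have "z - of_real a \<noteq> 0" using z by (auto simp: chart1_def pball_def)
  ultimately show "(log1 a has_field_derivative 1 / (z - of_real a)) (at z)"
    unfolding log1_def by (auto intro!: derivative_eq_intros simp: field_simps)
next
  assume z: "z \<in> chart2 a"
  then have "z - of_real a \<notin> \<real>\<^sub>\<le>\<^sub>0" by (auto simp: chart2_def complex_nonpos_Reals_iff)
  then show "(log2 a has_field_derivative 1 / (z - of_real a)) (at z)"
    unfolding log2_def by (auto intro!: derivative_eq_intros simp: inverse_eq_divide)
qed

lemma log_branches:
  "Im z > 0 \<Longrightarrow> log1 a z = log2 a z" "Im z < 0 \<Longrightarrow> log1 a z = log2 a z + 2 * of_real pi * \<i>"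
proof -
  assume "Im z > 0"
  then have "z - of_real a \<noteq> 0" "\<not> Im (z - of_real a) \<le> 0" by (auto simp: complex_eq_iff)
  then show "log1 a z = log2 a z" unfolding log1_def log2_def Ln_minus[OF \<open>z - of_real a \<noteq> 0\<close>] by simp
next
  assume "Im z < 0"
  then have "z - of_real a \<noteq> 0" "Im (z - of_real a) \<le> 0" "Im (z - of_real a) \<noteq> 0" by (auto simp: complex_eq_iff)
  then show "log1 a z = log2 a z + 2 * of_real pi * \<i>" unfolding log1_def log2_def Ln_minus[OF \<open>z - of_real a \<noteq> 0\<close>] by simp
qed

text \<open>The bound 8 is a crude one for \<open>1 + pi\<close>.\<close>

lemma log_moderate:
  assumes "0 < norm (z - of_real a)" "norm (z - of_real a) < 1 / 2"
  shows "norm (log1 a z) * norm (z - of_real a) \<le> 8" "norm (log2 a z) * norm (z - of_real a) \<le> 8"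
proof -
  have *: "norm (Ln w) * norm w \<le> 1 + pi / 2" if w: "0 < norm w" "norm w < 1 / 2" for w
  proof -
    have "norm (Ln w) \<le> \<bar>Re (Ln w)\<bar> + \<bar>Im (Ln w)\<bar>" by (rule cmod_le)
    also have "\<bar>Im (Ln w)\<bar> \<le> pi" using w mpi_less_Im_Ln[of w] Im_Ln_le_pi[of w] by (auto simp: abs_le_iff)
    also have "\<bar>Re (Ln w)\<bar> = ln (1 / norm w)" using w by (simp add: ln_div)
    also have "ln (1 / norm w) \<le> 1 / norm w" using ln_le_minus_one[of "1 / norm w"] w by auto
    finally have "norm (Ln w) * norm w \<le> (1 / norm w + pi) * norm w" by (intro mult_right_mono) auto
    also have "\<dots> = 1 + pi * norm w" using w by (simp add: field_simps)
    also have "pi * norm w \<le> pi * (1 / 2)" using w by (intro mult_left_mono) auto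
    finally show ?thesis by simp
  qed
  show "norm (log2 a z) * norm (z - of_real a) \<le> 8"
    unfolding log2_def using *[OF assms] pi_less_4 by linarith
  have "norm (log1 a z) * norm (z - of_real a) \<le> (norm (Ln (- (z - of_real a))) + pi) * norm (z - of_real a)"
    unfolding log1_def using norm_triangle_ineq[of "Ln (- (z - of_real a))" "\<i> * of_real pi"]
    by (intro mult_right_mono) (auto simp: norm_mult)
  also have "\<dots> = norm (Ln (- (z - of_real a))) * norm (- (z - of_real a)) + pi * norm (z - of_real a)"
    by (simp only: distrib_right norm_minus_cancel)
  also have "\<dots> \<le> (1 + pi / 2) + pi * (1 / 2)"
    using *[of "- (z - of_real a)"] assms unfolding norm_minus_cancel by (intro add_mono mult_left_mono) auto
  finally show "norm (log1 a z) * norm (z - of_real a) \<le> 8" using pi_less_4 by linarith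
qed


lemma mhol_zero_at_center:
  assumes "mhol E (ball a 1)" "\<And>z. z \<in> pball a \<Longrightarrow> E z = 0"
  shows "E a = 0"
proof -
  have "isCont E a" using mhol_continuous_on[OF open_ball assms(1)] by (simp add: continuous_on_eq_continuous_at)
  then have "E \<midarrow>a\<rightarrow> E a" by (simp add: isCont_def)
  moreover have "\<forall>\<^sub>F z in at a. E z = 0"
    using eventually_at_in_open[of "ball a 1" a] assms(2) by (auto elim!: eventually_mono simp: pball_def)
  ultimately show ?thesis using tendsto_eventually[of E 0 "at a"] tendsto_unique[of "at a" E] by auto
qed

text \<open>Under the monodromy \<open>D\<close> reproduces itself up to \<open>- 2 *m J\<close>, a
  defect that the jump of a logarithm can compensate.\<close>

lemma unipotent_conjugation:
  assumes "N = \<epsilon> *m (mat 1 + J)" "\<epsilon> * \<epsilon> = 1" "J ** J = 0" "trace J = 0"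
  shows "adj2 N = \<epsilon> *m (mat 1 - J)" "N ** J ** adj2 N = J"
    "D ** J - J ** D = 2 *m J \<Longrightarrow> N ** D ** adj2 N = D - 2 *m J"
proof -
  have t: "J $ 2 $ 2 = - J $ 1 $ 1" using assms(4) by (simp add: trace_def sum_2 eq_neg_iff_add_eq_0 add.commute)
  show a: "adj2 N = \<epsilon> *m (mat 1 - J)" unfolding assms(1) by (simp add: cmat2_eq_iff t)
  have JJ: "X ** J ** J = 0" for X :: cmat2 by (simp add: matrix_mul_assoc[symmetric] assms(3) cmat2_mult_algebra)
  have c: "N ** X ** adj2 N = (mat 1 + J) ** X ** (mat 1 - J)" for X
    unfolding a unfolding assms(1) by (simp add: cscale_mult assms(2))
  show "N ** J ** adj2 N = J" unfolding c by (simp add: cmat2_mult_algebra assms(3))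
  assume D: "D ** J - J ** D = 2 *m J"
  then have DJ: "D ** J = J ** D + 2 *m J" by (simp add: algebra_simps)
  have "J ** D ** J = J ** (J ** D + 2 *m J)" by (simp add: DJ matrix_mul_assoc[symmetric])
  also have "\<dots> = 0" by (simp add: cmat2_mult_algebra matrix_mul_assoc assms(3) cscale_mult)
  finally have "J ** D ** J = 0" .
  then show "N ** D ** adj2 N = D - 2 *m J" unfolding c
    by (simp add: cmat2_mult_algebra) (simp add: DJ)
qed

text \<open>For nonzero \<open>J\<close>, \<open>D\<close> is the semisimple member of an sl2 triple
  with nilpotent member \<open>J\<close>; it is written down explicitly.\<close>

lemma sl2_triple:
  assumes "J ** J = 0" "trace J = 0"
  shows "\<exists>D :: cmat2. D ** J - J ** D = 2 *m J"
proof -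
  define x y v where "x = J $ 1 $ 1" and "y = J $ 1 $ 2" and "v = J $ 2 $ 1"
  have t: "J $ 2 $ 2 = - x" using assms(2) by (simp add: x_def trace_def sum_2 eq_neg_iff_add_eq_0 add.commute)
  have n: "x * x + y * v = 0"
    using arg_cong[OF assms(1), of "\<lambda>M. M $ 1 $ 1"] by (simp add: cmat2_mult_nth x_def y_def v_def)
  show ?thesis
  proof (cases "y = 0")
    case True
    then have "x = 0" using n by simp
    then show ?thesis using t True
      by (intro exI[of _ "mat2 (-1) 0 0 1"]) (simp add: cmat2_simps x_def[symmetric] y_def[symmetric] v_def[symmetric])
  next
    case False
    have v: "v = - (x * x) / y" using n False by (simp add: field_simps eq_neg_iff_add_eq_0)
    show ?thesis using t False
      by (intro exI[of _ "mat2 1 0 (- 2 * x / y) (-1)"])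
         (simp add: cmat2_simps x_def[symmetric] y_def[symmetric] v_def[symmetric], simp add: v field_simps)
  qed
qed

text \<open>With a logarithm present, the eigenvalue of \<open>f J f\<^sup>-\<^sup>1\<close> under the adjoint residue is the positive one: the
  exponent \<open>0\<close> is excluded by nilpotency, and a negative exponent by the equation for
  \<open>f D f\<^sup>-\<^sup>1 + 2 log f J f\<^sup>-\<^sup>1 / (2 \<pi> \<i>)\<close>, which is single valued as \<open>[D, J] = 2 J\<close>.\<close>

lemma fuchs_log_order:
  fixes a :: real and n :: int
  assumes p: "fuchs_pair a A H N f1 f2" and AA: "A ** A = (th\<^sup>2 / 4) *m mat 1" and n: "th\<^sup>2 = (of_int n)\<^sup>2" "n \<noteq> 0"
    and N: "N = \<epsilon> *m (mat 1 + J)" "\<epsilon> * \<epsilon> = 1" "J ** J = 0" "trace J = 0" "J \<noteq> 0"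
  defines "G \<equiv> glue a (\<lambda>z. f1 z ** J ** adj2 (f1 z)) (\<lambda>z. f2 z ** J ** adj2 (f2 z))"
  shows "\<exists>Q. mhol Q (ball (of_real a) 1) \<and> Q (of_real a) \<noteq> 0 \<and> (\<forall>z\<in>pball (of_real a). G z = (z - of_real a) powi \<bar>n\<bar> *m Q z) \<and>
     comm2 A A (Q (of_real a)) = of_int \<bar>n\<bar> *m Q (of_real a)"
proof -
  let ?a = "complex_of_real a"
  note u = unipotent_conjugation[OF N(1-4)]
  note G = fuchs_product[OF p p u(2), folded G_def]
  note p' = p[unfolded fuchs_pair_def]
  have mH: "mhol H (ball ?a 1)" using p' by blast
  have mG: "mhol G (pball ?a)" unfolding mhol_iff[OF open_pball] using G(3) by blast
  have Gz: "\<exists>f. det f = 1 \<and> G z = f ** J ** adj2 f" if "z \<in> pball ?a" for z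
    using pball_charts[OF that] G(1)[of z] G(2)[of z] p' by blast
  define b where "b = ?a + \<i> / 2"
  have b: "b \<in> pball ?a" by (simp add: b_def pball_def dist_norm norm_mult norm_divide)
  have "G b \<noteq> 0"
  proof
    assume "G b = 0"
    then obtain f where f: "det f = 1" "f ** J ** adj2 f = 0" using Gz[OF b] by auto
    have "J = adj2 f ** (f ** J ** adj2 f) ** f" by (simp add: matrix_mul_assoc[symmetric] adj2_cancel[OF f(1)])
    then show False using f(2) N(5) by (simp add: cmat2_mult_algebra)
  qed
  from moderate_order[OF mG G(4) b this] obtain g Q where Q: "mhol Q (ball ?a 1)" "Q ?a \<noteq> 0"
     "\<And>z. z \<in> pball ?a \<Longrightarrow> G z = (z - ?a) powi g *m Q z" by blast
  have mz: "mhol (\<lambda>z. 0) (ball ?a 1)" by (rule mhol_intros)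
  have lead: "of_int g *m Q ?a = comm2 A A (Q ?a)"
    using leading_coefficient[OF Q(3,1) mz mH mH, of A A] G(3) by (simp add: fuchs_coeff_def)
  have za: "z - ?a \<noteq> 0" if "z \<in> pball ?a" for z using that by (auto simp: pball_def)
  \<comment> \<open>Nilpotency, and below it the vanishing of the trace, pass from \<open>J\<close>
    through its conjugates \<open>G z\<close> to the leading coefficient.\<close>
  have "Q ?a ** Q ?a = 0"
  proof (rule mhol_zero_at_center)
    show "mhol (\<lambda>z. Q z ** Q z) (ball ?a 1)" by (intro mhol_intros Q)
    fix z assume z: "z \<in> pball ?a"
    obtain f where f: "det f = 1" "G z = f ** J ** adj2 f" using Gz[OF z] by auto
    have "G z ** G z = f ** (J ** J) ** adj2 f"
      unfolding f(2) by (simp add: matrix_mul_assoc[symmetric] adj2_cancel[OF f(1)])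
    then have "((z - ?a) powi g * (z - ?a) powi g) *m (Q z ** Q z) = 0"
      unfolding Q(3)[OF z] by (simp add: N(3) cmat2_mult_algebra cscale_mult)
    then show "Q z ** Q z = 0" using za[OF z] by simp
  qed
  have "Q ?a + adj2 (Q ?a) = 0"
  proof (rule mhol_zero_at_center)
    show "mhol (\<lambda>z. Q z + adj2 (Q z)) (ball ?a 1)" by (intro mhol_intros Q)
    fix z assume z: "z \<in> pball ?a"
    obtain f where f: "det f = 1" "G z = f ** J ** adj2 f" using Gz[OF z] by auto
    have "J $ 2 $ 2 = - J $ 1 $ 1" using N(4) by (simp add: trace_def sum_2 eq_neg_iff_add_eq_0 add.commute)
    then have "adj2 J = - J" by (simp add: cmat2_eq_iff)
    moreover have "adj2 (adj2 f) = f" by (simp add: cmat2_eq_iff)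
    ultimately have "G z + adj2 (G z) = 0"
      unfolding f(2) adj2_mult by (simp add: cmat2_mult_algebra matrix_mul_assoc)
    then have "(z - ?a) powi g *m (Q z + adj2 (Q z)) = 0"
      unfolding Q(3)[OF z] by (simp add: cmat2_eq_iff algebra_simps)
    then show "Q z + adj2 (Q z) = 0" using za[OF z] by simp
  qed
  then have trQ: "trace (Q ?a) = 0" by (simp add: cmat2_eq_iff trace_def sum_2)
  have g_cases: "g = 0 \<or> g = \<bar>n\<bar> \<or> g = - \<bar>n\<bar>"
  proof -
    have "of_int g = (0 :: complex) \<or> (of_int g)\<^sup>2 = th\<^sup>2" using comm2_eigenvalue[OF AA AA lead[symmetric] Q(2)] .
    then have "g = 0 \<or> g\<^sup>2 = n\<^sup>2" unfolding n(1) by (simp flip: of_int_power)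
    then show ?thesis by (auto simp: power2_eq_iff)
  qed
  have th0: "th\<^sup>2 / 4 \<noteq> 0" using n by simp
  have "g \<noteq> 0"
  proof
    assume "g = 0"
    then have "A ** Q ?a = Q ?a ** A" using lead by (simp add: comm2_def)
    then have "Q ?a = 0"
      using nilpotent_commuting_zero[OF AA th0 _ trQ \<open>Q ?a ** Q ?a = 0\<close>] p' by blast
    then show False using Q(2) by simp
  qed
  moreover have "g \<noteq> - \<bar>n\<bar>"
  proof
    assume gn: "g = - \<bar>n\<bar>"
    obtain D where D: "D ** J - J ** D = 2 *m J" using sl2_triple[OF N(3,4)] by blast
    \<comment> \<open>\<open>c * (2 * pi * \<i>) = 2\<close>: the jump of \<open>c\<close> times the
      logarithm cancels the \<open>- 2 *m J\<close> from conjugating \<open>D\<close>.\<close>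
    define c where "c = 1 / (of_real pi * \<i>)"
    define g1 where "g1 z = f1 z ** D ** adj2 (f1 z) + (c * log1 a z) *m (f1 z ** J ** adj2 (f1 z))" for z
    define g2 where "g2 z = f2 z ** D ** adj2 (f2 z) + (c * log2 a z) *m (f2 z ** J ** adj2 (f2 z))" for z
    define P where "P = glue a g1 g2"
    have eq: "g1 z = g2 z" if z: "z \<in> pball ?a" "Im z \<noteq> 0" for z
    proof (cases "Im z > 0")
      case True
      then show ?thesis using p' z log_branches(1) by (simp add: g1_def g2_def)
    next
      case False
      then have f: "f1 z = f2 z ** N" and l: "log1 a z = log2 a z + 2 * of_real pi * \<i>"
        using p' z log_branches(2)[of z a] by auto
      have "f1 z ** D ** adj2 (f1 z) = f2 z ** (N ** D ** adj2 N) ** adj2 (f2 z)"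
        "f1 z ** J ** adj2 (f1 z) = f2 z ** (N ** J ** adj2 N) ** adj2 (f2 z)"
        unfolding f by (simp_all add: adj2_mult matrix_mul_assoc)
      then have "g1 z = f2 z ** (D - 2 *m J) ** adj2 (f2 z) + (c * log1 a z) *m (f2 z ** J ** adj2 (f2 z))"
        unfolding u(2) u(3)[OF D] g1_def by simp
      moreover have "c * log1 a z = c * log2 a z + 2" unfolding l by (simp add: c_def field_simps)
      ultimately show ?thesis
        unfolding g2_def by (simp add: cmat2_mult_algebra cscale_mult cscale.add_left)
    qed
    have P1: "P z = g1 z" if "z \<in> chart1 a" for z unfolding P_def by (rule glue_eq(1)[OF eq that])
    have P2: "P z = g2 z" if "z \<in> chart2 a" for z unfolding P_def by (rule glue_eq(2)[OF eq that])
    let ?F = "fuchs_coeff ?a A H"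
    have tr: "trace (?F z) = 0" for z
      using p' by (simp add: fuchs_coeff_def trace_def sum_2 add_eq_0_iff2 flip: add_divide_distrib)
    have dP: "has_mderiv P (?F z ** P z - P z ** ?F z + (c / (z - ?a)) *m G z) z" if z: "z \<in> pball ?a" for z
    proof -
      have d: "has_mderiv (\<lambda>z. f z ** D ** adj2 (f z) + (c * l z) *m (f z ** J ** adj2 (f z)))
          (?F z ** (f z ** D ** adj2 (f z) + (c * l z) *m (f z ** J ** adj2 (f z))) - (f z ** D ** adj2 (f z) + (c * l z) *m (f z ** J ** adj2 (f z))) ** ?F z
           + (c / (z - ?a)) *m (f z ** J ** adj2 (f z))) z"
        if "has_mderiv f (?F z ** f z) z" "(l has_field_derivative 1 / (z - ?a)) (at z)" for f l z
      proof -
        have "((\<lambda>z. c * l z) has_field_derivative c / (z - ?a)) (at z)"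
          using DERIV_cmult[OF that(2), of c] by simp
        from has_mderiv_add[OF conjugation_deriv[OF that(1,1) tr, of D] has_mderiv_cscale[OF this conjugation_deriv[OF that(1,1) tr, of J]]]
        show ?thesis by (simp add: cmat2_mult_algebra cscale_mult cscale.diff_right algebra_simps)
      qed
      show ?thesis
      proof (subst P_def, rule glue_has_mderiv[OF eq _ _ _ _ z])
        show "has_mderiv g1 (?F z ** g1 z - g1 z ** ?F z + (c / (z - ?a)) *m (f1 z ** J ** adj2 (f1 z))) z" if "z \<in> chart1 a" for z
          unfolding g1_def using p' that by (intro d log_deriv) (auto simp: msol_def)
        show "has_mderiv g2 (?F z ** g2 z - g2 z ** ?F z + (c / (z - ?a)) *m (f2 z ** J ** adj2 (f2 z))) z" if "z \<in> chart2 a" for z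
          unfolding g2_def using p' that by (intro d log_deriv) (auto simp: msol_def)
      qed (simp_all add: P1 P2 G(1,2))
    qed
    have modP: "moderate ?a P"
    proof -
      obtain C K where CK: "\<And>z. 0 < norm (z - ?a) \<Longrightarrow> norm (z - ?a) < 1 / 2 \<Longrightarrow>
         (Re z \<le> a \<longrightarrow> norm (f1 z) * norm (z - ?a) ^ K \<le> C) \<and> (a \<le> Re z \<longrightarrow> norm (f2 z) * norm (z - ?a) ^ K \<le> C)"
        using fuchs_moderate[OF p] by blast
      have bd: "norm (f ** D ** adj2 f + (c * l) *m (f ** J ** adj2 f)) * r ^ (2 * K + 1) \<le> C * C * norm D + norm c * 8 * (C * C * norm J)"
        if f: "norm f * r ^ K \<le> C" "0 \<le> r" "r \<le> 1" "norm l * r \<le> 8" for f r l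
      proof -
        have C0: "0 \<le> C" using order_trans[OF _ f(1)] f(2) by simp
        have tri: "norm (f ** M ** adj2 f) * r ^ (2 * K) \<le> C * C * norm M" for M
        proof -
          have "norm (f ** M ** adj2 f) \<le> norm f * norm M * norm f"
            using norm_cmat2_mult[of "f ** M" "adj2 f"] mult_right_mono[OF norm_cmat2_mult[of f M], of "norm f"] by simp
          then have "norm (f ** M ** adj2 f) * r ^ (2 * K) \<le> norm f * norm M * norm f * r ^ (2 * K)"
            using f(2) by (intro mult_right_mono) auto
          also have "\<dots> = (norm f * r ^ K) * (norm f * r ^ K) * norm M" by (simp add: mult_2 power_add)
          also have "\<dots> \<le> C * C * norm M" using f C0 by (intro mult_mono) auto
          finally show ?thesis .
        qed
        have "norm (f ** D ** adj2 f + (c * l) *m (f ** J ** adj2 f)) \<le> norm (f ** D ** adj2 f) + norm c * norm l * norm (f ** J ** adj2 f)"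
          using norm_triangle_ineq[of "f ** D ** adj2 f" "(c * l) *m (f ** J ** adj2 f)"] by (simp add: norm_mult)
        then have "norm (f ** D ** adj2 f + (c * l) *m (f ** J ** adj2 f)) * r ^ (2 * K + 1)
           \<le> (norm (f ** D ** adj2 f) + norm c * norm l * norm (f ** J ** adj2 f)) * r ^ (2 * K + 1)"
          using f(2) by (intro mult_right_mono) auto
        also have "\<dots> = (norm (f ** D ** adj2 f) * r ^ (2 * K)) * r + norm c * (norm l * r) * (norm (f ** J ** adj2 f) * r ^ (2 * K))"
          by (simp add: algebra_simps)
        also have "\<dots> \<le> (C * C * norm D) * 1 + norm c * 8 * (C * C * norm J)"
        proof -
          have "0 \<le> C * C * norm D" "0 \<le> norm c * 8" "0 \<le> norm (f ** J ** adj2 f) * r ^ (2 * K)" using C0 f by auto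
          then show ?thesis
            using add_mono[OF mult_mono[OF tri[of D] f(3) _ f(2)] mult_mono[OF mult_left_mono[OF f(4), of "norm c"] tri[of J]]] by simp
        qed
        finally show ?thesis by simp
      qed
      show ?thesis
        unfolding moderate_def
      proof (rule exI[of _ "C * C * norm D + norm c * 8 * (C * C * norm J)"], rule exI[of _ "2 * K + 1"], intro allI impI)
        fix z :: complex assume z: "0 < norm (z - ?a) \<and> norm (z - ?a) < 1 / 2"
        then have zp: "z \<in> pball ?a" by (auto simp: pball_def dist_norm norm_minus_commute)
        show "norm (P z) * norm (z - ?a) ^ (2 * K + 1) \<le> C * C * norm D + norm c * 8 * (C * C * norm J)"
        proof (cases "Re z \<le> a")
          case True
          then have "z \<in> chart1 a" using zp by (auto simp: chart1_def pball_def complex_eq_iff)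
          then show ?thesis using CK[of z] z True log_moderate(1)[of z a] unfolding P1[OF \<open>z \<in> chart1 a\<close>] g1_def
            by (intro bd) auto
        next
          case False
          then have "z \<in> chart2 a" using zp by (auto simp: chart2_def)
          then show ?thesis using CK[of z] z False log_moderate(2)[of z a] unfolding P2[OF \<open>z \<in> chart2 a\<close>] g2_def
            by (intro bd) auto
        qed
      qed
    qed
    have mP: "mhol P (pball ?a)" unfolding mhol_iff[OF open_pball] using dP by blast
    have lead_eq: "of_int k *m V ?a = comm2 A A (V ?a) + c *m W ?a"
      if "mhol V (ball ?a 1)" "mhol W (ball ?a 1)" "\<And>z. z \<in> pball ?a \<Longrightarrow> P z = (z - ?a) powi k *m V z"
        "\<And>z. z \<in> pball ?a \<Longrightarrow> G z = (z - ?a) powi k *m W z" for k V W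
    proof (rule leading_coefficient[OF that(3,1) _ mH mH, of "\<lambda>z. c *m W z"])
      show "mhol (\<lambda>z. c *m W z) (ball ?a 1)" by (intro mhol_intros holomorphic_intros that)
      show "has_mderiv P (((1 / (z - ?a)) *m A + H z) ** P z - P z ** ((1 / (z - ?a)) *m A + H z) + (1 / (z - ?a)) *m ((z - ?a) powi k *m (c *m W z))) z"
        if "z \<in> pball ?a" for z
        using dP[OF that] that(1) \<open>\<And>z. z \<in> pball ?a \<Longrightarrow> G z = (z - ?a) powi k *m W z\<close>[OF that] by (simp add: fuchs_coeff_def mult.commute)
    qed
    have c0: "c \<noteq> 0" by (simp add: c_def)
    have g2: "(of_int g)\<^sup>2 = th\<^sup>2" "of_int g \<noteq> (0 :: complex)"
      unfolding n(1) gn using n(2) by (simp_all flip: of_int_power)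
    \<comment> \<open>If \<open>P\<close> has at least the order \<open>g\<close> of
      \<open>G\<close>, comparison at this order gives the relation excluded by
      \<open>comm2_log_obstruction\<close>. An identically vanishing \<open>P\<close> is included,
      with \<open>V\<close> equal to 0.\<close>
    have extends: False if V: "mhol V (ball ?a 1)" "\<And>z. z \<in> pball ?a \<Longrightarrow> P z = (z - ?a) powi g *m V z" for V
    proof -
      have "of_int g *m V ?a = comm2 A A (V ?a) + c *m Q ?a" by (rule lead_eq[OF V(1) Q(1) V(2) Q(3)])
      then have "Q ?a = 0"
        by (intro comm2_log_obstruction[OF AA lead[symmetric] _ g2 c0, of "V ?a"]) simp
      then show False using Q(2) by simp
    qed
    show False
    proof (cases "\<forall>z\<in>pball ?a. P z = 0")
      case True
      then show False using extends[OF mz] by simp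
    next
      case False
      then obtain b' where "b' \<in> pball ?a" "P b' \<noteq> 0" by blast
      from moderate_order[OF mP modP this] obtain k V where V: "mhol V (ball ?a 1)" "V ?a \<noteq> 0"
        "\<And>z. z \<in> pball ?a \<Longrightarrow> P z = (z - ?a) powi k *m V z" by blast
      show False
      proof (cases "g \<le> k")
        case True
        have "(z - ?a) powi k = (z - ?a) powi g * (z - ?a) ^ nat (k - g)" if "z \<in> pball ?a" for z
          using za[OF that] True power_int_add[of "z - ?a" g "k - g"] by (simp add: power_int_def[of _ "k - g"])
        then show False
          using V(3) by (intro extends[of "\<lambda>z. (z - ?a) ^ nat (k - g) *m V z"] mhol_intros holomorphic_intros V(1)) simp
      next
        case False
        \<comment> \<open>If \<open>P\<close> has order \<open>k < g\<close>, the logarithmic term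
          does not reach its leading coefficient; so \<open>k\<close> would be an eigenvalue smaller
          than \<open>- \<bar>n\<bar>\<close>.\<close>
        have "(z - ?a) powi g = (z - ?a) powi k * (z - ?a) ^ nat (g - k)" if "z \<in> pball ?a" for z
          using za[OF that] False power_int_add[of "z - ?a" k "g - k"] by (simp add: power_int_def[of _ "g - k"])
        then have G': "G z = (z - ?a) powi k *m ((z - ?a) ^ nat (g - k) *m Q z)" if "z \<in> pball ?a" for z
          using Q(3)[OF that] that by simp
        have "mhol (\<lambda>z. (z - ?a) ^ nat (g - k) *m Q z) (ball ?a 1)" by (intro mhol_intros holomorphic_intros Q(1))
        from lead_eq[OF V(1) this V(3) G'] False
        have "comm2 A A (V ?a) = of_int k *m V ?a" by simp
        from comm2_eigenvalue[OF AA AA this V(2)] have "k = 0 \<or> k\<^sup>2 = n\<^sup>2" unfolding n(1) by (simp flip: of_int_power)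
        then have "k = 0 \<or> k = n \<or> k = - n" by (auto simp: power2_eq_iff)
        then show False using False gn n(2) by auto
      qed
    qed
  qed
  ultimately have "g = \<bar>n\<bar>" using g_cases by blast
  then show ?thesis using Q lead by (intro exI[of _ Q]) auto
qed

text \<open>If the quotient had a pole, its order \<open>m < 0\<close> would be an eigenvalue of the adjoint residue, so that
  \<open>th = \<plusminus>m\<close> and the monodromy is \<open>\<plusminus>(1 + J)\<close> with \<open>J\<^sup>2 = 0\<close>. The quotient intertwines the functions \<open>f J f\<^sup>-\<^sup>1\<close>
  of the two systems, and comparing the eigenvalues of the residue on the leading coefficients gives a contradiction.\<close>

theorem fuchs_quotient_extends:
  fixes a :: real
  assumes p: "fuchs_pair a A H N f1 f2" and p': "fuchs_pair a A' H' N f1' f2'"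
    and AA: "A ** A = (th\<^sup>2 / 4) *m mat 1" "A' ** A' = (th\<^sup>2 / 4) *m mat 1"
    and N: "det N = 1" "trace N = 2 * cos (of_real pi * th)" "N \<noteq> mat 1" "N \<noteq> - mat 1"
  shows "\<exists>Q. mhol Q (ball (of_real a) 1) \<and> (\<forall>z\<in>chart1 a. Q z = f1 z ** adj2 (f1' z)) \<and> (\<forall>z\<in>chart2 a. Q z = f2 z ** adj2 (f2' z))"
proof -
  let ?a = "complex_of_real a"
  define R where "R = glue a (\<lambda>z. f1 z ** mat 1 ** adj2 (f1' z)) (\<lambda>z. f2 z ** mat 1 ** adj2 (f2' z))"
  have C: "N ** mat 1 ** adj2 N = mat 1" by (simp add: adj2_cancel[OF N(1)])
  note R = fuchs_product[OF p p' C, folded R_def]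
  note q = p[unfolded fuchs_pair_def] p'[unfolded fuchs_pair_def]
  have mR: "mhol R (pball ?a)" unfolding mhol_iff[OF open_pball] using R(3) by blast
  have mH: "mhol H (ball ?a 1)" "mhol H' (ball ?a 1)" using q by blast+
  have za: "z - ?a \<noteq> 0" if "z \<in> pball ?a" for z using that by (auto simp: pball_def)
  define b where "b = ?a + \<i> / 2"
  have b: "b \<in> pball ?a" by (simp add: b_def pball_def dist_norm norm_mult norm_divide)
  then have "b \<in> chart1 a" by (simp add: chart1_def b_def)
  then have "det (R b) = 1" using q by (simp add: R(1) det_mul)
  then have "R b \<noteq> 0" by (auto simp: det_2)
  from moderate_order[OF mR R(4) b this] obtain m Q where Q: "mhol Q (ball ?a 1)" "Q ?a \<noteq> 0"
     "\<And>z. z \<in> pball ?a \<Longrightarrow> R z = (z - ?a) powi m *m Q z" by blast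
  have "0 \<le> m"
  proof (rule ccontr)
    assume "\<not> 0 \<le> m"
    then have m: "m < 0" "\<bar>m\<bar> = - m" by auto
    have mz: "mhol (\<lambda>z. 0) (ball ?a 1)" by (rule mhol_intros)
    have lead: "of_int m *m Q ?a = comm2 A A' (Q ?a)"
      using leading_coefficient[OF Q(3,1) mz mH, of A A'] R(3) by (simp add: fuchs_coeff_def)
    have m2: "(of_int m)\<^sup>2 = th\<^sup>2" using comm2_eigenvalue[OF AA lead[symmetric] Q(2)] m by auto
    define \<epsilon> where "\<epsilon> = cos (of_real pi * th)"
    have "sin (of_real pi * th) = 0"
    proof -
      have "(of_real pi * of_int m :: complex) = of_real (pi * of_int m)" by simp
      then have "sin (of_real pi * of_int m :: complex) = of_real (sin (pi * of_int m))" by (simp only: sin_of_real)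
      moreover have "sin (pi * of_int m) = 0" by simp
      ultimately have s: "sin (of_real pi * of_int m :: complex) = 0" by (simp only: of_real_0)
      have "th = of_int m \<or> th = - of_int m" using m2 by (auto simp: power2_eq_iff)
      then show ?thesis using s by auto
    qed
    then have \<epsilon>: "\<epsilon> * \<epsilon> = 1" using sin_cos_squared_add[of "of_real pi * th"] by (simp add: \<epsilon>_def power2_eq_square)
    have t: "N $ 2 $ 2 = 2 * \<epsilon> - N $ 1 $ 1" using N(2) by (simp add: \<epsilon>_def trace_def sum_2 algebra_simps)
    \<comment> \<open>As \<open>th\<close> is an integer, \<open>\<epsilon> = cos (pi * th)\<close>
      is 1 or -1 and \<open>N\<close> has the double eigenvalue \<open>\<epsilon>\<close>. As
      \<open>N\<close> is not scalar, \<open>J\<close> is nonzero with square 0.\<close>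
    define J where "J = \<epsilon> *m N - mat 1"
    have NJ: "N = \<epsilon> *m (mat 1 + J)" by (simp add: J_def cscale.add_right cscale.diff_right \<epsilon>)
    have trJ: "trace J = 0" by (simp add: J_def trace_def sum_2 t algebra_simps \<epsilon>)
    have dJ: "det J = 0"
      using N(1) \<epsilon> unfolding J_def det_2 by (simp add: t) algebra
    have "J $ 2 $ 2 = - J $ 1 $ 1" using trJ by (simp add: trace_def sum_2 eq_neg_iff_add_eq_0 add.commute)
    then have JJ: "J ** J = 0" using dJ[symmetric] by (simp add: cmat2_simps det_2 algebra_simps)
    have "\<epsilon> = 1 \<or> \<epsilon> = -1" using \<epsilon> by (simp add: square_eq_1_iff)
    then have J0: "J \<noteq> 0" using N(3,4) NJ by (auto simp: cmat2_eq_iff)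
    have n: "th\<^sup>2 = (of_int m)\<^sup>2" "m \<noteq> 0" using m2 m by auto
    define G where "G = glue a (\<lambda>z. f1 z ** J ** adj2 (f1 z)) (\<lambda>z. f2 z ** J ** adj2 (f2 z))"
    define G' where "G' = glue a (\<lambda>z. f1' z ** J ** adj2 (f1' z)) (\<lambda>z. f2' z ** J ** adj2 (f2' z))"
    obtain QG where QG: "mhol QG (ball ?a 1)" "QG ?a \<noteq> 0" "\<And>z. z \<in> pball ?a \<Longrightarrow> G z = (z - ?a) powi (- m) *m QG z"
       "comm2 A A (QG ?a) = of_int (- m) *m QG ?a"
      using fuchs_log_order[OF p AA(1) n NJ \<epsilon> JJ trJ J0, folded G_def] unfolding m(2) by blast
    obtain QG' where QG': "mhol QG' (ball ?a 1)" "QG' ?a \<noteq> 0" "\<And>z. z \<in> pball ?a \<Longrightarrow> G' z = (z - ?a) powi (- m) *m QG' z"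
       "comm2 A' A' (QG' ?a) = of_int (- m) *m QG' ?a"
      using fuchs_log_order[OF p' AA(2) n NJ \<epsilon> JJ trJ J0, folded G'_def] unfolding m(2) by blast
    note u = unipotent_conjugation[OF NJ \<epsilon> JJ trJ]
    note Gp = fuchs_product(1,2)[OF p p u(2), folded G_def] fuchs_product(1,2)[OF p' p' u(2), folded G'_def]
    have RG: "R z ** G' z = G z ** R z" if z: "z \<in> pball ?a" for z
      using pball_charts[OF z]
    proof
      assume c: "z \<in> chart1 a"
      then have "det (f1 z) = 1" "det (f1' z) = 1" using q by blast+
      then show ?thesis unfolding R(1)[OF c] Gp(1)[OF c] Gp(3)[OF c]
        by (simp add: matrix_mul_assoc[symmetric] adj2_cancel)
    next
      assume c: "z \<in> chart2 a"
      then have "det (f2 z) = 1" "det (f2' z) = 1" using q by blast+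
      then show ?thesis unfolding R(2)[OF c] Gp(2)[OF c] Gp(4)[OF c]
        by (simp add: matrix_mul_assoc[symmetric] adj2_cancel)
    qed
    \<comment> \<open>On both sides of \<open>RG\<close> the orders of the factors are
      \<open>m\<close> and \<open>- m\<close>, so the leading coefficients intertwine too.\<close>
    have "Q ?a ** QG' ?a - QG ?a ** Q ?a = 0"
    proof (rule mhol_zero_at_center)
      show "mhol (\<lambda>z. Q z ** QG' z - QG z ** Q z) (ball ?a 1)" by (intro mhol_intros Q QG QG')
      fix z assume z: "z \<in> pball ?a"
      have "(z - ?a) powi m * (z - ?a) powi (- m) = 1" using za[OF z] by (simp add: power_int_minus)
      then show "Q z ** QG' z - QG z ** Q z = 0"
        using RG[OF z] unfolding Q(3)[OF z] QG(3)[OF z] QG'(3)[OF z] by (simp add: cscale_mult mult.commute)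
    qed
    then have QQ: "Q ?a ** QG' ?a = QG ?a ** Q ?a" by simp
    \<comment> \<open>\<open>Q ?a\<close> belongs to the eigenvalue \<open>- h\<close> of
      \<open>A\<close> on the left and \<open>h\<close> of \<open>A'\<close> on the right, while
      \<open>QG ?a\<close> and \<open>QG' ?a\<close> belong to \<open>h\<close>. Hence
      \<open>A\<close> acts on \<open>Q ?a ** QG' ?a\<close> both by \<open>- h\<close> and by
      \<open>h\<close>; so this product is zero, and \<open>eigen_product_zero\<close> makes one of
      its factors zero.\<close>
    define h where "h = - (of_int m / 2 :: complex)"
    have m0: "of_int m \<noteq> (0 :: complex)" using m by simp
    have e1: "A ** Q ?a = (- h) *m Q ?a" "Q ?a ** A' = h *m Q ?a"
      using comm2_eigenvector[OF AA lead[symmetric] m0 m2] by (simp_all add: h_def)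
    have "(of_int (- m))\<^sup>2 = th\<^sup>2" "of_int (- m) \<noteq> (0 :: complex)" using m2 m0 by simp_all
    then have e2: "A ** QG ?a = h *m QG ?a" "A' ** QG' ?a = h *m QG' ?a"
      using comm2_eigenvector(1)[OF AA(1,1) QG(4)] comm2_eigenvector(1)[OF AA(2,2) QG'(4)] by (simp_all add: h_def)
    have "A ** (Q ?a ** QG' ?a) = (- h) *m (Q ?a ** QG' ?a)" unfolding matrix_mul_assoc e1 by (simp only: cscale_mult)
    moreover have "A ** (Q ?a ** QG' ?a) = h *m (Q ?a ** QG' ?a)" unfolding QQ matrix_mul_assoc e2 by (simp only: cscale_mult)
    ultimately have "(h - (- h)) *m (Q ?a ** QG' ?a) = 0" by (simp only: cscale.diff_left diff_self)
    then have "Q ?a ** QG' ?a = 0" using m0 by (simp add: h_def)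
    then have "Q ?a = 0 \<or> QG' ?a = 0"
      using q m0 by (intro eigen_product_zero[OF _ e1(2) e2(2)]) (auto simp: h_def)
    then show False using Q(2) QG'(2) by blast
  qed
  then have "R z = (z - ?a) ^ nat m *m Q z" if "z \<in> pball ?a" for z
    using Q(3)[OF that] by (simp add: power_int_def)
  moreover have "mhol (\<lambda>z. (z - ?a) ^ nat m *m Q z) (ball ?a 1)" by (intro mhol_intros holomorphic_intros Q(1))
  ultimately show ?thesis
    using R(1,2) charts_subset by (intro exI[of _ "\<lambda>z. (z - ?a) ^ nat m *m Q z"]) force
qed


section \<open>Uniqueness\<close>

lemma sheets_det:
  assumes X: "canon th w P Q k X" "trace P = 0" "trace Q = 0" and s: "sheets (exp w) P Q X N fL fM fR"
  shows "\<eta> \<in> cutL \<Longrightarrow> det (fL \<eta>) = 1" "\<eta> \<in> cutM \<Longrightarrow> det (fM \<eta>) = 1" "\<eta> \<in> cutR \<Longrightarrow> det (fR \<eta>) = 1"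
proof -
  have *: "det (f \<eta>) = 1"
    if "open D" "connected D" "msol (eta_coeff (exp w) P Q) D f" "\<And>e. e \<in> ustrip \<Longrightarrow> f (exp e) = X e" "2 * \<i> \<in> D" "\<eta> \<in> D" for f D \<eta>
  proof -
    have "f (2 * \<i>) = X (Ln (2 * \<i>))" using that(4)[OF ustrip(4)] by simp
    moreover have "\<exists>d. \<forall>z\<in>D. det (f z) = d" by (rule det_msol_constant[OF that(1-3) trace_eta_coeff[OF X(2,3)]])
    moreover have "det (X (Ln (2 * \<i>))) = 1" using canon_det[OF X] ustrip(4) by (simp add: ustrip_def)
    ultimately show ?thesis using that(5,6) by metis
  qed
  show "\<eta> \<in> cutL \<Longrightarrow> det (fL \<eta>) = 1" "\<eta> \<in> cutM \<Longrightarrow> det (fM \<eta>) = 1" "\<eta> \<in> cutR \<Longrightarrow> det (fR \<eta>) = 1"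
    using *[OF open_cuts(1) connected_cuts(1)] *[OF open_cuts(2) connected_cuts(2)] *[OF open_cuts(3) connected_cuts(3)] s
    by (simp_all add: sheets_def cuts_upper_lower)
qed

lemma sheets_upper:
  assumes X: "canon th w P Q k X" "trace P = 0" "trace Q = 0" and s: "sheets (exp w) P Q X N fL fM fR" and "0 < Im \<eta>"
  shows "fL \<eta> = fM \<eta>" "fM \<eta> = fR \<eta>"
proof -
  let ?H = "{\<eta>. 0 < Im \<eta>}"
  have sub: "?H \<subseteq> cutL" "?H \<subseteq> cutM" "?H \<subseteq> cutR" by (auto intro: cuts_upper_lower)
  have H: "open ?H" "connected ?H" by (simp_all add: open_halfspace_Im_gt convex_connected convex_halfspace_Im_gt)
  have v: "fL (2 * \<i>) = X (Ln (2 * \<i>))" "fM (2 * \<i>) = X (Ln (2 * \<i>))" "fR (2 * \<i>) = X (Ln (2 * \<i>))"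
    using s[unfolded sheets_def] ustrip(4) by (metis exp_Ln complex_i_not_zero mult_eq_0_iff zero_neq_numeral)+
  note d = sheets_det[OF X s]
  show "fL \<eta> = fM \<eta>"
    by (rule msol_eqI[OF H msol_subset[OF _ sub(1)] msol_subset[OF _ sub(2)] trace_eta_coeff[OF X(2,3)], where a = "2 * \<i>"])
       (use s sub d v assms(5) in \<open>auto simp: sheets_def\<close>)
  show "fM \<eta> = fR \<eta>"
    by (rule msol_eqI[OF H msol_subset[OF _ sub(2)] msol_subset[OF _ sub(3)] trace_eta_coeff[OF X(2,3)], where a = "2 * \<i>"])
       (use s sub d v assms(5) in \<open>auto simp: sheets_def\<close>)
qed

lemma charts_cuts:
  "chart1 (-1) \<subseteq> cutL" "chart2 (-1) \<subseteq> cutM" "chart1 1 \<subseteq> cutM" "chart2 1 \<subseteq> cutR"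
proof -
  have n: "\<bar>Re z - a\<bar> < 1" if "z \<in> pball (of_real a)" for z a
    using that abs_Re_le_cmod[of "z - of_real a"] by (simp add: pball_def dist_norm norm_minus_commute)
  show "chart1 (-1) \<subseteq> cutL" "chart2 (-1) \<subseteq> cutM" "chart1 1 \<subseteq> cutM" "chart2 1 \<subseteq> cutR"
    using n[of _ "-1"] n[of _ 1] by (fastforce simp: chart1_def chart2_def cutL_def cutM_def cutR_def)+
qed

lemma sheets_fuchs:
  assumes X: "canon th w P Q k X" "trace P = 0" "trace Q = 0" and s: "sheets (exp w) P Q X N fL fM fR"
  shows "fuchs_pair (-1) P (\<lambda>z. (exp w / 4) *m sigma3 + (1 / (z - 1)) *m Q) (fst N) fL fM"
    "fuchs_pair 1 Q (\<lambda>z. (exp w / 4) *m sigma3 + (1 / (z + 1)) *m P) (snd N) fM fR"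
proof -
  have c: "fuchs_coeff (of_real (-1)) P (\<lambda>z. (exp w / 4) *m sigma3 + (1 / (z - 1)) *m Q) = eta_coeff (exp w) P Q"
    "fuchs_coeff (of_real 1) Q (\<lambda>z. (exp w / 4) *m sigma3 + (1 / (z + 1)) *m P) = eta_coeff (exp w) P Q"
    by (simp_all add: fuchs_coeff_def eta_coeff_def fun_eq_iff)
  have t: "trace (c *m sigma3 + d *m A) = 0" if "trace A = 0" for c d A
    using that by (simp add: trace_def sum_2 sigma3_def flip: distrib_left)
  have "\<not> (1 :: complex) \<in> ball (of_real (-1)) 1" "\<not> (-1 :: complex) \<in> ball (of_real 1) 1" by (auto simp: dist_norm)
  then have h: "mhol (\<lambda>z. (exp w / 4) *m sigma3 + (1 / (z - 1)) *m Q) (ball (of_real (-1)) 1)"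
    "mhol (\<lambda>z. (exp w / 4) *m sigma3 + (1 / (z + 1)) *m P) (ball (of_real 1) 1)"
    by (intro mhol_intros holomorphic_intros; fastforce simp: add_eq_0_iff2 add_eq_0_iff)+
  note q = s[unfolded sheets_def] sheets_det[OF X s] sheets_upper[OF X s]
  have sol: "msol (eta_coeff (exp w) P Q) (chart1 (-1)) fL" "msol (eta_coeff (exp w) P Q) (chart2 (-1)) fM"
    "msol (eta_coeff (exp w) P Q) (chart1 1) fM" "msol (eta_coeff (exp w) P Q) (chart2 1) fR"
    using q(1) charts_cuts by (meson msol_subset)+
  show "fuchs_pair (-1) P (\<lambda>z. (exp w / 4) *m sigma3 + (1 / (z - 1)) *m Q) (fst N) fL fM"
    unfolding fuchs_pair_def c using h(1) X t[OF X(3)] sol charts_cuts q by (auto simp: subset_iff)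
  show "fuchs_pair 1 Q (\<lambda>z. (exp w / 4) *m sigma3 + (1 / (z + 1)) *m P) (snd N) fM fR"
    unfolding fuchs_pair_def c using h(2) X t[OF X(2)] sol charts_cuts q by (auto simp: subset_iff)
qed

text \<open>If a residue vanishes, the two cut planes next to that point lie in a larger star-shaped
  domain on which the system is regular, so there is no monodromy. Thus nontrivial monodromy makes
  the residues nonzero, as \<open>A_mats_inject\<close> requires.\<close>

lemma sheets_residue_zero:
  assumes X: "canon th w P Q k X" "trace P = 0" "trace Q = 0" and s: "sheets (exp w) P Q X N fL fM fR"
  shows "P = 0 \<Longrightarrow> fst N = mat 1" "Q = 0 \<Longrightarrow> snd N = mat 1"
proof -
  have conv: "(1 - t) * a + t * b < c" if "0 \<le> t" "t \<le> 1" "a < c" "b < c" for t a b c :: real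
    using convex_bound_lt[of a c b "1 - t" t] that by simp
  have conv': "c < (1 - t) * a + t * b" if "0 \<le> t" "t \<le> 1" "c < a" "c < b" for t a b c :: real
    using conv[of t "-a" "-c" "-b"] that by simp
  note q = s[unfolded sheets_def] sheets_det[OF X s]
  have v: "fL (2 * \<i>) = X (Ln (2 * \<i>))" "fM (2 * \<i>) = X (Ln (2 * \<i>))" "fR (2 * \<i>) = X (Ln (2 * \<i>))"
    using q(1) ustrip(4) by (metis exp_Ln complex_i_not_zero mult_eq_0_iff zero_neq_numeral)+
  let ?A = "eta_coeff (exp w) P Q"
  have main: "f1 (- \<i>) = f2 (- \<i>)"
    if D: "open D" "b \<in> D" "\<And>z. z \<in> D \<Longrightarrow> closed_segment b z \<subseteq> D" "mhol ?A D" "2 * \<i> \<in> D"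
      and D1: "open D1" "connected D1" "D1 \<subseteq> D" "2 * \<i> \<in> D1" "msol ?A D1 f1" "- \<i> \<in> D1"
      and D2: "open D2" "connected D2" "D2 \<subseteq> D" "2 * \<i> \<in> D2" "msol ?A D2 f2" "- \<i> \<in> D2"
      and eq: "f1 (2 * \<i>) = X (Ln (2 * \<i>))" "f2 (2 * \<i>) = X (Ln (2 * \<i>))"
    for D b D1 f1 D2 f2
  proof -
    have "det (X (Ln (2 * \<i>))) = 1" using canon_det[OF X] ustrip(4) by (simp add: ustrip_def)
    from linear_ode_exists_SL2[OF D(1-4) trace_eta_coeff[OF X(2,3)] D(5) this]
    obtain h where h: "h (2 * \<i>) = X (Ln (2 * \<i>))" "msol ?A D h" "\<And>z. z \<in> D \<Longrightarrow> det (h z) = 1" by auto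
    have "h (- \<i>) = f1 (- \<i>)"
      by (rule msol_eqI[OF D1(1,2) msol_subset[OF h(2) D1(3)] D1(5) trace_eta_coeff[OF X(2,3)] _ D1(4) _ D1(6)])
         (use h D1 eq in auto)
    moreover have "h (- \<i>) = f2 (- \<i>)"
      by (rule msol_eqI[OF D2(1,2) msol_subset[OF h(2) D2(3)] D2(5) trace_eta_coeff[OF X(2,3)] _ D2(4) _ D2(6)])
         (use h D2 eq in auto)
    ultimately show ?thesis using eq by simp
  qed
  have on: "open {\<eta>. Im \<eta> \<noteq> 0}"
    using open_Collect_neq[of Im "\<lambda>_. 0"] by (simp add: continuous_intros)
  show "fst N = mat 1" if P: "P = 0"
  proof -
    let ?D = "{\<eta>. Im \<eta> \<noteq> 0} \<union> {\<eta>. Re \<eta> < 1}"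
    have seg: "closed_segment (of_real (-3)) z \<subseteq> ?D" if "z \<in> ?D" for z
    proof
      fix x assume "x \<in> closed_segment (complex_of_real (-3)) z"
      then show "x \<in> ?D" using that cut_star_aux[of x "-3" z] conv[of _ "-3" 1 "Re z"]
        by (cases "x = of_real (-3)") auto
    qed
    have op: "open ?D" by (intro open_Un on open_halfspace_Re_lt)
    have hol: "mhol ?A ?D" unfolding eta_coeff_def P
      by (simp, intro mhol_intros holomorphic_intros) auto
    have "fL (- \<i>) = fM (- \<i>)"
      by (rule main[of ?D "of_real (-3)" cutL fL cutM fM, OF op _ seg hol _ open_cuts(1) connected_cuts(1) _ _ _ _ open_cuts(2) connected_cuts(2) _ _ _ _ v(1,2)])
         (use q in \<open>auto simp: cutL_def cutM_def\<close>)
    then have "fM (- \<i>) ** fst N = fM (- \<i>) ** mat 1" using q by simp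
    then show ?thesis by (rule cmat2_left_cancel) (simp add: q(3) cutM_def)
  qed
  show "snd N = mat 1" if Q: "Q = 0"
  proof -
    let ?D = "{\<eta>. Im \<eta> \<noteq> 0} \<union> {\<eta>. -1 < Re \<eta>}"
    have seg: "closed_segment (of_real 3) z \<subseteq> ?D" if "z \<in> ?D" for z
    proof
      fix x assume "x \<in> closed_segment (complex_of_real 3) z"
      then show "x \<in> ?D" using that cut_star_aux[of x 3 z] conv'[of _ "-1" 3 "Re z"]
        by (cases "x = of_real 3") auto
    qed
    have op: "open ?D" by (intro open_Un on open_halfspace_Re_gt)
    have hol: "mhol ?A ?D" unfolding eta_coeff_def Q
      by (simp, intro mhol_intros holomorphic_intros) (auto simp: add_eq_0_iff2)
    have "fM (- \<i>) = fR (- \<i>)"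
      by (rule main[of ?D "of_real 3" cutM fM cutR fR, OF op _ seg hol _ open_cuts(2) connected_cuts(2) _ _ _ _ open_cuts(3) connected_cuts(3) _ _ _ _ v(2,3)])
         (use q in \<open>auto simp: cutR_def cutM_def\<close>)
    then have "fR (- \<i>) ** snd N = fR (- \<i>) ** mat 1" using q by simp
    then show ?thesis by (rule cmat2_left_cancel) (simp add: q(4) cutR_def)
  qed
qed

section \<open>Entire functions and the behaviour at infinity\<close>

lemma mhol_local:
  assumes "\<And>z. z \<in> S \<Longrightarrow> \<exists>T g. open T \<and> z \<in> T \<and> mhol g T \<and> (\<forall>x\<in>T. f x = g x)" "open S"
  shows "mhol f S"
  unfolding mhol_iff[OF assms(2)]
proof
  fix z assume "z \<in> S"
  from assms(1)[OF this] obtain T g where T: "open T" "z \<in> T" "mhol g T" "\<forall>x\<in>T. f x = g x" by (elim exE conjE)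
  then have e: "\<And>x. x \<in> T \<Longrightarrow> g x = f x" by simp
  obtain D where "has_mderiv g D z" using T(1-3) mhol_iff by blast
  from has_mderiv_transform[where f = g and g = f, OF this T(1,2) e] show "\<exists>D. has_mderiv f D z" by blast
qed

lemma mhol_identity:
  assumes "open S" "connected S" "mhol f S" "mhol g S" "open T" "T \<subseteq> S" "T \<noteq> {}" "\<And>z. z \<in> T \<Longrightarrow> f z = g z" "z \<in> S"
  shows "f z = g z"
proof -
  obtain a where a: "a \<in> T" using assms(7) by auto
  have "f z $ i $ j = g z $ i $ j" for i j
  proof (rule analytic_continuation_open[of T S "\<lambda>z. f z $ i $ j" "\<lambda>z. g z $ i $ j"])
    show "(\<lambda>z. f z $ i $ j) holomorphic_on S" "(\<lambda>z. g z $ i $ j) holomorphic_on S" using assms by (auto simp: mhol_def)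
  qed (use assms in auto)
  then show ?thesis by (simp add: cmat2_eq_iff)
qed

lemma mhol_Liouville:
  assumes "mhol f UNIV" "\<And>z. norm (f z) \<le> B"
  shows "f z = f 0"
proof -
  have "f z $ i $ j = f 0 $ i $ j" for i j
  proof -
    have "bounded (range (\<lambda>z. f z $ i $ j))"
      using order_trans[OF norm_cmat2_entry assms(2)] by (auto simp: bounded_iff)
    then have "(\<lambda>z. f z $ i $ j) constant_on UNIV"
      using assms(1) by (intro Liouville_theorem) (auto simp: mhol_def)
    then show ?thesis by (auto simp: constant_on_def)
  qed
  then show ?thesis by (simp add: cmat2_eq_iff)
qed


text \<open>Where both canonical solutions have their asymptotics, the exponentials in
  \<open>E\<close> cancel and it is bounded. This covers a closed subsector of angle
  \<open>3 * pi / 2\<close>; the complementary strip of width \<open>pi / 2\<close> is filled by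
  \<open>strip_decay\<close>, and periodicity gives the bound on the edge that lies outside the
  subsector.\<close>

lemma quotient_bounded_at_infinity:
  assumes X: "canon th w P Q 2 X" and X': "canon th w P' Q' 2 X'"
    and E: "mhol E {e. 0 < Re e}" "\<And>e. 0 < Re e \<Longrightarrow> E e = X e ** adj2 (X' e)"
    and per: "\<And>e. 0 < Re e \<Longrightarrow> E (e + 2 * of_real pi * \<i>) = E e"
  shows "\<exists>B \<rho>. \<forall>e. \<rho> < Re e \<longrightarrow> norm (E e) \<le> B"
proof -
  define F F' where "F e = X e ** exp_sigma3 (- canon_exponent th w e)"
    and "F' e = X' e ** exp_sigma3 (- canon_exponent th w e)" for e
  have bd: "\<exists>C R. 0 \<le> C \<and> (\<forall>e. R < Re e \<and> \<bar>Im (e + w) - pi / 2\<bar> \<le> 3 * pi / 4 \<longrightarrow> norm (Y e ** exp_sigma3 (- canon_exponent th w e)) \<le> C)"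
    if "canon th w A B 2 Y" for A B Y
  proof -
    have "0 < pi / 4" by simp
    then have "\<exists>C R. \<forall>e. Re e > R \<and> \<bar>Im (e + w) - pi / 2 - (of_int 2 - 2) * pi\<bar> \<le> pi - pi / 4 \<longrightarrow>
        norm (Y e ** exp_sigma3 (- canon_exponent th w e) - mat 1) \<le> C * exp (- Re e)"
      using that unfolding canon_def by blast
    moreover have "pi - pi / 4 = 3 * pi / 4" "Im (e + w) - pi / 2 - (of_int 2 - 2) * pi = Im (e + w) - pi / 2" for e by simp_all
    ultimately obtain C R where C: "\<And>e. Re e > R \<Longrightarrow> \<bar>Im (e + w) - pi / 2\<bar> \<le> 3 * pi / 4 \<Longrightarrow>
       norm (Y e ** exp_sigma3 (- canon_exponent th w e) - mat 1) \<le> C * exp (- Re e)" by (simp only:) blast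
    have "norm (Y e ** exp_sigma3 (- canon_exponent th w e)) \<le> \<bar>C\<bar> + 2"
      if e: "max 0 R < Re e" "\<bar>Im (e + w) - pi / 2\<bar> \<le> 3 * pi / 4" for e
    proof -
      have "C * exp (- Re e) \<le> \<bar>C\<bar> * 1" using e(1) by (intro mult_mono) auto
      then have "norm (Y e ** exp_sigma3 (- canon_exponent th w e) - mat 1) \<le> \<bar>C\<bar>" using C[of e] e by simp
      then show ?thesis
        using norm_triangle_ineq[of "Y e ** exp_sigma3 (- canon_exponent th w e) - mat 1" "mat 1"] norm_mat_1_le by simp
    qed
    then show ?thesis by (intro exI[of _ "\<bar>C\<bar> + 2"] exI[of _ "max 0 R"]) auto
  qed
  obtain C R where C: "0 \<le> C" "\<And>e. R < Re e \<Longrightarrow> \<bar>Im (e + w) - pi / 2\<bar> \<le> 3 * pi / 4 \<Longrightarrow> norm (F e) \<le> C"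
    using bd[OF X] unfolding F_def by blast
  obtain C' R' where C': "0 \<le> C'" "\<And>e. R' < Re e \<Longrightarrow> \<bar>Im (e + w) - pi / 2\<bar> \<le> 3 * pi / 4 \<Longrightarrow> norm (F' e) \<le> C'"
    using bd[OF X'] unfolding F'_def by blast
  define \<rho> where "\<rho> = max 0 (max R R')"
  have EF: "E e = F e ** adj2 (F' e)" if "0 < Re e" for e
  proof -
    have "adj2 (exp_sigma3 a) = exp_sigma3 (- a)" for a by (simp add: exp_sigma3_def cmat2_eq_iff)
    then show ?thesis
      unfolding E(2)[OF that] F_def F'_def adj2_mult by (simp add: matrix_mul_assoc[symmetric] exp_sigma3_cancel)
  qed
  have sector: "norm (E e) \<le> C * C'" if e: "\<rho> < Re e" "\<bar>Im (e + w) - pi / 2\<bar> \<le> 3 * pi / 4" for e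
  proof -
    have "norm (F e) \<le> C" "norm (F' e) \<le> C'" using e C C' by (auto simp: \<rho>_def)
    then have "norm (F e) * norm (F' e) \<le> C * C'" using C(1) by (intro mult_mono) auto
    then show ?thesis using EF[of e] e(1) norm_cmat2_mult[of "F e" "adj2 (F' e)"] by (simp add: \<rho>_def)
  qed
  \<comment> \<open>The middle of the complementary sector is at
    \<open>Im (e + w) = - pi / 2\<close>.\<close>
  define c where "c = - pi / 2 - Im w"
  have shift: "norm (E e) \<le> C * C'" if e: "\<rho> < Re e" "Im (e + w) = - 3 * pi / 4" for e
  proof -
    have "norm (E (e + 2 * of_real pi * \<i>)) \<le> C * C'" using e by (intro sector) auto
    then show ?thesis using per[of e] e(1) by (simp add: \<rho>_def)
  qed
  have side: "norm (E e) \<le> C * C'" if e: "\<rho> < Re e" "\<bar>Im e - c\<bar> = pi / 4" for e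
  proof -
    have "Im (e + w) = - pi / 4 \<or> Im (e + w) = - 3 * pi / 4"
      using e(2) unfolding c_def by (auto simp: abs_if split: if_splits)
    then show ?thesis using sector[OF e(1)] shift[OF e(1)] by auto
  qed
  have growth: "\<exists>K. \<forall>e. 1 \<le> Re e \<and> \<bar>Im e - c\<bar> \<le> pi / 4 \<longrightarrow> norm (E e) \<le> exp (K * exp (Re e))"
  proof -
    obtain K where K: "\<And>e. 1 \<le> Re e \<Longrightarrow> c - pi / 4 \<le> Im e \<Longrightarrow> Im e \<le> c + pi / 4 \<Longrightarrow> norm (X e) \<le> exp (K * exp (Re e))"
      using solution_growth[of "exp w" P Q X "c - pi / 4" "c + pi / 4"] X unfolding canon_def by blast
    obtain K' where K': "\<And>e. 1 \<le> Re e \<Longrightarrow> c - pi / 4 \<le> Im e \<Longrightarrow> Im e \<le> c + pi / 4 \<Longrightarrow> norm (X' e) \<le> exp (K' * exp (Re e))"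
      using solution_growth[of "exp w" P' Q' X' "c - pi / 4" "c + pi / 4"] X' unfolding canon_def by blast
    have "norm (E e) \<le> exp ((K + K') * exp (Re e))" if e: "1 \<le> Re e" "\<bar>Im e - c\<bar> \<le> pi / 4" for e
    proof -
      have "c - pi / 4 \<le> Im e" "Im e \<le> c + pi / 4" using e(2) by linarith+
      then have "norm (X e) * norm (X' e) \<le> exp (K * exp (Re e)) * exp (K' * exp (Re e))"
        using e(1) by (intro mult_mono K K') auto
      then show ?thesis using E(2)[of e] e(1) norm_cmat2_mult[of "X e" "adj2 (X' e)"]
        by (simp add: distrib_right exp_add)
    qed
    then show ?thesis by (intro exI[of _ "K + K'"]) auto
  qed
  have "\<exists>C R. \<forall>e. R < Re e \<and> \<bar>Im e - c\<bar> = pi / 4 \<longrightarrow> norm (E e) \<le> C * exp (- 0 * Re e)"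
    using side by (intro exI[of _ "C * C'"] exI[of _ \<rho>]) auto
  from strip_decay[OF E(1) this growth]
  obtain C'' R'' where C'': "\<And>e. R'' < Re e \<Longrightarrow> \<bar>Im e - c\<bar> \<le> pi / 4 \<Longrightarrow> norm (E e) \<le> C''" by auto
  define B where "B = max (C * C') C''"
  have per': "E (e + of_int n * (2 * of_real pi * \<i>)) = E e" if "0 < Re e" for e n
  proof (induction n rule: int_induct[where k = 0])
    case (step1 i)
    have "E (e + of_int (i + 1) * (2 * of_real pi * \<i>)) = E ((e + of_int i * (2 * of_real pi * \<i>)) + 2 * of_real pi * \<i>)"
      by (simp add: algebra_simps)
    then show ?case using step1 per[of "e + of_int i * (2 * of_real pi * \<i>)"] that by simp
  next
    case (step2 i)
    have "E (e + of_int i * (2 * of_real pi * \<i>)) = E ((e + of_int (i - 1) * (2 * of_real pi * \<i>)) + 2 * of_real pi * \<i>)"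
      by (simp add: algebra_simps)
    then show ?case using step2 per[of "e + of_int (i - 1) * (2 * of_real pi * \<i>)"] that by simp
  qed simp
  have "norm (E e) \<le> B" if e: "max \<rho> R'' < Re e" for e
  proof -
    \<comment> \<open>Reduces \<open>Im (e + w)\<close> modulo \<open>2 * pi\<close> to the interval
      from \<open>- 3 * pi / 4\<close> to \<open>5 * pi / 4\<close>, the union of both
      ranges.\<close>
    define n where "n = \<lfloor>(Im (e + w) + 3 * pi / 4) / (2 * pi)\<rfloor>"
    define e' where "e' = e + of_int (- n) * (2 * of_real pi * \<i>)"
    have "of_int n \<le> (Im (e + w) + 3 * pi / 4) / (2 * pi)" "(Im (e + w) + 3 * pi / 4) / (2 * pi) < of_int n + 1"
      unfolding n_def by linarith+
    then have "of_int n * (2 * pi) \<le> Im (e + w) + 3 * pi / 4" "Im (e + w) + 3 * pi / 4 < (of_int n + 1) * (2 * pi)"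
      by (simp_all only: pos_le_divide_eq pos_divide_less_eq pi_gt_zero zero_less_mult_iff zero_less_numeral simp_thms)
    moreover have "(of_int n + 1) * (2 * pi) = of_int n * (2 * pi) + 2 * pi" by (simp add: distrib_right)
    moreover have "Im (e' + w) = Im (e + w) - of_int n * (2 * pi)" by (simp add: e'_def)
    ultimately have I: "- 3 * pi / 4 \<le> Im (e' + w)" "Im (e' + w) < 5 * pi / 4" by linarith+
    have Im: "Im e' = Im (e' + w) - Im w" by simp
    have Re: "Re e' = Re e" by (simp add: e'_def)
    have "norm (E e') \<le> B"
    proof (cases "Im (e' + w) \<le> - pi / 4")
      case True
      then have "\<bar>Im e' - c\<bar> \<le> pi / 4" using I Im unfolding c_def by linarith
      then show ?thesis using C''[of e'] e Re by (simp add: B_def)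
    next
      case False
      then have "\<bar>Im (e' + w) - pi / 2\<bar> \<le> 3 * pi / 4" using I by linarith
      then show ?thesis using sector[of e'] e Re by (simp add: B_def)
    qed
    then show ?thesis using per'[of e "- n"] e by (simp add: e'_def \<rho>_def)
  qed
  then show ?thesis by blast
qed

text \<open>After clearing denominators the difference is affine in \<open>\<eta>\<close>, so two
  points decide.\<close>

lemma eta_coeff_inject:
  assumes "\<And>\<eta>. 0 < Im \<eta> \<Longrightarrow> eta_coeff x P Q \<eta> = eta_coeff x P' Q' \<eta>"
  shows "P = P'" "Q = Q'"
proof -
  have p: "(\<eta> - 1) * (P $ i $ j - P' $ i $ j) + (\<eta> + 1) * (Q $ i $ j - Q' $ i $ j) = 0" if "0 < Im \<eta>" for \<eta> i j
  proof -
    have n: "\<eta> + 1 \<noteq> 0" "\<eta> - 1 \<noteq> 0" using that by (auto simp: add_eq_0_iff2)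
    have "P $ i $ j / (\<eta> + 1) + Q $ i $ j / (\<eta> - 1) = P' $ i $ j / (\<eta> + 1) + Q' $ i $ j / (\<eta> - 1)"
      using arg_cong[OF assms[OF that], of "\<lambda>A. A $ i $ j"] by (simp add: eta_coeff_def)
    then have "(P $ i $ j - P' $ i $ j) / (\<eta> + 1) + (Q $ i $ j - Q' $ i $ j) / (\<eta> - 1) = 0"
      unfolding diff_divide_distrib by (simp add: algebra_simps)
    then show ?thesis using n by (simp add: divide_simps mult.commute split: if_splits)
  qed
  have "P $ i $ j - P' $ i $ j = 0 \<and> Q $ i $ j - Q' $ i $ j = 0" for i j
  proof -
    let ?p = "P $ i $ j - P' $ i $ j" and ?q = "Q $ i $ j - Q' $ i $ j"
    have 1: "(\<i> - 1) * ?p + (\<i> + 1) * ?q = 0" and 2: "(2 * \<i> - 1) * ?p + (2 * \<i> + 1) * ?q = 0"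
      using p[of \<i>] p[of "2 * \<i>"] by simp_all
    have "\<i> * (?p + ?q) = 0" using arg_cong2[OF 2 1, of "(-)"] by (simp add: algebra_simps)
    then have q: "?q = - ?p" by (simp add: add_eq_0_iff)
    then show ?thesis using 1 by (simp only: q) (simp add: algebra_simps)
  qed
  then show "P = P'" "Q = Q'" by (simp_all add: cmat2_eq_iff)
qed

theorem mono_rep_unique:
  assumes r: "mono_rep th w P Q N" "mono_rep th w P' Q' N"
    and tr: "trace P = 0" "trace Q = 0" "trace P' = 0" "trace Q' = 0"
    and P: "P ** P = (t0\<^sup>2 / 4) *m mat 1" "P' ** P' = (t0\<^sup>2 / 4) *m mat 1"
    and Q: "Q ** Q = (t1\<^sup>2 / 4) *m mat 1" "Q' ** Q' = (t1\<^sup>2 / 4) *m mat 1"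
    and N0: "det (fst N) = 1" "trace (fst N) = 2 * cos (of_real pi * t0)" "fst N \<noteq> mat 1" "fst N \<noteq> - mat 1"
    and N1: "det (snd N) = 1" "trace (snd N) = 2 * cos (of_real pi * t1)" "snd N \<noteq> mat 1" "snd N \<noteq> - mat 1"
  shows "P = P'" "Q = Q'"
proof -
  obtain X fL fM fR where X: "canon th w P Q 2 X" and s: "sheets (exp w) P Q X N fL fM fR" using r(1) by (auto simp: mono_rep_def)
  obtain X' fL' fM' fR' where X': "canon th w P' Q' 2 X'" and s': "sheets (exp w) P' Q' X' N fL' fM' fR'" using r(2) by (auto simp: mono_rep_def)
  note Xt = X tr(1,2) and Xt' = X' tr(3,4)
  note d = sheets_det[OF Xt s] sheets_det[OF Xt' s'] and u = sheets_upper[OF Xt s] sheets_upper[OF Xt' s']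
  obtain Q0 where Q0: "mhol Q0 (ball (of_real (-1)) 1)" "\<And>z. z \<in> chart1 (-1) \<Longrightarrow> Q0 z = fL z ** adj2 (fL' z)"
      "\<And>z. z \<in> chart2 (-1) \<Longrightarrow> Q0 z = fM z ** adj2 (fM' z)"
    using fuchs_quotient_extends[OF sheets_fuchs(1)[OF Xt s] sheets_fuchs(1)[OF Xt' s'] P N0] by blast
  obtain Q1 where Q1: "mhol Q1 (ball (of_real 1) 1)" "\<And>z. z \<in> chart1 1 \<Longrightarrow> Q1 z = fM z ** adj2 (fM' z)"
      "\<And>z. z \<in> chart2 1 \<Longrightarrow> Q1 z = fR z ** adj2 (fR' z)"
    using fuchs_quotient_extends[OF sheets_fuchs(2)[OF Xt s] sheets_fuchs(2)[OF Xt' s'] Q N1] by blast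
  \<comment> \<open>Where cut planes overlap the branches coincide by \<open>agree\<close>; the last
    two serve only the points -1 and 1.\<close>
  define R where "R \<eta> = (if \<eta> \<in> cutL then fL \<eta> ** adj2 (fL' \<eta>) else if \<eta> \<in> cutM then fM \<eta> ** adj2 (fM' \<eta>)
     else if \<eta> \<in> cutR then fR \<eta> ** adj2 (fR' \<eta>) else if \<eta> = -1 then Q0 \<eta> else Q1 \<eta>)" for \<eta>
  have agree: "fL \<eta> ** adj2 (fL' \<eta>) = fM \<eta> ** adj2 (fM' \<eta>)" "fM \<eta> ** adj2 (fM' \<eta>) = fR \<eta> ** adj2 (fR' \<eta>)" if "Im \<eta> \<noteq> 0" for \<eta>
  proof -
    have c: "f ** N ** adj2 (f' ** N) = f ** adj2 f'" if "det N = 1" for f f' N :: cmat2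
      using that by (simp add: adj2_mult matrix_mul_assoc[symmetric] adj2_cancel)
    have "Im \<eta> < 0 \<or> 0 < Im \<eta>" using that by auto
    then show "fL \<eta> ** adj2 (fL' \<eta>) = fM \<eta> ** adj2 (fM' \<eta>)" "fM \<eta> ** adj2 (fM' \<eta>) = fR \<eta> ** adj2 (fR' \<eta>)"
      using u s s' c[OF N0(1)] c[OF N1(1)] by (auto simp: sheets_def)
  qed
  have RL: "R \<eta> = fL \<eta> ** adj2 (fL' \<eta>)" if "\<eta> \<in> cutL" for \<eta> using that by (simp add: R_def)
  have RM: "R \<eta> = fM \<eta> ** adj2 (fM' \<eta>)" if "\<eta> \<in> cutM" for \<eta>
    using that agree[of \<eta>] by (auto simp: R_def cutL_def cutM_def)
  have RR: "R \<eta> = fR \<eta> ** adj2 (fR' \<eta>)" if "\<eta> \<in> cutR" for \<eta>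
    using that agree[of \<eta>] by (auto simp: R_def cutL_def cutM_def cutR_def)
  have R0: "R \<eta> = Q0 \<eta>" if "\<eta> \<in> ball (of_real (-1)) 1" for \<eta>
  proof (cases "\<eta> = -1")
    case True
    then show ?thesis by (simp add: R_def cutL_def cutM_def cutR_def)
  next
    case False
    then have "\<eta> \<in> pball (of_real (-1))" using that by (simp add: pball_def)
    from pball_charts[OF this] show ?thesis using RL RM Q0 charts_cuts by (metis subsetD)
  qed
  have R1: "R \<eta> = Q1 \<eta>" if "\<eta> \<in> ball (of_real 1) 1" for \<eta>
  proof (cases "\<eta> = 1")
    case True
    then show ?thesis by (simp add: R_def cutL_def cutM_def cutR_def)
  next
    case False
    then have "\<eta> \<in> pball (of_real 1)" using that by (simp add: pball_def)
    from pball_charts[OF this] show ?thesis using RM RR Q1 charts_cuts by (metis subsetD)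
  qed
  have hol: "mhol (\<lambda>\<eta>. f \<eta> ** adj2 (f' \<eta>)) D" if "open D" "msol A D f" "msol A' D f'" for f f' D A A'
    using msol_mhol[OF that(1,2)] msol_mhol[OF that(1,3)] by (intro mhol_intros)
  have cut_hol: "mhol (\<lambda>\<eta>. fL \<eta> ** adj2 (fL' \<eta>)) cutL" "mhol (\<lambda>\<eta>. fM \<eta> ** adj2 (fM' \<eta>)) cutM" "mhol (\<lambda>\<eta>. fR \<eta> ** adj2 (fR' \<eta>)) cutR"
    using s s' hol[OF open_cuts(1)] hol[OF open_cuts(2)] hol[OF open_cuts(3)] unfolding sheets_def by blast+
  have Rhol: "mhol R UNIV"
  proof (rule mhol_local)
    fix \<eta> :: complex
    consider "\<eta> \<in> cutL" | "\<eta> \<in> cutM" | "\<eta> \<in> cutR" | "\<eta> = -1" | "\<eta> = 1"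
      by (cases "Im \<eta> = 0"; cases "Re \<eta>" "-1 :: real" rule: linorder_cases; cases "Re \<eta>" "1 :: real" rule: linorder_cases)
         (auto simp: cutL_def cutM_def cutR_def complex_eq_iff)
    then show "\<exists>T g. open T \<and> \<eta> \<in> T \<and> mhol g T \<and> (\<forall>x\<in>T. R x = g x)"
    proof cases
      case 1
      then show ?thesis using open_cuts(1) RL cut_hol(1) by blast
    next
      case 2
      then show ?thesis using open_cuts(2) RM cut_hol(2) by blast
    next
      case 3
      then show ?thesis using open_cuts(3) RR cut_hol(3) by blast
    next
      case 4
      then show ?thesis using R0 Q0(1) open_ball[of "of_real (-1) :: complex" 1]
        by (intro exI[of _ "ball (of_real (-1)) 1"] exI[of _ Q0]) auto
    next
      case 5
      then show ?thesis using R1 Q1(1) open_ball[of "of_real 1 :: complex" 1]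
        by (intro exI[of _ "ball (of_real 1) 1"] exI[of _ Q1]) auto
    qed
  qed simp
  define E where "E e = R (exp e)" for e
  have Ehol: "mhol E {e. 0 < Re e}"
  proof -
    have "(\<lambda>e. R (exp e) $ i $ j) holomorphic_on {e. 0 < Re e}" for i j
      using holomorphic_on_compose_gen[of exp "{e. 0 < Re e}" "\<lambda>\<eta>. R \<eta> $ i $ j" UNIV] Rhol
      by (auto simp: mhol_def o_def intro!: holomorphic_intros)
    then show ?thesis by (simp add: mhol_def E_def)
  qed
  have EX: "E e = X e ** adj2 (X' e)" if "0 < Re e" for e
  proof (rule mhol_identity[OF open_convex_RH(1) convex_connected[OF open_convex_RH(2)] Ehol _ ustrip(1)])
    show "mhol (\<lambda>e. X e ** adj2 (X' e)) {e. 0 < Re e}"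
      using hol[OF open_convex_RH(1)] X X' unfolding canon_def by blast
    show "E e = X e ** adj2 (X' e)" if "e \<in> ustrip" for e
    proof -
      have "Im (exp e) \<noteq> 0" using ustrip(3)[OF that] by simp
      then have "exp e \<in> cutL" by (rule cuts_upper_lower)
      then show ?thesis using s s' that by (simp add: E_def RL sheets_def)
    qed
  qed (use that ustrip(4) in \<open>auto simp: ustrip_def\<close>)
  have per: "E (e + 2 * of_real pi * \<i>) = E e" for e by (simp add: E_def exp_add)
  obtain B \<rho> where B: "\<And>e. \<rho> < Re e \<Longrightarrow> norm (E e) \<le> B"
    using quotient_bounded_at_infinity[OF X X' Ehol EX per] by blast
  have "continuous_on UNIV R" by (rule mhol_continuous_on[OF open_UNIV Rhol])
  then have "compact (R ` cball 0 (exp \<rho>))" by (intro compact_continuous_image compact_cball) (rule continuous_on_subset, auto)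
  then obtain B' where B': "\<And>\<eta>. norm \<eta> \<le> exp \<rho> \<Longrightarrow> norm (R \<eta>) \<le> B'"
    using compact_imp_bounded by (fastforce simp: bounded_iff)
  have Rb: "norm (R \<eta>) \<le> max B B'" for \<eta>
  proof (cases "norm \<eta> \<le> exp \<rho>")
    case True
    then show ?thesis using B' by (simp add: le_max_iff_disj)
  next
    case False
    then have n: "exp \<rho> < norm \<eta>" by simp
    then have "\<eta> \<noteq> 0" by (auto simp: not_less)
    then have "\<rho> < Re (Ln \<eta>)" "exp (Ln \<eta>) = \<eta>" using n by (auto simp: ln_strict_mono) (metis exp_less_cancel_iff exp_ln zero_less_norm_iff)
    then show ?thesis using B[of "Ln \<eta>"] by (simp add: E_def le_max_iff_disj)
  qed
  have Rc: "R \<eta> = R 0" for \<eta> by (rule mhol_Liouville[OF Rhol Rb])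
  \<comment> \<open>\<open>R\<close> is constant by now; its value is the limit of
    \<open>F t ** adj2 (F' t)\<close> along the middle of the sector, where both factors tend to
    1.\<close>
  have "R 0 = mat 1"
  proof -
    define g where "g t = Complex t (pi / 2 - Im w)" for t
    define F F' where "F t = X (g t) ** exp_sigma3 (- canon_exponent th w (g t))"
      and "F' t = X' (g t) ** exp_sigma3 (- canon_exponent th w (g t))" for t
    have "(F \<longlongrightarrow> mat 1) at_top" "(F' \<longlongrightarrow> mat 1) at_top"
      unfolding F_def F'_def g_def using canon_limit[OF X] canon_limit[OF X'] by simp_all
    then have l: "((\<lambda>t. F t $ i $ j) \<longlongrightarrow> (mat 1 :: cmat2) $ i $ j) at_top" "((\<lambda>t. F' t $ i $ j) \<longlongrightarrow> (mat 1 :: cmat2) $ i $ j) at_top" for i j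
      by (auto intro!: tendsto_vec_nth)
    have "\<forall>\<^sub>F t in at_top. R 0 = F t ** adj2 (F' t)"
      using eventually_gt_at_top[of 0]
    proof eventually_elim
      case (elim t)
      have "adj2 (exp_sigma3 a) = exp_sigma3 (- a)" for a by (simp add: exp_sigma3_def cmat2_eq_iff)
      then have "F t ** adj2 (F' t) = X (g t) ** adj2 (X' (g t))"
        unfolding F_def F'_def adj2_mult by (simp add: matrix_mul_assoc[symmetric] exp_sigma3_cancel)
      also have "\<dots> = R (exp (g t))" using EX[of "g t"] elim by (simp add: g_def E_def)
      finally show ?case using Rc[of "exp (g t)"] by simp
    qed
    then have e: "\<forall>\<^sub>F t in at_top. R 0 $ i $ j = (F t ** adj2 (F' t)) $ i $ j" for i j by eventually_elim simp
    have lim: "((\<lambda>t. (F t ** adj2 (F' t)) $ i $ j) \<longlongrightarrow> (mat 1 ** adj2 (mat 1)) $ i $ j) at_top" for i j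
    proof -
      have "((\<lambda>t. adj2 (F' t) $ k $ j) \<longlongrightarrow> adj2 (mat 1) $ k $ j) at_top" for k
        using exhaust_2[of j] exhaust_2[of k] l(2)[of 1 1] l(2)[of 1 2] l(2)[of 2 1] l(2)[of 2 2]
        by (auto intro: tendsto_minus_cancel)
      then show ?thesis unfolding cmat2_mult_nth by (intro tendsto_add tendsto_mult l)
    qed
    have "((\<lambda>t::real. R 0 $ i $ j) \<longlongrightarrow> (mat 1 ** adj2 (mat 1)) $ i $ j) at_top" for i j
      by (rule iffD2[OF tendsto_cong[OF e] lim])
    then have "R 0 $ i $ j = (mat 1 ** adj2 (mat 1)) $ i $ j" for i j
      using tendsto_const_iff[of "at_top :: real filter"] by (metis trivial_limit_at_top_linorder)
    then show ?thesis by (simp add: cmat2_simps)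
  qed
  then have fL: "fL \<eta> = fL' \<eta>" if "\<eta> \<in> cutL" for \<eta>
  proof -
    have "fL \<eta> ** adj2 (fL' \<eta>) ** fL' \<eta> = mat 1 ** fL' \<eta>" using Rc RL[OF that] \<open>R 0 = mat 1\<close> by metis
    then show ?thesis by (simp add: matrix_mul_assoc[symmetric] adj2_cancel[OF d(4)[OF that]])
  qed
  \<comment> \<open>A solution of determinant 1 determines its coefficient, as derivative times
    inverse.\<close>
  have "eta_coeff (exp w) P Q \<eta> = eta_coeff (exp w) P' Q' \<eta>" if "0 < Im \<eta>" for \<eta>
  proof -
    have c: "\<eta> \<in> cutL" using that by (auto intro: cuts_upper_lower)
    have "has_mderiv fL (eta_coeff (exp w) P Q \<eta> ** fL \<eta>) \<eta>" "has_mderiv fL' (eta_coeff (exp w) P' Q' \<eta> ** fL' \<eta>) \<eta>"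
      using s s' c by (simp_all add: sheets_def msol_def)
    then have "has_mderiv fL' (eta_coeff (exp w) P Q \<eta> ** fL \<eta>) \<eta>" "has_mderiv fL' (eta_coeff (exp w) P' Q' \<eta> ** fL' \<eta>) \<eta>"
      using has_mderiv_transform[of fL _ \<eta> cutL fL'] open_cuts(1) c fL by auto
    then have "(eta_coeff (exp w) P Q \<eta> ** fL \<eta>) $ i $ j = (eta_coeff (exp w) P' Q' \<eta> ** fL' \<eta>) $ i $ j" for i j
      using DERIV_unique has_mderiv_entry by blast
    then have "eta_coeff (exp w) P Q \<eta> ** fL \<eta> = eta_coeff (exp w) P' Q' \<eta> ** fL \<eta>"      unfolding fL[OF c] cmat2_eq_iff[of "_ ** _"] by blast
    then have "eta_coeff (exp w) P Q \<eta> ** fL \<eta> ** adj2 (fL \<eta>) = eta_coeff (exp w) P' Q' \<eta> ** fL \<eta> ** adj2 (fL \<eta>)" by simp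
    then show ?thesis by (simp add: matrix_mul_assoc[symmetric] adj2_cancel[OF d(1)[OF c]])
  qed
  from eta_coeff_inject[OF this] show "P = P'" "Q = Q'" by auto
qed


section \<open>From the residues back to the Painleve function\<close>

lemma mono_rep_conj_pair:
  assumes "mono_rep th w P Q N" "c \<noteq> 0"
  defines "K \<equiv> pow_sigma3 c" and "K' \<equiv> pow_sigma3 (inverse c)"
  shows "mono_rep th w (K ** P ** K') (K ** Q ** K') (conj_pair c N)"
proof -
  obtain X fL fM fR where X: "canon th w P Q 2 X" and s: "sheets (exp w) P Q X N fL fM fR" using assms(1) by (auto simp: mono_rep_def)
  note k = pow_sigma3_cancel[OF assms(2), folded K_def K'_def]
  have k': "A ** K ** K' = A" "A ** K' ** K = A" for A using k by (simp_all add: matrix_mul_assoc[symmetric])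
  have s3: "K ** sigma3 ** K' = sigma3"
    using assms(2) by (simp add: K_def K'_def pow_sigma3_def sigma3_def cmat2_simps)
  have A: "K ** eta_coeff x P Q \<eta> ** K' = eta_coeff x (K ** P ** K') (K ** Q ** K') \<eta>" for x \<eta>
    by (simp add: eta_coeff_def cmat2_mult_algebra cscale_mult s3)
  have sol: "msol (\<lambda>z. a z *m eta_coeff (exp w) (K ** P ** K') (K ** Q ** K') (b z)) S (\<lambda>z. K ** f z ** K')"
    if "msol (\<lambda>z. a z *m eta_coeff (exp w) P Q (b z)) S f" for S f and a b :: "complex \<Rightarrow> complex"
    unfolding msol_def
  proof
    fix z assume "z \<in> S"
    then have "has_mderiv f (a z *m eta_coeff (exp w) P Q (b z) ** f z) z" using that by (simp add: msol_def)
    from has_mderiv_mult[OF has_mderiv_mult[OF has_mderiv_const this] has_mderiv_const, of K K']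
    show "has_mderiv (\<lambda>z. K ** f z ** K') (a z *m eta_coeff (exp w) (K ** P ** K') (K ** Q ** K') (b z) ** (K ** f z ** K')) z"
      by (simp add: A[symmetric] cmat2_mult_algebra cscale_mult matrix_mul_assoc k')
  qed
  have "canon th w (K ** P ** K') (K ** Q ** K') 2 (\<lambda>e. K ** X e ** K')"
    unfolding canon_def
  proof (intro conjI allI impI)
    show "msol (\<lambda>e. exp e *m eta_coeff (exp w) (K ** P ** K') (K ** Q ** K') (exp e)) {e. 0 < Re e} (\<lambda>e. K ** X e ** K')"
      using X sol unfolding canon_def by blast
    fix \<delta> :: real assume "\<delta> > 0"
    then obtain C R where C: "\<And>e. Re e > R \<and> \<bar>Im (e + w) - pi / 2 - (of_int 2 - 2) * pi\<bar> \<le> pi - \<delta> \<Longrightarrow>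
        norm (X e ** exp_sigma3 (- canon_exponent th w e) - mat 1) \<le> C * exp (- Re e)"
      using X unfolding canon_def by meson
    have "norm (K ** X e ** K' ** exp_sigma3 (- canon_exponent th w e) - mat 1) \<le> (norm K * C * norm K') * exp (- Re e)"
      if e: "Re e > R \<and> \<bar>Im (e + w) - pi / 2 - (of_int 2 - 2) * pi\<bar> \<le> pi - \<delta>" for e
    proof -
      let ?F = "X e ** exp_sigma3 (- canon_exponent th w e) - mat 1"
      have "K' ** exp_sigma3 a = exp_sigma3 a ** K'" for a
        by (simp add: K'_def exp_sigma3_eq_pow pow_sigma3_mult mult.commute)
      then have "K ** X e ** K' ** exp_sigma3 (- canon_exponent th w e) - mat 1 = K ** ?F ** K'"
        by (simp add: cmat2_mult_algebra matrix_mul_assoc[symmetric] k)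
      moreover have "norm (K ** ?F ** K') \<le> norm K * norm ?F * norm K'"
        using norm_cmat2_mult[of "K ** ?F" K'] mult_right_mono[OF norm_cmat2_mult[of K ?F], of "norm K'"] by simp
      moreover have "norm K * norm ?F * norm K' \<le> norm K * (C * exp (- Re e)) * norm K'"
        using C[OF e] by (intro mult_right_mono mult_left_mono) auto
      ultimately show ?thesis by (simp add: mult_ac)
    qed
    then show "\<exists>C R. \<forall>e. Re e > R \<and> \<bar>Im (e + w) - pi / 2 - (of_int 2 - 2) * pi\<bar> \<le> pi - \<delta> \<longrightarrow>
        norm (K ** X e ** K' ** exp_sigma3 (- canon_exponent th w e) - mat 1) \<le> C * exp (- Re e)" by blast
  qed
  moreover have "sheets (exp w) (K ** P ** K') (K ** Q ** K') (\<lambda>e. K ** X e ** K') (conj_pair c N)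
     (\<lambda>\<eta>. K ** fL \<eta> ** K') (\<lambda>\<eta>. K ** fM \<eta> ** K') (\<lambda>\<eta>. K ** fR \<eta> ** K')"
    using s sol[of "\<lambda>_. 1" "\<lambda>z. z"] unfolding sheets_def
    by (simp add: conj_pair_def K_def[symmetric] K'_def[symmetric] matrix_mul_assoc k')
  ultimately show ?thesis unfolding mono_rep_def by blast
qed

text \<open>Diagonal conjugation rescales \<open>u\<close> and leaves \<open>y\<close> and
  \<open>z\<close> alone; this is why data modulo conjugation are the right labels for
  \<open>y\<close>.\<close>

lemma A_mats_conj:
  assumes "c \<noteq> 0" "u \<noteq> 0" "y \<noteq> 0"
  shows "pow_sigma3 c ** A0_mat \<theta>0 z u ** pow_sigma3 (inverse c) = A0_mat \<theta>0 z (c\<^sup>2 * u)"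
    "pow_sigma3 c ** A1_mat \<theta>0 \<theta>1 \<theta>i y z u ** pow_sigma3 (inverse c) = A1_mat \<theta>0 \<theta>1 \<theta>i y z (c\<^sup>2 * u)"
  using assms by (simp_all add: A0_mat_def A1_mat_def pow_sigma3_def mat2_mult) 
    (simp_all add: cmat2_eq_iff field_simps power2_eq_square)

lemma A_mats_square:
  assumes "u \<noteq> 0" "y \<noteq> 0"
  shows "A0_mat \<theta>0 z u ** A0_mat \<theta>0 z u = (\<theta>0\<^sup>2 / 4) *m mat 1"
    "A1_mat \<theta>0 \<theta>1 \<theta>i y z u ** A1_mat \<theta>0 \<theta>1 \<theta>i y z u = (\<theta>1\<^sup>2 / 4) *m mat 1"
  using assms by (simp_all add: A0_mat_def A1_mat_def mat2_mult)
    (simp_all add: cmat2_eq_iff field_simps power2_eq_square)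

text \<open>A residue whose off-diagonal entries both vanish is zero. So one of them is available to
  recover \<open>u\<close> from \<open>A0_mat\<close>, and then \<open>y\<close> from
  \<open>A1_mat\<close>.\<close>

lemma A_mats_inject:
  assumes nz: "u \<noteq> 0" "u' \<noteq> 0" "y \<noteq> 0" "y' \<noteq> 0"
    and eq: "A0_mat \<theta>0 z u = A0_mat \<theta>0 z' u'" "A1_mat \<theta>0 \<theta>1 \<theta>i y z u = A1_mat \<theta>0 \<theta>1 \<theta>i y' z' u'"
    and n0: "A0_mat \<theta>0 z u \<noteq> 0" "A1_mat \<theta>0 \<theta>1 \<theta>i y z u \<noteq> 0"
  shows "y = y'"
proof -
  have e0: "z = z'" "u * (z + \<theta>0) = u' * (z' + \<theta>0)" "z / u = z' / u'"
    using eq(1) by (auto simp: A0_mat_def cmat2_eq_iff)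
  have "u = u'"
  proof (cases "z = 0")
    case True
    then have "z + \<theta>0 \<noteq> 0" using n0(1) by (auto simp: A0_mat_def cmat2_eq_iff)
    then show ?thesis using e0 by auto
  next
    case False
    then show ?thesis using e0 nz by (simp add: field_simps)
  qed
  define p q where "p = z + (\<theta>0 - \<theta>1 + \<theta>i) / 2" and "q = z + (\<theta>0 + \<theta>1 + \<theta>i) / 2"
  have e1: "u * y * p = u * y' * p" "- q / (u * y) = - q / (u * y')"
    using eq(2) e0(1) \<open>u = u'\<close> by (auto simp: A1_mat_def cmat2_eq_iff p_def q_def)
  show ?thesis
  proof (cases "p = 0")
    case True
    have "q \<noteq> 0"
    proof
      assume "q = 0"
      moreover have "z + (\<theta>0 + \<theta>i) / 2 = (p + q) / 2" by (simp add: p_def q_def field_simps)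
      ultimately have d: "z + (\<theta>0 + \<theta>i) / 2 = 0" using True by simp
      then have "- (z + (\<theta>0 + \<theta>i) / 2) = 0" by simp
      then have "- z - (\<theta>0 + \<theta>i) / 2 = 0" by (simp only: minus_add_distrib) simp
      note d this
      with n0(2) show False using True \<open>q = 0\<close> unfolding A1_mat_def p_def[symmetric] q_def[symmetric]
        by (simp add: cmat2_eq_iff)
    qed
    then show ?thesis using e1(2) nz by (simp add: field_simps)
  next
    case False
    then show ?thesis using e1(1) nz by simp
  qed
qed

text \<open>At an exceptional point both functions have the same limit as value, or both have a pole
  and the value 0.\<close>

lemma nicely_meromorphic_eqI:
  assumes "f nicely_meromorphic_on UNIV" "g nicely_meromorphic_on UNIV" "\<forall>\<^sub>\<approx>w\<in>UNIV. f w = g w"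
  shows "f = g"
proof
  fix z
  have ev: "\<forall>\<^sub>F w in at z. f w = g w" using assms(3) by (simp add: eventually_cosparse_open_eq)
  have fz: "is_pole f z \<and> f z = 0 \<or> f \<midarrow>z\<rightarrow> f z" "is_pole g z \<and> g z = 0 \<or> g \<midarrow>z\<rightarrow> g z"
    using assms(1,2) by (auto simp: nicely_meromorphic_on_def)
  have "is_pole f z \<longleftrightarrow> is_pole g z" by (rule is_pole_cong[OF ev refl])
  moreover have "f \<midarrow>z\<rightarrow> c \<longleftrightarrow> g \<midarrow>z\<rightarrow> c" for c by (rule tendsto_cong[OF ev])
  moreover have "\<not> is_pole h z" if "h \<midarrow>z\<rightarrow> c" for h c
    using that unfolding is_pole_def by (metis at_neq_bot not_tendsto_and_filterlim_at_infinity)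
  ultimately show "f z = g z" using fz tendsto_unique[OF at_neq_bot] by metis
qed

lemma conj_pair_neq:
  assumes "c \<noteq> 0"
  shows "fst (conj_pair c N) = mat 1 \<longleftrightarrow> fst N = mat 1" "fst (conj_pair c N) = - mat 1 \<longleftrightarrow> fst N = - mat 1"
    "snd (conj_pair c N) = mat 1 \<longleftrightarrow> snd N = mat 1" "snd (conj_pair c N) = - mat 1 \<longleftrightarrow> snd N = - mat 1"
  using assms by (simp_all add: cmat2_eq_iff conj_pair_nth mat_def field_simps)

text \<open>The two solutions may come with different representatives of the class. Conjugation by
  \<open>pow_sigma3 c\<close> makes these equal at the price of replacing \<open>u'\<close> by
  \<open>c\<^sup>2 * u'\<close>, which does not touch \<open>y'\<close>.\<close>

theorem PV_solutions_unique:
  assumes N: "N \<in> monodromy_pairs \<theta>0 \<theta>1 \<theta>i" "fst N \<notin> {mat 1, - mat 1}" "snd N \<notin> {mat 1, - mat 1}"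
    and y: "y \<in> PV_solutions \<theta>0 \<theta>1 \<theta>i N" "y' \<in> PV_solutions \<theta>0 \<theta>1 \<theta>i N"
  shows "y = y'"
proof -
  from PV_solutions_regular[OF y(1)] obtain z u G N1 where N1: "N1 \<in> monodromy_class N" and r: "regular_solution \<theta>0 \<theta>1 \<theta>i N1 G y z u" by blast
  from PV_solutions_regular[OF y(2)] obtain z' u' G' N2 where N2: "N2 \<in> monodromy_class N" and r': "regular_solution \<theta>0 \<theta>1 \<theta>i N2 G' y' z' u'" by blast
  obtain a b where ab: "a \<noteq> 0" "N1 = conj_pair a N" "b \<noteq> 0" "N2 = conj_pair b N" using N1 N2 by (auto simp: monodromy_class_eq)
  define c where "c = a / b"
  have c: "c \<noteq> 0" "conj_pair c N2 = N1" using ab by (simp_all add: c_def conj_pair_conj_pair)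
  have N1': "N1 \<in> monodromy_pairs \<theta>0 \<theta>1 \<theta>i" unfolding ab(2) by (rule conj_pair_in_pairs[OF N(1) ab(1)])
  then have m0: "det (fst N1) = 1" "trace (fst N1) = 2 * cos (of_real pi * \<theta>0)" "det (snd N1) = 1" "trace (snd N1) = 2 * cos (of_real pi * \<theta>1)"
    by (auto simp: monodromy_pairs_def)
  have m1: "fst N1 \<noteq> mat 1" "fst N1 \<noteq> - mat 1" "snd N1 \<noteq> mat 1" "snd N1 \<noteq> - mat 1"
    using N conj_pair_neq[OF ab(1), of N] by (auto simp: ab(2))
  have "y w = y' w" if w: "w \<in> G" "w \<in> G'" for w
  proof -
    have nz: "y w \<noteq> 0" "u w \<noteq> 0" "y' w \<noteq> 0" "u' w \<noteq> 0"
      and m: "mono_rep \<theta>i w (A0_mat \<theta>0 (z w) (u w)) (A1_mat \<theta>0 \<theta>1 \<theta>i (y w) (z w) (u w)) N1"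
        "mono_rep \<theta>i w (A0_mat \<theta>0 (z' w) (u' w)) (A1_mat \<theta>0 \<theta>1 \<theta>i (y' w) (z' w) (u' w)) N2"
      using r r' w by (auto simp: regular_solution_def)
    have nz': "c\<^sup>2 * u' w \<noteq> 0" using nz c by simp
    from mono_rep_conj_pair[OF m(2) c(1)]
    have m': "mono_rep \<theta>i w (A0_mat \<theta>0 (z' w) (c\<^sup>2 * u' w)) (A1_mat \<theta>0 \<theta>1 \<theta>i (y' w) (z' w) (c\<^sup>2 * u' w)) N1"
      unfolding A_mats_conj[OF c(1) nz(4,3)] c(2) .
    note eq = mono_rep_unique[OF m(1) m' trace_A_mats trace_A_mats A_mats_square(1)[OF nz(2,1)] A_mats_square(1)[OF nz' nz(3)]
        A_mats_square(2)[OF nz(2,1)] A_mats_square(2)[OF nz' nz(3)] m0(1,2) m1(1,2) m0(3,4) m1(3,4)]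
    obtain X fL fM fR where X: "canon \<theta>i w (A0_mat \<theta>0 (z w) (u w)) (A1_mat \<theta>0 \<theta>1 \<theta>i (y w) (z w) (u w)) 2 X"
       "sheets (exp w) (A0_mat \<theta>0 (z w) (u w)) (A1_mat \<theta>0 \<theta>1 \<theta>i (y w) (z w) (u w)) X N1 fL fM fR"
      using m(1) by (auto simp: mono_rep_def)
    have "A0_mat \<theta>0 (z w) (u w) \<noteq> 0" "A1_mat \<theta>0 \<theta>1 \<theta>i (y w) (z w) (u w) \<noteq> 0"
      using sheets_residue_zero[OF X(1) trace_A_mats X(2)] m1 by auto
    with A_mats_inject[OF nz(2) nz' nz(1,3) eq] show ?thesis by simp
  qed
  moreover have "\<forall>\<^sub>\<approx>w\<in>UNIV. w \<in> G" "\<forall>\<^sub>\<approx>w\<in>UNIV. w \<in> G'" using r r' by (auto simp: regular_solution_def)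
  ultimately have "\<forall>\<^sub>\<approx>w\<in>UNIV. y w = y' w" by (auto elim: eventually_elim2)
  then show ?thesis using y by (intro nicely_meromorphic_eqI) (auto simp: PV_solutions_def)
qed

lemma conj_scalar_iff:
  fixes L R A :: cmat2
  assumes "R ** L = mat 1" "L ** R = mat 1"
  shows "L ** A ** R \<in> {mat 1, - mat 1} \<longleftrightarrow> A \<in> {mat 1, - mat 1}"
proof -
  have s: "L ** A ** R = C \<longleftrightarrow> A = R ** C ** L" for C
  proof
    assume "L ** A ** R = C"
    then have "R ** C ** L = (R ** L) ** A ** (R ** L)" by (auto simp: matrix_mul_assoc)
    then show "A = R ** C ** L" by (simp add: assms)
  next
    assume "A = R ** C ** L"
    then have "L ** A ** R = (L ** R) ** C ** (L ** R)" by (simp add: matrix_mul_assoc)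
    then show "L ** A ** R = C" by (simp add: assms)
  qed
  show ?thesis by (simp add: s cmat2_mult_algebra assms)
qed

text \<open>All members of both orbits are conjugate to \<open>M\<close>, and \<open>mat 1\<close>
  and \<open>- mat 1\<close> are fixed by conjugation; so the condition for uniqueness passes from
  \<open>M\<close> to both orbits.\<close>

lemma orbits_scalar_iff:
  assumes "M \<in> monodromy_pairs \<theta>0 \<theta>1 \<theta>i"
  shows "fst (mono_orbit M p) \<in> {mat 1, - mat 1} \<longleftrightarrow> fst M \<in> {mat 1, - mat 1}"
    "snd (mono_orbit M p) \<in> {mat 1, - mat 1} \<longleftrightarrow> snd M \<in> {mat 1, - mat 1}"
    "fst (hat_orbit \<theta>i M p) \<in> {mat 1, - mat 1} \<longleftrightarrow> fst M \<in> {mat 1, - mat 1}"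
    "snd (hat_orbit \<theta>i M p) \<in> {mat 1, - mat 1} \<longleftrightarrow> snd M \<in> {mat 1, - mat 1}"
proof -
  let ?P = "snd M ** fst M" and ?S = "stokes2 \<theta>i M" and ?e = "of_real pi * \<i> / 2 * \<theta>i"
  have P: "det ?P = 1" using monodromy_pairs_SL2[OF assms] by (simp add: det_mul)
  have o: "orbit_mat M p A \<in> {mat 1, - mat 1} \<longleftrightarrow> A \<in> {mat 1, - mat 1}" for A
    using conj_scalar_iff[OF mat_powi_minus[OF P, of "- p", simplified] mat_powi_minus[OF P]]
    by (simp add: orbit_mat_def case_prod_beta)
  have h: "conj_sigma1 (hat_mat \<theta>i M A) \<in> {mat 1, - mat 1} \<longleftrightarrow> A \<in> {mat 1, - mat 1}" for A
  proof -
    let ?L = "sigma1 ** exp_sigma3 (- ?e) ** matrix_inv ?S" and ?R = "?S ** exp_sigma3 ?e ** sigma1"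
    have LR: "sigma1 ** (sigma1 ** B) = B" for B by (simp add: matrix_mul_assoc sigma1_sq)
    have "?R ** ?L = mat 1" "?L ** ?R = mat 1"
      by (simp_all add: matrix_mul_assoc[symmetric] matrix_inv_SL2 matrix_inv_SL2_cancel LR sigma1_sq exp_sigma3_cancel)
    from conj_scalar_iff[OF this, of A] show ?thesis
      by (simp add: conj_sigma1_def hat_mat_def matrix_mul_assoc)
  qed
  show "fst (mono_orbit M p) \<in> {mat 1, - mat 1} \<longleftrightarrow> fst M \<in> {mat 1, - mat 1}"
    "snd (mono_orbit M p) \<in> {mat 1, - mat 1} \<longleftrightarrow> snd M \<in> {mat 1, - mat 1}"
    "fst (hat_orbit \<theta>i M p) \<in> {mat 1, - mat 1} \<longleftrightarrow> fst M \<in> {mat 1, - mat 1}"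
    "snd (hat_orbit \<theta>i M p) \<in> {mat 1, - mat 1} \<longleftrightarrow> snd M \<in> {mat 1, - mat 1}"
    unfolding mono_orbit_def hat_orbit_def fst_conv snd_conv by (simp_all only: o h)
qed


text \<open>A label may denote several solutions when a monodromy matrix is 1 or -1. The first half
  therefore equates sets of solutions, for every \<open>M\<close>. In the second half the labels are
  unambiguous; \<open>Y\<close> and \<open>Ym\<close> are arbitrary choices of the labelled
  solutions, and the formulas hold pointwise.\<close>

theorem theorem2p17:
  fixes \<theta>0 \<theta>1 \<theta>i :: complex and M :: "(complex^2^2) \<times> (complex^2^2)" and p :: int
  assumes "monodromy_class M \<in> monodromy_manifold \<theta>0 \<theta>1 \<theta>i"
  shows
    "((\<lambda>y w. y (w + 2 * of_real pi * \<i>)) ` PV_solutions \<theta>0 \<theta>1 \<theta>i (mono_orbit M p)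
        = PV_solutions \<theta>0 \<theta>1 \<theta>i (op_m M (mono_orbit M p)) \<and>
      (\<lambda>y w. y (w + of_real pi * \<i>)) ` PV_solutions \<theta>0 \<theta>1 \<theta>i (mono_orbit M p)
        = (\<lambda>y w. 1 / y w) ` PV_solutions \<theta>0 \<theta>1 (- \<theta>i) (op_s \<theta>i M 0 (mono_orbit M p)) \<and>
      (\<lambda>y w. y (w - of_real pi * \<i>)) ` PV_solutions \<theta>0 \<theta>1 \<theta>i (mono_orbit M p)
        = (\<lambda>y w. 1 / y w) ` PV_solutions \<theta>0 \<theta>1 (- \<theta>i) (op_s \<theta>i M (-1) (mono_orbit M p)) \<and>
      (\<lambda>y w. y (w + 2 * of_real pi * \<i>)) ` PV_solutions \<theta>0 \<theta>1 (- \<theta>i) (hat_orbit \<theta>i M p)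
        = PV_solutions \<theta>0 \<theta>1 (- \<theta>i) (op_hat_m \<theta>i M (hat_orbit \<theta>i M p)) \<and>
      (\<lambda>y w. y (w + of_real pi * \<i>)) ` PV_solutions \<theta>0 \<theta>1 (- \<theta>i) (hat_orbit \<theta>i M p)
        = (\<lambda>y w. 1 / y w) ` PV_solutions \<theta>0 \<theta>1 \<theta>i (op_hat_s \<theta>i M 1 (hat_orbit \<theta>i M p)) \<and>
      (\<lambda>y w. y (w - of_real pi * \<i>)) ` PV_solutions \<theta>0 \<theta>1 (- \<theta>i) (hat_orbit \<theta>i M p)
        = (\<lambda>y w. 1 / y w) ` PV_solutions \<theta>0 \<theta>1 \<theta>i (op_hat_s \<theta>i M 0 (hat_orbit \<theta>i M p)))
     \<and>
     (fst M \<notin> {mat 1, - mat 1} \<and> snd M \<notin> {mat 1, - mat 1} \<longrightarrow>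
       (\<forall>Y Ym.
         (\<forall>N \<in> range (mono_orbit M). Y N \<in> PV_solutions \<theta>0 \<theta>1 \<theta>i N) \<and>
         (\<forall>N \<in> range (hat_orbit \<theta>i M). Ym N \<in> PV_solutions \<theta>0 \<theta>1 (- \<theta>i) N) \<longrightarrow>
         (\<forall>w.
           Y (mono_orbit M p) (w + 2 * of_real pi * \<i>) = Y (op_m M (mono_orbit M p)) w \<and>
           Y (mono_orbit M p) (w + of_real pi * \<i>) = 1 / Ym (op_s \<theta>i M 0 (mono_orbit M p)) w \<and>
           Y (mono_orbit M p) (w - of_real pi * \<i>) = 1 / Ym (op_s \<theta>i M (-1) (mono_orbit M p)) w \<and>
           Ym (hat_orbit \<theta>i M p) (w + 2 * of_real pi * \<i>)
             = Ym (op_hat_m \<theta>i M (hat_orbit \<theta>i M p)) w \<and>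
           Ym (hat_orbit \<theta>i M p) (w + of_real pi * \<i>)
             = 1 / Y (op_hat_s \<theta>i M 1 (hat_orbit \<theta>i M p)) w \<and>
           Ym (hat_orbit \<theta>i M p) (w - of_real pi * \<i>)
             = 1 / Y (op_hat_s \<theta>i M 0 (hat_orbit \<theta>i M p)) w)))"
proof -
  have M: "M \<in> monodromy_pairs \<theta>0 \<theta>1 \<theta>i" using in_manifold_imp_pairs[OF assms] .
  note ops = op_m_orbit[OF monodromy_pairs_SL2[OF M]] op_hat_m_hat_orbit[OF monodromy_pairs_SL2[OF M]]
    op_s_0_orbit[OF monodromy_pairs_SL2[OF M]] op_s_minus_1_orbit[OF monodromy_pairs_SL2[OF M]]
    op_hat_s_0_hat_orbit[OF monodromy_pairs_SL2[OF M]] op_hat_s_1_hat_orbit[OF monodromy_pairs_SL2[OF M]]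
  note images = PV_solutions_orbit_full_turn_images[OF M] PV_solutions_orbit_half_turn_images[OF M]
  have unique: "y = y'" if "fst M \<notin> {mat 1, - mat 1}" "snd M \<notin> {mat 1, - mat 1}"
    "y \<in> PV_solutions \<theta>0 \<theta>1 \<theta>i (mono_orbit M q)" "y' \<in> PV_solutions \<theta>0 \<theta>1 \<theta>i (mono_orbit M q)" for y y' q
    using PV_solutions_unique[OF mono_orbit_in_pairs[OF M], of q y y'] orbits_scalar_iff[OF M] that by blast
  have unique': "y = y'" if "fst M \<notin> {mat 1, - mat 1}" "snd M \<notin> {mat 1, - mat 1}"
    "y \<in> PV_solutions \<theta>0 \<theta>1 (- \<theta>i) (hat_orbit \<theta>i M q)" "y' \<in> PV_solutions \<theta>0 \<theta>1 (- \<theta>i) (hat_orbit \<theta>i M q)" for y y' q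
    using PV_solutions_unique[OF hat_orbit_in_pairs[OF M], of q y y'] orbits_scalar_iff[OF M] that by blast
  show ?thesis
    unfolding ops
  proof (rule conjI, goal_cases)
    case 1
    show ?case by (intro conjI images)
  next
    case 2
    show ?case
    proof (intro impI allI, elim conjE)
      fix Y Ym w
      assume n: "fst M \<notin> {mat 1, - mat 1}" "snd M \<notin> {mat 1, - mat 1}"
        and Y: "\<forall>N\<in>range (mono_orbit M). Y N \<in> PV_solutions \<theta>0 \<theta>1 \<theta>i N"
        and Ym: "\<forall>N\<in>range (hat_orbit \<theta>i M). Ym N \<in> PV_solutions \<theta>0 \<theta>1 (- \<theta>i) N"
      have Y': "Y (mono_orbit M q) \<in> PV_solutions \<theta>0 \<theta>1 \<theta>i (mono_orbit M q)"
        and Ym': "Ym (hat_orbit \<theta>i M q) \<in> PV_solutions \<theta>0 \<theta>1 (- \<theta>i) (hat_orbit \<theta>i M q)" for q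
        using Y Ym by auto
      \<comment> \<open>Holds with \<open>1 / 0 = 0\<close> too, so that zeros and poles are no
        exception.\<close>
      have inv: "1 / a = b \<Longrightarrow> a = 1 / b" for a b :: complex by auto
      have full: "(\<lambda>w. Y (mono_orbit M p) (w + 2 * of_real pi * \<i>)) = Y (mono_orbit M (p + 1))"
        "(\<lambda>w. Ym (hat_orbit \<theta>i M p) (w + 2 * of_real pi * \<i>)) = Ym (hat_orbit \<theta>i M (p + 1))"
        using images(1,2)[of p] Y' Ym' by (intro unique[OF n _ Y'] unique'[OF n _ Ym']; blast)+
      have half: "(\<lambda>w. 1 / Y (mono_orbit M p) (w + of_real pi * \<i>)) = Ym (hat_orbit \<theta>i M p)"
        "(\<lambda>w. 1 / Y (mono_orbit M p) (w - of_real pi * \<i>)) = Ym (hat_orbit \<theta>i M (p - 1))"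
        "(\<lambda>w. 1 / Ym (hat_orbit \<theta>i M p) (w + of_real pi * \<i>)) = Y (mono_orbit M (p + 1))"
        "(\<lambda>w. 1 / Ym (hat_orbit \<theta>i M p) (w - of_real pi * \<i>)) = Y (mono_orbit M p)"
        by (rule unique[OF n _ Y'] unique'[OF n _ Ym'], rule PV_solutions_orbit_turns[OF M], rule Y' Ym')+
      show "Y (mono_orbit M p) (w + 2 * of_real pi * \<i>) = Y (mono_orbit M (p + 1)) w \<and>
           Y (mono_orbit M p) (w + of_real pi * \<i>) = 1 / Ym (hat_orbit \<theta>i M p) w \<and>
           Y (mono_orbit M p) (w - of_real pi * \<i>) = 1 / Ym (hat_orbit \<theta>i M (p - 1)) w \<and>
           Ym (hat_orbit \<theta>i M p) (w + 2 * of_real pi * \<i>) = Ym (hat_orbit \<theta>i M (p + 1)) w \<and>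
           Ym (hat_orbit \<theta>i M p) (w + of_real pi * \<i>) = 1 / Y (mono_orbit M (p + 1)) w \<and>
           Ym (hat_orbit \<theta>i M p) (w - of_real pi * \<i>) = 1 / Y (mono_orbit M p) w"
        by (intro conjI inv fun_cong[OF half(1)] fun_cong[OF half(2)] fun_cong[OF half(3)] fun_cong[OF half(4)]
            fun_cong[OF full(1)] fun_cong[OF full(2)])
    qed
  qed
qed

end
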